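(* Let $r\in\mathbb{Z}_{>0}$, $p,q\in\mathbb{C}^*$ with $|p|,|q|<1$, $\epsilon\in\{0,1\}$, fix a square root $\sqrt{pq}$, and let $t_1,\ldots,t_8\in\mathbb{C}^*$, $n_1,\ldots,n_8\in\mathbb{Z}$ satisfy $\sqrt{|pq|}<|t_a|<1$ for all $a$ and $$\prod_{a=1}^8t_a=(pq)^2,\qquad \sum_{a=1}^8n_a+4\epsilon=0 .$$ Then $$V_\epsilon^{(r)}(t_a,n_a;p,q)=\prod_{1\le b<c\le8}\Gamma^{(r)}(t_bt_c,n_b+n_c+\epsilon)\;V_\epsilon^{(r)}\left(\frac{\sqrt{pq}}{t_a},-n_a-\epsilon;p,q\right).$$
   Context: Notation: $(z;p)_\infty=\prod_{j\ge0}(1-zp^j)$ for $|p|<1$. The elliptic gamma function is $\Gamma(z;p,q)=\prod_{j,k=0}^\infty\frac{1-z^{-1}p^{j+1}q^{k+1}}{1-zp^jq^k}$ for $|p|,|q|<1$, $z\in\mathbb{C}^*$. For $r\in\mathbb{Z}_{>0}$, $m\in\mathbb{Z}$, nonzero $p,q$ with $|p|,|q|<1$, the rarefied elliptic gamma function is the meromorphic function of $z\in\mathbb{C}^*$ $$\Gamma^{(r)}(z,m)=\Gamma^{(r)}(z,m;p,q)=(-z)^{\frac{m(m-1)}{2}}p^{\frac{m(m-1)(m-2)}{6}}q^{-\frac{m(m^2-1)}{6}}\;\Gamma(zp^m;p^r,pq)\,\Gamma(zq^{r-m};q^r,pq)$$ (all exponents are integers). Products and quotients of these functions are understood as meromorphic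 functions. For $\epsilon\in\{0,1\}$, $t_a\in\mathbb{C}^*$ with $|t_a|<1$, $n_a\in\mathbb{Z}$ ($a=1,\ldots,8$) satisfying $\prod_{a=1}^8t_a=(pq)^2$ and $\sum_{a=1}^8n_a+4\epsilon=0$, the rarefied elliptic hypergeometric function is $$V_\epsilon^{(r)}(t_a,n_a;p,q)=\frac{(p^r;p^r)_\infty(q^r;q^r)_\infty}{4\pi\mathrm{i}}\sum_{m=0}^{r-1}\int_{\mathbb{T}}\frac{\prod_{a=1}^8\Gamma^{(r)}(t_az,n_a+\epsilon+m)\,\Gamma^{(r)}(t_az^{-1},n_a-m)}{\Gamma^{(r)}(z^2,2m+\epsilon)\,\Gamma^{(r)}(z^{-2},-2m-\epsilon)}\frac{dz}{z},$$ with $\mathbb{T}$ the positively oriented unit circle. *)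

theory Defs
  imports "HOL-Complex_Analysis.Complex_Analysis"
begin

definition qpoch_inf :: "complex \<Rightarrow> complex \<Rightarrow> complex" where
  "qpoch_inf z p = (\<Prod>j. 1 - z * p ^ j)"

text \<open>
  The double product converges absolutely for \<open>|p|, |q| < 1\<close> and \<open>z \<noteq> 0\<close> off the poles,
  so it may be written as an iterated product. At a pole some factor is a division by zero,
  hence \<open>0\<close>; these junk values are discarded in \<open>rar_gamma\<close> below.
\<close>
definition ell_gamma :: "complex \<Rightarrow> complex \<Rightarrow> complex \<Rightarrow> complex" where
  "ell_gamma z p q =
     (\<Prod>j. \<Prod>k. (1 - inverse z * p ^ (j + 1) * q ^ (k + 1)) / (1 - z * p ^ j * q ^ k))"

text \<open>
  \<open>\<Gamma>\<^sup>(\<^sup>r\<^sup>)(z, m; p, q)\<close> as a meromorphic function of \<open>z\<close>. For \<open>m\<close> outside \<open>{0..r}\<close> poles of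
  one elliptic gamma factor may cancel against zeros of the other, so the pointwise product is
  passed through \<^const>\<open>remove_sings\<close>, which takes the limit at removable singularities
  (and the value \<open>0\<close> at genuine poles). All integer divisions are exact.
\<close>
definition rar_gamma ::
    "nat \<Rightarrow> complex \<Rightarrow> complex \<Rightarrow> complex \<Rightarrow> int \<Rightarrow> complex" where
  "rar_gamma r p q z m =
     remove_sings
       (\<lambda>w. (-w) powi (m * (m - 1) div 2)
          * p powi (m * (m - 1) * (m - 2) div 6)
          * q powi (- (m * (m\<^sup>2 - 1) div 6))
          * ell_gamma (w * p powi m) (p ^ r) (p * q)
          * ell_gamma (w * q powi (int r - m)) (q ^ r) (p * q)) z"

text \<open>
  The quotient is again taken as a meromorphic function of \<open>z\<close>, whence the outer
  \<^const>\<open>remove_sings\<close>.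
\<close>
definition rar_integrand ::
    "nat \<Rightarrow> int \<Rightarrow> (nat \<Rightarrow> complex) \<Rightarrow> (nat \<Rightarrow> int) \<Rightarrow> complex \<Rightarrow> complex \<Rightarrow> int
     \<Rightarrow> complex \<Rightarrow> complex" where
  "rar_integrand r \<epsilon> t n p q m =
     remove_sings
       (\<lambda>z. (\<Prod>a=1..8. rar_gamma r p q (t a * z) (n a + \<epsilon> + m)
                       * rar_gamma r p q (t a * inverse z) (n a - m))
          / (rar_gamma r p q (z ^ 2) (2 * m + \<epsilon>)
             * rar_gamma r p q (inverse (z ^ 2)) (- 2 * m - \<epsilon>)))"

definition rar_V ::
    "nat \<Rightarrow> int \<Rightarrow> (nat \<Rightarrow> complex) \<Rightarrow> (nat \<Rightarrow> int) \<Rightarrow> complex \<Rightarrow> complex \<Rightarrow> complex" where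
  "rar_V r \<epsilon> t n p q =
     qpoch_inf (p ^ r) (p ^ r) * qpoch_inf (q ^ r) (q ^ r) / (4 * of_real pi * \<i>)
     * (\<Sum>m = 0..<r. contour_integral (circlepath 0 1)
                        (\<lambda>z. rar_integrand r \<epsilon> t n p q (int m) z / z))"

end

theory Submission
  imports Defs
begin

text \<open>
  Write \<open>V\<close> as a sum of circle means of a product of functions \<open>G\<close>, where \<open>G\<close> is the rarefied gamma
  function with all removable singularities filled in. It satisfies a shift equation under
  \<open>(z, m) \<mapsto> (q z, m + 1)\<close>, quasi-periodicity in \<open>m\<close> with period \<open>r\<close>, and a reflection equation.

  For six parameters there is a product evaluation (beta integral). Its two sides have a quotient \<open>J\<close>
  that is unchanged when \<open>(t\<^sub>1, n\<^sub>1; t\<^sub>6, n\<^sub>6)\<close> is replaced by \<open>(q t\<^sub>1, n\<^sub>1 + 1; t\<^sub>6 / q, n\<^sub>6 - 1)\<close>, because a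
  theta function identity turns the difference of the integrands into a telescoping one. Together with
  periodicity in \<open>n\<^sub>1\<close> and the maximum principle on an annulus wider than \<open>\<bar>q\<bar>\<close>, \<open>J\<close> does not depend on
  \<open>(t\<^sub>1, n\<^sub>1)\<close>, and it is evaluated by letting two parameters pinch the contour. Analytic continuation
  removes the restrictions on the parameters.

  Integrating a product of two kernels over both variables and applying the beta integral to either
  one gives a transformation attached to each set of four of the eight parameters. The composition of
  the transformations for \<open>1234\<close>, \<open>1256\<close> and \<open>1278\<close> is the asserted one, up to a permutation of the
  parameters and an even shift of \<open>\<epsilon>\<close>. Its intermediate parameters stay in the unit disc only near special
  points, from which one continues analytically.
\<close>

section \<open>Infinite products\<close>

text \<open>All computations use fixed logarithms \<open>lp\<close>, \<open>lq\<close> of p and q.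
  Each prefactor is then \<open>exp\<close> of a polynomial in the integer index, and a functional
  equation becomes a polynomial identity modulo 2 pi i times an integer. The product formula is
  reliable only for indices in {0..r}; elsewhere quasi-periodicity defines the function.

  The two gamma functions in the denominator of the integrand can have poles at z = 1 and z = -1.
  Their reciprocal product is an expression in theta functions, holomorphic on the punctured plane,
  and is used in their place.

  The maximum principle needs a fundamental annulus for multiplication by q. With t2, ..., t5 fixed,
  t1 fills the annulus |p q| / |t2 t3 t4 t5| < |t1| < 1, whence the temporary condition |p| < |t2 t3
  t4 t5|. A shift by q changes the integer indices as well, so all indices have to be treated at
  once.

  Continuation runs along affine paths of logarithms: the balancing product stays constant, and the
  constraints on the moduli become half planes or strips, so that the domain is convex.\<close>

definition geo_prod :: "(complex \<Rightarrow> complex) \<Rightarrow> complex \<Rightarrow> complex \<Rightarrow> complex" where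
  "geo_prod Q P z = (\<Prod>j. Q (z * P ^ j))"

text \<open>The difference quotient at 0 is entire, hence bounded on a disc. The linear bound
  supplies the geometric majorant for the infinite products below.\<close>

lemma entire_linear_bound:
  assumes Q: "Q holomorphic_on UNIV" and Q0: "Q 0 = (1::complex)"
  obtains C where "C \<ge> 0" "\<And>z. norm z \<le> R \<Longrightarrow> norm (Q z - 1) \<le> C * norm z"
proof -
  define h where "h = (\<lambda>z. if z = 0 then deriv Q 0 else (Q z - Q 0) / (z - 0))"
  have "h holomorphic_on UNIV" unfolding h_def by (rule pole_lemma[OF Q]) auto
  hence "continuous_on (cball 0 R) h"
    using holomorphic_on_imp_continuous_on continuous_on_subset by blast
  then obtain C where C: "\<And>z. z \<in> cball 0 R \<Longrightarrow> norm (h z) \<le> C"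
    using compact_continuous_image[of "cball 0 R" h] compact_imp_bounded
    by (metis bounded_iff compact_cball image_eqI)
  have "norm (Q z - 1) \<le> max C 0 * norm z" if "norm z \<le> R" for z
  proof (cases "z = 0")
    case False
    have "norm (h z) \<le> max C 0" using C[of z] that by auto
    moreover have "Q z - 1 = h z * z" using False Q0 by (simp add: h_def)
    ultimately show ?thesis by (simp add: norm_mult mult_right_mono)
  qed (use Q0 in auto)
  thus ?thesis using that[of "max C 0"] by auto
qed

lemma geo_prod_bound:
  assumes Q: "Q holomorphic_on UNIV" and Q0: "Q 0 = (1::complex)" and P: "norm P < 1"
  obtains C where "C \<ge> 0" "\<And>z j. norm z \<le> R \<Longrightarrow> norm (Q (z * P ^ j) - 1) \<le> C * norm P ^ j"
proof -
  obtain C where C: "C \<ge> 0" "\<And>z. norm z \<le> max R 0 \<Longrightarrow> norm (Q z - 1) \<le> C * norm z"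
    using entire_linear_bound[OF Q Q0] by metis
  have "norm (Q (z * P ^ j) - 1) \<le> (C * max R 0) * norm P ^ j" if z: "norm z \<le> R" for z j
  proof -
    have R: "norm z \<le> max R 0" using z by auto
    have "norm z * norm P ^ j \<le> max R 0 * 1"
      by (rule mult_mono) (use R P in \<open>auto simp: power_le_one\<close>)
    hence "norm (Q (z * P ^ j) - 1) \<le> C * norm (z * P ^ j)"
      by (intro C(2)) (simp add: norm_mult norm_power)
    also have "\<dots> \<le> C * (max R 0 * norm P ^ j)"
      using R C(1) by (intro mult_left_mono) (auto simp: norm_mult norm_power mult_right_mono)
    finally show ?thesis by (simp add: mult.assoc)
  qed
  thus ?thesis using that[of "C * max R 0"] C(1) by auto
qed

lemma geo_prod_convergent:
  assumes Q: "Q holomorphic_on UNIV" and Q0: "Q 0 = (1::complex)" and P: "norm P < 1"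
  shows "convergent_prod (\<lambda>j. Q (z * P ^ j))"
proof -
  obtain C where C: "C \<ge> 0" "\<And>w j. norm w \<le> norm z \<Longrightarrow> norm (Q (w * P ^ j) - 1) \<le> C * norm P ^ j"
    using geo_prod_bound[OF Q Q0 P] by metis
  have "summable (\<lambda>j. norm (Q (z * P ^ j) - 1))"
    by (rule summable_comparison_test'[where g = "\<lambda>j. C * norm P ^ j" and N = 0])
       (use P C in \<open>auto intro!: summable_mult summable_geometric\<close>)
  thus ?thesis
    by (intro abs_convergent_prod_imp_convergent_prod summable_imp_abs_convergent_prod)
qed

lemma geo_prod_holomorphic:
  assumes Q: "Q holomorphic_on UNIV" and Q0: "Q 0 = (1::complex)" and P: "norm P < 1"
  shows "geo_prod Q P holomorphic_on A"
proof -
  have "geo_prod Q P holomorphic_on UNIV"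
  proof (rule holomorphic_uniform_sequence[where f = "\<lambda>N z. \<Prod>n<N. Q (z * P ^ n)"])
    have comp: "(\<lambda>z. Q (z * P ^ n)) holomorphic_on S" for n S
    proof -
      have "(\<lambda>z. z * P ^ n) holomorphic_on S" by (intro holomorphic_intros)
      from holomorphic_on_compose_gen[OF this Q] show ?thesis by (simp add: o_def)
    qed
    show "(\<lambda>z. \<Prod>n<N. Q (z * P ^ n)) holomorphic_on UNIV" for N
      by (intro holomorphic_on_prod comp)
    fix x :: complex
    obtain C where C: "C \<ge> 0"
      "\<And>w j. norm w \<le> norm x + 1 \<Longrightarrow> norm (Q (w * P ^ j) - 1) \<le> C * norm P ^ j"
      using geo_prod_bound[OF Q Q0 P] by metis
    have uc: "uniformly_convergent_on (cball x 1) (\<lambda>N z. \<Prod>n<N. Q (z * P ^ n))"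
    proof (rule uniformly_convergent_on_prod')
      show "continuous_on (cball x 1) (\<lambda>z. Q (z * P ^ n))" for n
        using comp holomorphic_on_imp_continuous_on by blast
      show "uniformly_convergent_on (cball x 1) (\<lambda>N z. \<Sum>n<N. norm (Q (z * P ^ n) - 1))"
      proof (rule Weierstrass_m_test')
        show "summable (\<lambda>j. C * norm P ^ j)"
          using P by (intro summable_mult summable_geometric) auto
        show "norm (norm (Q (z * P ^ n) - 1)) \<le> C * norm P ^ n" if "z \<in> cball x 1" for n z
        proof -
          have "norm z \<le> norm x + norm (z - x)" by (metis norm_triangle_sub)
          moreover have "norm (z - x) \<le> 1" using that by (simp add: dist_norm norm_minus_commute)
          ultimately show ?thesis using C(2) by simp
        qed
      qed
    qed simp
    have "geo_prod Q P z = lim (\<lambda>N. \<Prod>n<N. Q (z * P ^ n))" for z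
    proof -
      have "(\<lambda>N. \<Prod>n\<le>N. Q (z * P ^ n)) \<longlonglongrightarrow> geo_prod Q P z"
        unfolding geo_prod_def by (rule convergent_prod_LIMSEQ[OF geo_prod_convergent[OF Q Q0 P]])
      hence "(\<lambda>N. \<Prod>n<N. Q (z * P ^ n)) \<longlonglongrightarrow> geo_prod Q P z"
        using LIMSEQ_lessThan_iff_atMost[of "prod (\<lambda>n. Q (z * P ^ n))"] by auto
      thus ?thesis by (simp add: limI)
    qed
    hence "uniform_limit (cball x 1) (\<lambda>N z. \<Prod>n<N. Q (z * P ^ n)) (geo_prod Q P) sequentially"
      using uc unfolding uniformly_convergent_uniform_limit_iff by presburger
    thus "\<exists>d>0. cball x d \<subseteq> UNIV \<and>
            uniform_limit (cball x d) (\<lambda>N z. \<Prod>n<N. Q (z * P ^ n)) (geo_prod Q P) sequentially"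
      by (intro exI[of _ 1]) auto
  qed auto
  thus ?thesis using holomorphic_on_subset by blast
qed

lemma geo_prod_rec:
  assumes Q: "Q holomorphic_on UNIV" and Q0: "Q 0 = (1::complex)" and P: "norm P < 1"
  shows "geo_prod Q P z = Q z * geo_prod Q P (z * P)"
proof (cases "Q z = 0")
  case True
  have "geo_prod Q P z = 0"
    unfolding geo_prod_def
    using has_prod_eq_0_iff[OF convergent_prod_has_prod[OF geo_prod_convergent[OF Q Q0 P, of z]]]
      True by (metis (no_types, lifting) mult.right_neutral power_0 rangeI)
  thus ?thesis using True by simp
next
  case False
  have "(\<Prod>j. Q (z * P ^ Suc j)) = (\<Prod>j. Q (z * P ^ j)) / Q (z * P ^ 0)"
    using prodinf_split_head[OF geo_prod_convergent[OF Q Q0 P, of z]] False by auto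
  thus ?thesis using False by (simp add: geo_prod_def mult.assoc field_simps)
qed

lemma geo_prod_eq_0_iff:
  assumes Q: "Q holomorphic_on UNIV" and Q0: "Q 0 = (1::complex)" and P: "norm P < 1"
  shows "geo_prod Q P z = 0 \<longleftrightarrow> (\<exists>j. Q (z * P ^ j) = 0)"
  unfolding geo_prod_def
  using has_prod_eq_0_iff[OF convergent_prod_has_prod[OF geo_prod_convergent[OF Q Q0 P, of z]]]
  by auto

lemma geo_prod_at_0: "Q 0 = 1 \<Longrightarrow> geo_prod Q P 0 = 1"
  by (simp add: geo_prod_def)

lemma qpoch_eq_geo_prod: "qpoch_inf z P = geo_prod (\<lambda>z. 1 - z) P z"
  by (simp add: qpoch_inf_def geo_prod_def)

lemma qpoch_holomorphic: "norm P < 1 \<Longrightarrow> (\<lambda>z. qpoch_inf z P) holomorphic_on A"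
  unfolding qpoch_eq_geo_prod by (rule geo_prod_holomorphic) (auto intro!: holomorphic_intros)

lemma qpoch_rec: "norm P < 1 \<Longrightarrow> qpoch_inf z P = (1 - z) * qpoch_inf (z * P) P"
  unfolding qpoch_eq_geo_prod by (rule geo_prod_rec) (auto intro!: holomorphic_intros)

lemma qpoch_eq_0_iff: "norm P < 1 \<Longrightarrow> qpoch_inf z P = 0 \<longleftrightarrow> (\<exists>j. z * P ^ j = 1)"
  unfolding qpoch_eq_geo_prod by (subst geo_prod_eq_0_iff) (auto intro!: holomorphic_intros)

lemma qpoch_0 [simp]: "qpoch_inf 0 P = 1"
  by (simp add: qpoch_inf_def)

text \<open>For |Q| < 1 the inner Pochhammer symbol is entire in z with value 1 at 0, so the double
  product is again a \<open>geo_prod\<close> and inherits holomorphy, zeros and a recursion. The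
  elliptic gamma function is a quotient of two of its values.\<close>

definition ell_prod :: "complex \<Rightarrow> complex \<Rightarrow> complex \<Rightarrow> complex" where
  "ell_prod P Q z = geo_prod (\<lambda>z. qpoch_inf z Q) P z"

context
  fixes P Q :: complex
  assumes P: "norm P < 1" and Q: "norm Q < 1"
begin

lemma ell_prod_holomorphic: "ell_prod P Q holomorphic_on A"
  unfolding ell_prod_def using P Q by (intro geo_prod_holomorphic qpoch_holomorphic) auto

lemma ell_prod_rec1: "ell_prod P Q z = qpoch_inf z Q * ell_prod P Q (z * P)"
  unfolding ell_prod_def using P Q by (intro geo_prod_rec qpoch_holomorphic) auto

lemma ell_prod_eq_0_iff: "ell_prod P Q z = 0 \<longleftrightarrow> (\<exists>j k. z * P ^ j * Q ^ k = 1)"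
  unfolding ell_prod_def using P Q
  by (subst geo_prod_eq_0_iff) (auto intro!: qpoch_holomorphic simp: qpoch_eq_0_iff)

lemma ell_prod_0 [simp]: "ell_prod P Q 0 = 1"
  unfolding ell_prod_def by (simp add: geo_prod_at_0)

text \<open>The recursion in Q is not a case of \<open>geo_prod_rec\<close>, since Q belongs to the
  inner product: the first factor of every inner product is split off, and these factors together
  form \<open>qpoch_inf z P\<close>.\<close>

lemma ell_prod_rec2: "ell_prod P Q z = qpoch_inf z P * ell_prod P Q (z * Q)"
proof -
  have c1: "convergent_prod (\<lambda>j. 1 - z * P ^ j)"
    by (rule geo_prod_convergent) (use P in \<open>auto intro!: holomorphic_intros\<close>)
  have c2: "convergent_prod (\<lambda>j. qpoch_inf (z * Q * P ^ j) Q)"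
    by (rule geo_prod_convergent) (use P Q in \<open>auto intro!: qpoch_holomorphic\<close>)
  have "(\<lambda>j. (1 - z * P ^ j) * qpoch_inf (z * Q * P ^ j) Q) has_prod
        (qpoch_inf z P * ell_prod P Q (z * Q))"
    unfolding qpoch_inf_def[of z P] ell_prod_def geo_prod_def
    by (intro has_prod_mult convergent_prod_has_prod c1 c2)
  moreover have "(1 - z * P ^ j) * qpoch_inf (z * Q * P ^ j) Q = qpoch_inf (z * P ^ j) Q" for j
    using qpoch_rec[OF Q, of "z * P ^ j"] by (simp add: mult_ac)
  ultimately show ?thesis
    unfolding ell_prod_def geo_prod_def by (metis (no_types, lifting) ext has_prod_iff)
qed

lemma ell_gamma_eq:
  assumes nz: "ell_prod P Q z \<noteq> 0"
  shows "ell_gamma z P Q = ell_prod P Q (P * Q / z) / ell_prod P Q z"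
proof -
  have cq: "convergent_prod (\<lambda>k. 1 - w * Q ^ k)" for w
    by (rule geo_prod_convergent) (use Q in \<open>auto intro!: holomorphic_intros\<close>)
  have ce: "convergent_prod (\<lambda>k. qpoch_inf (w * P ^ k) Q)" for w
    by (rule geo_prod_convergent) (use P Q in \<open>auto intro!: qpoch_holomorphic\<close>)
  have 1: "(\<Prod>k. (1 - inverse z * P ^ (j + 1) * Q ^ (k + 1)) / (1 - z * P ^ j * Q ^ k)) =
     qpoch_inf ((P * Q / z) * P ^ j) Q / qpoch_inf (z * P ^ j) Q" for j
  proof -
    have "(\<Prod>k. (1 - (P * Q / z * P ^ j) * Q ^ k) / (1 - z * P ^ j * Q ^ k)) =
      qpoch_inf ((P * Q / z) * P ^ j) Q / qpoch_inf (z * P ^ j) Q"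
      unfolding qpoch_inf_def by (rule prodinf_divide[symmetric, OF cq cq])
    moreover have "P * Q / z * P ^ j * Q ^ k = inverse z * P ^ (j + 1) * Q ^ (k + 1)" for k
      by (simp add: divide_inverse mult_ac)
    ultimately show ?thesis by simp
  qed
  show ?thesis
    unfolding ell_gamma_def 1 ell_prod_def geo_prod_def
    by (rule prodinf_divide[symmetric, OF ce ce])
qed

end

section \<open>Theta functions\<close>

text \<open>The set where g does not vanish is open and nonempty, so the identity theorem extends
  the cancellation to the zeros of g. In this way the addition formulas lose their nonvanishing
  conditions.\<close>

lemma entire_eqI:
  assumes f: "f holomorphic_on UNIV" and f': "f' holomorphic_on UNIV" and g: "g holomorphic_on UNIV"
    and eq: "\<And>z. f z * g z = f' z * g z" and nz: "g z0 \<noteq> (0::complex)"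
  shows "f z = f' z"
proof -
  have "continuous_on UNIV g" using g holomorphic_on_imp_continuous_on by blast
  hence op: "open {z. g z \<noteq> 0}" by (intro open_Collect_neq) auto
  show ?thesis
  proof (rule analytic_continuation_open[OF op, of UNIV f f' z])
    show "{z. g z \<noteq> 0} \<noteq> {}" using nz by auto
    show "f z = f' z" if "z \<in> {z. g z \<noteq> 0}" for z using that eq[of z] by auto
  qed (use f f' in auto)
qed

text \<open>At a zero of g the quotient is prescribed by l'Hospital's rule. Near such a zero both
  functions may be replaced by their difference quotients, and that of g is nonzero because the zero
  is simple.\<close>

lemma entire_quotient_simple_zeros:
  assumes f: "f holomorphic_on UNIV" and g: "g holomorphic_on UNIV"
    and z: "\<And>z. g z = 0 \<Longrightarrow> f z = 0 \<and> deriv g z \<noteq> (0::complex)"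
  obtains h where "h holomorphic_on UNIV" "\<And>z. f z = h z * g z"
proof -
  define h where "h = (\<lambda>z. if g z = 0 then deriv f z / deriv g z else f z / g z)"
  have "h analytic_on {a}" for a
  proof (cases "g a = 0")
    case False
    have "continuous_on UNIV g" using g holomorphic_on_imp_continuous_on by blast
    hence op: "open {z. g z \<noteq> 0}" by (intro open_Collect_neq) auto
    have "(\<lambda>z. f z / g z) holomorphic_on {z. g z \<noteq> 0}"
      using f g by (auto intro!: holomorphic_intros intro: holomorphic_on_subset)
    hence "h holomorphic_on {z. g z \<noteq> 0}"
      by (rule holomorphic_transform) (auto simp: h_def)
    thus ?thesis using False op analytic_at by blast
  next
    case True
    define F where "F = (\<lambda>z. if z = a then deriv f a else (f z - f a) / (z - a))"
    define G where "G = (\<lambda>z. if z = a then deriv g a else (g z - g a) / (z - a))"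
    have F: "F holomorphic_on UNIV" unfolding F_def by (rule pole_lemma[OF f]) auto
    have G: "G holomorphic_on UNIV" unfolding G_def by (rule pole_lemma[OF g]) auto
    have fa: "f a = 0" and ga: "deriv g a \<noteq> 0" using z[OF True] by auto
    have "continuous_on UNIV G" using G holomorphic_on_imp_continuous_on by blast
    hence op: "open {z. G z \<noteq> 0}" by (intro open_Collect_neq) auto
    have "(\<lambda>z. F z / G z) holomorphic_on {z. G z \<noteq> 0}"
      using F G by (auto intro!: holomorphic_intros intro: holomorphic_on_subset)
    hence "h holomorphic_on {z. G z \<noteq> 0}"
      by (rule holomorphic_transform) (use True fa in \<open>auto simp: h_def F_def G_def\<close>)
    moreover have "a \<in> {z. G z \<noteq> 0}" using ga by (simp add: G_def)
    ultimately show ?thesis using op analytic_at by blast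
  qed
  hence "h holomorphic_on UNIV"
    by (meson analytic_at_imp_isCont analytic_imp_holomorphic analytic_on_analytic_at UNIV_I)
  moreover have "f z = h z * g z" for z using z[of z] by (auto simp: h_def)
  ultimately show ?thesis using that by blast
qed

lemma doubly_periodic_entire_const:
  assumes h: "h holomorphic_on UNIV" and per1: "\<And>x. h (x + 2 * of_real pi * \<i>) = h x"
    and per2: "\<And>x. h (x + L) = (h x :: complex)" and L: "Re L \<noteq> 0"
  obtains c where "\<And>x. h x = c"
proof -
  have sh: "h (x + of_int k * w) = h x" if "\<And>x. h (x + w) = h x" for x w and k :: int
  proof (induction k rule: int_induct[where k = 0])
    case (step1 i)
    have "h (x + of_int (i + 1) * w) = h ((x + of_int i * w) + w)" by (simp add: algebra_simps)
    with step1 that show ?case by simp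
  next
    case (step2 i)
    have "h (x + of_int i * w) = h ((x + of_int (i - 1) * w) + w)" by (simp add: algebra_simps)
    with step2 that show ?case by simp
  qed auto
  define K where "K = cbox (Complex (-\<bar>Re L\<bar>) (-2*pi)) (Complex \<bar>Re L\<bar> (2*pi))"
  have red: "\<exists>y\<in>K. h x = h y" for x
  proof -
    \<comment> \<open>A multiple of L first brings the real part into range; a multiple of 2 pi i,
      which leaves the real part alone, then does so for the imaginary part.\<close>
    define k where "k = \<lfloor>Re x / Re L\<rfloor>"
    define x' where "x' = x + of_int (-k) * L"
    define l where "l = \<lfloor>Im x' / (2*pi)\<rfloor>"
    define y where "y = x' + of_int (-l) * (2 * of_real pi * \<i>)"
    have "Re x' = frac (Re x / Re L) * Re L"
      using L by (simp add: x'_def k_def frac_def algebra_simps)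
    hence 1: "\<bar>Re y\<bar> \<le> \<bar>Re L\<bar>"
      using frac_ge_0[of "Re x / Re L"] frac_lt_1[of "Re x / Re L"]
      by (simp add: y_def abs_mult mult_left_le_one_le)
    have "Im y = frac (Im x' / (2*pi)) * (2*pi)"
      by (simp add: y_def l_def frac_def algebra_simps)
    hence 2: "\<bar>Im y\<bar> \<le> 2*pi"
      using frac_ge_0[of "Im x' / (2*pi)"] frac_lt_1[of "Im x' / (2*pi)"]
      by (simp add: abs_mult mult_left_le_one_le)
    have "h x = h y" unfolding y_def x'_def using sh[OF per1] sh[OF per2] by metis
    moreover have "y \<in> K" using 1 2 by (auto simp: K_def in_cbox_complex_iff)
    ultimately show ?thesis by blast
  qed
  have "continuous_on K h" using h holomorphic_on_imp_continuous_on continuous_on_subset by blast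
  hence "bounded (h ` K)"
    by (intro compact_imp_bounded compact_continuous_image) (auto simp: K_def)
  moreover have "range h \<subseteq> h ` K" using red by auto
  ultimately have "bounded (range h)" using bounded_subset by blast
  thus ?thesis using Liouville_theorem[OF h] that by (metis constant_on_def UNIV_I)
qed

section \<open>Theta functions in multiplicative and additive notation\<close>

definition theta :: "complex \<Rightarrow> complex \<Rightarrow> complex" where
  "theta P x = qpoch_inf x P * qpoch_inf (P / x) P"

context
  fixes P :: complex
  assumes P: "norm P < 1"
begin

lemma qpoch_compose_holomorphic:
  "f holomorphic_on A \<Longrightarrow> (\<lambda>z. qpoch_inf (f z) P) holomorphic_on A"
  using holomorphic_on_compose_gen[OF _ qpoch_holomorphic[OF P, of UNIV], of f A] by (simp add: o_def)

lemma theta_compose_holomorphic: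
  "f holomorphic_on A \<Longrightarrow> (\<And>z. z \<in> A \<Longrightarrow> f z \<noteq> 0) \<Longrightarrow> (\<lambda>z. theta P (f z)) holomorphic_on A"
  unfolding theta_def by (intro holomorphic_intros qpoch_compose_holomorphic) auto

lemma theta_inverse: "x \<noteq> 0 \<Longrightarrow> theta P (1 / x) = - theta P x / x"
proof -
  assume x: "x \<noteq> 0"
  have "theta P (1 / x) = (1 - 1 / x) * qpoch_inf (P / x) P * qpoch_inf (x * P) P"
    unfolding theta_def using qpoch_rec[OF P, of "1 / x"] by (simp add: mult_ac)
  also have "\<dots> = - ((1 - x) * qpoch_inf (x * P) P * qpoch_inf (P / x) P) / x"
    using x by (simp add: field_simps)
  also have "\<dots> = - theta P x / x"
    unfolding theta_def using qpoch_rec[OF P, of x] by simp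
  finally show ?thesis .
qed

lemma theta_shift: "x \<noteq> 0 \<Longrightarrow> P \<noteq> 0 \<Longrightarrow> theta P (x * P) = - theta P x / x"
  using theta_inverse[of x] by (simp add: theta_def mult_ac)

end

text \<open>The factor \<open>exp (-X / 2)\<close> makes the theta function odd in the additive
  variable. Up to normalization this is Jacobi's theta_1, for which the addition formulas take a
  symmetric form without prefactors.\<close>

definition br :: "complex \<Rightarrow> complex \<Rightarrow> complex" where
  "br L X = exp (-X / 2) * theta (exp L) (exp X)"

context
  fixes L :: complex
  assumes L: "Re L < 0"
begin

lemma norm_exp_L: "norm (exp L) < 1" using L by simp

lemma br_minus: "br L (-X) = - br L X"
proof -
  have "theta (exp L) (exp (-X)) = - theta (exp L) (exp X) / exp X"
    using theta_inverse[OF norm_exp_L, of "exp X"] by (simp add: exp_minus inverse_eq_divide)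
  moreover have "exp (X / 2) = exp (- X / 2) * exp X" by (simp flip: exp_add)
  ultimately show ?thesis by (simp add: br_def)
qed

lemma br_0 [simp]: "br L 0 = 0"
  using br_minus[of 0] by simp

lemma br_2pi: "br L (X + 2 * of_real pi * \<i>) = - br L X"
proof -
  have "- (X + 2 * of_real pi * \<i>) / 2 = -X/2 + -(of_real pi * \<i>)"
    by (simp add: diff_divide_distrib)
  hence "exp (- (X + 2 * of_real pi * \<i>) / 2) = exp (-X/2) * exp (-(of_real pi * \<i>))"
    by (simp only: exp_add)
  also have "exp (-(of_real pi * \<i>)) = (-1::complex)" by (simp add: exp_minus)
  finally show ?thesis by (simp add: br_def exp_add)
qed

lemma br_shift: "br L (X + L) = - exp (- X - L / 2) * br L X"
proof -
  have "theta (exp L) (exp (X + L)) = - theta (exp L) (exp X) / exp X"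
    using theta_shift[OF norm_exp_L, of "exp X", OF exp_not_eq_zero exp_not_eq_zero]
    by (simp add: exp_add)
  moreover have "- (X + L) / 2 = (- X - L / 2) + (-X/2) + X" by (simp add: field_simps)
  hence "exp (- (X + L) / 2) = exp (- X - L / 2) * exp (-X/2) * exp X"
    by (simp only: exp_add)
  ultimately show ?thesis by (simp add: br_def)
qed

lemma br_holomorphic [holomorphic_intros]:
  assumes "f holomorphic_on A" shows "(\<lambda>z. br L (f z)) holomorphic_on A"
proof -
  have "(\<lambda>X. theta (exp L) (exp X)) holomorphic_on UNIV"
    by (intro theta_compose_holomorphic norm_exp_L holomorphic_on_exp) auto
  hence "br L holomorphic_on UNIV" unfolding br_def by (intro holomorphic_intros) auto
  from holomorphic_on_compose_gen[OF assms this] show ?thesis by (simp add: o_def)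
qed

lemma br_near_0:
  "br L X = (1 - exp X) * (exp (-X / 2) * qpoch_inf (exp (X + L)) (exp L) * qpoch_inf (exp (L - X)) (exp L))"
  unfolding br_def theta_def using qpoch_rec[OF norm_exp_L, of "exp X"]
  by (simp add: exp_add exp_diff)

lemma exp_power_eq_1_iff:
  "exp (X::complex) * exp L ^ j = 1 \<longleftrightarrow> (\<exists>a::int. X = 2 * of_real pi * \<i> * of_int a - of_nat j * L)"
proof -
  have "exp X * exp L ^ j = exp (X + of_nat j * L)" by (simp add: exp_add exp_of_nat_mult)
  moreover have "exp (X + of_nat j * L) = 1 \<longleftrightarrow> (\<exists>a::int. X + of_nat j * L = 2 * of_real pi * \<i> * of_int a)"
    unfolding exp_eq_1 by (auto simp: complex_eq_iff mult_ac)
  ultimately show ?thesis by (simp add: algebra_simps eq_diff_eq)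
qed

lemma br_eq_0:
  assumes "br L X = 0"
  shows "\<exists>a b::int. X = 2 * of_real pi * \<i> * of_int a + of_int b * L"
proof -
  have "qpoch_inf (exp X) (exp L) = 0 \<or> qpoch_inf (exp (L - X)) (exp L) = 0"
    using assms by (auto simp: br_def theta_def exp_diff)
  then obtain j where "exp X * exp L ^ j = 1 \<or> exp (L - X) * exp L ^ j = 1"
    by (auto simp: qpoch_eq_0_iff[OF norm_exp_L])
  then consider a where "X = 2 * of_real pi * \<i> * of_int a - of_nat j * L"
    | a where "L - X = 2 * of_real pi * \<i> * of_int a - of_nat j * L"
    unfolding exp_power_eq_1_iff by blast
  thus ?thesis
  proof cases
    case (1 a)
    thus ?thesis by (intro exI[of _ a] exI[of _ "- int j"]) simp
  next
    case (2 a)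
    hence "X = L - (2 * of_real pi * \<i> * of_int a - of_nat j * L)" by (simp add: algebra_simps)
    thus ?thesis by (intro exI[of _ "-a"] exI[of _ "1 + int j"]) (simp add: algebra_simps)
  qed
qed

text \<open>Translation by any lattice point costs only a nonvanishing factor
  \<open>C * exp (k * X)\<close>. Hence facts about the zero at 0 carry over to every lattice
  point.\<close>

lemma br_translate:
  obtains C k where "C \<noteq> (0::complex)"
    "\<And>X. br L (X + (2 * of_real pi * \<i> * of_int a + of_int b * L)) = C * exp (k * X) * br L X"
proof -
  have 1: "\<exists>C. C \<noteq> 0 \<and> (\<forall>X. br L (X + 2 * of_real pi * \<i> * of_int a) = C * br L X)"
  proof (induction a rule: int_induct[where k = 0])
    case (step1 i)
    then obtain C where C: "C \<noteq> 0" "\<And>X. br L (X + 2 * of_real pi * \<i> * of_int i) = C * br L X" by auto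
    have "br L (X + 2 * of_real pi * \<i> * of_int (i + 1)) = - C * br L X" for X
      using br_2pi[of "X + 2 * of_real pi * \<i> * of_int i"] C(2)[of X] by (simp add: algebra_simps)
    thus ?case using C(1) by (intro exI[of _ "-C"]) auto
  next
    case (step2 i)
    then obtain C where C: "C \<noteq> 0" "\<And>X. br L (X + 2 * of_real pi * \<i> * of_int i) = C * br L X" by auto
    have "br L (X + 2 * of_real pi * \<i> * of_int (i - 1)) = - C * br L X" for X
    proof -
      let ?Y = "X + 2 * of_real pi * \<i> * of_int (i - 1)"
      have "?Y + 2 * of_real pi * \<i> = X + 2 * of_real pi * \<i> * of_int i" by (simp add: algebra_simps)
      hence "br L (X + 2 * of_real pi * \<i> * of_int i) = - br L ?Y" using br_2pi[of ?Y] by metis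
      hence "br L ?Y = - br L (X + 2 * of_real pi * \<i> * of_int i)" by simp
      thus ?thesis by (simp only: C(2)) simp
    qed
    thus ?case using C(1) by (intro exI[of _ "-C"]) auto
  qed (auto intro!: exI[of _ 1])
  have 2: "\<exists>C k. C \<noteq> 0 \<and> (\<forall>X. br L (X + of_int b * L) = C * exp (k * X) * br L X)"
  proof (induction b rule: int_induct[where k = 0])
    case base
    show ?case by (intro exI[of _ 1] exI[of _ 0]) auto
  next
    case (step1 i)
    then obtain C k where C: "C \<noteq> 0" "\<And>X. br L (X + of_int i * L) = C * exp (k * X) * br L X" by auto
    have "br L (X + of_int (i + 1) * L) = (- C * exp (- of_int i * L - L / 2)) * exp ((k - 1) * X) * br L X" for X
    proof -
      have "br L (X + of_int (i + 1) * L) = br L ((X + of_int i * L) + L)" by (simp add: algebra_simps)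
      also have "\<dots> = - exp (- (X + of_int i * L) - L / 2) * (C * exp (k * X) * br L X)"
        by (simp only: br_shift C(2))
      also have "exp (- (X + of_int i * L) - L / 2) * exp (k * X) = exp (- of_int i * L - L / 2) * exp ((k - 1) * X)"
        by (simp add: algebra_simps flip: exp_add)
      hence "- exp (- (X + of_int i * L) - L / 2) * (C * exp (k * X) * br L X) =
        (- C * exp (- of_int i * L - L / 2)) * exp ((k - 1) * X) * br L X" by (simp add: mult_ac)
      finally show ?thesis .
    qed
    thus ?case using C(1) by (intro exI[of _ "- C * exp (- of_int i * L - L / 2)"] exI[of _ "k - 1"]) auto
  next
    case (step2 i)
    then obtain C k where C: "C \<noteq> 0" "\<And>X. br L (X + of_int i * L) = C * exp (k * X) * br L X" by auto
    have "br L (X + of_int (i - 1) * L) = (- C * exp (of_int (i - 1) * L + L / 2)) * exp ((k + 1) * X) * br L X" for X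
    proof -
      let ?Y = "X + of_int (i - 1) * L"
      have "br L (X + of_int i * L) = br L (?Y + L)" by (simp add: algebra_simps)
      also have "\<dots> = - exp (- ?Y - L / 2) * br L ?Y" by (rule br_shift)
      finally have e: "exp (- ?Y - L / 2) * br L ?Y = - C * exp (k * X) * br L X"
        using C(2)[of X] by (simp add: minus_equation_iff)
      have "br L ?Y = exp (?Y + L / 2) * (exp (- ?Y - L / 2) * br L ?Y)"
        by (simp flip: exp_add mult.assoc)
      also have "\<dots> = - C * (exp (?Y + L / 2) * exp (k * X)) * br L X"
        unfolding e by (simp add: mult_ac)
      also have "exp (?Y + L / 2) * exp (k * X) = exp (of_int (i - 1) * L + L / 2) * exp ((k + 1) * X)"
        by (simp add: algebra_simps flip: exp_add)
      finally show ?thesis by (simp add: mult_ac)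
    qed
    thus ?case using C(1) by (intro exI[of _ "- C * exp (of_int (i - 1) * L + L / 2)"] exI[of _ "k + 1"]) auto
  qed
  obtain C where C: "C \<noteq> 0" "\<And>X. br L (X + 2 * of_real pi * \<i> * of_int a) = C * br L X" using 1 by auto
  obtain D k where D: "D \<noteq> 0" "\<And>X. br L (X + of_int b * L) = D * exp (k * X) * br L X" using 2 by auto
  show ?thesis
  proof (rule that[of "D * exp (k * (2 * of_real pi * \<i> * of_int a)) * C" k])
    fix X
    have "br L (X + (2 * of_real pi * \<i> * of_int a + of_int b * L)) =
       br L ((X + 2 * of_real pi * \<i> * of_int a) + of_int b * L)" by (simp add: algebra_simps)
    also have "\<dots> = D * exp (k * (X + 2 * of_real pi * \<i> * of_int a)) * (C * br L X)"
      by (simp only: C(2) D(2))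
    finally show "br L (X + (2 * of_real pi * \<i> * of_int a + of_int b * L)) =
       D * exp (k * (2 * of_real pi * \<i> * of_int a)) * C * exp (k * X) * br L X"
      by (simp add: distrib_left exp_add mult_ac)
  qed (use C D in auto)
qed

lemma qpoch_expL_nz: "qpoch_inf (exp L) (exp L) \<noteq> 0"
proof
  assume "qpoch_inf (exp L) (exp L) = 0"
  then obtain j where "exp L * exp L ^ j = 1" by (auto simp: qpoch_eq_0_iff[OF norm_exp_L])
  hence "exp L ^ Suc j = 1" by simp
  hence "norm (exp L) ^ Suc j = 1" by (metis norm_one norm_power)
  thus False using norm_exp_L power_less_one_iff[of "norm (exp L)" "Suc j"] by simp
qed

lemma br_deriv_0: "\<exists>D. D \<noteq> 0 \<and> (br L has_field_derivative D) (at 0)"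
proof -
  define h where "h = (\<lambda>X. exp (-X / 2) * qpoch_inf (exp (X + L)) (exp L) * qpoch_inf (exp (L - X)) (exp L))"
  have "h holomorphic_on UNIV" unfolding h_def
    by (intro holomorphic_intros qpoch_compose_holomorphic norm_exp_L) auto
  then obtain h' where h': "(h has_field_derivative h') (at 0)"
    by (meson UNIV_I field_differentiable_def holomorphic_on_imp_differentiable_at open_UNIV)
  have "((\<lambda>X. (1 - exp X) * h X) has_field_derivative (- h 0)) (at 0)"
    by (rule derivative_eq_intros h' refl | simp)+
  moreover have "(\<lambda>X. (1 - exp X) * h X) = br L" using br_near_0 by (auto simp: h_def)
  moreover have "h 0 \<noteq> 0" using qpoch_expL_nz by (simp add: h_def)
  ultimately show ?thesis by (intro exI[of _ "- h 0"]) auto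
qed

text \<open>Every zero is a lattice point, and by \<open>br_translate\<close> the function looks
  there as it does at 0, where the zero is simple.\<close>

lemma br_deriv_nz:
  assumes "br L X = 0" shows "\<exists>D. D \<noteq> 0 \<and> (br L has_field_derivative D) (at X)"
proof -
  obtain a b :: int where X: "X = 2 * of_real pi * \<i> * of_int a + of_int b * L"
    using br_eq_0[OF assms] by auto
  obtain C k where C: "C \<noteq> (0::complex)" "\<And>Y. br L (Y + X) = C * exp (k * Y) * br L Y"
    using br_translate[of a b] X by metis
  obtain D where D: "D \<noteq> 0" "(br L has_field_derivative D) (at 0)" using br_deriv_0 by auto
  have "((\<lambda>Y. C * exp (k * Y) * br L Y) has_field_derivative (C * D)) (at 0)"
    by (rule derivative_eq_intros D(2) refl | simp)+
  hence "((\<lambda>Y. br L (Y + X)) has_field_derivative (C * D)) (at 0)" by (simp add: C(2))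
  hence "(br L has_field_derivative (C * D)) (at X)" using DERIV_shift[of "br L" "C * D" 0 X] by simp
  thus ?thesis using C(1) D(1) by (intro exI[of _ "C * D"]) auto
qed

lemma br_nonzero: "\<exists>X. br L X \<noteq> 0"
proof (rule ccontr)
  assume "\<not> ?thesis"
  hence "br L = (\<lambda>X. 0)" by auto
  moreover obtain D where "D \<noteq> 0" "(br L has_field_derivative D) (at 0)" using br_deriv_0 by auto
  ultimately show False using DERIV_unique[of "br L" D 0 0] by simp
qed

section \<open>Addition formulas for the theta function\<close>

text \<open>As functions of x, the left side and \<open>br L (x + u) * br L (x - u)\<close> have the
  same multipliers for both periods, and the first vanishes at the zeros of the second. The quotient
  is therefore entire and doubly periodic, so constant. The condition on 2 u keeps the two families
  of zeros apart, which makes all of them simple.\<close>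

lemma br_fay_aux:
  assumes u: "br L (2 * u) \<noteq> 0"
  obtains c where
   "\<And>x. br L (x + y) * br L (x - y) * br L (u + v) * br L (u - v) -
        br L (x + v) * br L (x - v) * br L (u + y) * br L (u - y) = c * (br L (x + u) * br L (x - u))"
proof -
  let ?b = "br L"
  define f where "f = (\<lambda>x. ?b (x + y) * ?b (x - y) * ?b (u + v) * ?b (u - v) -
        ?b (x + v) * ?b (x - v) * ?b (u + y) * ?b (u - y))"
  define g where "g = (\<lambda>x. ?b (x + u) * ?b (x - u))"
  have f: "f holomorphic_on UNIV" unfolding f_def by (intro holomorphic_intros)
  have g: "g holomorphic_on UNIV" unfolding g_def by (intro holomorphic_intros)
  \<comment> \<open>The multiplier of the pair does not depend on w, so when x - u is a lattice
    point both terms of \<open>f\<close> reduce to the same product as at x = u and cancel.\<close>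
  have prod_tr: "\<exists>C. C \<noteq> 0 \<and> (\<forall>w. ?b (u + l + w) * ?b (u + l - w) = C * (?b (u + w) * ?b (u - w)))"
    if l: "l = 2 * of_real pi * \<i> * of_int a + of_int b * L" for l and a b :: int
  proof -
    obtain C k where C: "C \<noteq> (0::complex)" "\<And>Y. ?b (Y + l) = C * exp (k * Y) * ?b Y"
      using br_translate[of a b] l by metis
    have "?b (u + l + w) * ?b (u + l - w) = (C * C * exp (k * (2 * u))) * (?b (u + w) * ?b (u - w))" for w
    proof -
      have "?b (u + l + w) = C * exp (k * (u + w)) * ?b (u + w)"
           "?b (u + l - w) = C * exp (k * (u - w)) * ?b (u - w)"
        using C(2)[of "u + w"] C(2)[of "u - w"] by (simp_all add: algebra_simps)
      moreover have "exp (k * (u + w)) * exp (k * (u - w)) = exp (k * (2 * u))"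
        by (simp add: algebra_simps flip: exp_add)
      ultimately show ?thesis by (simp add: mult_ac)
    qed
    thus ?thesis using C(1) by (intro exI[of _ "C * C * exp (k * (2 * u))"]) auto
  qed
  have zu: "f x = 0 \<and> ?b (x + u) \<noteq> 0" if x: "?b (x - u) = 0" for x
  proof -
    obtain a b :: int where ab: "x - u = 2 * of_real pi * \<i> * of_int a + of_int b * L"
      using br_eq_0[OF x] by auto
    obtain C where C: "C \<noteq> 0" "\<And>w. ?b (u + (x - u) + w) * ?b (u + (x - u) - w) = C * (?b (u + w) * ?b (u - w))"
      using prod_tr[OF ab] by auto
    have C': "?b (x + w) * ?b (x - w) = C * (?b (u + w) * ?b (u - w))" for w using C(2)[of w] by simp
    have "f x = 0" unfolding f_def C' by (simp add: mult_ac)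
    moreover obtain C k where C: "C \<noteq> (0::complex)" "\<And>Y. ?b (Y + (x - u)) = C * exp (k * Y) * ?b Y"
      using br_translate[of a b] ab by metis
    have "?b (x + u) = C * exp (k * (2 * u)) * ?b (2 * u)" using C(2)[of "2 * u"] by (simp add: algebra_simps)
    ultimately show ?thesis using C(1) u by simp
  qed
  \<comment> \<open>Evenness reduces the zeros of \<open>br L (x + u)\<close> to those of
    \<open>br L (x - u)\<close>.\<close>
  have even: "f (-x) = f x" "g (-x) = g x" for x
  proof -
    have "?b (-x + w) * ?b (-x - w) = ?b (x + w) * ?b (x - w)" for w
    proof -
      have "-x + w = - (x - w)" "-x - w = - (x + w)" by simp_all
      thus ?thesis by (simp only: br_minus) simp
    qed
    thus "f (-x) = f x" "g (-x) = g x" by (simp_all add: f_def g_def)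
  qed
  have zeros: "f x = 0 \<and> deriv g x \<noteq> 0" if gx: "g x = 0" for x
  proof -
    have *: "deriv g x = D * ?b (x + u)" if "(?b has_field_derivative D) (at (x - u))" "?b (x - u) = 0" for x D
    proof -
      have "?b field_differentiable at (x + u)"
        using br_holomorphic[OF holomorphic_on_id, of UNIV] by (auto simp: holomorphic_on_def)
      then obtain D' where "(?b has_field_derivative D') (at (x + u))" by (auto simp: field_differentiable_def)
      hence d1: "((\<lambda>x. ?b (x + u)) has_field_derivative D') (at x)" by (simp add: DERIV_shift)
      have d2: "((\<lambda>x. ?b (x - u)) has_field_derivative D) (at x)"
        using that(1) DERIV_shift[of ?b D x "-u"] by simp
      have "(g has_field_derivative (D' * ?b (x - u) + D * ?b (x + u))) (at x)"
        unfolding g_def using DERIV_mult'[OF d1 d2] by (simp add: mult_ac add_ac)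
      thus ?thesis using that(2) by (simp add: DERIV_imp_deriv)
    qed
    have A: "f x = 0 \<and> deriv g x \<noteq> 0" if x: "?b (x - u) = 0" for x
    proof -
      obtain D where D: "D \<noteq> 0" "(?b has_field_derivative D) (at (x - u))" using br_deriv_nz[OF x] by auto
      show ?thesis using zu[OF x] *[OF D(2) x] D(1) by simp
    qed
    show ?thesis
    proof (cases "?b (x - u) = 0")
      case True thus ?thesis by (rule A)
    next
      case False
      hence *: "?b (x + u) = 0" using gx by (simp add: g_def)
      have "-x - u = - (x + u)" by simp
      hence "?b (-x - u) = 0" by (simp only: br_minus * minus_zero)
      hence B: "f (-x) = 0" "deriv g (-x) \<noteq> 0" using A[of "-x"] by auto
      have "g field_differentiable at x"
        using g by (auto simp: holomorphic_on_def)
      then obtain g' where g': "(g has_field_derivative g') (at x)" by (auto simp: field_differentiable_def)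
      have "((\<lambda>y. g (-y)) has_field_derivative (- g')) (at (-x))"
      proof -
        have m: "(uminus has_field_derivative (-1::complex)) (at (-x))" by (auto intro!: derivative_eq_intros)
        show ?thesis using DERIV_chain2[OF _ m, of g g'] g' by simp
      qed
      hence "(g has_field_derivative (- g')) (at (-x))" by (simp add: even(2))
      hence "deriv g (-x) = - deriv g x" using g' by (simp add: DERIV_imp_deriv)
      thus ?thesis using B even by simp
    qed
  qed
  obtain h where h: "h holomorphic_on UNIV" "\<And>x. f x = h x * g x"
    using entire_quotient_simple_zeros[OF f g zeros] by blast
  have gnz: "\<exists>x. g x \<noteq> 0"
  proof (rule ccontr)
    assume "\<not> ?thesis"
    hence "g = (\<lambda>x. 0)" by auto
    hence "g u = 0" "deriv g u = 0" by auto
    thus False using zeros by auto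
  qed
  then obtain x0 where x0: "g x0 \<noteq> 0" by auto
  have hsh: "h (x + w) = h x" if "\<And>x. f (x + w) = e x * f x" "\<And>x. g (x + w) = e x * g x" "\<And>x. e x \<noteq> 0" for e w x
  proof (rule entire_eqI[of "\<lambda>x. h (x + w)" h g x0 x])
    show "(\<lambda>x. h (x + w)) holomorphic_on UNIV"
    proof -
      have "(\<lambda>x. x + w) holomorphic_on UNIV" by (intro holomorphic_intros)
      from holomorphic_on_compose_gen[OF this h(1)] show ?thesis by (simp add: o_def)
    qed
    show "h (z + w) * g z = h z * g z" for z
      using h(2)[of "z + w"] h(2)[of z] that[of z] by (auto simp: mult_ac)
  qed (use h g x0 in auto)
  have shp: "?b (x + 2 * of_real pi * \<i> + w) * ?b (x + 2 * of_real pi * \<i> - w) = 1 * (?b (x + w) * ?b (x - w))" for x w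
    using br_2pi[of "x + w"] br_2pi[of "x - w"] by (simp add: algebra_simps)
  have shL: "?b (x + L + w) * ?b (x + L - w) = exp (- 2 * x - L) * (?b (x + w) * ?b (x - w))" for x w
  proof -
    have "?b (x + L + w) * ?b (x + L - w) = exp (- (x + w) - L / 2) * exp (- (x - w) - L / 2) * (?b (x + w) * ?b (x - w))"
      using br_shift[of "x + w"] br_shift[of "x - w"] by (simp add: algebra_simps)
    also have "exp (- (x + w) - L / 2) * exp (- (x - w) - L / 2) = exp (- 2 * x - L)"
      by (simp flip: exp_add)
    finally show ?thesis .
  qed
  have "h (x + 2 * of_real pi * \<i>) = h x" for x
    by (rule hsh[of _ "\<lambda>_. 1"]) (unfold f_def g_def shp, simp_all)
  moreover have "h (x + L) = h x" for x
    by (rule hsh[of _ "\<lambda>x. exp (- 2 * x - L)"]) (unfold f_def g_def shL, simp_all add: algebra_simps)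
  ultimately obtain c where c: "\<And>x. h x = c"
    using doubly_periodic_entire_const[OF h(1), of L] L by auto
  show ?thesis using that[of c] h(2) c by (simp add: f_def g_def)
qed

text \<open>This is Weierstrass' three-term addition formula. Putting x = v in
  \<open>br_fay_aux\<close> kills the second term, because \<open>br L 0 = 0\<close>, and so
  determines the constant. The conditions on u and v are then removed by \<open>entire_eqI\<close>,
  first in v and afterwards in u.\<close>

theorem br_fay:
  "br L (x + y) * br L (x - y) * br L (u + v) * br L (u - v) -
   br L (x + v) * br L (x - v) * br L (u + y) * br L (u - y) =
   br L (y + v) * br L (y - v) * br L (x + u) * br L (x - u)"
proof -
  let ?b = "br L"
  have 1: "?b (x + y) * ?b (x - y) * ?b (u + v) * ?b (u - v) -
      ?b (x + v) * ?b (x - v) * ?b (u + y) * ?b (u - y) =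
      ?b (y + v) * ?b (y - v) * ?b (x + u) * ?b (x - u)"
    if u: "?b (2 * u) \<noteq> 0" and w: "?b (u + v) * ?b (u - v) \<noteq> 0" for u v
  proof -
    obtain c where c: "\<And>x. ?b (x + y) * ?b (x - y) * ?b (u + v) * ?b (u - v) -
        ?b (x + v) * ?b (x - v) * ?b (u + y) * ?b (u - y) = c * (?b (x + u) * ?b (x - u))"
      using br_fay_aux[OF u] by blast
    have "?b (v + y) * ?b (v - y) * (?b (u + v) * ?b (u - v)) = - c * (?b (u + v) * ?b (u - v))"
    proof -
      have "?b (v + u) = ?b (u + v)" "?b (v - u) = - ?b (u - v)"
        using br_minus[of "u - v"] by (simp_all add: add.commute)
      thus ?thesis using c[of v] by (simp add: mult.assoc del: mult_cancel_left mult_cancel_right)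
    qed
    hence "c = ?b (y + v) * ?b (y - v)"
      using w br_minus[of "y - v"] by (simp add: add.commute minus_equation_iff)
    thus ?thesis using c[of x] by (simp add: mult_ac)
  qed
  obtain X where X: "?b X \<noteq> 0" using br_nonzero by auto
  have 2: "?b (x + y) * ?b (x - y) * ?b (u + v) * ?b (u - v) -
      ?b (x + v) * ?b (x - v) * ?b (u + y) * ?b (u - y) =
      ?b (y + v) * ?b (y - v) * ?b (x + u) * ?b (x - u)"
    if u: "?b (2 * u) \<noteq> 0" for u v
  proof (rule entire_eqI[of "\<lambda>v. ?b (x + y) * ?b (x - y) * ?b (u + v) * ?b (u - v) -
      ?b (x + v) * ?b (x - v) * ?b (u + y) * ?b (u - y)"
      "\<lambda>v. ?b (y + v) * ?b (y - v) * ?b (x + u) * ?b (x - u)" "\<lambda>v. ?b (u + v) * ?b (u - v)"])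
    show "(\<lambda>v. ?b (x + y) * ?b (x - y) * ?b (u + v) * ?b (u - v) -
      ?b (x + v) * ?b (x - v) * ?b (u + y) * ?b (u - y)) holomorphic_on UNIV"
      by (intro holomorphic_intros)
    show "(\<lambda>v. ?b (y + v) * ?b (y - v) * ?b (x + u) * ?b (x - u)) holomorphic_on UNIV"
      by (intro holomorphic_intros)
    show "(\<lambda>v. ?b (u + v) * ?b (u - v)) holomorphic_on UNIV" by (intro holomorphic_intros)
    have "\<exists>v. ?b (u + v) * ?b (u - v) \<noteq> 0"
    proof (rule ccontr)
      assume "\<not> ?thesis"
      hence *: "?b (u + v) * ?b (u - v) = 0 * ?b (u - v)" for v by simp
      have "?b (u + v) = 0" for v
      proof (rule entire_eqI[of "\<lambda>v. ?b (u + v)" "\<lambda>v. 0" "\<lambda>v. ?b (u - v)" "u - X"])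
        show "(\<lambda>v. ?b (u + v)) holomorphic_on UNIV" "(\<lambda>v. ?b (u - v)) holomorphic_on UNIV"
          by (intro holomorphic_intros)+
      qed (use X * in auto)
      from this[of "X - u"] show False using X by simp
    qed
    thus "?b (u + (SOME v. ?b (u + v) * ?b (u - v) \<noteq> 0)) * ?b (u - (SOME v. ?b (u + v) * ?b (u - v) \<noteq> 0)) \<noteq> 0"
      by (rule someI_ex)
    show "(?b (x + y) * ?b (x - y) * ?b (u + v) * ?b (u - v) - ?b (x + v) * ?b (x - v) * ?b (u + y) * ?b (u - y)) *
      (?b (u + v) * ?b (u - v)) = ?b (y + v) * ?b (y - v) * ?b (x + u) * ?b (x - u) * (?b (u + v) * ?b (u - v))" for v
      using 1[OF u, of v] by (cases "?b (u + v) * ?b (u - v) = 0") auto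
  qed
  show ?thesis
  proof (rule entire_eqI[of "\<lambda>u. ?b (x + y) * ?b (x - y) * ?b (u + v) * ?b (u - v) -
      ?b (x + v) * ?b (x - v) * ?b (u + y) * ?b (u - y)"
      "\<lambda>u. ?b (y + v) * ?b (y - v) * ?b (x + u) * ?b (x - u)" "\<lambda>u. ?b (2 * u)" "X / 2"])
    show "(\<lambda>u. ?b (x + y) * ?b (x - y) * ?b (u + v) * ?b (u - v) -
      ?b (x + v) * ?b (x - v) * ?b (u + y) * ?b (u - y)) holomorphic_on UNIV"
      by (intro holomorphic_intros)
    show "(\<lambda>u. ?b (y + v) * ?b (y - v) * ?b (x + u) * ?b (x - u)) holomorphic_on UNIV"
      by (intro holomorphic_intros)
    show "(\<lambda>u. ?b (2 * u)) holomorphic_on UNIV" by (intro holomorphic_intros)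
    show "(?b (x + y) * ?b (x - y) * ?b (z + v) * ?b (z - v) - ?b (x + v) * ?b (x - v) * ?b (z + y) * ?b (z - y)) *
      ?b (2 * z) = ?b (y + v) * ?b (y - v) * ?b (x + z) * ?b (x - z) * ?b (2 * z)" for z
      using 2[of z v] by (cases "?b (2 * z) = 0") auto
  qed (use X in auto)
qed

text \<open>The arguments of \<open>br_fay\<close> come in pairs x + y, x - y and u + v, u - v; half
  sums and half differences bring four arguments with sum 2 z + 2 z into this form, and the
  vanishing of \<open>U1 + U2 + U3 + U4\<close> matches the remaining ones.\<close>

lemma br_four:
  assumes U: "U1 + U2 + U3 + U4 = 0"
  shows "br L (U1 + z) * br L (U2 + z) * br L (U3 + z) * br L (U4 + z) -
         br L (U1 - z) * br L (U2 - z) * br L (U3 - z) * br L (U4 - z) =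
         br L (2 * z) * br L (U1 + U2) * br L (U1 + U3) * br L (U1 + U4)"
proof -
  define x y u v where "x = (U1 + U2) / 2 + z" "y = (U1 - U2) / 2"
    "u = (U3 + U4) / 2 + z" "v = (U3 - U4) / 2"
  have U4: "U4 = - U1 - U2 - U3" using U by (simp add: algebra_simps eq_neg_iff_add_eq_0)
  have e: "x + y = U1 + z" "x - y = U2 + z" "u + v = U3 + z" "u - v = U4 + z"
    "x + v = - (U4 - z)" "x - v = - (U3 - z)" "u + y = - (U2 - z)" "u - y = - (U1 - z)"
    "y + v = U1 + U3" "y - v = U1 + U4" "x + u = 2 * z" "x - u = U1 + U2"
    unfolding x_y_u_v_def U4 by (simp_all add: field_simps)
  show ?thesis using br_fay[of x y u v] unfolding e br_minus by (simp add: mult_ac)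
qed

text \<open>\<open>expand\<close> writes the product of the factors for S2 and S3 as a combination
  of two products, one with \<open>br L (S6 - z)\<close> and one with \<open>br L (S1 - z)\<close>.
  Multiplied by the other four factors, each part is a product even in z times four factors whose
  arguments sum to zero at z = 0; antisymmetrizing in z reduces it to \<open>br_four\<close>. The
  factor \<open>br L (S4 + S5)\<close> comes from \<open>expand\<close>.\<close>

lemma br_six_aux:
  assumes S: "S1 + S2 + S3 + S4 + S5 + S6 = 0"
  shows "br L (S1 - S6) * (br L (S1 + z) * br L (S2 + z) * br L (S3 + z) * br L (S4 + z) * br L (S5 + z) * br L (S6 + z)
     - br L (S1 - z) * br L (S2 - z) * br L (S3 - z) * br L (S4 - z) * br L (S5 - z) * br L (S6 - z)) * br L (S4 + S5) =
     br L (2 * z) * (br L (S2 + S6) * br L (S3 + S6) * br L (S4 + S6) * br L (S5 + S6) * br L (S1 + z) * br L (S1 - z)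
       - br L (S1 + S2) * br L (S1 + S3) * br L (S1 + S4) * br L (S1 + S5) * br L (S6 + z) * br L (S6 - z)) * br L (S4 + S5)"
proof -
  let ?b = "br L"
  have W: "S1 + S2 + S3 + S6 = - (S4 + S5)" using S by (simp add: algebra_simps eq_neg_iff_add_eq_0)
  have expand: "?b (S2 + z) * ?b (S3 + z) * ?b (S4 + S5) * ?b (S1 - S6) =
     ?b (S6 + S2 + S3 + z) * ?b (S6 - z) * ?b (S1 + S2) * ?b (S1 + S3)
     - ?b (S2 + S6) * ?b (S3 + S6) * ?b (S1 + S2 + S3 + z) * ?b (S1 - z)" for z
  proof -
    define x y u v where "x = (S2 + S3) / 2 + z" "y = (S2 - S3) / 2"
      "u = (S2 + S3) / 2 + S1" "v = (S2 + S3) / 2 + S6"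
    have e: "x + y = S2 + z" "x - y = S3 + z" "u + v = - (S4 + S5)" "u - v = S1 - S6"
      "x + v = S6 + S2 + S3 + z" "x - v = - (S6 - z)" "u + y = S1 + S2" "u - y = S1 + S3"
      "y + v = S2 + S6" "y - v = - (S3 + S6)" "x + u = S1 + S2 + S3 + z" "x - u = - (S1 - z)"
      unfolding x_y_u_v_def W[symmetric] by (simp_all add: field_simps)
    show ?thesis using br_fay[of x y u v] unfolding e br_minus by (simp add: algebra_simps)
  qed
  have X6: "?b (S1 + z) * ?b (S6 + S2 + S3 + z) * ?b (S4 + z) * ?b (S5 + z) -
     ?b (S1 - z) * ?b (S6 + S2 + S3 - z) * ?b (S4 - z) * ?b (S5 - z) =
     ?b (2 * z) * ?b (S1 + (S6 + S2 + S3)) * ?b (S1 + S4) * ?b (S1 + S5)"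
    by (rule br_four) (use S in \<open>simp add: algebra_simps\<close>)
  have X1: "?b (S6 + z) * ?b (S1 + S2 + S3 + z) * ?b (S4 + z) * ?b (S5 + z) -
     ?b (S6 - z) * ?b (S1 + S2 + S3 - z) * ?b (S4 - z) * ?b (S5 - z) =
     ?b (2 * z) * ?b (S6 + (S1 + S2 + S3)) * ?b (S6 + S4) * ?b (S6 + S5)"
    by (rule br_four) (use S in \<open>simp add: algebra_simps\<close>)
  have e: "S1 + (S6 + S2 + S3) = - (S4 + S5)" "S6 + (S1 + S2 + S3) = - (S4 + S5)" using W by (simp_all add: algebra_simps)
  note X6' = X6[unfolded e br_minus] and X1' = X1[unfolded e br_minus]
  have c: "S6 + S4 = S4 + S6" "S6 + S5 = S5 + S6" by simp_all
  show ?thesis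
    using expand[of z] expand[of "-z"] X6' X1' unfolding c
    by simp algebra
qed

text \<open>Moving S4 and S2 in opposite directions preserves the vanishing sum, and along this line
  the factor \<open>br L (S4 + S5)\<close> of \<open>br_six_aux\<close> can be cancelled. The
  identity is the source of the telescoping for the beta integral.\<close>

lemma br_six:
  assumes S: "S1 + S2 + S3 + S4 + S5 + S6 = 0"
  shows "br L (S1 - S6) * (br L (S1 + z) * br L (S2 + z) * br L (S3 + z) * br L (S4 + z) * br L (S5 + z) * br L (S6 + z)
     - br L (S1 - z) * br L (S2 - z) * br L (S3 - z) * br L (S4 - z) * br L (S5 - z) * br L (S6 - z)) =
     br L (2 * z) * (br L (S2 + S6) * br L (S3 + S6) * br L (S4 + S6) * br L (S5 + S6) * br L (S1 + z) * br L (S1 - z)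
       - br L (S1 + S2) * br L (S1 + S3) * br L (S1 + S4) * br L (S1 + S5) * br L (S6 + z) * br L (S6 - z))"
  (is "?l S2 S4 = ?r S2 S4")
proof -
  obtain X where X: "br L X \<noteq> 0" using br_nonzero by auto
  have "?l (S2 - 0) (S4 + 0) = ?r (S2 - 0) (S4 + 0)"
  proof (rule entire_eqI[of "\<lambda>s. ?l (S2 - s) (S4 + s)" "\<lambda>s. ?r (S2 - s) (S4 + s)" "\<lambda>s. br L (S4 + s + S5)" "X - S4 - S5"])
    show "(\<lambda>s. ?l (S2 - s) (S4 + s)) holomorphic_on UNIV" by (intro holomorphic_intros)
    show "(\<lambda>s. ?r (S2 - s) (S4 + s)) holomorphic_on UNIV" by (intro holomorphic_intros)
    show "(\<lambda>s. br L (S4 + s + S5)) holomorphic_on UNIV" by (intro holomorphic_intros)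
    show "?l (S2 - s) (S4 + s) * br L (S4 + s + S5) = ?r (S2 - s) (S4 + s) * br L (S4 + s + S5)" for s
      by (rule br_six_aux) (use S in \<open>simp add: algebra_simps\<close>)
  qed (use X in auto)
  thus ?thesis by simp
qed

end

section \<open>The rarefied gamma function\<close>

text \<open>Properties of the gamma function are checked on the window {0..<r}, where its product
  formula is valid, and carried to all integers by quasi-periodicity in both directions.\<close>

lemma int_mod_induct [case_names pos base up down]:
  fixes r m :: int
  assumes "r > 0" and base: "\<And>m. 0 \<le> m \<Longrightarrow> m < r \<Longrightarrow> Q m"
    and up: "\<And>m. Q m \<Longrightarrow> Q (m + r)" and down: "\<And>m. Q (m + r) \<Longrightarrow> Q m"
  shows "Q m"
proof -
  have "Q (m mod r + d * r)" for d :: int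
  proof (induction d rule: int_induct[where k = 0])
    case base show ?case using assms(1) by (auto intro!: assms(2))
  next
    case (step1 i) thus ?case using up[of "m mod r + i * r"] by (simp add: algebra_simps)
  next
    case (step2 i) thus ?case using down[of "m mod r + (i - 1) * r"] by (simp add: algebra_simps)
  qed
  from this[of "m div r"] show ?thesis by (simp add: mult.commute)
qed

lemma of_int_div_exact: "b dvd a \<Longrightarrow> (of_int (a div b) :: complex) = of_int a / of_int b"
  by (cases "b = 0") (auto elim!: dvdE)

text \<open>Prefactors are compared through their exponents; the integer k supplied at each use
  accounts for signs and for the ambiguity of logarithms.\<close>

lemma exp_eqI: "x - y = 2 * of_real pi * \<i> * of_int k \<Longrightarrow> exp x = exp (y :: complex)"
proof -
  assume "x - y = 2 * of_real pi * \<i> * of_int k"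
  hence "x = y + 2 * of_real pi * \<i> * of_int k" by (simp add: algebra_simps)
  moreover have "exp (2 * of_real pi * \<i> * of_int k :: complex) = 1"
    using exp_integer_2pi[of "of_int k"] by (simp add: mult_ac)
  ultimately show ?thesis by (simp only: exp_add mult_1_right)
qed

lemma Ln_exp_diff: "\<exists>k::int. Ln (exp x) = x + 2 * of_real pi * \<i> * of_int k"
proof -
  have "exp (Ln (exp x)) = exp x" by simp
  then obtain k :: int where "Ln (exp x) = x + (of_int (2 * k) * pi) * \<i>"
    unfolding exp_eq by blast
  thus ?thesis by (intro exI[of _ k]) (simp add: mult_ac)
qed

lemma exp_ipi_add: "exp (\<i> * of_real pi + x) = - exp x"
  by (simp add: exp_add)

lemma six_dvd: "6 dvd m * (m - 1) * (m - 2 :: int)" "6 dvd m * (m\<^sup>2 - 1 :: int)"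
proof -
  have "3 dvd m * (m - 1) * (m - 2)"
  proof -
    have "3 dvd m \<or> 3 dvd m - 1 \<or> 3 dvd m - 2" by presburger
    thus ?thesis by auto
  qed
  moreover have "2 dvd m * (m - 1) * (m - 2)" by auto
  ultimately show "6 dvd m * (m - 1) * (m - 2 :: int)"
    using divides_mult[of 3 "m * (m - 1) * (m - 2)" 2] by simp
  have "3 dvd m * (m - 1) * (m + 1)"
  proof -
    have "3 dvd m \<or> 3 dvd m - 1 \<or> 3 dvd m + 1" by presburger
    thus ?thesis by auto
  qed
  moreover have "2 dvd m * (m - 1) * (m + 1)" by auto
  ultimately have "6 dvd m * (m - 1) * (m + 1)"
    using divides_mult[of 3 "m * (m - 1) * (m + 1)" 2] by simp
  thus "6 dvd m * (m\<^sup>2 - 1 :: int)" by (simp add: algebra_simps power2_eq_square)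
qed

lemma theta_exp_shift:
  assumes L: "Re L < 0"
  shows "theta (exp L) (exp (x + of_int k * L)) =
     exp (- of_int k * (\<i> * of_real pi + x) - L * (of_int k * (of_int k - 1) / 2)) * theta (exp L) (exp x)"
proof -
  let ?l = "\<lambda>k::int. theta (exp L) (exp (x + of_int k * L))"
  let ?r = "\<lambda>k::int. exp (- of_int k * (\<i> * of_real pi + x) - L * (of_int k * (of_int k - 1) / 2)) * theta (exp L) (exp x)"
  have l: "?l (k + 1) = - exp (- (x + of_int k * L)) * ?l k" for k
  proof -
    have "x + of_int (k + 1) * L = x + of_int k * L + L" by (simp add: algebra_simps)
    hence "?l (k + 1) = theta (exp L) (exp (x + of_int k * L) * exp L)" by (simp only: exp_add)
    also have "\<dots> = - ?l k / exp (x + of_int k * L)"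
      using L by (intro theta_shift) auto
    finally show ?thesis
      by (simp add: exp_minus divide_inverse mult_ac del: minus_add_distrib)
  qed
  have r: "?r (k + 1) = - exp (- (x + of_int k * L)) * ?r k" for k
  proof -
    have "exp (- of_int (k + 1) * (\<i> * of_real pi + x) - L * (of_int (k + 1) * (of_int (k + 1) - 1) / 2)) =
      exp ((\<i> * of_real pi + (- (x + of_int k * L))) +
           (- of_int k * (\<i> * of_real pi + x) - L * (of_int k * (of_int k - 1) / 2)))"
      by (rule exp_eqI[of _ _ "-1"]) (simp add: field_simps)
    also have "\<dots> = - exp (- (x + of_int k * L)) * exp (- of_int k * (\<i> * of_real pi + x) - L * (of_int k * (of_int k - 1) / 2))"
      by (simp only: exp_add[of "\<i> * of_real pi + (- (x + of_int k * L))"] exp_ipi_add)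
    finally show ?thesis by simp
  qed
  show ?thesis
  proof (induction k rule: int_induct[where k = 0])
    case (step1 i)
    show ?case unfolding l r step1 ..
  next
    case (step2 i)
    have "?l i = - exp (- (x + of_int (i - 1) * L)) * ?l (i - 1)" using l[of "i - 1"] by simp
    moreover have "?r i = - exp (- (x + of_int (i - 1) * L)) * ?r (i - 1)" using r[of "i - 1"] by simp
    ultimately have "- exp (- (x + of_int (i - 1) * L)) * ?l (i - 1) = - exp (- (x + of_int (i - 1) * L)) * ?r (i - 1)"
      using step2 by metis
    thus ?case by simp
  qed auto
qed

lemma eventually_entire_nonzero:
  assumes f: "f holomorphic_on UNIV" and f0: "f 0 \<noteq> (0::complex)" and a: "a \<noteq> 0" and z: "z \<noteq> 0"
  shows "eventually (\<lambda>w. f (a * w) \<noteq> 0) (at z)"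
proof -
  have "(\<lambda>w. a * w) holomorphic_on UNIV" by (intro holomorphic_intros)
  from holomorphic_on_compose_gen[OF this f] have h: "(\<lambda>w. f (a * w)) holomorphic_on UNIV" by (simp add: o_def)
  show ?thesis
proof (cases "f (a * z) = 0")
  case False
  have "isCont (\<lambda>w. f (a * w)) z"
    using holomorphic_on_imp_continuous_on[OF h] by (simp add: continuous_on_eq_continuous_at)
  thus ?thesis using False by (auto simp: isCont_def intro: tendsto_imp_eventually_ne)
next
  case True
  obtain d where "d > 0" "\<And>w. w \<in> ball z d - {z} \<Longrightarrow> f (a * w) \<noteq> 0"
    using isolated_zeros[OF h open_UNIV connected_UNIV, of z 0] True f0 by auto
  thus ?thesis unfolding eventually_at by (intro exI[of _ d]) (auto simp: dist_commute)
qed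
qed

text \<open>The logarithms belong to the data because \<open>polx\<close> and the arguments of
  \<open>br\<close> involve fractional powers of p and q, for which a branch has to be
  fixed.\<close>

locale rarefied =
  fixes r :: nat and p q lp lq :: complex
  assumes r: "r > 0" and Re_lp: "Re lp < 0" and Re_lq: "Re lq < 0"
    and p_exp: "p = exp lp" and q_exp: "q = exp lq"
begin

definition E1 :: "complex \<Rightarrow> complex" where "E1 = ell_prod (p ^ r) (p * q)"
definition E2 :: "complex \<Rightarrow> complex" where "E2 = ell_prod (q ^ r) (p * q)"

definition den :: "complex \<Rightarrow> int \<Rightarrow> complex" where
  "den z m = E1 (z * p powi m) * E2 (z * q powi (int r - m))"

definition num :: "complex \<Rightarrow> int \<Rightarrow> complex" where
  "num z m = E1 (p ^ r * (p * q) / (z * p powi m)) * E2 (q ^ r * (p * q) / (z * q powi (int r - m)))"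

definition pref :: "complex \<Rightarrow> int \<Rightarrow> complex" where
  "pref z m = (-z) powi (m * (m - 1) div 2) * p powi (m * (m - 1) * (m - 2) div 6)
     * q powi (- (m * (m\<^sup>2 - 1) div 6))"

text \<open>The product formula as it stands; the value 0 at zeros of \<open>den\<close> carries no
  meaning.\<close>

definition raw :: "complex \<Rightarrow> int \<Rightarrow> complex" where
  "raw z m = pref z m * num z m / den z m"

definition prx :: "complex \<Rightarrow> int \<Rightarrow> complex" where
  "prx x m = (\<i> * of_real pi + x) * (of_int m * (of_int m - 1) / 2)
     + lp * (of_int m * (of_int m - 1) * (of_int m - 2) / 6) - lq * (of_int m * ((of_int m)\<^sup>2 - 1) / 6)"

text \<open>\<open>exp (cx x m)\<close> is the ratio of the rarefied gamma function at \<open>(exp x, m + r)\<close> and \<open>(exp x, m)\<close>;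
  \<open>polx x\<close> is a cubic polynomial in \<open>m\<close> whose \<open>r\<close>-step difference is \<open>cx x\<close>.\<close>

definition cx :: "complex \<Rightarrow> int \<Rightarrow> complex" where
  "cx x m = (\<i> * of_real pi + x) * ((of_nat r - 1) * (of_int m + of_nat r / 2))
     + lp * ((of_nat r - 1) / 2 * (of_int m)\<^sup>2 + (of_nat r - 1)\<^sup>2 / 2 * of_int m
             + of_nat r * (of_nat r - 1) * (of_nat r - 2) / 6)
     - lq * ((of_nat r - 1) / 2 * (of_int m)\<^sup>2 + ((of_nat r)\<^sup>2 - 1) / 2 * of_int m
             + of_nat r * ((of_nat r)\<^sup>2 - 1) / 6)"

definition polx :: "complex \<Rightarrow> int \<Rightarrow> complex" where
  "polx x m = (of_nat r - 1) * (
       (\<i> * of_real pi + x) * ((of_int m)\<^sup>2 / (2 * of_nat r))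
     + lp * ((of_int m) ^ 3 / (6 * of_nat r) - (of_int m)\<^sup>2 / (4 * of_nat r) - of_int m / 12)
     - lq * ((of_int m) ^ 3 / (6 * of_nat r) + (of_int m)\<^sup>2 / (4 * of_nat r) - of_int m / 12))"

definition cf :: "complex \<Rightarrow> int \<Rightarrow> complex" where
  "cf z m = exp (cx (Ln z) m)"

text \<open>For indices in {0..<r} the product formula has no singularity in the punctured disc of
  radius \<open>Rad\<close> except the pole at 1 for index 0. All other values are forced by the
  multiplier \<open>cf\<close>; the difference of \<open>polx\<close> is the exponent of the
  accumulated multiplier. Cancelling zeros and poles thus never have to be discussed.\<close>

definition G :: "complex \<Rightarrow> int \<Rightarrow> complex" where
  "G z m = exp (polx (Ln z) m - polx (Ln z) (m mod int r)) * raw z (m mod int r)"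

text \<open>The multiplier of \<open>G\<close> under the shift of (z, m) to (q z, m + 1), see
  \<open>G_shift_q\<close>.\<close>

definition Th :: "complex \<Rightarrow> int \<Rightarrow> complex" where
  "Th z m = exp (of_int m * (\<i> * of_real pi + Ln z) + lp * (of_int m * (of_int m - 1) / 2))
     * theta (p ^ r) (z * p powi m)"

text \<open>The reciprocal of \<open>G x k * G (1 / x) (- k)\<close>, see \<open>G_Ker\<close>; in
  this form it is visibly holomorphic for nonzero x, also at x = 1.\<close>

definition Ker :: "complex \<Rightarrow> int \<Rightarrow> complex" where
  "Ker x k = exp ((lp + lq) * (of_int k * (of_int k - 1) / 2))
     * theta (p ^ r) (x * p powi k) * theta (q ^ r) (q powi k / x)"

text \<open>The part of \<open>Ker\<close> that remains when the factor \<open>Th\<close> with base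
  \<open>p ^ r\<close> is split off, see \<open>Ker_KerQ\<close>.\<close>

definition KerQ :: "complex \<Rightarrow> int \<Rightarrow> complex" where
  "KerQ x k = exp (lq * (of_int k * (of_int k - 1) / 2) - of_int k * (\<i> * of_real pi + Ln x))
     * theta (q ^ r) (q powi k / x)"

lemma p_nz [simp]: "p \<noteq> 0" and q_nz [simp]: "q \<noteq> 0" by (auto simp: p_exp q_exp)
lemma norm_p: "norm p < 1" and norm_q: "norm q < 1" using Re_lp Re_lq by (auto simp: p_exp q_exp)
lemma norm_pr: "norm (p ^ r) < 1" and norm_qr: "norm (q ^ r) < 1"
  using norm_p norm_q r by (auto simp: norm_power power_less_one_iff)
lemma norm_pq: "norm (p * q) < 1"
  using norm_p norm_q mult_strict_mono[of "norm p" 1 "norm q" 1] by (simp add: norm_mult)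

lemma pr_exp: "p ^ r = exp (of_nat r * lp)" and qr_exp: "q ^ r = exp (of_nat r * lq)"
  by (simp_all add: p_exp q_exp exp_of_nat_mult)
lemma pq_exp: "p * q = exp (lp + lq)" by (simp add: p_exp q_exp exp_add)
lemma powi_p: "p powi k = exp (of_int k * lp)" and powi_q: "q powi k = exp (of_int k * lq)"
  by (simp_all add: p_exp q_exp exp_power_int)

lemma Re_rlp: "Re (of_nat r * lp) < 0" and Re_rlq: "Re (of_nat r * lq) < 0"
  and Re_lpq: "Re (lp + lq) < 0"
  using r Re_lp Re_lq by (auto simp: mult_pos_neg)

lemma E1_hol: "E1 holomorphic_on A" and E2_hol: "E2 holomorphic_on A"
  unfolding E1_def E2_def using norm_pr norm_qr norm_pq by (auto intro!: ell_prod_holomorphic)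

lemma E1_rec1: "E1 z = qpoch_inf z (p * q) * E1 (z * p ^ r)"
  and E2_rec1: "E2 z = qpoch_inf z (p * q) * E2 (z * q ^ r)"
  unfolding E1_def E2_def using norm_pr norm_qr norm_pq by (auto intro!: ell_prod_rec1)

lemma E1_rec2: "E1 z = qpoch_inf z (p ^ r) * E1 (z * (p * q))"
  and E2_rec2: "E2 z = qpoch_inf z (q ^ r) * E2 (z * (p * q))"
  unfolding E1_def E2_def using norm_pr norm_qr norm_pq by (auto intro!: ell_prod_rec2)

lemma E_0: "E1 0 = 1" "E2 0 = 1"
  unfolding E1_def E2_def using norm_pr norm_qr norm_pq by auto

lemma pref_exp: "pref (exp x) m = exp (prx x m)"
proof -
  have "even (m * (m - 1))" by simp
  hence 2: "(of_int (m * (m - 1) div 2) :: complex) = of_int m * (of_int m - 1) / 2"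
    by (simp add: of_int_div_exact)
  have 6: "(of_int (m * (m - 1) * (m - 2) div 6) :: complex) = of_int m * (of_int m - 1) * (of_int m - 2) / 6"
    "(of_int (m * (m\<^sup>2 - 1) div 6) :: complex) = of_int m * ((of_int m)\<^sup>2 - 1) / 6"
    using six_dvd[of m] by (simp_all add: of_int_div_exact)
  have "(- exp x) powi (m * (m - 1) div 2) = exp (of_int (m * (m - 1) div 2) * (\<i> * of_real pi + x))"
    unfolding exp_ipi_add[symmetric] exp_power_int ..
  thus ?thesis
    unfolding pref_def prx_def powi_p powi_q of_int_minus 2 6
    by (simp only: exp_add[symmetric] minus_mult_left) (simp add: mult_ac)
qed

text \<open>The two arguments differ by the m-th power of the base \<open>p * q\<close>, because p^m
  = q^(-m) (p q)^m. This coincidence is what makes the two elliptic gamma factors fit together under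
  m -> m + r.\<close>

lemma taux: "theta (p * q) (exp x * p powi m) =
   exp (- of_int m * (\<i> * of_real pi + x) - lp * (of_int m * (of_int m - 1) / 2) + lq * (of_int m * (of_int m + 1) / 2))
   * theta (p * q) (exp x * q powi (-m))"
proof -
  have 1: "exp x * p powi m = exp ((x - of_int m * lq) + of_int m * (lp + lq))"
    by (simp add: powi_p algebra_simps flip: exp_add)
  have 2: "exp x * q powi (-m) = exp (x - of_int m * lq)"
    by (simp add: powi_q flip: exp_add)
  have 3: "- of_int m * (\<i> * of_real pi + (x - of_int m * lq)) - (lp + lq) * (of_int m * (of_int m - 1) / 2) =
     - of_int m * (\<i> * of_real pi + x) - lp * (of_int m * (of_int m - 1) / 2) + lq * (of_int m * (of_int m + 1) / 2)"
    by (simp add: field_simps)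
  show ?thesis unfolding 1 2 pq_exp theta_exp_shift[OF Re_lpq] 3 ..
qed

text \<open>Raising m by r moves the argument of \<open>E1\<close> by p^r and that of
  \<open>E2\<close> by q^(-r). Each move splits off a Pochhammer symbol with base
  \<open>p * q\<close>; with those from the numerators they form two theta functions, whose quotient
  is elementary by \<open>taux\<close>.\<close>

lemma raw_step:
  assumes z: "z \<noteq> 0" and d: "den z m \<noteq> 0" "den z (m + int r) \<noteq> 0"
  shows "raw z (m + int r) = cf z m * raw z m"
proof -
  define x where "x = Ln z"
  have zx: "z = exp x" using z by (simp add: x_def)
  let ?Q = "\<lambda>w. qpoch_inf w (p * q)"
  define A B C D where "A = E1 (z * p powi (m + int r))" "B = E2 (z * q powi (int r - m))"
    "C = E1 (p ^ r * (p * q) / (z * p powi m))" "D = E2 (q ^ r * (p * q) / (z * q powi (-m)))"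
  define u v s t where "u = ?Q (z * p powi m)" "v = ?Q (z * q powi (-m))"
    "s = ?Q (p * q / (z * p powi m))" "t = ?Q (p * q / (z * q powi (-m)))"
  have a1: "z * p powi m * p ^ r = z * p powi (m + int r)" by (simp add: power_int_add)
  have a2: "z * q powi (-m) * q ^ r = z * q powi (int r - m)"
    by (simp add: power_int_diff power_int_minus divide_inverse mult_ac)
  have a3: "p ^ r * (p * q) / (z * p powi (m + int r)) = p * q / (z * p powi m)"
    by (simp add: power_int_add field_simps)
  have a4: "q ^ r * (p * q) / (z * q powi (int r - m)) = p * q / (z * q powi (-m))"
    unfolding a2[symmetric] by (simp add: field_simps)
  have dm: "den z m = u * A * B"
    unfolding den_def A_B_C_D_def u_v_s_t_def using E1_rec1[of "z * p powi m"] a1 by simp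
  have dmr: "den z (m + int r) = A * (v * B)"
    unfolding den_def A_B_C_D_def u_v_s_t_def using E2_rec1[of "z * q powi (-m)"] a2 by simp
  have nm: "num z m = C * (t * D)"
    unfolding num_def A_B_C_D_def u_v_s_t_def a4 using E2_rec1[of "p * q / (z * q powi (-m))"]
    by (simp add: mult_ac)
  have nmr: "num z (m + int r) = s * C * D"
    unfolding num_def A_B_C_D_def u_v_s_t_def a3 using E1_rec1[of "p * q / (z * p powi m)"]
    by (simp add: mult_ac)
  define e where "e = - of_int m * (\<i> * of_real pi + x) - lp * (of_int m * (of_int m - 1) / 2) + lq * (of_int m * (of_int m + 1) / 2)"
  have th: "u * s = exp e * (v * t)"
    using taux[of x m] unfolding theta_def zx[symmetric] u_v_s_t_def e_def by simp
  have "cx x m = prx x (m + int r) + e - prx x m"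
    unfolding cx_def prx_def e_def by (simp add: field_simps power2_eq_square)
  moreover have "cf z m = exp (cx x m)" by (simp add: cf_def x_def)
  ultimately have "cf z m * pref z m = pref z (m + int r) * exp e"
    by (simp add: zx pref_exp exp_add exp_diff)
  hence *: "pref z (m + int r) * s * u = cf z m * pref z m * t * v"
    using th by (simp add: mult_ac)
  have nz: "u \<noteq> 0" "v \<noteq> 0" "A \<noteq> 0" "B \<noteq> 0" using d unfolding dm dmr by auto
  have "raw z (m + int r) = (pref z (m + int r) * s * u) * (C * D) / (A * B * u * v)"
    unfolding raw_def dmr nmr using nz by (simp add: mult_ac)
  also have "\<dots> = cf z m * raw z m"
    unfolding * raw_def dm nm using nz by (simp add: mult_ac)
  finally show ?thesis .
qed

text \<open>The coefficient of x in \<open>cx\<close> is an integer. Hence \<open>cf\<close> does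
  not depend on the branch of the logarithm and is, up to a constant, a power of -z.\<close>

lemma cx_Aint: "(of_nat r - 1) * (of_int m + of_nat r / 2) =
   (of_int ((int r - 1) * m + int r * (int r - 1) div 2) :: complex)"
  by (simp add: of_int_div_exact field_simps)

lemma cf_exp: "cf (exp x) m = exp (cx x m)"
proof -
  obtain k :: int where k: "Ln (exp x) = x + 2 * of_real pi * \<i> * of_int k" using Ln_exp_diff by blast
  show ?thesis unfolding cf_def k
    by (rule exp_eqI[of _ _ "k * ((int r - 1) * m + int r * (int r - 1) div 2)"])
       (unfold cx_def of_int_mult[of k] cx_Aint, simp add: algebra_simps)
qed

lemma cf_nz [simp]: "cf z m \<noteq> 0" by (simp add: cf_def)

lemma cf_hol: "0 \<notin> A \<Longrightarrow> (\<lambda>z. cf z m) holomorphic_on A"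
proof -
  assume A: "0 \<notin> A"
  define a where "a = (int r - 1) * m + int r * (int r - 1) div 2"
  define B where "B = lp * ((of_nat r - 1) / 2 * (of_int m)\<^sup>2 + (of_nat r - 1)\<^sup>2 / 2 * of_int m
             + of_nat r * (of_nat r - 1) * (of_nat r - 2) / 6)
     - lq * ((of_nat r - 1) / 2 * (of_int m)\<^sup>2 + ((of_nat r)\<^sup>2 - 1) / 2 * of_int m
             + of_nat r * ((of_nat r)\<^sup>2 - 1) / 6)"
  have "(-z) powi a * exp B = cf z m" if "z \<in> A" for z
  proof -
    have z: "z \<noteq> 0" using A that by auto
    have "(- exp (Ln z)) powi a = exp (of_int a * (\<i> * of_real pi + Ln z))"
      unfolding exp_ipi_add[symmetric] exp_power_int ..
    hence "(-z) powi a = exp (of_int a * (\<i> * of_real pi + Ln z))" using z by simp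
    thus ?thesis unfolding cf_def cx_def cx_Aint a_def[symmetric] B_def
      by (simp add: algebra_simps flip: exp_add)
  qed
  moreover have "(\<lambda>z. (-z) powi a * exp B) holomorphic_on A"
    using A by (intro holomorphic_intros) auto
  ultimately show ?thesis by (rule holomorphic_transform[rotated])
qed

lemma G_base: "0 \<le> m \<Longrightarrow> m < int r \<Longrightarrow> G z m = raw z m"
  by (simp add: G_def)

lemma G_step: "G z (m + int r) = cf z m * G z m"
proof -
  have "polx x (m + int r) - polx x m = cx x m" for x
    unfolding polx_def cx_def using r by (simp add: field_simps power2_eq_square power3_eq_cube)
  hence "polx x (m + int r) - y = cx x m + (polx x m - y)" for x y by (metis add_diff_eq diff_add_cancel)
  thus ?thesis unfolding G_def cf_def by (simp add: exp_add exp_diff)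
qed

text \<open>For indices in {0..r} the zeros of \<open>den\<close> other than 1 have the form p^(-a)
  q^(-b) with a + b > 0, so none of them has modulus below \<open>Rad\<close>.\<close>

definition Rad :: real where "Rad = min (1 / norm p) (1 / norm q)"

lemma Rad_gt_1: "Rad > 1" unfolding Rad_def using norm_p norm_q by (simp add: field_simps)

lemma den_nz:
  assumes m: "0 \<le> m" "m \<le> int r" and z: "norm z < Rad" and z1: "z = 1 \<Longrightarrow> m \<noteq> 0 \<and> m \<noteq> int r"
  shows "den z m \<noteq> 0"
proof -
  have key: "False" if e: "z * p ^ a * q ^ b = 1" and ab: "a + b > 0" for a b
  proof -
    have np: "norm z * norm p < 1" "norm z * norm q < 1"
      using z by (auto simp: Rad_def field_simps)
    have "norm z * norm p ^ a * norm q ^ b = 1"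
      using arg_cong[OF e, of norm] by (simp add: norm_mult norm_power)
    moreover have "norm z * norm p ^ a * norm q ^ b < 1"
    proof (cases a)
      case (Suc a')
      have "norm z * norm p ^ a * norm q ^ b = (norm z * norm p) * (norm p ^ a' * norm q ^ b)" by (simp add: Suc)
      also have "\<dots> \<le> (norm z * norm p) * 1"
        using norm_p norm_q by (intro mult_left_mono mult_le_one power_le_one) auto
      finally show ?thesis using np by simp
    next
      case 0
      then obtain b' where b': "b = Suc b'" using ab by (cases b) auto
      have "norm z * norm p ^ a * norm q ^ b = (norm z * norm q) * (norm q ^ b')" by (simp add: 0 b')
      also have "\<dots> \<le> (norm z * norm q) * 1"
        using norm_p norm_q by (intro mult_left_mono power_le_one) auto
      finally show ?thesis using np by simp
    qed
    ultimately show False by simp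
  qed
  obtain n where n: "m = int n" using m(1) by (metis nonneg_int_cases)
  have nr: "n \<le> r" using m n by simp
  have "E1 (z * p powi m) \<noteq> 0"
  proof
    assume "E1 (z * p powi m) = 0"
    then obtain j k where "z * p powi m * (p ^ r) ^ j * (p * q) ^ k = 1"
      unfolding E1_def ell_prod_eq_0_iff[OF norm_pr norm_pq] by auto
    hence *: "z * p ^ (n + r * j + k) * q ^ k = 1"
      by (simp add: n power_add power_mult_distrib mult_ac flip: power_mult)
    have "\<not> n + r * j + k + k > 0" using key[OF *] by blast
    hence e: "n + r * j + k = 0" "k = 0" by linarith+
    moreover from * have "z = 1" unfolding e(1) by (simp add: e(2))
    ultimately show False using z1 n by auto
  qed
  moreover have "E2 (z * q powi (int r - m)) \<noteq> 0"
  proof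
    assume "E2 (z * q powi (int r - m)) = 0"
    then obtain j k where "z * q powi (int r - m) * (q ^ r) ^ j * (p * q) ^ k = 1"
      unfolding E2_def ell_prod_eq_0_iff[OF norm_qr norm_pq] by auto
    moreover have "q powi (int r - m) = q ^ (r - n)" using nr by (simp add: n flip: of_nat_diff)
    ultimately have *: "z * p ^ k * q ^ ((r - n) + r * j + k) = 1"
      by (simp add: n power_add power_mult_distrib mult_ac flip: power_mult)
    have "\<not> k + ((r - n) + r * j + k) > 0" using key[OF *] by blast
    hence e: "(r - n) + r * j + k = 0" "k = 0" by linarith+
    moreover from * have "z = 1" unfolding e(1) by (simp add: e(2))
    ultimately show False using z1 n nr by auto
  qed
  ultimately show ?thesis by (simp add: den_def)
qed

text \<open>The domain reaches beyond the unit disc: z^2 on the unit circle has modulus 1, and in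
  the pinching argument some quotients of a parameter by z have modulus slightly above 1. The point
  1 is removed for the residue class of m that has the pole.\<close>

definition dom :: "int \<Rightarrow> complex set" where
  "dom m = {z. z \<noteq> 0 \<and> norm z < Rad \<and> \<not> (int r dvd m \<and> z = 1)}"

lemma dom_unit: "z \<noteq> 0 \<Longrightarrow> norm z < 1 \<Longrightarrow> z \<in> dom m"
  using Rad_gt_1 by (auto simp: dom_def)

lemma open_dom [simp]: "open (dom m)"
proof -
  have "dom m = ball 0 Rad - {0} - (if int r dvd m then {1} else {})" by (auto simp: dom_def)
  thus ?thesis by (auto intro!: open_Diff)
qed

text \<open>The right end m = r is included because m -> m + 1 and m -> r - m lead out of {0..<r},
  but not out of {0..r}.\<close>

lemma G_raw:
  assumes m: "0 \<le> m" "m \<le> int r" and z: "z \<in> dom m"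
  shows "G z m = raw z m"
proof (cases "m = int r")
  case True
  have "raw z (0 + int r) = cf z 0 * raw z 0"
    by (rule raw_step; (intro den_nz)?) (use z True in \<open>auto simp: dom_def\<close>)
  thus ?thesis using G_step[of z 0] G_base[of 0 z] True r by simp
qed (use m in \<open>auto intro: G_base\<close>)

lemma E_comp_hol: "f holomorphic_on A \<Longrightarrow> (\<lambda>z. E1 (f z)) holomorphic_on A"
  "f holomorphic_on A \<Longrightarrow> (\<lambda>z. E2 (f z)) holomorphic_on A"
  using holomorphic_on_compose_gen[of f A E1 UNIV] holomorphic_on_compose_gen[of f A E2 UNIV] E1_hol E2_hol
  by (auto simp: o_def)

lemma pref_hol: "0 \<notin> A \<Longrightarrow> (\<lambda>z. pref z m) holomorphic_on A"
  unfolding pref_def by (intro holomorphic_intros) auto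

lemma num_hol: "0 \<notin> A \<Longrightarrow> (\<lambda>z. num z m) holomorphic_on A"
  unfolding num_def by (intro holomorphic_intros E_comp_hol) auto

lemma raw_hol: "0 \<notin> A \<Longrightarrow> (\<And>z. z \<in> A \<Longrightarrow> den z m \<noteq> 0) \<Longrightarrow> (\<lambda>z. raw z m) holomorphic_on A"
proof -
  assume "0 \<notin> A" "\<And>z. z \<in> A \<Longrightarrow> den z m \<noteq> 0"
  moreover have "(\<lambda>z. den z m) holomorphic_on A"
    unfolding den_def by (intro holomorphic_intros E_comp_hol)
  ultimately show ?thesis unfolding raw_def by (intro holomorphic_intros pref_hol num_hol) auto
qed

lemma dom_step: "dom (m + int r) = dom m" by (simp add: dom_def)

lemma G_hol_dom: "(\<lambda>z. G z m) holomorphic_on dom m"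
proof (induction m rule: int_mod_induct[where r = "int r"])
  case (base m)
  have "(\<lambda>z. raw z m) holomorphic_on dom m"
  proof (rule raw_hol)
    fix z assume z: "z \<in> dom m"
    show "den z m \<noteq> 0" by (rule den_nz) (use base z r in \<open>auto simp: dom_def\<close>)
  qed (auto simp: dom_def)
  thus ?case by (simp add: G_base[OF base])
next
  case (up m)
  thus ?case unfolding G_step dom_step by (intro holomorphic_intros cf_hol) (auto simp: dom_def)
next
  case (down m)
  have "(\<lambda>z. G z (m + int r) / cf z m) holomorphic_on dom m"
    using down unfolding dom_step by (intro holomorphic_intros cf_hol) (auto simp: dom_def)
  thus ?case by (simp add: G_step)
qed (use r in auto)

lemma G_hol:
  assumes "f holomorphic_on A" "\<And>z. z \<in> A \<Longrightarrow> f z \<in> dom m"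
  shows "(\<lambda>z. G (f z) m) holomorphic_on A"
  using holomorphic_on_compose_gen[OF assms(1) G_hol_dom[of m]] assms(2) by (auto simp: o_def)

lemma G_cont_dom: "continuous_on (dom m) (\<lambda>z. G z m)"
  using G_hol_dom holomorphic_on_imp_continuous_on by blast

lemma G_cont:
  assumes "continuous_on A f" "\<And>z. z \<in> A \<Longrightarrow> f z \<in> dom m"
  shows "continuous_on A (\<lambda>z. G (f z) m)"
  using continuous_on_compose2[OF G_cont_dom[of m] assms(1)] assms(2) by auto

lemma Th_exp: "Th (exp x) m = exp (of_int m * (\<i> * of_real pi + x) + lp * (of_int m * (of_int m - 1) / 2))
     * theta (exp (of_nat r * lp)) (exp (x + of_int m * lp))"
proof -
  obtain k :: int where k: "Ln (exp x) = x + 2 * of_real pi * \<i> * of_int k" using Ln_exp_diff by blast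
  have "exp (of_int m * (\<i> * of_real pi + Ln (exp x)) + lp * (of_int m * (of_int m - 1) / 2)) =
    exp (of_int m * (\<i> * of_real pi + x) + lp * (of_int m * (of_int m - 1) / 2))"
    unfolding k by (rule exp_eqI[of _ _ "k * m"]) (simp add: algebra_simps)
  thus ?thesis unfolding Th_def by (simp add: pr_exp powi_p exp_add)
qed

text \<open>Compatibility of \<open>Th\<close> with the multiplier \<open>cf\<close>; it is the
  induction step of \<open>G_shift_q\<close>.\<close>

lemma Th_step: "Th (exp x) (m + int r) * cf (exp x) m = cf (q * exp x) (m + 1) * Th (exp x) m"
proof -
  have "x + of_int (m + int r) * lp = (x + of_int m * lp) + of_int 1 * (of_nat r * lp)"
    by (simp add: algebra_simps)
  hence t: "theta (exp (of_nat r * lp)) (exp (x + of_int (m + int r) * lp)) =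
     exp (- of_int 1 * (\<i> * of_real pi + (x + of_int m * lp)) - of_nat r * lp * (of_int 1 * (of_int 1 - 1) / 2))
      * theta (exp (of_nat r * lp)) (exp (x + of_int m * lp))"
    by (simp only: theta_exp_shift[OF Re_rlp])
  have qx: "q * exp x = exp (x + lq)" by (simp add: q_exp exp_add)
  have "(of_int (m + int r) * (\<i> * of_real pi + x) + lp * (of_int (m + int r) * (of_int (m + int r) - 1) / 2)) +
    (- of_int 1 * (\<i> * of_real pi + (x + of_int m * lp)) - of_nat r * lp * (of_int 1 * (of_int 1 - 1) / 2)) + cx x m =
    cx (x + lq) (m + 1) + (of_int m * (\<i> * of_real pi + x) + lp * (of_int m * (of_int m - 1) / 2))"
    unfolding cx_def by (simp add: field_simps power2_eq_square)
  hence "exp (of_int (m + int r) * (\<i> * of_real pi + x) + lp * (of_int (m + int r) * (of_int (m + int r) - 1) / 2)) *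
    exp (- of_int 1 * (\<i> * of_real pi + (x + of_int m * lp)) - of_nat r * lp * (of_int 1 * (of_int 1 - 1) / 2)) * exp (cx x m) =
    exp (cx (x + lq) (m + 1)) * exp (of_int m * (\<i> * of_real pi + x) + lp * (of_int m * (of_int m - 1) / 2))"
    unfolding exp_add[symmetric] by (rule arg_cong)
  thus ?thesis unfolding Th_exp qx cf_exp t by (simp add: mult_ac)
qed

lemma pref_q: "pref (q * exp x) (m + 1) =
   exp (of_int m * (\<i> * of_real pi + x) + lp * (of_int m * (of_int m - 1) / 2)) * pref (exp x) m"
proof -
  have "q * exp x = exp (x + lq)" by (simp add: q_exp exp_add)
  thus ?thesis unfolding pref_exp exp_add[symmetric]
    by (simp only: pref_exp) (rule arg_cong[of _ _ exp], simp add: prx_def field_simps power2_eq_square)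
qed

text \<open>Passing from (z, m) to (q z, m + 1) leaves the argument of \<open>E2\<close> unchanged
  and multiplies that of \<open>E1\<close> by \<open>p * q\<close>. By \<open>E1_rec2\<close> only
  Pochhammer symbols with base \<open>p ^ r\<close> are left over, and they combine to a theta
  function.\<close>

lemma G_shift_q:
  assumes z: "z \<noteq> 0" "norm z < 1"
  shows "G (q * z) (m + 1) = Th z m * G z m"
proof -
  define x where "x = Ln z"
  have zx: "z = exp x" using z by (simp add: x_def)
  have nqz: "norm (q * z) < 1"
    using z norm_q mult_strict_mono[of "norm q" 1 "norm z" 1] by (simp add: norm_mult)
  show ?thesis
  proof (induction m rule: int_mod_induct[where r = "int r"])
    case (base m)
    have dz: "den z m \<noteq> 0" by (rule den_nz) (use base z Rad_gt_1 in auto)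
    have dqz: "den (q * z) (m + 1) \<noteq> 0" by (rule den_nz) (use base nqz Rad_gt_1 in auto)
    have "G (q * z) (m + 1) = raw (q * z) (m + 1)"
      by (rule G_raw) (use base nqz z in \<open>auto intro: dom_unit\<close>)
    also have "\<dots> = Th z m * raw z m"
    proof -
      have a1: "q * z * p powi (m + 1) = z * p powi m * (p * q)" by (simp add: power_int_add mult_ac)
      have a2: "q * z * q powi (int r - (m + 1)) = z * q powi (int r - m)"
      proof -
        have "q powi (int r - m) = q powi (int r - (m + 1)) * q powi 1"
          by (subst power_int_add[symmetric]) auto
        thus ?thesis by simp
      qed
      have a3: "p ^ r * (p * q) / (z * p powi m * (p * q)) = p ^ r / (z * p powi m)" by simp
      define P where "P = qpoch_inf (z * p powi m) (p ^ r)"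
      define P' where "P' = qpoch_inf (p ^ r / (z * p powi m)) (p ^ r)"
      have d: "den z m = P * den (q * z) (m + 1)"
        unfolding den_def a1 a2 P_def using E1_rec2[of "z * p powi m"] by simp
      have n: "num (q * z) (m + 1) = P' * num z m"
        unfolding num_def a1 a2 a3 P'_def using E1_rec2[of "p ^ r / (z * p powi m)"] by simp
      have th: "theta (p ^ r) (z * p powi m) = P * P'" by (simp add: theta_def P_def P'_def)
      have "Th z m * pref z m = pref (q * z) (m + 1) * (P * P')"
      proof -
        have "Th z m = exp (of_int m * (\<i> * of_real pi + x) + lp * (of_int m * (of_int m - 1) / 2)) * (P * P')"
          by (simp add: Th_def th x_def)
        thus ?thesis using pref_q[of x m] unfolding zx[symmetric] by simp
      qed
      moreover have "P \<noteq> 0" using d dz by auto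
      ultimately show ?thesis unfolding raw_def n d using dqz by (simp add: field_simps)
    qed
    finally show ?case by (simp add: G_base[OF base])
  next
    case (up m)
    have "G (q * z) (m + int r + 1) = cf (q * z) (m + 1) * G (q * z) (m + 1)"
      using G_step[of "q * z" "m + 1"] by (simp add: add_ac)
    thus ?case using up Th_step[of x m] unfolding G_step zx[symmetric] by (simp add: mult_ac)
  next
    case (down m)
    have "cf (q * z) (m + 1) * G (q * z) (m + 1) = G (q * z) (m + int r + 1)"
      using G_step[of "q * z" "m + 1"] by (simp add: add_ac)
    also have "\<dots> = cf (q * z) (m + 1) * (Th z m * G z m)"
      using down Th_step[of x m] unfolding G_step zx[symmetric] by (simp add: mult_ac)
    finally show ?case by simp
  qed (use r in auto)
qed

text \<open>With y = p q / z, the denominator at (z, m) is the numerator at (y, r - m) and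
  conversely, so only elementary factors remain. The index -m lies outside the window unless m = 0
  and is first raised by r. The bounds on |z| put both arguments into the unit disc.\<close>

lemma G_reflect:
  assumes z: "norm (p * q) < norm z" "norm z < 1"
  shows "G z m * G (p * q / z) (-m) = 1"
proof -
  have z0: "z \<noteq> 0" using z(1) by auto
  define x where "x = Ln z"
  have zx: "z = exp x" using z0 by (simp add: x_def)
  define y where "y = p * q / z"
  have yx: "y = exp (lp + lq - x)" unfolding y_def pq_exp zx by (simp add: exp_diff)
  have y: "y \<noteq> 0" "norm y < 1" using z z0 by (auto simp: y_def norm_mult norm_divide field_simps)
  have "G z m * G y (-m) = 1"
  proof (induction m rule: int_mod_induct[where r = "int r"])
    case (base m)
    have dz: "den z m \<noteq> 0" by (rule den_nz) (use base z Rad_gt_1 in auto)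
    have dy: "den y (int r - m) \<noteq> 0" by (rule den_nz) (use base y Rad_gt_1 in auto)
    have "cf y (-m) * G y (-m) = raw y (int r - m)"
      using G_step[of y "-m"] G_raw[of "int r - m" y] base y by (simp add: dom_unit)
    moreover have "G z m = raw z m" using base by (simp add: G_base)
    moreover have "raw z m * raw y (int r - m) = cf y (-m)"
    proof -
      have p1: "p ^ r = p powi m * p powi (int r - m)" and q1: "q ^ r = q powi m * q powi (int r - m)"
        by (simp_all flip: power_int_add)
      have a: "p ^ r * (p * q) / (y * p powi (int r - m)) = z * p powi m"
        "q ^ r * (p * q) / (y * q powi (int r - (int r - m))) = z * q powi (int r - m)"
        "p ^ r * (p * q) / (z * p powi m) = y * p powi (int r - m)"
        "q ^ r * (p * q) / (z * q powi (int r - m)) = y * q powi (int r - (int r - m))"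
        unfolding p1 q1 y_def using z0 by (simp_all add: field_simps)
      have "num y (int r - m) = den z m" "num z m = den y (int r - m)"
        unfolding num_def den_def a by simp_all
      hence "raw z m * raw y (int r - m) = pref z m * pref y (int r - m)"
        unfolding raw_def using dz dy by simp
      also have "\<dots> = exp (prx x m + prx (lp + lq - x) (int r - m))"
        unfolding zx yx pref_exp exp_add ..
      also have "\<dots> = exp (cx (lp + lq - x) (-m))"
        by (rule exp_eqI[of _ _ "m * (m - 1) div 2"])
           (simp add: of_int_div_exact prx_def cx_def field_simps power2_eq_square)
      finally show ?thesis unfolding yx cf_exp .
    qed
    ultimately have "cf y (-m) * (G z m * G y (-m)) = cf y (-m) * 1" by (simp add: mult_ac)
    thus ?case by simp
  next
    case (up m)
    have e: "cf z m = cf y (-m - int r)"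
      unfolding zx yx cf_exp
      by (rule exp_eqI[of _ _ "(int r - 1) * m + int r * (int r - 1) div 2"])
         (unfold cx_Aint[symmetric], simp add: cx_def field_simps power2_eq_square)
    have "G y (-m) = cf y (-m - int r) * G y (- (m + int r))"
      using G_step[of y "-m - int r"] by (simp add: algebra_simps)
    thus ?case using up e by (simp add: G_step mult_ac)
  next
    case (down m)
    have e: "cf z m = cf y (-m - int r)"
      unfolding zx yx cf_exp
      by (rule exp_eqI[of _ _ "(int r - 1) * m + int r * (int r - 1) div 2"])
         (unfold cx_Aint[symmetric], simp add: cx_def field_simps power2_eq_square)
    have "G y (-m) = cf y (-m - int r) * G y (- (m + int r))"
      using G_step[of y "-m - int r"] by (simp add: algebra_simps)
    thus ?case using down e by (simp add: G_step mult_ac)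
  qed (use r in auto)
  thus ?thesis by (simp add: y_def)
qed

lemma G_nz: "norm (p * q) < norm z \<Longrightarrow> norm z < 1 \<Longrightarrow> G z m \<noteq> 0"
  using G_reflect[of z m] by auto

section \<open>Theta functions replacing the denominator of the integrand\<close>

lemma Ker_step:
  assumes x: "x \<noteq> 0"
  shows "Ker x (k + int r) = exp ((lp + lq) * ((of_nat r - 1) * (of_int k + of_nat r / 2))) * Ker x k"
proof -
  define X where "X = Ln x"
  have xX: "x = exp X" using x by (simp add: X_def)
  have t1: "theta (p ^ r) (x * p powi (k + int r)) = - theta (p ^ r) (x * p powi k) * exp (-X - of_int k * lp)"
  proof -
    have "x * p powi (k + int r) = x * p powi k * p ^ r" by (simp add: power_int_add)
    hence "theta (p ^ r) (x * p powi (k + int r)) = - theta (p ^ r) (x * p powi k) / (x * p powi k)"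
      using x by (simp only: ) (intro theta_shift norm_pr, auto)
    thus ?thesis by (simp add: xX powi_p exp_diff exp_minus field_simps)
  qed
  have t2: "theta (q ^ r) (q powi (k + int r) / x) = - theta (q ^ r) (q powi k / x) * exp (X - of_int k * lq)"
  proof -
    have "q powi (k + int r) / x = q powi k / x * q ^ r" by (simp add: power_int_add)
    hence "theta (q ^ r) (q powi (k + int r) / x) = - theta (q ^ r) (q powi k / x) / (q powi k / x)"
      using x by (simp only: ) (intro theta_shift norm_qr, auto)
    thus ?thesis by (simp add: xX powi_q exp_diff exp_minus field_simps)
  qed
  have "(lp + lq) * (of_int (k + int r) * (of_int (k + int r) - 1) / 2) + (-X - of_int k * lp) + (X - of_int k * lq) =
     (lp + lq) * ((of_nat r - 1) * (of_int k + of_nat r / 2)) + (lp + lq) * (of_int k * (of_int k - 1) / 2)"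
    by (simp add: field_simps)
  hence e: "exp ((lp + lq) * (of_int (k + int r) * (of_int (k + int r) - 1) / 2)) * exp (-X - of_int k * lp) * exp (X - of_int k * lq) =
     exp ((lp + lq) * ((of_nat r - 1) * (of_int k + of_nat r / 2))) * exp ((lp + lq) * (of_int k * (of_int k - 1) / 2))"
    unfolding exp_add[symmetric] by (rule arg_cong)
  have "Ker x (k + int r) = exp ((lp + lq) * (of_int (k + int r) * (of_int (k + int r) - 1) / 2)) * exp (-X - of_int k * lp) * exp (X - of_int k * lq)
     * theta (p ^ r) (x * p powi k) * theta (q ^ r) (q powi k / x)"
    unfolding Ker_def t1 t2 by (simp only: mult_minus_left mult_minus_right minus_minus mult_ac)
  thus ?thesis unfolding e Ker_def by (simp only: mult_ac)
qed

lemma Ker_cf: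
  assumes x: "x \<noteq> 0"
  shows "cf x k * Ker x (k + int r) = cf (1 / x) (-k - int r) * Ker x k"
proof -
  define X where "X = Ln x"
  have xX: "x = exp X" using x by (simp add: X_def)
  have yX: "1 / x = exp (-X)" unfolding xX by (simp add: exp_minus inverse_eq_divide)
  have "exp (cx X k + (lp + lq) * ((of_nat r - 1) * (of_int k + of_nat r / 2))) = exp (cx (-X) (-k - int r))"
    by (rule exp_eqI[of _ _ "(int r - 1) * k + int r * (int r - 1) div 2"])
       (unfold cx_Aint[symmetric], simp add: cx_def field_simps power2_eq_square)
  thus ?thesis unfolding yX unfolding xX Ker_step[OF exp_not_eq_zero] cf_exp by (simp add: exp_add)
qed

text \<open>In contrast to \<open>G_reflect\<close>, each numerator here belongs to the opposite
  denominator with argument multiplied by \<open>p * q\<close>. The recursions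
  \<open>E1_rec2\<close> and \<open>E2_rec2\<close> turn the quotients into four Pochhammer symbols,
  which pair up to the two theta functions of \<open>Ker\<close>.\<close>

lemma G_Ker:
  assumes x: "1 / Rad < norm x" "norm x < Rad" "x \<noteq> 1"
  shows "G x k * Ker x k * G (1 / x) (-k) = 1"
proof -
  have x0: "x \<noteq> 0" using x(1) Rad_gt_1 by auto
  define X where "X = Ln x"
  have xX: "x = exp X" using x0 by (simp add: X_def)
  define y where "y = 1 / x"
  have yX: "y = exp (-X)" unfolding y_def xX by (simp add: exp_minus inverse_eq_divide)
  have y: "y \<noteq> 0" "norm y < Rad" "y \<noteq> 1" using x x0 Rad_gt_1 by (auto simp: y_def norm_divide field_simps)
  have "G x k * Ker x k * G y (-k) = 1"
  proof (induction k rule: int_mod_induct[where r = "int r"])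
    case (base k)
    have dx: "den x k \<noteq> 0" by (rule den_nz) (use base x in auto)
    have dy: "den y (int r - k) \<noteq> 0" by (rule den_nz) (use base y in auto)
    have "cf y (-k) * G y (-k) = raw y (int r - k)"
      using G_step[of y "-k"] G_raw[of "int r - k" y] base y by (simp add: dom_def)
    moreover have "G x k = raw x k" using base by (simp add: G_base)
    moreover have "raw x k * Ker x k * raw y (int r - k) = cf y (-k)"
    proof -
      have p1: "p ^ r = p powi k * p powi (int r - k)" and q1: "q ^ r = q powi k * q powi (int r - k)"
        by (simp_all flip: power_int_add)
      have a: "p ^ r * (p * q) / (y * p powi (int r - k)) = x * p powi k * (p * q)"
        "q ^ r * (p * q) / (y * q powi (int r - (int r - k))) = x * q powi (int r - k) * (p * q)"
        "p ^ r * (p * q) / (x * p powi k) = y * p powi (int r - k) * (p * q)"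
        "q ^ r * (p * q) / (x * q powi (int r - k)) = y * q powi (int r - (int r - k)) * (p * q)"
        unfolding p1 q1 y_def using x0 by (simp_all add: field_simps)
      have b: "p ^ r / (x * p powi k) = y * p powi (int r - k)"
        "q powi k / x = y * q powi (int r - (int r - k))" "q ^ r / (y * q powi (int r - (int r - k))) = x * q powi (int r - k)"
        unfolding p1 q1 y_def using x0 by (simp_all add: field_simps)
      have dd: "den x k * den y (int r - k) = theta (p ^ r) (x * p powi k) * theta (q ^ r) (q powi k / x) *
          (num y (int r - k) * num x k)"
        unfolding num_def a unfolding den_def theta_def b
        using E1_rec2[of "x * p powi k"] E2_rec2[of "x * q powi (int r - k)"]
          E1_rec2[of "y * p powi (int r - k)"] E2_rec2[of "y * q powi (int r - (int r - k))"]
        by (simp add: mult_ac)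
      have "raw x k * Ker x k * raw y (int r - k) =
          pref x k * pref y (int r - k) * exp ((lp + lq) * (of_int k * (of_int k - 1) / 2)) *
          (theta (p ^ r) (x * p powi k) * theta (q ^ r) (q powi k / x) * (num y (int r - k) * num x k)
           / (den x k * den y (int r - k)))"
        unfolding raw_def Ker_def by simp
      also have "\<dots> = pref x k * pref y (int r - k) * exp ((lp + lq) * (of_int k * (of_int k - 1) / 2))"
        unfolding dd[symmetric] using dx dy by simp
      also have "\<dots> = exp (prx X k + prx (-X) (int r - k) + (lp + lq) * (of_int k * (of_int k - 1) / 2))"
        unfolding xX yX pref_exp exp_add ..
      also have "\<dots> = exp (cx (-X) (-k))"
        by (rule exp_eqI[of _ _ "k * (k - 1) div 2"])
           (simp add: of_int_div_exact prx_def cx_def field_simps power2_eq_square)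
      finally show ?thesis unfolding yX cf_exp .
    qed
    ultimately have "cf y (-k) * (G x k * Ker x k * G y (-k)) = cf y (-k) * 1"
      by (metis mult.left_commute mult.assoc mult.right_neutral)
    thus ?case by simp
  next
    case (up k)
    have "G y (-k) = cf y (-k - int r) * G y (- (k + int r))"
      using G_step[of y "-k - int r"] by (simp add: algebra_simps)
    have "G x (k + int r) * Ker x (k + int r) * G y (- (k + int r)) =
        G x k * (cf x k * Ker x (k + int r)) * G y (- (k + int r))" by (simp only: G_step mult_ac)
    also have "\<dots> = G x k * Ker x k * (cf y (-k - int r) * G y (- (k + int r)))"
      unfolding Ker_cf[OF x0] y_def[symmetric] by (simp only: mult_ac)
    also have "\<dots> = 1" using up \<open>G y (-k) = cf y (-k - int r) * G y (- (k + int r))\<close> by simp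
    finally show ?case .
  next
    case (down k)
    have "G y (-k) = cf y (-k - int r) * G y (- (k + int r))"
      using G_step[of y "-k - int r"] by (simp add: algebra_simps)
    hence "G x k * Ker x k * G y (-k) = G x k * (cf y (-k - int r) * Ker x k) * G y (- (k + int r))" by simp
    also have "\<dots> = G x (k + int r) * Ker x (k + int r) * G y (- (k + int r))"
      using Ker_cf[OF x0, of k] unfolding y_def[symmetric] by (simp add: G_step mult_ac)
    finally show ?case using down by simp
  qed (use r in auto)
  thus ?thesis by (simp add: y_def)
qed

lemma Ker_exp: "Ker (exp X) k = exp ((lp + lq) * (of_int k * (of_int k - 1) / 2))
   * theta (exp (of_nat r * lp)) (exp (X + of_int k * lp)) * theta (exp (of_nat r * lq)) (exp (of_int k * lq - X))"
  unfolding Ker_def pr_exp qr_exp powi_p powi_q exp_add exp_diff ..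

lemma KerQ_exp: "KerQ (exp X) k = exp (lq * (of_int k * (of_int k - 1) / 2) - of_int k * (\<i> * of_real pi + X))
   * theta (exp (of_nat r * lq)) (exp (of_int k * lq - X))"
proof -
  obtain j :: int where j: "Ln (exp X) = X + 2 * of_real pi * \<i> * of_int j" using Ln_exp_diff by blast
  have "exp (lq * (of_int k * (of_int k - 1) / 2) - of_int k * (\<i> * of_real pi + Ln (exp X))) =
    exp (lq * (of_int k * (of_int k - 1) / 2) - of_int k * (\<i> * of_real pi + X))"
    unfolding j by (rule exp_eqI[of _ _ "- (j * k)"]) (simp add: algebra_simps)
  thus ?thesis unfolding KerQ_def by (simp add: qr_exp powi_q exp_diff)
qed

lemma Ker_KerQ: "x \<noteq> 0 \<Longrightarrow> Ker x k = Th x k * KerQ x k"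
proof -
  assume "x \<noteq> 0"
  then obtain X where x: "x = exp X" by (metis exp_Ln)
  have "(lp + lq) * (of_int k * (of_int k - 1) / 2) =
     (of_int k * (\<i> * of_real pi + X) + lp * (of_int k * (of_int k - 1) / 2)) +
     (lq * (of_int k * (of_int k - 1) / 2) - of_int k * (\<i> * of_real pi + X))" by (simp add: field_simps)
  hence "exp ((lp + lq) * (of_int k * (of_int k - 1) / 2)) =
     exp (of_int k * (\<i> * of_real pi + X) + lp * (of_int k * (of_int k - 1) / 2)) *
     exp (lq * (of_int k * (of_int k - 1) / 2) - of_int k * (\<i> * of_real pi + X))"
    by (simp only: exp_add)
  thus ?thesis unfolding x Ker_exp Th_exp KerQ_exp by (simp only: mult_ac)
qed

lemma theta_exp_minus: "Re L < 0 \<Longrightarrow> theta (exp L) (exp (- Y)) = exp (\<i> * of_real pi - Y) * theta (exp L) (exp Y)"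
  using theta_inverse[of "exp L" "exp Y"] by (simp add: exp_minus exp_diff exp_add inverse_eq_divide)

lemma KerQ_inverse: "x \<noteq> 0 \<Longrightarrow> KerQ (1 / x) (-k) = - x * KerQ x k"
proof -
  assume "x \<noteq> 0"
  then obtain X where x: "x = exp X" by (metis exp_Ln)
  have y: "1 / x = exp (-X)" by (simp add: x exp_minus inverse_eq_divide)
  have t: "of_int (-k) * lq - (-X) = - (of_int k * lq - X)" by simp
  have "exp (lq * (of_int (-k) * (of_int (-k) - 1) / 2) - of_int (-k) * (\<i> * of_real pi + (-X)) + (\<i> * of_real pi - (of_int k * lq - X)))
    = exp (\<i> * of_real pi + X + (lq * (of_int k * (of_int k - 1) / 2) - of_int k * (\<i> * of_real pi + X)))"
    by (rule exp_eqI[of _ _ k]) (simp add: field_simps)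
  hence e: "exp (lq * (of_int (-k) * (of_int (-k) - 1) / 2) - of_int (-k) * (\<i> * of_real pi + (-X))) * exp (\<i> * of_real pi - (of_int k * lq - X))
    = - exp X * exp (lq * (of_int k * (of_int k - 1) / 2) - of_int k * (\<i> * of_real pi + X))"
    by (simp only: exp_add exp_ipi_add[symmetric])
  show ?thesis unfolding y unfolding x KerQ_exp t theta_exp_minus[OF Re_rlq] mult.assoc[symmetric] e ..
qed

text \<open>For the substitution z -> 1 / (q z), under which z^2 becomes 1 / (q^2 z^2); see
  \<open>Hf_reflect\<close>.\<close>

lemma KerQ_reflect: "x \<noteq> 0 \<Longrightarrow> KerQ (1 / (q\<^sup>2 * x)) (-k - 2) = - KerQ x k / (q * x)"
proof -
  assume "x \<noteq> 0"
  then obtain X where x: "x = exp X" by (metis exp_Ln)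
  have y: "1 / (q\<^sup>2 * x) = exp (-2 * lq - X)"
    by (simp add: x q_exp exp_minus exp_diff exp_double inverse_eq_divide flip: power2_eq_square)
  have t: "of_int (-k - 2) * lq - (-2 * lq - X) = - (of_int k * lq - X)" by (simp add: algebra_simps)
  have qx: "- exp (- lq - X) = - 1 / (q * x)" by (simp add: q_exp x exp_diff exp_minus field_simps)
  have "exp (lq * (of_int (-k-2) * (of_int (-k-2) - 1) / 2) - of_int (-k-2) * (\<i> * of_real pi + (-2 * lq - X)) + (\<i> * of_real pi - (of_int k * lq - X)))
    = exp (\<i> * of_real pi + (- lq - X) + (lq * (of_int k * (of_int k - 1) / 2) - of_int k * (\<i> * of_real pi + X)))"
    by (rule exp_eqI[of _ _ "k + 1"]) (simp add: field_simps)
  hence e: "exp (lq * (of_int (-k-2) * (of_int (-k-2) - 1) / 2) - of_int (-k-2) * (\<i> * of_real pi + (-2 * lq - X))) * exp (\<i> * of_real pi - (of_int k * lq - X))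
    = - exp (- lq - X) * exp (lq * (of_int k * (of_int k - 1) / 2) - of_int k * (\<i> * of_real pi + X))"
    by (simp only: exp_add[of "lq * (of_int (-k-2) * (of_int (-k-2) - 1) / 2) - of_int (-k-2) * (\<i> * of_real pi + (-2 * lq - X))"]
        exp_add[of "\<i> * of_real pi + (- lq - X)"] exp_ipi_add)
  show ?thesis unfolding y unfolding x KerQ_exp t theta_exp_minus[OF Re_rlq] mult.assoc[symmetric] e qx[unfolded x] by simp
qed

lemma KerQ_step: "KerQ (exp X) (k + int r) =
   exp ((of_nat r - 1) * (lq * (of_int k + of_nat r / 2) - (\<i> * of_real pi + X))) * KerQ (exp X) k"
proof -
  have "of_int (k + int r) * lq - X = (of_int k * lq - X) + of_int 1 * (of_nat r * lq)" by (simp add: algebra_simps)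
  hence t: "theta (exp (of_nat r * lq)) (exp (of_int (k + int r) * lq - X)) =
    exp (- of_int 1 * (\<i> * of_real pi + (of_int k * lq - X)) - of_nat r * lq * (of_int 1 * (of_int 1 - 1) / 2))
    * theta (exp (of_nat r * lq)) (exp (of_int k * lq - X))"
    by (simp only: theta_exp_shift[OF Re_rlq])
  have e: "exp (lq * (of_int (k + int r) * (of_int (k + int r) - 1) / 2) - of_int (k + int r) * (\<i> * of_real pi + X)) *
    exp (- of_int 1 * (\<i> * of_real pi + (of_int k * lq - X)) - of_nat r * lq * (of_int 1 * (of_int 1 - 1) / 2)) =
    exp ((of_nat r - 1) * (lq * (of_int k + of_nat r / 2) - (\<i> * of_real pi + X))) *
    exp (lq * (of_int k * (of_int k - 1) / 2) - of_int k * (\<i> * of_real pi + X))"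
    unfolding exp_add[symmetric] by (rule exp_eqI[of _ _ "- 1"]) (simp add: field_simps)
  show ?thesis unfolding KerQ_exp t mult.assoc[symmetric] e ..
qed

lemma Ker_hol: "f holomorphic_on A \<Longrightarrow> (\<And>z. z \<in> A \<Longrightarrow> f z \<noteq> 0) \<Longrightarrow> (\<lambda>z. Ker (f z) k) holomorphic_on A"
  unfolding Ker_def
  by (intro holomorphic_intros theta_compose_holomorphic norm_pr norm_qr) auto

lemma KerQ_hol:
  assumes f: "f holomorphic_on A" "\<And>z. z \<in> A \<Longrightarrow> f z \<noteq> 0"
  shows "(\<lambda>z. KerQ (f z) k) holomorphic_on A"
proof -
  have "KerQ x k = exp (lq * (of_int k * (of_int k - 1) / 2)) * (-x) powi (-k) * theta (q ^ r) (q powi k / x)"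
    if x: "x \<noteq> 0" for x
  proof -
    have "(- exp (Ln x)) powi (-k) = exp (of_int (-k) * (\<i> * of_real pi + Ln x))"
      unfolding exp_ipi_add[symmetric] exp_power_int ..
    hence "(-x) powi (-k) = exp (of_int (-k) * (\<i> * of_real pi + Ln x))" using x by simp
    moreover have "lq * (of_int k * (of_int k - 1) / 2) - of_int k * (\<i> * of_real pi + Ln x) =
       lq * (of_int k * (of_int k - 1) / 2) + of_int (-k) * (\<i> * of_real pi + Ln x)" by simp
    ultimately show ?thesis unfolding KerQ_def by (simp only: exp_add)
  qed
  hence "KerQ (f z) k = exp (lq * (of_int k * (of_int k - 1) / 2)) * (- f z) powi (-k) * theta (q ^ r) (q powi k / f z)"
    if "z \<in> A" for z using f(2)[OF that] by blast
  moreover have "(\<lambda>z. exp (lq * (of_int k * (of_int k - 1) / 2)) * (- f z) powi (-k) * theta (q ^ r) (q powi k / f z)) holomorphic_on A"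
    using f by (intro holomorphic_intros theta_compose_holomorphic norm_qr) auto
  ultimately show ?thesis by (subst holomorphic_cong[OF refl]) auto
qed

section \<open>The pole at 1 and the comparison with \<open>rar_gamma\<close>\<close>

text \<open>At w = 1 the recursions cancel all double products, leaving the two Pochhammer symbols
  that also occur in the normalization of \<open>rar_V\<close>.\<close>

lemma G_pole: "((\<lambda>w. (1 - w) * G w 0) \<longlongrightarrow> 1 / (qpoch_inf (p ^ r) (p ^ r) * qpoch_inf (q ^ r) (q ^ r))) (at 1)"
proof -
  \<comment> \<open>\<open>h\<close> is \<open>(1 - w) * G w 0\<close> with the factor
    \<open>1 - w\<close> of \<open>den\<close> cancelled, hence continuous at 1.\<close>
  define h where "h = (\<lambda>w. E1 (p ^ r * (p * q) / w) * E2 (q ^ r * (p * q) / (w * q ^ r)) /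
     (qpoch_inf (w * p ^ r) (p ^ r) * E1 (w * (p * q)) * E2 (w * q ^ r)))"
  have nz: "qpoch_inf (p ^ r) (p ^ r) \<noteq> 0" "qpoch_inf (q ^ r) (q ^ r) \<noteq> 0" "qpoch_inf (p * q) (p * q) \<noteq> 0"
    using qpoch_expL_nz[OF Re_rlp] qpoch_expL_nz[OF Re_rlq] qpoch_expL_nz[OF Re_lpq] pr_exp qr_exp pq_exp by simp_all
  have nE: "norm (E :: complex) < 1 \<Longrightarrow> E * P ^ j * Q ^ k = 1 \<Longrightarrow> norm P < 1 \<Longrightarrow> norm Q < 1 \<Longrightarrow> False" for E P Q j k
  proof -
    assume a: "norm E < 1" "E * P ^ j * Q ^ k = 1" "norm P < 1" "norm Q < 1"
    have "1 = norm E * (norm P ^ j * norm Q ^ k)" using arg_cong[OF a(2), of norm] by (simp add: norm_mult norm_power)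
    also have "\<dots> \<le> norm E * 1" using a by (intro mult_left_mono mult_le_one power_le_one) auto
    finally show False using a by simp
  qed
  have nz2: "E1 (p * q) \<noteq> 0" "E2 (q ^ r) \<noteq> 0" "E2 (p * q) \<noteq> 0"
    unfolding E1_def E2_def ell_prod_eq_0_iff[OF norm_pr norm_pq] ell_prod_eq_0_iff[OF norm_qr norm_pq]
    using nE[OF norm_pq _ norm_pr norm_pq] nE[OF norm_qr _ norm_qr norm_pq] nE[OF norm_pq _ norm_qr norm_pq]
    by auto
  have eq: "(1 - w) * G w 0 = h w" if "w \<noteq> 1" for w
  proof -
    have "den w 0 = (1 - w) * (qpoch_inf (w * p ^ r) (p ^ r) * E1 (w * (p * q)) * E2 (w * q ^ r))"
      unfolding den_def using E1_rec2[of w] qpoch_rec[OF norm_pr, of w] by simp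
    moreover have "num w 0 = E1 (p ^ r * (p * q) / w) * E2 (q ^ r * (p * q) / (w * q ^ r))"
      by (simp add: num_def)
    moreover have "pref w 0 = 1" by (simp add: pref_def)
    ultimately show ?thesis using that r by (simp add: G_base raw_def h_def)
  qed
  have hh: "h holomorphic_on {w. w \<noteq> 0 \<and> qpoch_inf (w * p ^ r) (p ^ r) * E1 (w * (p * q)) * E2 (w * q ^ r) \<noteq> 0}"
    unfolding h_def by (intro holomorphic_intros E_comp_hol qpoch_compose_holomorphic norm_pr) auto
  have "continuous_on UNIV (\<lambda>w. qpoch_inf (w * p ^ r) (p ^ r) * E1 (w * (p * q)) * E2 (w * q ^ r))"
    by (intro holomorphic_on_imp_continuous_on holomorphic_intros E_comp_hol qpoch_compose_holomorphic norm_pr)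
  hence "open {w. qpoch_inf (w * p ^ r) (p ^ r) * E1 (w * (p * q)) * E2 (w * q ^ r) \<noteq> 0}"
    by (rule open_Collect_neq) auto
  hence "open ({w. w \<noteq> 0} \<inter> {w. qpoch_inf (w * p ^ r) (p ^ r) * E1 (w * (p * q)) * E2 (w * q ^ r) \<noteq> 0})"
    using open_Collect_neq[of "\<lambda>w. w" "\<lambda>w. 0::complex"] by (intro open_Int) auto
  hence op: "open {w. w \<noteq> 0 \<and> qpoch_inf (w * p ^ r) (p ^ r) * E1 (w * (p * q)) * E2 (w * q ^ r) \<noteq> 0}"
    by (simp add: Collect_conj_eq)
  have "isCont h 1"
    using holomorphic_on_imp_continuous_on[OF hh] nz nz2 unfolding continuous_on_eq_continuous_at[OF op] by auto
  hence "(h \<longlongrightarrow> h 1) (at 1)" by (simp add: isCont_def)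
  moreover have "h 1 = 1 / (qpoch_inf (p ^ r) (p ^ r) * qpoch_inf (q ^ r) (q ^ r))"
  proof -
    have "E1 (p * q) = qpoch_inf (p * q) (p * q) * E1 (p ^ r * (p * q))"
      using E1_rec1[of "p * q"] by (simp add: mult_ac)
    moreover have "E2 (q ^ r) = qpoch_inf (q ^ r) (q ^ r) * E2 (q ^ r * (p * q))"
      using E2_rec2[of "q ^ r"] .
    moreover have "E2 (p * q) = qpoch_inf (p * q) (p * q) * E2 (q ^ r * (p * q))"
      using E2_rec1[of "p * q"] by (simp add: mult_ac)
    ultimately show ?thesis using nz nz2 unfolding h_def by (auto simp: field_simps)
  qed
  ultimately have "(h \<longlongrightarrow> 1 / (qpoch_inf (p ^ r) (p ^ r) * qpoch_inf (q ^ r) (q ^ r))) (at 1)" by simp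
  thus ?thesis
    by (rule Lim_transform_eventually) (auto simp: eventually_at eq intro!: exI[of _ 1])
qed

lemma eventually_den_nz: "z \<noteq> 0 \<Longrightarrow> eventually (\<lambda>w. den w m \<noteq> 0) (at z)"
  unfolding den_def using eventually_entire_nonzero[OF E1_hol, of "p powi m" z] eventually_entire_nonzero[OF E2_hol, of "q powi (int r - m)" z]
  by (auto simp: E_0 mult_ac elim: eventually_elim2)

lemma eventually_raw_eq_G: "z \<noteq> 0 \<Longrightarrow> eventually (\<lambda>w. raw w m = G w m) (at z)"
proof -
  assume z: "z \<noteq> 0"
  have nz: "eventually (\<lambda>w. w \<noteq> 0) (at z)" using z by (intro eventually_neq_at_within)
  show ?thesis
  proof (induction m rule: int_mod_induct[where r = "int r"])
    case (base m)
    thus ?case by (simp add: G_base)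
  next
    case (up m)
    show ?case
      using up eventually_den_nz[OF z, of m] eventually_den_nz[OF z, of "m + int r"] nz
      by eventually_elim (simp add: raw_step G_step)
  next
    case (down m)
    show ?case
      using down eventually_den_nz[OF z, of m] eventually_den_nz[OF z, of "m + int r"] nz
      by eventually_elim (simp add: raw_step G_step)
  qed (use r in auto)
qed

text \<open>\<open>remove_sings\<close> sees only a punctured neighbourhood. It therefore suffices
  that \<open>G\<close> is continuous at z and agrees with the product formula off the isolated
  zeros of \<open>den\<close>.\<close>

lemma rar_gamma_eq_G:
  assumes z: "z \<in> dom m"
  shows "rar_gamma r p q z m = G z m"
proof -
  have z0: "z \<noteq> 0" using z by (simp add: dom_def)
  let ?f = "\<lambda>w. (-w) powi (m * (m - 1) div 2) * p powi (m * (m - 1) * (m - 2) div 6) * q powi (- (m * (m\<^sup>2 - 1) div 6))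
          * ell_gamma (w * p powi m) (p ^ r) (p * q) * ell_gamma (w * q powi (int r - m)) (q ^ r) (p * q)"
  have "eventually (\<lambda>w. ?f w = G w m) (at z)"
    using eventually_raw_eq_G[OF z0, of m] eventually_den_nz[OF z0, of m]
  proof eventually_elim
    case (elim w)
    have "ell_prod (p ^ r) (p * q) (w * p powi m) \<noteq> 0" "ell_prod (q ^ r) (p * q) (w * q powi (int r - m)) \<noteq> 0"
      using elim(2) by (auto simp: den_def E1_def E2_def)
    hence "?f w = raw w m"
      unfolding raw_def num_def den_def E1_def E2_def pref_def
      by (simp add: ell_gamma_eq norm_pr norm_qr norm_pq)
    thus ?case using elim by simp
  qed
  moreover have "((\<lambda>w. G w m) \<longlongrightarrow> G z m) (at z)"
    using G_cont_dom[of m] z by (simp add: continuous_on_eq_continuous_at isCont_def)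
  ultimately have "(?f \<longlongrightarrow> G z m) (at z)"
    by (subst filterlim_cong[OF refl refl])
  thus ?thesis unfolding rar_gamma_def by (rule remove_sings_eqI)
qed

end

section \<open>Circle means\<close>

definition circ :: "complex \<Rightarrow> real \<Rightarrow> complex" where
  "circ w t = w * exp (2 * of_real pi * \<i> * of_real t)"

text \<open>The integral over the circle through w against dz / (2 pi i z). Keeping the base point
  w, and not just its modulus, makes \<open>avg_scale\<close> an identity of integrands.\<close>

definition avg :: "(complex \<Rightarrow> complex) \<Rightarrow> complex \<Rightarrow> complex" where
  "avg F w = integral {0..1} (\<lambda>t. F (circ w t))"

lemma norm_circ [simp]: "norm (circ w t) = norm w"
  by (simp add: circ_def norm_mult)

lemma circ_eq_0 [simp]: "circ w t = 0 \<longleftrightarrow> w = 0"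
  by (simp add: circ_def)

lemma circ_mult: "c * circ w t = circ (c * w) t"
  by (simp add: circ_def)

lemma circ_continuous [continuous_intros]: "continuous_on A (circ w)"
  unfolding circ_def by (intro continuous_intros)

lemma contour_integral_unit_circle:
  "contour_integral (circlepath 0 1) (\<lambda>z. F z / z) = 2 * of_real pi * \<i> * avg F 1"
proof -
  have "contour_integral (circlepath 0 1) (\<lambda>z. F z / z) =
     integral {0..1} (\<lambda>t. 2 * of_real pi * \<i> * F (circ 1 t))"
    unfolding contour_integral_integral
  proof (intro integral_cong)
    fix t :: real
    have "circlepath 0 1 t = circ 1 t" by (simp add: circ_def circlepath)
    moreover have "vector_derivative (circlepath 0 1) (at t) = 2 * of_real pi * \<i> * circ 1 t"
      by (simp add: circ_def vector_derivative_circlepath)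
    ultimately show "F (circlepath 0 1 t) / circlepath 0 1 t * vector_derivative (circlepath 0 1) (at t) =
        2 * of_real pi * \<i> * F (circ 1 t)" by simp
  qed
  thus ?thesis by (simp add: avg_def)
qed

lemma circ_integrable:
  fixes F :: "complex \<Rightarrow> complex"
  assumes F: "continuous_on (sphere 0 (norm w)) F"
  shows "(\<lambda>t. F (circ w t)) integrable_on {0..1}"
proof -
  have "circ w ` {0..1} \<subseteq> sphere 0 (norm w)" by auto
  from continuous_on_compose2[OF F circ_continuous this] show ?thesis
    by (rule integrable_continuous_interval)
qed

lemma avg_cong: "(\<And>z. norm z = norm w \<Longrightarrow> F z = F' z) \<Longrightarrow> avg F w = avg F' w"
  unfolding avg_def by (intro integral_cong) simp

lemma avg_diff:
  "continuous_on (sphere 0 (norm w)) F \<Longrightarrow> continuous_on (sphere 0 (norm w)) F' \<Longrightarrow>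
   avg (\<lambda>z. F z - F' z) w = avg F w - avg F' w"
  unfolding avg_def by (intro integral_diff circ_integrable)

lemma avg_add:
  "continuous_on (sphere 0 (norm w)) F \<Longrightarrow> continuous_on (sphere 0 (norm w)) F' \<Longrightarrow>
   avg (\<lambda>z. F z + F' z) w = avg F w + avg F' w"
  unfolding avg_def by (intro integral_add circ_integrable)

lemma avg_cmult: "avg (\<lambda>z. c * F z) w = c * avg F w"
  unfolding avg_def by simp

lemma avg_const [simp]: "avg (\<lambda>z. c) w = c"
  unfolding avg_def by simp

lemma avg_sum:
  "finite I \<Longrightarrow> (\<And>i. i \<in> I \<Longrightarrow> continuous_on (sphere 0 (norm w)) (F i)) \<Longrightarrow>
   avg (\<lambda>z. \<Sum>i\<in>I. F i z) w = (\<Sum>i\<in>I. avg (F i) w)"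
  unfolding avg_def by (intro integral_sum circ_integrable)

lemma avg_scale: "avg (\<lambda>z. F (c * z)) w = avg F (c * w)"
  unfolding avg_def circ_mult ..

lemma avg_inverse:
  assumes F: "continuous_on (sphere 0 1) F"
  shows "avg (\<lambda>z. F (1 / z)) 1 = avg F 1"
proof -
  have "((\<lambda>t. F (circ 1 t)) has_integral avg F 1) (cbox 0 1)"
    using circ_integrable[of 1 F] F by (simp add: avg_def integrable_integral)
  from has_integral_affinity[OF this, of "-1" 1]
  have "((\<lambda>t. F (circ 1 (1 - t))) has_integral avg F 1) {0..1}" by simp
  moreover have "circ 1 (1 - t) = 1 / circ 1 t" for t
  proof -
    have "2 * of_real pi * \<i> * of_real (1 - t) = 2 * of_real pi * \<i> - 2 * of_real pi * \<i> * of_real t"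
      by (simp add: algebra_simps)
    thus ?thesis by (simp only: circ_def exp_diff) simp
  qed
  ultimately show ?thesis by (simp add: avg_def integral_unique)
qed

text \<open>On a circle of radius \<open>exp (Re u)\<close> the mean value is the increment of a primitive of
  \<open>F \<circ> exp\<close> over a period \<open>2\<pi>\<i>\<close>, and that increment does not depend on \<open>u\<close>.\<close>

lemma avg_annulus:
  assumes F: "F holomorphic_on {z. a < norm z \<and> norm z < b}" and a: "0 \<le> a"
    and w: "a < norm w1" "norm w1 < b" "a < norm w2" "norm w2 < b"
  shows "avg F w1 = avg F w2"
proof -
  define S where "S = {x::complex. (a = 0 \<or> ln a < Re x) \<and> Re x < ln b}"
  have b: "b > 0" using w a by linarith
  have S: "x \<in> S \<longleftrightarrow> a < norm (exp x) \<and> norm (exp x) < b" for x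
  proof -
    have "ln a < Re x \<longleftrightarrow> a < exp (Re x)" if "a > 0"
      using that by (metis exp_less_cancel_iff exp_ln)
    moreover have "Re x < ln b \<longleftrightarrow> exp (Re x) < b" using b by (metis exp_less_cancel_iff exp_ln)
    ultimately show ?thesis using a by (cases "a = 0") (auto simp: S_def)
  qed
  have op: "open S"
  proof -
    have "S = {x. a < norm (exp x)} \<inter> {x. norm (exp x) < b}" using S by auto
    thus ?thesis by (auto intro!: open_Int open_Collect_less continuous_intros)
  qed
  have conv: "convex S"
  proof -
    have "S = (if a = 0 then UNIV else {x. Re x > ln a}) \<inter> {x. Re x < ln b}" by (auto simp: S_def)
    thus ?thesis by (auto intro!: convex_Int convex_halfspace_Re_gt convex_halfspace_Re_lt)
  qed
  have hol: "(\<lambda>x. F (exp x)) holomorphic_on S"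
  proof -
    have "exp ` S \<subseteq> {z. a < norm z \<and> norm z < b}" using S by blast
    from holomorphic_on_compose_gen[OF holomorphic_on_exp F this] show ?thesis by (simp add: o_def)
  qed
  obtain H where H: "\<And>x. x \<in> S \<Longrightarrow> (H has_field_derivative F (exp x)) (at x)"
    using holomorphic_convex_primitive'[OF conv op hol] at_within_open[OF _ op] by metis
  have S2: "x + 2 * of_real pi * \<i> \<in> S \<longleftrightarrow> x \<in> S" for x unfolding S by simp
  have "\<exists>c. \<forall>x\<in>S. H (x + 2 * of_real pi * \<i>) - H x = c"
  proof (rule has_field_derivative_zero_constant[OF conv])
    fix x assume x: "x \<in> S"
    have "((\<lambda>x. H (x + 2 * of_real pi * \<i>)) has_field_derivative F (exp (x + 2 * of_real pi * \<i>))) (at x)"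
      using H[of "x + 2 * of_real pi * \<i>"] x S2 by (simp add: DERIV_shift)
    hence "((\<lambda>x. H (x + 2 * of_real pi * \<i>) - H x) has_field_derivative F (exp (x + 2 * of_real pi * \<i>)) - F (exp x)) (at x)"
      using H[OF x] by (rule DERIV_diff)
    thus "((\<lambda>x. H (x + 2 * of_real pi * \<i>) - H x) has_field_derivative 0) (at x within S)"
      by (simp add: exp_add has_field_derivative_at_within)
  qed
  then obtain c where c: "\<And>x. x \<in> S \<Longrightarrow> H (x + 2 * of_real pi * \<i>) - H x = c" by blast
  have "2 * of_real pi * \<i> * avg F w = c" if w: "a < norm w" "norm w < b" for w
  proof -
    define u where "u = Ln w"
    have "w \<noteq> 0" using w a by auto
    hence wu: "w = exp u" by (simp add: u_def)
    hence uS: "u \<in> S" using S w by simp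
    have "u + 2 * of_real pi * \<i> \<in> S" using uS S2 by blast
    hence "closed_segment u (u + 2 * of_real pi * \<i>) \<subseteq> S" using uS conv by (simp add: closed_segment_subset)
    hence "((\<lambda>x. F (exp x)) has_contour_integral (H (u + 2 * of_real pi * \<i>) - H u)) (linepath u (u + 2 * of_real pi * \<i>))"
      using contour_integral_primitive[of S H "\<lambda>x. F (exp x)" "linepath u (u + 2 * of_real pi * \<i>)"]
      by (simp add: H has_field_derivative_at_within)
    hence "((\<lambda>t. F (exp (linepath u (u + 2 * of_real pi * \<i>) t)) * (2 * of_real pi * \<i>)) has_integral c) {0..1}"
      using c[OF uS] by (simp add: has_contour_integral_linepath)
    moreover have "exp (linepath u (u + 2 * of_real pi * \<i>) t) = circ w t" for t
    proof -
      have "linepath u (u + 2 * of_real pi * \<i>) t = u + 2 * of_real pi * \<i> * of_real t"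
        by (simp add: linepath_def scaleR_conv_of_real algebra_simps)
      thus ?thesis by (simp add: circ_def wu exp_add)
    qed
    ultimately have "((\<lambda>t. F (circ w t) * (2 * of_real pi * \<i>)) has_integral c) {0..1}" by simp
    from integral_unique[OF this] show ?thesis by (simp add: avg_def mult_ac)
  qed
  from this[of w1] this[of w2] w show ?thesis by (metis complex_i_not_zero mult_cancel_left mult_eq_0_iff of_real_eq_0_iff pi_neq_zero zero_neq_numeral)
qed

lemma avg_swap:
  assumes "continuous_on (sphere 0 (norm v) \<times> sphere 0 (norm w)) (\<lambda>(x, y). F x y)"
  shows "avg (\<lambda>x. avg (F x) w) v = avg (\<lambda>y. avg (\<lambda>x. F x y) v) w"
proof -
  have "continuous_on (cbox (0::real, 0::real) (1, 1)) (\<lambda>p. (\<lambda>(x, y). F x y) (circ v (fst p), circ w (snd p)))"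
    by (rule continuous_on_compose2[OF assms])
       (auto simp: circ_def norm_mult intro!: continuous_intros)
  hence "continuous_on (cbox (0::real, 0::real) (1, 1)) (\<lambda>(x, y). F (circ v x) (circ w y))"
    by (simp add: case_prod_beta)
  from integral_swap_continuous[OF this] show ?thesis by (simp add: avg_def)
qed

lemma avg_continuous_param:
  fixes F :: "'a :: metric_space \<Rightarrow> complex \<Rightarrow> complex"
  assumes "continuous_on (U \<times> sphere 0 (norm w)) (\<lambda>(x, y). F x y)"
  shows "continuous_on U (\<lambda>x. avg (F x) w)"
proof -
  have "continuous_on (U \<times> cbox 0 1) (\<lambda>p. (\<lambda>(x, y). F x y) (fst p, circ w (snd p)))"
    by (rule continuous_on_compose2[OF assms])
       (auto simp: circ_def norm_mult intro!: continuous_intros)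
  hence "continuous_on (U \<times> cbox (0::real) 1) (\<lambda>(x, t). F x (circ w t))"
    by (simp add: case_prod_beta)
  from integral_continuous_on_param[OF this] show ?thesis by (simp add: avg_def)
qed

text \<open>By Morera's theorem: integration along a side of a triangle is interchanged with the
  mean, and the triangle integrals vanish for each point of the circle. Joint continuity is enough
  for the interchange.\<close>

lemma avg_holomorphic_param:
  assumes cont: "continuous_on (U \<times> sphere 0 (norm w)) (\<lambda>(x, y). F x y)" and U: "open U"
    and hol: "\<And>z. norm z = norm w \<Longrightarrow> (\<lambda>x. F x z) holomorphic_on U"
  shows "(\<lambda>x. avg (F x) w) holomorphic_on U"
proof -
  have cU: "continuous_on U (\<lambda>x. avg (F x) w)" by (rule avg_continuous_param[OF cont])
  have lp: "contour_integral (linepath a b) (\<lambda>x. avg (F x) w) =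
      avg (\<lambda>z. contour_integral (linepath a b) (\<lambda>x. F x z)) w"
    if ab: "closed_segment a b \<subseteq> U" for a b
  proof -
    have "continuous_on (cbox (0::real, 0::real) (1, 1)) (\<lambda>p. (\<lambda>(x, y). F x y) (linepath a b (fst p), circ w (snd p)))"
    proof (rule continuous_on_compose2[OF cont])
      have "linepath a b (fst p) \<in> closed_segment a b" if "p \<in> cbox (0::real, 0::real) (1, 1)" for p
        using that by (intro linepath_in_path) (auto simp: mem_Times_iff cbox_Pair_eq)
      thus "(\<lambda>p. (linepath a b (fst p), circ w (snd p))) ` cbox (0, 0) (1, 1) \<subseteq> U \<times> sphere 0 (norm w)"
        using ab by auto
    qed (auto simp: circ_def linepath_def intro!: continuous_intros)
    hence "continuous_on (cbox (0::real, 0::real) (1, 1)) (\<lambda>(x, y). F (linepath a b x) (circ w y) * (b - a))"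
      by (auto simp: case_prod_beta intro!: continuous_intros)
    from integral_swap_continuous[OF this] show ?thesis
      by (simp add: avg_def contour_integral_integral)
  qed
  have "(\<lambda>x. avg (F x) w) analytic_on U"
  proof (rule Morera_triangle[OF cU U], intro impI)
    fix a b c assume abc: "convex hull {a, b, c} \<subseteq> U"
    have seg: "closed_segment a b \<subseteq> U" "closed_segment b c \<subseteq> U" "closed_segment c a \<subseteq> U"
      using abc by (auto simp: segment_convex_hull intro!: subset_trans[OF hull_mono abc])
    have cz: "continuous_on (sphere 0 (norm w)) (\<lambda>z. contour_integral (linepath u v) (\<lambda>x. F x z))"
      if uv: "closed_segment u v \<subseteq> U" for u v
    proof -
      have "continuous_on (sphere 0 (norm w) \<times> cbox (0::real) 1) (\<lambda>p. (\<lambda>(x, y). F x y) (linepath u v (snd p), fst p))"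
      proof (rule continuous_on_compose2[OF cont])
        have "linepath u v (snd p) \<in> closed_segment u v" if "p \<in> sphere 0 (norm w) \<times> cbox (0::real) 1" for p
          using that by (intro linepath_in_path) (auto simp: mem_Times_iff cbox_Pair_eq)
        thus "(\<lambda>p. (linepath u v (snd p), fst p)) ` (sphere 0 (norm w) \<times> cbox 0 1) \<subseteq> U \<times> sphere 0 (norm w)"
          using uv by auto
      qed (auto simp: linepath_def intro!: continuous_intros)
      hence "continuous_on (sphere 0 (norm w) \<times> cbox (0::real) 1) (\<lambda>(z, t). F (linepath u v t) z * (v - u))"
        by (auto simp: case_prod_beta intro!: continuous_intros)
      from integral_continuous_on_param[OF this] show ?thesis
        by (simp add: contour_integral_integral)
    qed
    have "avg (\<lambda>z. contour_integral (linepath a b) (\<lambda>x. F x z) + contour_integral (linepath b c) (\<lambda>x. F x z)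
        + contour_integral (linepath c a) (\<lambda>x. F x z)) w = avg (\<lambda>z. 0) w"
    proof (rule avg_cong)
      fix z :: complex assume z: "norm z = norm w"
      have h: "(\<lambda>x. F x z) holomorphic_on convex hull {a, b, c}"
        using hol[OF z] abc holomorphic_on_subset by blast
      from Cauchy_theorem_triangle[OF h]
      have "((\<lambda>x. F x z) has_contour_integral 0) (linepath a b +++ linepath b c +++ linepath c a)" .
      moreover have "(\<lambda>x. F x z) contour_integrable_on linepath u v" if "closed_segment u v \<subseteq> U" for u v
        using holomorphic_on_imp_continuous_on[OF hol[OF z]] that
        by (intro contour_integrable_continuous_linepath) (rule continuous_on_subset)
      ultimately show "contour_integral (linepath a b) (\<lambda>x. F x z) + contour_integral (linepath b c) (\<lambda>x. F x z)
        + contour_integral (linepath c a) (\<lambda>x. F x z) = 0"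
        using seg by (auto dest!: contour_integral_unique simp: add.assoc)
    qed
    thus "contour_integral (linepath a b) (\<lambda>x. avg (F x) w) + contour_integral (linepath b c) (\<lambda>x. avg (F x) w)
        + contour_integral (linepath c a) (\<lambda>x. avg (F x) w) = 0"
      unfolding lp[OF seg(1)] lp[OF seg(2)] lp[OF seg(3)]
      using cz seg by (simp add: avg_add continuous_on_add)
  qed
  thus ?thesis by (rule analytic_imp_holomorphic)
qed

lemma sum_periodic_shift:
  fixes f :: "int \<Rightarrow> 'a :: ab_group_add"
  assumes per: "\<And>m. f (m + int r) = f m"
  shows "(\<Sum>m<r. f (int m + c)) = (\<Sum>m<r. f (int m))"
proof -
  have step: "(\<Sum>m<r. f (int m + (c + 1))) = (\<Sum>m<r. f (int m + c))" for c
  proof -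
    have "(\<Sum>m<r. f (int (Suc m) + c) - f (int m + c)) = f (int r + c) - f (int 0 + c)"
      by (rule sum_lessThan_telescope)
    also have "\<dots> = 0" using per[of c] by (simp add: add.commute)
    finally show ?thesis by (simp add: sum_subtractf algebra_simps)
  qed
  show ?thesis
  proof (induction c rule: int_induct[where k = 0])
    case (step1 i) thus ?case using step[of i] by simp
  next
    case (step2 i) thus ?case using step[of "i - 1"] by simp
  qed auto
qed

context rarefied
begin

section \<open>The beta integral\<close>

text \<open>The integrand for an arbitrary finite set of parameters, with \<open>Ker\<close> in
  place of the reciprocal of the gamma functions of z^2 and z^(-2). Sets of six and of eight
  parameters both occur.\<close>

definition Dl :: "nat set \<Rightarrow> (nat \<Rightarrow> complex) \<Rightarrow> (nat \<Rightarrow> int) \<Rightarrow> int \<Rightarrow> complex \<Rightarrow> int \<Rightarrow> complex" where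
  "Dl A t n e z m = (\<Prod>a\<in>A. G (t a * z) (n a + e + m) * G (t a / z) (n a - m)) * Ker (z\<^sup>2) (2 * m + e)"

definition Iv :: "nat set \<Rightarrow> (nat \<Rightarrow> complex) \<Rightarrow> (nat \<Rightarrow> int) \<Rightarrow> int \<Rightarrow> complex" where
  "Iv A t n e = (\<Sum>m<r. avg (\<lambda>z. Dl A t n e z (int m)) 1)"

text \<open>The case l = 1 is the balancing condition of the beta integral, l = 2 that of the
  rarefied hypergeometric function.\<close>

definition bal :: "nat \<Rightarrow> nat set \<Rightarrow> (nat \<Rightarrow> complex) \<Rightarrow> (nat \<Rightarrow> int) \<Rightarrow> int \<Rightarrow> bool" where
  "bal l A t n e \<longleftrightarrow> finite A \<and> card A = 2 * l + 4 \<and> (\<Prod>a\<in>A. t a) = (p * q) ^ l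
     \<and> (\<Sum>a\<in>A. n a) + (int l + 2) * e = 0 \<and> (\<forall>a\<in>A. t a \<noteq> 0)"

definition pairs :: "nat set \<Rightarrow> nat set set" where
  "pairs A = {x. x \<subseteq> A \<and> card x = 2}"

text \<open>Indexing by two-element sets instead of ordered pairs b < c makes the product manifestly
  invariant under relabelling.\<close>

definition PG :: "nat set \<Rightarrow> (nat \<Rightarrow> complex) \<Rightarrow> (nat \<Rightarrow> int) \<Rightarrow> int \<Rightarrow> complex" where
  "PG A t n e = (\<Prod>x\<in>pairs A. G (\<Prod>a\<in>x. t a) ((\<Sum>a\<in>x. n a) + e))"

lemma Ker_cont: "continuous_on A f \<Longrightarrow> (\<And>x. x \<in> A \<Longrightarrow> f x \<noteq> 0) \<Longrightarrow> continuous_on A (\<lambda>x. Ker (f x) k)"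
proof -
  assume f: "continuous_on A f" and nz: "\<And>x. x \<in> A \<Longrightarrow> f x \<noteq> 0"
  have "continuous_on (-{0}) (\<lambda>x. Ker x k)"
    by (intro holomorphic_on_imp_continuous_on Ker_hol holomorphic_intros) auto
  moreover have "f ` A \<subseteq> -{0}" using nz by auto
  ultimately show ?thesis using f continuous_on_compose2 by blast
qed

lemma Dl_continuous:
  assumes "continuous_on S f" "\<And>a. a \<in> A \<Longrightarrow> continuous_on S (\<lambda>x. T x a)"
    and "\<And>x a. x \<in> S \<Longrightarrow> a \<in> A \<Longrightarrow> T x a * f x \<in> dom (n a + e + m) \<and> T x a / f x \<in> dom (n a - m)"
    and "\<And>x. x \<in> S \<Longrightarrow> f x \<noteq> 0"
  shows "continuous_on S (\<lambda>x. Dl A (T x) n e (f x) m)"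
  unfolding Dl_def using assms
  by (intro continuous_on_mult continuous_on_prod G_cont Ker_cont continuous_intros) auto

lemma Dl_cont_sphere:
  assumes "\<And>a. a \<in> A \<Longrightarrow> t a \<noteq> 0 \<and> norm (t a) < 1"
  shows "continuous_on (sphere 0 1) (\<lambda>z. Dl A t n e z m)"
  using assms by (intro Dl_continuous continuous_intros)
    (auto intro!: dom_unit simp: norm_mult norm_divide)

lemma Iv_holomorphic:
  assumes U: "open U" and T: "\<And>a. a \<in> A \<Longrightarrow> (\<lambda>x. T x a) holomorphic_on U"
    and n: "\<And>x a. x \<in> U \<Longrightarrow> a \<in> A \<Longrightarrow> T x a \<noteq> 0 \<and> norm (T x a) < 1"
  shows "(\<lambda>x. Iv A (T x) n e) holomorphic_on U"
  unfolding Iv_def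
proof (intro holomorphic_on_sum avg_holomorphic_param U)
  fix m :: nat
  have "continuous_on (U \<times> sphere 0 (norm (1::complex))) (\<lambda>w. Dl A (T (fst w)) n e (snd w) (int m))"
    using n T by (intro Dl_continuous continuous_intros
        continuous_on_compose2[OF holomorphic_on_imp_continuous_on[OF T]])
      (auto intro!: dom_unit simp: norm_mult norm_divide)
  thus "continuous_on (U \<times> sphere 0 (norm (1::complex))) (\<lambda>(x, z). Dl A (T x) n e z (int m))"
    by (simp add: case_prod_beta)
  fix z :: complex assume z: "norm z = norm (1::complex)"
  have "z \<noteq> 0" using z by auto
  thus "(\<lambda>x. Dl A (T x) n e z (int m)) holomorphic_on U"
    unfolding Dl_def using n T z
    by (intro holomorphic_on_mult holomorphic_on_prod G_hol holomorphic_on_divide holomorphic_on_const)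
       (auto intro!: dom_unit simp: norm_mult norm_divide)
qed

lemma Iv_reindex: "bij_betw h A B \<Longrightarrow> Iv A (\<lambda>a. t (h a)) (\<lambda>a. n (h a)) e = Iv B t n e"
  unfolding Iv_def Dl_def
  by (subst prod.reindex_bij_betw[of h A B, symmetric]) auto

lemma Iv_cong: "(\<And>a. a \<in> A \<Longrightarrow> t a = t' a \<and> n a = n' a) \<Longrightarrow> Iv A t n e = Iv A t' n' e"
  unfolding Iv_def Dl_def by simp

lemma PG_cong: "(\<And>a. a \<in> A \<Longrightarrow> t a = t' a \<and> n a = n' a) \<Longrightarrow> PG A t n e = PG A t' n' e"
  unfolding PG_def
proof (intro prod.cong refl)
  fix x assume a: "\<And>a. a \<in> A \<Longrightarrow> t a = t' a \<and> n a = n' a" and x: "x \<in> pairs A"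
  hence "prod t x = prod t' x" "sum n x = sum n' x"
    by (auto simp: pairs_def subset_eq intro!: prod.cong sum.cong)
  thus "G (prod t x) (sum n x + e) = G (prod t' x) (sum n' x + e)" by simp
qed

lemma bij_pairs: "bij_betw h A B \<Longrightarrow> bij_betw ((`) h) (pairs A) (pairs B)"
proof -
  assume h: "bij_betw h A B"
  have i: "inj_on h A" and im: "h ` A = B" using h by (auto simp: bij_betw_def)
  have c: "card (h ` x) = card x" if "x \<subseteq> A" for x
    using card_image inj_on_subset[OF i that] by blast
  show ?thesis unfolding bij_betw_def
  proof
    show "inj_on ((`) h) (pairs A)"
      using inj_on_image_eq_iff[OF i] by (auto simp: inj_on_def pairs_def)
    show "(`) h ` pairs A = pairs B"
    proof safe
      fix y assume y: "y \<in> pairs B"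
      then obtain x where x: "x \<subseteq> A" "y = h ` x" unfolding pairs_def im[symmetric] by (auto simp: subset_image_iff)
      thus "y \<in> (`) h ` pairs A" using y c[OF x(1)] by (auto simp: pairs_def)
    qed (use c im in \<open>auto simp: pairs_def\<close>)
  qed
qed

lemma PG_reindex:
  assumes h: "bij_betw h A B"
  shows "PG A (\<lambda>a. t (h a)) (\<lambda>a. n (h a)) e = PG B t n e"
proof -
  have i: "inj_on h A" using h by (auto simp: bij_betw_def)
  have "PG B t n e = (\<Prod>x\<in>pairs A. G (prod t (h ` x)) (sum n (h ` x) + e))"
    unfolding PG_def by (subst prod.reindex_bij_betw[OF bij_pairs[OF h], symmetric]) auto
  also have "\<dots> = PG A (\<lambda>a. t (h a)) (\<lambda>a. n (h a)) e"
    unfolding PG_def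
  proof (intro prod.cong refl)
    fix x assume "x \<in> pairs A"
    hence "inj_on h x" using inj_on_subset[OF i] by (auto simp: pairs_def)
    thus "G (prod t (h ` x)) (sum n (h ` x) + e) = G (\<Prod>a\<in>x. t (h a)) ((\<Sum>a\<in>x. n (h a)) + e)"
      by (simp add: prod.reindex sum.reindex)
  qed
  finally show ?thesis ..
qed

lemma finite_pairs: "finite A \<Longrightarrow> finite (pairs A)"
  unfolding pairs_def by (rule finite_subset[of _ "Pow A"]) auto

lemma PG_empty [simp]: "PG {} t n e = 1"
proof -
  have "pairs {} = {}" by (auto simp: pairs_def)
  thus ?thesis by (simp add: PG_def)
qed

lemma PG_insert:
  assumes A: "finite A" "a \<notin> A"
  shows "PG (insert a A) t n e = (\<Prod>b\<in>A. G (t a * t b) (n a + n b + e)) * PG A t n e"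
proof -
  have eq: "pairs (insert a A) = (\<lambda>b. {a, b}) ` A \<union> pairs A"
  proof safe
    fix x assume x: "x \<in> pairs (insert a A)" "x \<notin> pairs A"
    hence "a \<in> x" "card x = 2" "x \<subseteq> insert a A" by (auto simp: pairs_def)
    then obtain b where "x = {a, b}" "b \<noteq> a" by (metis card_2_iff insertE singletonD insert_commute)
    thus "x \<in> (\<lambda>b. {a, b}) ` A" using \<open>x \<subseteq> insert a A\<close> by auto
  next
    fix b assume "b \<in> A"
    thus "{a, b} \<in> pairs (insert a A)" using A by (auto simp: pairs_def card_2_iff)
  next
    fix x assume "x \<in> pairs A" thus "x \<in> pairs (insert a A)" by (auto simp: pairs_def)
  qed
  have inj: "inj_on (\<lambda>b. {a, b}) A" using A by (auto simp: inj_on_def doubleton_eq_iff)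
  have disj: "(\<lambda>b. {a, b}) ` A \<inter> pairs A = {}" using A by (auto simp: pairs_def)
  have "(\<Prod>x\<in>(\<lambda>b. {a, b}) ` A. G (prod t x) (sum n x + e)) = (\<Prod>b\<in>A. G (t a * t b) (n a + n b + e))"
  proof (subst prod.reindex[OF inj], rule prod.cong[OF refl])
    fix b assume "b \<in> A"
    hence "a \<noteq> b" using A by auto
    thus "((\<lambda>x. G (prod t x) (sum n x + e)) \<circ> (\<lambda>b. {a, b})) b = G (t a * t b) (n a + n b + e)"
      by (simp add: add_ac)
  qed
  thus ?thesis unfolding PG_def eq
    using A finite_pairs[OF A(1)] disj by (subst prod.union_disjoint) auto
qed

lemma PG_holomorphic:
  assumes A: "finite A" and T: "\<And>a. a \<in> A \<Longrightarrow> (\<lambda>x. T x a) holomorphic_on U"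
    and n: "\<And>x a. x \<in> U \<Longrightarrow> a \<in> A \<Longrightarrow> T x a \<noteq> 0 \<and> norm (T x a) < 1"
  shows "(\<lambda>x. PG A (T x) n e) holomorphic_on U"
  using assms
proof (induction A rule: finite_induct)
  case (insert a A)
  have *: "norm (T x a * T x b) < 1" if "x \<in> U" "b \<in> A" for x b
    using insert.prems(2)[of x a] insert.prems(2)[of x b] that
      mult_strict_mono[of "norm (T x a)" 1 "norm (T x b)" 1] by (simp add: norm_mult)
  show ?case unfolding PG_insert[OF insert.hyps]
    using insert * by (intro holomorphic_on_mult holomorphic_on_prod G_hol) (auto intro!: dom_unit)
qed simp

text \<open>Under m -> m + r every gamma factor acquires an exponential multiplier. By the balancing
  conditions their product is the inverse of the multiplier of \<open>Ker\<close>, up to an integral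
  multiple of 2 pi i in the exponent.\<close>

lemma Dl_periodic:
  assumes b: "bal l A t n e" and z: "z \<noteq> 0"
  shows "Dl A t n e z (m + int r) = Dl A t n e z m"
proof -
  define R where "R = (of_nat r - 1 :: complex)"
  define Z where "Z = Ln z"
  define N where "N = (\<lambda>a. 2 * n a + e)"
  define \<tau> where "\<tau> = (\<lambda>a. Ln (t a))"
  define K :: int where "K = (int r - 1) * (e + 2 * m + int r)"
  have zZ: "z = exp Z" using z by (simp add: Z_def)
  have ta: "t a = exp (\<tau> a)" if "a \<in> A" for a using b that by (simp add: bal_def \<tau>_def)
  have fin: "finite A" and cA: "card A = 2 * l + 4" and sn: "(\<Sum>a\<in>A. n a) = - ((int l + 2) * e)"
    using b by (auto simp: bal_def)
  have "exp (\<Sum>a\<in>A. \<tau> a) = (p * q) ^ l"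
    using b fin by (simp add: exp_sum bal_def \<tau>_def)
  also have "\<dots> = exp (of_nat l * (lp + lq))" by (simp add: pq_exp exp_of_nat_mult)
  \<comment> \<open>The logarithms are balanced only modulo 2 pi i; the defect j will be multiplied
    by the integer \<open>K\<close> and so does not matter.\<close>
  finally obtain j :: int where j: "(\<Sum>a\<in>A. \<tau> a) = of_nat l * (lp + lq) + (of_int (2 * j) * pi) * \<i>"
    unfolding exp_eq by blast
  define c where "c = (\<lambda>a. cx (\<tau> a + Z) (n a + e + m) - cx (\<tau> a - Z) (n a - m - int r))"
  have step: "G (t a * z) (n a + e + (m + int r)) * G (t a / z) (n a - (m + int r)) =
      exp (c a) * (G (t a * z) (n a + e + m) * G (t a / z) (n a - m))" if a: "a \<in> A" for a
  proof -
    have tz: "t a * z = exp (\<tau> a + Z)" "t a / z = exp (\<tau> a - Z)" using ta[OF a] by (simp_all add: zZ exp_add exp_diff)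
    have 1: "G (t a * z) (n a + e + (m + int r)) = exp (cx (\<tau> a + Z) (n a + e + m)) * G (t a * z) (n a + e + m)"
      using G_step[of "t a * z" "n a + e + m"] cf_exp by (simp add: tz add_ac)
    have 2: "G (t a / z) (n a - m) = exp (cx (\<tau> a - Z) (n a - m - int r)) * G (t a / z) (n a - (m + int r))"
      using G_step[of "t a / z" "n a - m - int r"] cf_exp by (simp add: tz algebra_simps)
    show ?thesis unfolding 1 c_def exp_diff 2 by simp
  qed
  have K: "of_int K = R * (of_int e + 2 * of_int m + of_nat r)" by (simp add: K_def R_def)
  \<comment> \<open>The quadratic terms in the indices combine to terms linear in
    \<open>N a\<close>, since the two factors move in opposite directions; these disappear on
    summation because the \<open>N a\<close> add up to 0.\<close>
  have c: "c a = of_int K * (\<i> * of_real pi) + of_int K * \<tau> a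
      + of_int (N a) * (Z * R + of_int K * (lp - lq) / 2) - of_int K * (lp + lq) / 2" for a
    unfolding c_def cx_def R_def[symmetric] K N_def
    by (simp add: field_simps power2_eq_square R_def)
  have s0: "(\<Sum>a\<in>A. N a) = 0"
  proof -
    have "(\<Sum>a\<in>A. 2 * n a + e) = 2 * (\<Sum>a\<in>A. n a) + int (card A) * e"
      by (simp add: sum.distrib sum_distrib_left)
    thus ?thesis unfolding N_def sn cA by (simp add: algebra_simps)
  qed
  have "(\<Sum>a\<in>A. c a) = of_nat (card A) * (of_int K * (\<i> * of_real pi)) + of_int K * (\<Sum>a\<in>A. \<tau> a)
      + of_int (\<Sum>a\<in>A. N a) * (Z * R + of_int K * (lp - lq) / 2) - of_nat (card A) * (of_int K * (lp + lq) / 2)"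
    by (simp only: c sum.distrib sum_subtractf of_int_sum sum_distrib_left sum_distrib_right sum_constant)
  also have "\<dots> = - (2 * of_int K * (lp + lq)) + 2 * of_real pi * \<i> * of_int (K * (int l + 2 + j))"
    unfolding s0 j cA by (simp add: algebra_simps add_divide_distrib)
  finally have "exp (\<Sum>a\<in>A. c a) = exp (- (2 * of_int K * (lp + lq)))"
    by (intro exp_eqI[of _ _ "K * (int l + 2 + j)"]) simp
  moreover have "Ker (z\<^sup>2) (2 * (m + int r) + e) = exp (2 * of_int K * (lp + lq)) * Ker (z\<^sup>2) (2 * m + e)"
  proof -
    have z2: "z\<^sup>2 \<noteq> 0" using z by simp
    have "2 * (m + int r) + e = ((2 * m + e) + int r) + int r" by simp
    hence "Ker (z\<^sup>2) (2 * (m + int r) + e) = exp ((lp + lq) * ((of_nat r - 1) * (of_int (2 * m + e + int r) + of_nat r / 2)))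
       * (exp ((lp + lq) * ((of_nat r - 1) * (of_int (2 * m + e) + of_nat r / 2))) * Ker (z\<^sup>2) (2 * m + e))"
      by (simp only: Ker_step[OF z2])
    moreover have "(lp + lq) * ((of_nat r - 1) * (of_int (2 * m + e + int r) + of_nat r / 2)) +
        (lp + lq) * ((of_nat r - 1) * (of_int (2 * m + e) + of_nat r / 2)) = 2 * of_int K * (lp + lq)"
      unfolding K R_def by (simp add: field_simps)
    ultimately show ?thesis by (simp only: mult.assoc[symmetric] exp_add[symmetric])
  qed
  moreover have "(\<Prod>a\<in>A. G (t a * z) (n a + e + (m + int r)) * G (t a / z) (n a - (m + int r))) =
     exp (\<Sum>a\<in>A. c a) * (\<Prod>a\<in>A. G (t a * z) (n a + e + m) * G (t a / z) (n a - m))"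
    using step fin by (simp add: exp_sum prod.distrib)
  ultimately show ?thesis unfolding Dl_def by (simp add: exp_minus)
qed

text \<open>Changing the indices in this way is the substitution m -> m + d in the integrand, and
  the sum runs over a full period. This absorbs even changes of e.\<close>

lemma Iv_shift:
  assumes b: "bal l A t n e"
  shows "Iv A t (\<lambda>a. n a - d) (e + 2 * d) = Iv A t n e"
proof -
  have D: "Dl A t (\<lambda>a. n a - d) (e + 2 * d) z m = Dl A t n e z (m + d)" for z m
    unfolding Dl_def by (simp add: algebra_simps)
  have "avg (\<lambda>z. Dl A t n e z (m + int r)) 1 = avg (\<lambda>z. Dl A t n e z m) 1" for m
    by (rule avg_cong, rule Dl_periodic[OF b]) auto
  thus ?thesis unfolding Iv_def D by (intro sum_periodic_shift)
qed

end

declare One_nat_def [simp del]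

lemma set_1_6: "{1..6::nat} = {1, 2, 3, 4, 5, 6}" and set_2_5: "{2..5::nat} = {2, 3, 4, 5}"
  by auto

lemma prod_1_6: "(\<Prod>a=1..6::nat. f a) = f 1 * f 2 * f 3 * f 4 * f 5 * (f 6 :: complex)"
  and prod_2_5: "(\<Prod>a=2..5::nat. f a) = f 2 * f 3 * f 4 * (f 5 :: complex)"
  by (simp_all add: set_1_6 set_2_5 mult_ac)

context rarefied
begin

section \<open>The telescoping relation for six parameters\<close>

definition thx :: "complex \<Rightarrow> int \<Rightarrow> complex" where
  "thx X k = \<i> * of_real pi * of_int k + X * (of_int k + 1 / 2) + lp * ((of_int k)\<^sup>2 / 2)"

lemma Th_br: "Th (exp X) k = exp (thx X k) * br (of_nat r * lp) (X + of_int k * lp)"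
proof -
  have "thx X k + (- (X + of_int k * lp) / 2) =
      of_int k * (\<i> * of_real pi + X) + lp * (of_int k * (of_int k - 1) / 2)"
    by (simp add: thx_def field_simps power2_eq_square)
  hence "exp (thx X k) * exp (- (X + of_int k * lp) / 2) =
      exp (of_int k * (\<i> * of_real pi + X) + lp * (of_int k * (of_int k - 1) / 2))"
    by (simp only: exp_add[symmetric])
  thus ?thesis unfolding Th_exp br_def mult.assoc[symmetric] by simp
qed

text \<open>In additive notation, with \<open>\<zeta>\<close> for the variable and \<open>y\<close>
  for the parameters, this is \<open>br_six\<close>. The product of the s a contributes
  \<open>lp\<close> to the sum of the y a, the indices contribute \<open>- lp\<close>, so that the
  sum is 0 as required. The rest of the proof compares exponential prefactors.\<close>

lemma theta_telescope:
  fixes s :: "nat \<Rightarrow> complex" and n :: "nat \<Rightarrow> int"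
  assumes s: "\<And>a. a \<in> {1..6} \<Longrightarrow> s a \<noteq> 0" and sp: "(\<Prod>a=1..6. s a) = p"
    and n: "(\<Sum>a=1..6. n a) + 3 * e = -1"
  obtains \<kappa> where "\<And>z m. z \<noteq> 0 \<Longrightarrow> Th (z\<^sup>2) (2 * m + e) *
     ((\<Prod>a=2..5. Th (s a * s 6) (n a + n 6 + e)) * (Th (s 1 * z) (n 1 + e + m) * Th (s 1 / z) (n 1 - m))
    - (\<Prod>a=2..5. Th (s 1 * s a) (n 1 + n a + e)) * (Th (s 6 * z) (n 6 + e + m) * Th (s 6 / z) (n 6 - m)))
    = \<kappa> * ((\<Prod>a=1..6. Th (s a * z) (n a + e + m)) / z - z ^ 3 * (\<Prod>a=1..6. Th (s a / z) (n a - m)))"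
proof -
  define S1 S2 S3 S4 S5 where "S1 = Ln (s 1)" "S2 = Ln (s 2)" "S3 = Ln (s 3)" "S4 = Ln (s 4)" "S5 = Ln (s 5)"
  \<comment> \<open>S6 is fixed by the balancing condition, not as \<open>Ln (s 6)\<close>, so that
    the logarithms sum to \<open>lp\<close> exactly and not only modulo 2 pi i.\<close>
  define S6 where "S6 = lp - S1 - S2 - S3 - S4 - S5"
  have e: "s 1 = exp S1" "s 2 = exp S2" "s 3 = exp S3" "s 4 = exp S4" "s 5 = exp S5"
    using s by (simp_all add: S1_S2_S3_S4_S5_def)
  have e6: "s 6 = exp S6"
  proof -
    have "s 1 * s 2 * s 3 * s 4 * s 5 * s 6 = exp S1 * exp S2 * exp S3 * exp S4 * exp S5 * exp S6"
      using sp[unfolded set_1_6] by (simp add: mult_ac p_exp S6_def flip: exp_add)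
    thus ?thesis by (simp add: e)
  qed
  define n1 n2 n3 n4 n5 where "n1 = n 1" "n2 = n 2" "n3 = n 3" "n4 = n 4" "n5 = n 5"
  have n6: "n 6 = -1 - 3 * e - n1 - n2 - n3 - n4 - n5"
    using n[unfolded set_1_6] by (simp add: n1_n2_n3_n4_n5_def)
  define L where "L = of_nat r * lp"
  have L: "Re L < 0" unfolding L_def by (rule Re_rlp)
  \<comment> \<open>The integer index enters the theta argument through a multiple of
    \<open>lp\<close>; distributing e in halves makes the arguments symmetric under a change of sign
    of \<open>\<zeta>\<close>.\<close>
  define y where "y = (\<lambda>a::nat. (if a = 1 then S1 else if a = 2 then S2 else if a = 3 then S3
      else if a = 4 then S4 else if a = 5 then S5 else S6) + (of_int (n a) + of_int e / 2) * lp)"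
  have ysum: "y 1 + y 2 + y 3 + y 4 + y 5 + y 6 = 0"
    unfolding y_def by (simp add: n6 S6_def n1_n2_n3_n4_n5_def field_simps)
  \<comment> \<open>Exponents split off by \<open>Th_br\<close>: \<open>L1\<close> and
    \<open>L2\<close> belong to the two terms on the left, \<open>R1\<close> and \<open>R2\<close>
    to those on the right, including 1 / z and z^3. By balancing all four agree modulo 2 pi i, up to
    the constant that enters \<open>\<kappa>\<close>.\<close>
  define L1 where "L1 = (\<lambda>Z m. thx (2 * Z) (2 * m + e) + (thx (S2 + S6) (n2 + n 6 + e) + thx (S3 + S6) (n3 + n 6 + e)
      + thx (S4 + S6) (n4 + n 6 + e) + thx (S5 + S6) (n5 + n 6 + e)) + (thx (S1 + Z) (n1 + e + m) + thx (S1 - Z) (n1 - m)))"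
  define L2 where "L2 = (\<lambda>Z m. thx (2 * Z) (2 * m + e) + (thx (S1 + S2) (n1 + n2 + e) + thx (S1 + S3) (n1 + n3 + e)
      + thx (S1 + S4) (n1 + n4 + e) + thx (S1 + S5) (n1 + n5 + e)) + (thx (S6 + Z) (n 6 + e + m) + thx (S6 - Z) (n 6 - m)))"
  define R1 where "R1 = (\<lambda>Z m. thx (S1 + Z) (n1 + e + m) + thx (S2 + Z) (n2 + e + m) + thx (S3 + Z) (n3 + e + m)
      + thx (S4 + Z) (n4 + e + m) + thx (S5 + Z) (n5 + e + m) + thx (S6 + Z) (n 6 + e + m) - Z)"
  define R2 where "R2 = (\<lambda>Z m. thx (S1 - Z) (n1 - m) + thx (S2 - Z) (n2 - m) + thx (S3 - Z) (n3 - m)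
      + thx (S4 - Z) (n4 - m) + thx (S5 - Z) (n5 - m) + thx (S6 - Z) (n 6 - m) + 3 * Z)"
  define \<kappa> where "\<kappa> = exp (L1 0 0 - R1 0 0) * br L (y 1 - y 6)"
  have sS: "S1 + S2 + S3 + S4 + S5 + S6 = lp" by (simp add: S6_def)
  have sN: "(of_int n1 + of_int n2 + of_int n3 + of_int n4 + of_int n5 + of_int (n 6) :: complex) = - 1 - 3 * of_int e"
    by (simp add: n6)
  have eL: "exp (L2 Z m) = exp (L1 Z m)" for Z m
  proof -
    define T N n6' where "T = S2 + S3 + S4 + S5"
      "N = (of_int n2 + of_int n3 + of_int n4 + of_int n5 :: complex)" "n6' = (of_int (n 6) :: complex)"
    have T: "T = lp - S1 - S6" unfolding T_N_n6'_def by (simp add: S6_def)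
    have N: "N = - 1 - 3 * of_int e - of_int n1 - n6'" unfolding T_N_n6'_def by (simp add: n6)
    have "L1 Z m - L2 Z m = 2 * \<i> * of_real pi * (n6' - of_int n1) + (n6' - of_int n1) * T + (S6 - S1) * N
       + 2 * (S6 * n6' - S1 * of_int n1) + (S6 - S1) * (3 * of_int e + 1)
       + lp * ((n6' - of_int n1) * N + (n6'\<^sup>2 - (of_int n1)\<^sup>2) + 3 * of_int e * (n6' - of_int n1))"
      unfolding L1_def L2_def thx_def T_N_n6'_def by (simp add: field_simps power2_eq_square)
    also have "\<dots> = 2 * \<i> * of_real pi * (n6' - of_int n1)"
      unfolding T N by (simp add: field_simps power2_eq_square)
    finally show ?thesis
      by (intro exp_eqI[of _ _ "n1 - n 6"]) (simp add: T_N_n6'_def algebra_simps)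
  qed
  have eR: "exp (R2 Z m) = exp (R1 Z m)" for Z m
  proof -
    have "R2 Z m - R1 Z m = - 6 * \<i> * of_real pi * (2 * of_int m + of_int e)
       - Z * (2 * (of_int n1 + of_int n2 + of_int n3 + of_int n4 + of_int n5 + of_int (n 6)) + 6 * of_int e + 2)
       - (2 * of_int m + of_int e) * (S1 + S2 + S3 + S4 + S5 + S6)
       - lp * (2 * of_int m + of_int e) * ((of_int n1 + of_int n2 + of_int n3 + of_int n4 + of_int n5 + of_int (n 6)) + 3 * of_int e)"
      unfolding R1_def R2_def thx_def by (simp add: field_simps power2_eq_square)
    thus ?thesis unfolding sS sN
      by (intro exp_eqI[of _ _ "- 3 * (2 * m + e)"]) (simp add: algebra_simps)
  qed
  have eLR: "exp (L1 Z m) = exp (L1 0 0 - R1 0 0) * exp (R1 Z m)" for Z m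
  proof -
    have 1: "L1 Z m = L1 0 0 + (2 * \<i> * of_real pi * of_int m + Z * (6 * of_int m + 3 * of_int e + 1)
        + lp * (3 * (of_int m)\<^sup>2 + 3 * of_int e * of_int m))"
      unfolding L1_def thx_def by (simp add: field_simps power2_eq_square)
    have 2: "R1 Z m = R1 0 0 + (6 * \<i> * of_real pi * of_int m + of_int m * (S1 + S2 + S3 + S4 + S5 + S6)
        + Z * ((of_int n1 + of_int n2 + of_int n3 + of_int n4 + of_int n5 + of_int (n 6)) + 6 * of_int e + 6 * of_int m + 2)
        + lp * (of_int m * (of_int n1 + of_int n2 + of_int n3 + of_int n4 + of_int n5 + of_int (n 6))
           + 6 * of_int e * of_int m + 3 * (of_int m)\<^sup>2))"
      unfolding R1_def thx_def by (simp add: field_simps power2_eq_square)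
    have "L1 Z m - (L1 0 0 - R1 0 0 + R1 Z m) = 2 * of_real pi * \<i> * of_int (- 2 * m)"
      unfolding 1[of ] 2[unfolded sS sN] by (simp add: algebra_simps)
    thus ?thesis unfolding exp_add[symmetric] by (rule exp_eqI)
  qed
  show ?thesis
  proof (rule that[of \<kappa>])
    fix z :: complex and m :: int assume z: "z \<noteq> 0"
    define Z where "Z = Ln z"
    have zZ: "z = exp Z" using z by (simp add: Z_def)
    define \<zeta> where "\<zeta> = Z + (of_int m + of_int e / 2) * lp"
    have T2: "Th (z\<^sup>2) (2 * m + e) = exp (thx (2 * Z) (2 * m + e)) * br L (2 * \<zeta>)"
      unfolding zZ exp_double[symmetric] Th_br L_def \<zeta>_def
      by (simp add: algebra_simps)
    have plus: "Th (exp X * z) (k + e + m) = exp (thx (X + Z) (k + e + m)) * br L (X + (of_int k + of_int e / 2) * lp + \<zeta>)" for X k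
      unfolding zZ exp_add[symmetric] Th_br L_def \<zeta>_def by (simp add: algebra_simps)
    have minus: "Th (exp X / z) (k - m) = exp (thx (X - Z) (k - m)) * br L (X + (of_int k + of_int e / 2) * lp - \<zeta>)" for X k
      unfolding zZ exp_diff[symmetric] Th_br L_def \<zeta>_def by (simp add: algebra_simps)
    have pair: "Th (exp X * exp Y) (k + l + e) = exp (thx (X + Y) (k + l + e)) *
        br L ((X + (of_int k + of_int e / 2) * lp) + (Y + (of_int l + of_int e / 2) * lp))" for X Y k l
      unfolding exp_add[symmetric] Th_br L_def by (simp add: algebra_simps)
    have ya: "y 1 = S1 + (of_int n1 + of_int e / 2) * lp" "y 2 = S2 + (of_int n2 + of_int e / 2) * lp"
      "y 3 = S3 + (of_int n3 + of_int e / 2) * lp" "y 4 = S4 + (of_int n4 + of_int e / 2) * lp"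
      "y 5 = S5 + (of_int n5 + of_int e / 2) * lp" "y 6 = S6 + (of_int (n 6) + of_int e / 2) * lp"
      by (simp_all add: y_def n1_n2_n3_n4_n5_def)
    have nn: "n 1 = n1" "n 2 = n2" "n 3 = n3" "n 4 = n4" "n 5 = n5" by (simp_all add: n1_n2_n3_n4_n5_def)
    let ?b = "br L"
    define BA where "BA = ?b (y 1 + \<zeta>) * ?b (y 2 + \<zeta>) * ?b (y 3 + \<zeta>) * ?b (y 4 + \<zeta>) * ?b (y 5 + \<zeta>) * ?b (y 6 + \<zeta>)"
    define BB where "BB = ?b (y 1 - \<zeta>) * ?b (y 2 - \<zeta>) * ?b (y 3 - \<zeta>) * ?b (y 4 - \<zeta>) * ?b (y 5 - \<zeta>) * ?b (y 6 - \<zeta>)"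
    define B1 where "B1 = ?b (y 2 + y 6) * ?b (y 3 + y 6) * ?b (y 4 + y 6) * ?b (y 5 + y 6) * ?b (y 1 + \<zeta>) * ?b (y 1 - \<zeta>)"
    define B2 where "B2 = ?b (y 1 + y 2) * ?b (y 1 + y 3) * ?b (y 1 + y 4) * ?b (y 1 + y 5) * ?b (y 6 + \<zeta>) * ?b (y 6 - \<zeta>)"
    have six: "?b (y 1 - y 6) * (BA - BB) = ?b (2 * \<zeta>) * (B1 - B2)"
      unfolding BA_def BB_def B1_def B2_def by (rule br_six[OF L ysum])
    have l1: "Th (z\<^sup>2) (2 * m + e) * ((\<Prod>a=2..5. Th (s a * s 6) (n a + n 6 + e)) *
        (Th (s 1 * z) (n 1 + e + m) * Th (s 1 / z) (n 1 - m))) = exp (L1 Z m) * ?b (2 * \<zeta>) * B1"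
      unfolding prod_2_5 nn e e6 plus minus pair T2 B1_def L1_def exp_add ya by (simp only: mult_ac)
    have l2: "Th (z\<^sup>2) (2 * m + e) * ((\<Prod>a=2..5. Th (s 1 * s a) (n 1 + n a + e)) *
        (Th (s 6 * z) (n 6 + e + m) * Th (s 6 / z) (n 6 - m))) = exp (L2 Z m) * ?b (2 * \<zeta>) * B2"
      unfolding prod_2_5 nn e e6 plus minus pair T2 B2_def L2_def exp_add ya by (simp only: mult_ac)
    have r1: "(\<Prod>a=1..6. Th (s a * z) (n a + e + m)) / z = exp (R1 Z m) * BA"
      unfolding prod_1_6 nn e e6 plus BA_def R1_def ya exp_diff[of _ Z] exp_add zZ[symmetric]
      by (simp only: mult_ac times_divide_eq_left times_divide_eq_right)
    have z3: "z ^ 3 = exp (3 * Z)" by (simp add: zZ exp_of_nat_mult[of 3, simplified])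
    have r2: "z ^ 3 * (\<Prod>a=1..6. Th (s a / z) (n a - m)) = exp (R2 Z m) * BB"
      unfolding prod_1_6 nn e e6 minus BB_def R2_def ya exp_add z3[symmetric] by (simp only: mult_ac)
    have "Th (z\<^sup>2) (2 * m + e) *
     ((\<Prod>a=2..5. Th (s a * s 6) (n a + n 6 + e)) * (Th (s 1 * z) (n 1 + e + m) * Th (s 1 / z) (n 1 - m))
    - (\<Prod>a=2..5. Th (s 1 * s a) (n 1 + n a + e)) * (Th (s 6 * z) (n 6 + e + m) * Th (s 6 / z) (n 6 - m)))
      = exp (L1 Z m) * (?b (2 * \<zeta>) * (B1 - B2))"
      unfolding right_diff_distrib[of "Th (z\<^sup>2) (2 * m + e)"] l1 l2 eL by (simp add: algebra_simps)
    also have "\<dots> = \<kappa> * (exp (R1 Z m) * BA - exp (R1 Z m) * BB)"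
      unfolding six[symmetric] eLR \<kappa>_def by (simp add: algebra_simps)
    finally show "Th (z\<^sup>2) (2 * m + e) *
     ((\<Prod>a=2..5. Th (s a * s 6) (n a + n 6 + e)) * (Th (s 1 * z) (n 1 + e + m) * Th (s 1 / z) (n 1 - m))
    - (\<Prod>a=2..5. Th (s 1 * s a) (n 1 + n a + e)) * (Th (s 6 * z) (n 6 + e + m) * Th (s 6 / z) (n 6 - m)))
      = \<kappa> * ((\<Prod>a=1..6. Th (s a * z) (n a + e + m)) / z - z ^ 3 * (\<Prod>a=1..6. Th (s a / z) (n a - m)))"
      unfolding r1 r2 eR .
  qed
qed

text \<open>On the unit circle this is the first term on the right of \<open>theta_telescope\<close>
  times the integrand with \<open>KerQ\<close> for \<open>Ker\<close>. With the thetas absorbed by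
  \<open>G_shift_q\<close>, the two gamma factors of each parameter are exchanged by z -> 1 / (q z),
  which makes the symmetry \<open>Hf_reflect\<close> visible.\<close>

definition Hf :: "(nat \<Rightarrow> complex) \<Rightarrow> (nat \<Rightarrow> int) \<Rightarrow> int \<Rightarrow> complex \<Rightarrow> int \<Rightarrow> complex" where
  "Hf s n e z m = (\<Prod>a=1..6. G (q * (s a * z)) (n a + e + m + 1) * G (s a / z) (n a - m))
     * KerQ (z\<^sup>2) (2 * m + e) / z"

lemma Hf_reflect: "z \<noteq> 0 \<Longrightarrow> Hf s n e (1 / (q * z)) (- m - 1 - e) = - Hf s n e z m"
proof -
  assume z: "z \<noteq> 0"
  have "(1 / (q * z))\<^sup>2 = 1 / (q\<^sup>2 * z\<^sup>2)" "2 * (- m - 1 - e) + e = - (2 * m + e) - 2"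
    by (simp_all add: power_one_over power_mult_distrib)
  hence K: "KerQ ((1 / (q * z))\<^sup>2) (2 * (- m - 1 - e) + e) = - KerQ (z\<^sup>2) (2 * m + e) / (q * z\<^sup>2)"
    using KerQ_reflect[of "z\<^sup>2" "2 * m + e"] z by (simp only: power_not_zero) simp
  have g: "q * (s a * (1 / (q * z))) = s a / z" "s a / (1 / (q * z)) = q * (s a * z)" for a
    using z by (simp_all add: field_simps)
  have i: "n a + e + (- m - 1 - e) + 1 = n a - m" "n a - (- m - 1 - e) = n a + e + m + 1" for a by simp_all
  show ?thesis unfolding Hf_def K g i using z
    by (simp add: mult.commute power2_eq_square)
qed

text \<open>As for \<open>Dl_periodic\<close>, except that the \<open>N a\<close> now add up to -2;
  the surplus in the exponent is compensated by \<open>KerQ\<close>.\<close>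

lemma Hf_periodic:
  assumes s: "\<And>a. a \<in> {1..6} \<Longrightarrow> s a \<noteq> 0" and sp: "(\<Prod>a=1..6. s a) = p"
    and n: "(\<Sum>a=1..6. n a) + 3 * e = -1" and z: "z \<noteq> 0"
  shows "Hf s n e z (m + int r) = Hf s n e z m"
proof -
  define R where "R = (of_nat r - 1 :: complex)"
  define Z where "Z = Ln z"
  define N where "N = (\<lambda>a. 2 * n a + e)"
  define \<tau> where "\<tau> = (\<lambda>a. Ln (s a))"
  define K :: int where "K = (int r - 1) * (e + 2 * m + 1 + int r)"
  have zZ: "z = exp Z" using z by (simp add: Z_def)
  have ta: "s a = exp (\<tau> a)" if "a \<in> {1..6}" for a using s that by (simp add: \<tau>_def)
  have "exp (\<Sum>a=1..6. \<tau> a) = exp lp"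
    using sp s by (simp add: exp_sum \<tau>_def p_exp)
  then obtain j :: int where j: "(\<Sum>a=1..6. \<tau> a) = lp + (of_int (2 * j) * pi) * \<i>"
    unfolding exp_eq by blast
  define c where "c = (\<lambda>a. cx (lq + \<tau> a + Z) (n a + e + m + 1) - cx (\<tau> a - Z) (n a - m - int r))"
  have step: "G (q * (s a * z)) (n a + e + (m + int r) + 1) * G (s a / z) (n a - (m + int r)) =
      exp (c a) * (G (q * (s a * z)) (n a + e + m + 1) * G (s a / z) (n a - m))" if a: "a \<in> {1..6}" for a
  proof -
    have tz: "q * (s a * z) = exp (lq + \<tau> a + Z)" "s a / z = exp (\<tau> a - Z)"
      using ta[OF a] by (simp_all add: zZ exp_add exp_diff q_exp)
    have 1: "G (q * (s a * z)) (n a + e + (m + int r) + 1) = exp (cx (lq + \<tau> a + Z) (n a + e + m + 1)) * G (q * (s a * z)) (n a + e + m + 1)"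
      using G_step[of "q * (s a * z)" "n a + e + m + 1"] cf_exp[of "lq + \<tau> a + Z"] unfolding tz by (simp add: add_ac)
    have 2: "G (s a / z) (n a - m) = exp (cx (\<tau> a - Z) (n a - m - int r)) * G (s a / z) (n a - (m + int r))"
      using G_step[of "s a / z" "n a - m - int r"] cf_exp[of "\<tau> a - Z"] unfolding tz by (simp add: algebra_simps)
    show ?thesis unfolding 1 c_def exp_diff 2 by simp
  qed
  have K: "of_int K = R * (of_int e + 2 * of_int m + 1 + of_nat r)" by (simp add: K_def R_def)
  define Y where "Y = R * Z + of_int K * (lp - lq) / 2 + R * lq / 2"
  define W where "W = of_int K * (\<i> * of_real pi) + R * Z + (R - of_int K) * lq / 2"
  have c: "c a = W + of_int K * \<tau> a + of_int (N a) * Y" for a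
    unfolding c_def cx_def R_def[symmetric] K N_def Y_def W_def
    by (simp add: field_simps power2_eq_square R_def)
  have s0: "(\<Sum>a=1..6. N a) = -2"
    using n unfolding set_1_6 N_def by simp
  have "(\<Sum>a=1..6. c a) = of_nat (card {1..6::nat}) * W + of_int K * (\<Sum>a=1..6. \<tau> a) + of_int (\<Sum>a=1..6. N a) * Y"
    by (simp only: c sum.distrib of_int_sum sum_distrib_left sum_distrib_right sum_constant)
  also have "\<dots> = (4 * R * Z + 2 * (R - of_int K) * lq) + 2 * of_real pi * \<i> * of_int (K * (3 + j))"
    unfolding s0 j W_def Y_def by (simp add: field_simps)
  finally have E: "exp (\<Sum>a=1..6. c a) = exp (4 * R * Z + 2 * (R - of_int K) * lq)"
    by (intro exp_eqI[of _ _ "K * (3 + j)"]) simp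
  have z2: "z\<^sup>2 = exp (2 * Z)" by (simp add: zZ exp_double)
  have "2 * (m + int r) + e = ((2 * m + e) + int r) + int r" by simp
  hence Q: "KerQ (z\<^sup>2) (2 * (m + int r) + e) =
     exp ((of_nat r - 1) * (lq * (of_int (2 * m + e + int r) + of_nat r / 2) - (\<i> * of_real pi + 2 * Z))) *
    (exp ((of_nat r - 1) * (lq * (of_int (2 * m + e) + of_nat r / 2) - (\<i> * of_real pi + 2 * Z))) * KerQ (z\<^sup>2) (2 * m + e))"
    by (simp only: z2 KerQ_step)
  have "exp (4 * R * Z + 2 * (R - of_int K) * lq) *
     exp ((of_nat r - 1) * (lq * (of_int (2 * m + e + int r) + of_nat r / 2) - (\<i> * of_real pi + 2 * Z))) *
     exp ((of_nat r - 1) * (lq * (of_int (2 * m + e) + of_nat r / 2) - (\<i> * of_real pi + 2 * Z))) = exp 0"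
    unfolding exp_add[symmetric] K
    by (rule exp_eqI[of _ _ "- (int r - 1)"]) (simp add: R_def field_simps)
  moreover have "(\<Prod>a=1..6. G (q * (s a * z)) (n a + e + (m + int r) + 1) * G (s a / z) (n a - (m + int r))) =
     exp (\<Sum>a=1..6. c a) * (\<Prod>a=1..6. G (q * (s a * z)) (n a + e + m + 1) * G (s a / z) (n a - m))"
    using step by (simp add: exp_sum prod.distrib)
  ultimately show ?thesis unfolding Hf_def Q E by (simp add: mult.assoc[symmetric])
qed

text \<open>Summation of \<open>H z m - H (z / q) (m - 1)\<close>: moving the second term from the circle of radius
  \<open>1 / \<bar>q\<bar>\<close> to the unit circle crosses no pole.\<close>

lemma Iv_telescope:
  assumes s: "\<And>a. a \<in> {1..6} \<Longrightarrow> s a \<noteq> 0 \<and> norm (s a) < 1" and sp: "(\<Prod>a=1..6. s a) = p"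
    and n: "(\<Sum>a=1..6. n a) + 3 * e = -1"
  shows "(\<Prod>a=2..5. Th (s a * s 6) (n a + n 6 + e)) * Iv {1..6} (s(1 := q * s 1)) (n(1 := n 1 + 1)) e =
         (\<Prod>a=2..5. Th (s 1 * s a) (n 1 + n a + e)) * Iv {1..6} (s(6 := q * s 6)) (n(6 := n 6 + 1)) e"
proof -
  define A B where "A = (\<Prod>a=2..5. Th (s a * s 6) (n a + n 6 + e))"
    "B = (\<Prod>a=2..5. Th (s 1 * s a) (n 1 + n a + e))"
  obtain \<kappa> where \<kappa>: "\<And>z m. z \<noteq> 0 \<Longrightarrow> Th (z\<^sup>2) (2 * m + e) *
     (A * (Th (s 1 * z) (n 1 + e + m) * Th (s 1 / z) (n 1 - m)) - B * (Th (s 6 * z) (n 6 + e + m) * Th (s 6 / z) (n 6 - m)))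
    = \<kappa> * ((\<Prod>a=1..6. Th (s a * z) (n a + e + m)) / z - z ^ 3 * (\<Prod>a=1..6. Th (s a / z) (n a - m)))"
    using theta_telescope[of s n e] s sp n unfolding A_B_def by auto
  have sd: "s a * z \<in> dom k" "s a / z \<in> dom k" "s a * z \<noteq> 0" "norm (s a * z) < 1" "s a / z \<noteq> 0" "norm (s a / z) < 1"
    if "norm z = 1" "a \<in> {1..6}" for z a k
    using s[OF that(2)] that(1) by (auto intro!: dom_unit simp: norm_mult norm_divide)
  have up: "Dl {1..6} (s(b := q * s b)) (n(b := n b + 1)) e z m =
      Th (s b * z) (n b + e + m) * Th (s b / z) (n b - m) * Dl {1..6} s n e z m"
    if b: "b \<in> {1..6}" and z: "norm z = 1" for b z m
  proof -
    have "G (q * s b * z) (n b + 1 + e + m) = Th (s b * z) (n b + e + m) * G (s b * z) (n b + e + m)"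
      using G_shift_q[of "s b * z" "n b + e + m"] sd[OF z b] by (simp add: add_ac mult_ac)
    moreover have "G (q * s b / z) (n b + 1 - m) = Th (s b / z) (n b - m) * G (s b / z) (n b - m)"
      using G_shift_q[of "s b / z" "n b - m"] sd[OF z b] by (simp add: algebra_simps)
    moreover have "(\<Prod>a\<in>{1..6} - {b}. G ((s(b := q * s b)) a * z) ((n(b := n b + 1)) a + e + m) *
         G ((s(b := q * s b)) a / z) ((n(b := n b + 1)) a - m)) =
       (\<Prod>a\<in>{1..6} - {b}. G (s a * z) (n a + e + m) * G (s a / z) (n a - m))"
      by (intro prod.cong) auto
    ultimately show ?thesis
      unfolding Dl_def prod.remove[OF finite_atLeastAtMost b] by (simp only: fun_upd_same) (simp only: mult_ac)
  qed
  have H1: "Hf s n e z m = (\<Prod>a=1..6. Th (s a * z) (n a + e + m)) / z *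
      ((\<Prod>a=1..6. G (s a * z) (n a + e + m) * G (s a / z) (n a - m)) * KerQ (z\<^sup>2) (2 * m + e))" if z: "norm z = 1" for z m
  proof -
    have eq: "(\<Prod>a=1..6. G (q * (s a * z)) (n a + e + m + 1) * G (s a / z) (n a - m)) =
        (\<Prod>a=1..6. Th (s a * z) (n a + e + m) * (G (s a * z) (n a + e + m) * G (s a / z) (n a - m)))"
    proof (intro prod.cong refl)
      fix a assume a: "a \<in> {1..6::nat}"
      have "G (q * (s a * z)) (n a + e + m + 1) = Th (s a * z) (n a + e + m) * G (s a * z) (n a + e + m)"
        using sd[OF z a] by (intro G_shift_q) auto
      thus "G (q * (s a * z)) (n a + e + m + 1) * G (s a / z) (n a - m) =
          Th (s a * z) (n a + e + m) * (G (s a * z) (n a + e + m) * G (s a / z) (n a - m))" by simp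
    qed
    show ?thesis unfolding Hf_def eq by (simp add: prod.distrib)
  qed
  have H2: "Hf s n e (1 / z) (- m - e) = - (z ^ 3) * (\<Prod>a=1..6. Th (s a / z) (n a - m)) *
      ((\<Prod>a=1..6. G (s a * z) (n a + e + m) * G (s a / z) (n a - m)) * KerQ (z\<^sup>2) (2 * m + e))" if z: "norm z = 1" for z m
  proof -
    have z0: "z \<noteq> 0" using z by auto
    have i: "n a + e + (- m - e) = n a - m" "n a - (- m - e) = n a + e + m" for a by simp_all
    have "norm (1 / z) = 1" using z by (simp add: norm_divide)
    note h = H1[OF this, of "- m - e", unfolded i]
    have "KerQ ((1 / z)\<^sup>2) (2 * (- m - e) + e) = KerQ (1 / z\<^sup>2) (- (2 * m + e))"
      by (simp add: power_one_over algebra_simps)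
    also have "\<dots> = - z\<^sup>2 * KerQ (z\<^sup>2) (2 * m + e)" using z0 by (intro KerQ_inverse) auto
    finally show ?thesis unfolding h using z0
      by (simp add: power2_eq_square power3_eq_cube mult.commute)
  qed
  have main: "A * Dl {1..6} (s(1 := q * s 1)) (n(1 := n 1 + 1)) e z m -
      B * Dl {1..6} (s(6 := q * s 6)) (n(6 := n 6 + 1)) e z m = \<kappa> * (Hf s n e z m - Hf s n e (z / q) (m - 1))"
    if z: "norm z = 1" for z m
  proof -
    have z0: "z \<noteq> 0" using z by auto
    define P where "P = (\<Prod>a=1..6. G (s a * z) (n a + e + m) * G (s a / z) (n a - m)) * KerQ (z\<^sup>2) (2 * m + e)"
    have D: "Dl {1..6} s n e z m = Th (z\<^sup>2) (2 * m + e) * P"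
      unfolding Dl_def P_def using Ker_KerQ[of "z\<^sup>2" "2 * m + e"] z0 by simp
    have "A * Dl {1..6} (s(1 := q * s 1)) (n(1 := n 1 + 1)) e z m - B * Dl {1..6} (s(6 := q * s 6)) (n(6 := n 6 + 1)) e z m =
      (Th (z\<^sup>2) (2 * m + e) * (A * (Th (s 1 * z) (n 1 + e + m) * Th (s 1 / z) (n 1 - m))
        - B * (Th (s 6 * z) (n 6 + e + m) * Th (s 6 / z) (n 6 - m)))) * P"
      using up[of 1 z m] up[of 6 z m] z unfolding D by (simp add: algebra_simps)
    also have "\<dots> = \<kappa> * (Hf s n e z m + Hf s n e (1 / z) (- m - e))"
      unfolding \<kappa>[OF z0] H1[OF z] H2[OF z] P_def[symmetric] by (simp add: algebra_simps)
    \<comment> \<open>The second term of the theta identity is \<open>Hf\<close> at 1 / z.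
      Reflection at the point z / q with index m - 1 turns the sum into a difference of shifted
      values of one function.\<close>
    also have "Hf s n e (1 / z) (- m - e) = - Hf s n e (z / q) (m - 1)"
      using Hf_reflect[of "z / q" s n e "m - 1"] z0 by simp
    finally show ?thesis by (simp only: add_uminus_conv_diff)
  qed
  \<comment> \<open>Singularities of \<open>Hf\<close> coming from \<open>s a / z\<close> have |z|
    <= c, those from \<open>q * (s a * z)\<close> have |z| >= 1 / (|q| c). As c < 1, the circles of
    radius 1 and 1 / |q| both lie strictly between.\<close>
  define c where "c = Max ((\<lambda>a. norm (s a)) ` {1..6})"
  have cs: "norm (s a) \<le> c" if "a \<in> {1..6}" for a :: nat unfolding c_def using that by (intro Max_ge) auto
  have c1: "c < 1" unfolding c_def using s by (subst Max_less_iff) auto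
  have c0: "c > 0"
  proof -
    have "0 < norm (s 1)" using s[of 1] by simp
    also have "\<dots> \<le> c" using cs[of 1] by simp
    finally show ?thesis .
  qed
  have Hhol: "(\<lambda>z. Hf s n e z m) holomorphic_on {z. c < norm z \<and> norm z < 1 / (norm q * c)}" for m
    unfolding Hf_def
  proof (intro holomorphic_on_divide holomorphic_on_mult holomorphic_on_prod G_hol KerQ_hol holomorphic_intros)
    fix a :: nat and z :: complex assume a: "a \<in> {1..6}" and z: "z \<in> {z. c < norm z \<and> norm z < 1 / (norm q * c)}"
    have nz: "z \<noteq> 0" using z c0 by auto
    have "norm (s a) * norm z \<le> c * norm z" using cs[OF a] by (intro mult_right_mono) auto
    also have "\<dots> < c * (1 / (norm q * c))" using z c0 by (intro mult_strict_left_mono) auto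
    finally have "norm q * (norm (s a) * norm z) < norm q * (1 / norm q)" using c0
      by (intro mult_strict_left_mono) auto
    thus "q * (s a * z) \<in> dom (n a + e + m + 1)"
      using s[OF a] nz by (intro dom_unit) (auto simp: norm_mult)
    show "s a / z \<in> dom (n a - m)"
      using s[OF a] nz z cs[OF a] by (intro dom_unit) (auto simp: norm_divide divide_simps)
  qed (use c0 in auto)
  have in1: "c < norm (1::complex)" "norm (1::complex) < 1 / (norm q * c)"
    using c0 c1 norm_q mult_strict_mono[of "norm q" 1 c 1] by (auto simp: field_simps)
  have in2: "c < norm (1 / q)" "norm (1 / q) < 1 / (norm q * c)"
  proof -
    have "c * norm q < 1" using c0 c1 norm_q mult_strict_mono[of c 1 "norm q" 1] by simp
    thus "c < norm (1 / q)" by (simp add: norm_divide field_simps)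
    have "norm q * c < norm q * 1" using c1 by (intro mult_strict_left_mono) auto
    thus "norm (1 / q) < 1 / (norm q * c)" using c0 by (simp add: norm_divide field_simps)
  qed
  have sub: "sphere 0 1 \<subseteq> {z::complex. c < norm z \<and> norm z < 1 / (norm q * c)}" using in1 by auto
  have Hc: "continuous_on (sphere 0 1) (\<lambda>z. Hf s n e z m)" for m
    using holomorphic_on_imp_continuous_on[OF Hhol] continuous_on_subset[OF _ sub] by blast
  have Hqc: "continuous_on (sphere 0 1) (\<lambda>z. Hf s n e (z / q) m)" for m
  proof (rule continuous_on_compose2[OF holomorphic_on_imp_continuous_on[OF Hhol]])
    show "(\<lambda>z. z / q) ` sphere 0 1 \<subseteq> {z. c < norm z \<and> norm z < 1 / (norm q * c)}"
      using in2 by (auto simp: norm_divide)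
  qed (auto intro!: continuous_intros)
  have avH: "avg (\<lambda>z. Hf s n e (z / q) m) 1 = avg (\<lambda>z. Hf s n e z m) 1" for m
  proof -
    have "avg (\<lambda>z. Hf s n e (z / q) m) 1 = avg (\<lambda>z. Hf s n e z m) (1 / q)"
      using avg_scale[of "\<lambda>z. Hf s n e z m" "1 / q" 1] by simp
    also have "\<dots> = avg (\<lambda>z. Hf s n e z m) 1"
      using in1 in2 c0 by (intro avg_annulus[OF Hhol]) auto
    finally show ?thesis .
  qed
  define h where "h = (\<lambda>m. avg (\<lambda>z. Hf s n e z m) 1)"
  have hper: "h (m + int r) = h m" for m
    unfolding h_def by (intro avg_cong Hf_periodic) (use s sp n in auto)
  have D1: "continuous_on (sphere 0 1) (\<lambda>z. Dl {1..6} (s(b := q * s b)) (n(b := n b + 1)) e z m)" if "b \<in> {1..6}" for b m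
  proof (rule Dl_cont_sphere)
    fix a assume "a \<in> {1..6::nat}"
    thus "(s(b := q * s b)) a \<noteq> 0 \<and> norm ((s(b := q * s b)) a) < 1"
      using s[of a] s[of b] norm_q mult_strict_mono[of "norm q" 1 "norm (s b)" 1] that by (auto simp: norm_mult)
  qed
  have "A * Iv {1..6} (s(1 := q * s 1)) (n(1 := n 1 + 1)) e - B * Iv {1..6} (s(6 := q * s 6)) (n(6 := n 6 + 1)) e =
     (\<Sum>m<r. \<kappa> * (h (int m) - h (int m - 1)))"
    unfolding Iv_def sum_distrib_left sum_subtractf[symmetric]
  proof (intro sum.cong refl)
    fix m
    have "A * avg (\<lambda>z. Dl {1..6} (s(1 := q * s 1)) (n(1 := n 1 + 1)) e z (int m)) 1 -
        B * avg (\<lambda>z. Dl {1..6} (s(6 := q * s 6)) (n(6 := n 6 + 1)) e z (int m)) 1 =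
      avg (\<lambda>z. A * Dl {1..6} (s(1 := q * s 1)) (n(1 := n 1 + 1)) e z (int m) -
        B * Dl {1..6} (s(6 := q * s 6)) (n(6 := n 6 + 1)) e z (int m)) 1"
      using D1[of 1] D1[of 6] by (simp add: avg_diff avg_cmult continuous_on_mult_left)
    also have "\<dots> = avg (\<lambda>z. \<kappa> * (Hf s n e z (int m) - Hf s n e (z / q) (int m - 1))) 1"
      by (rule avg_cong) (simp only: main norm_one)
    also have "\<dots> = \<kappa> * (h (int m) - h (int m - 1))"
      using Hc Hqc by (simp add: avg_cmult avg_diff avH h_def)
    finally show "A * avg (\<lambda>z. Dl {1..6} (s(1 := q * s 1)) (n(1 := n 1 + 1)) e z (int m)) 1 -
        B * avg (\<lambda>z. Dl {1..6} (s(6 := q * s 6)) (n(6 := n 6 + 1)) e z (int m)) 1 = \<kappa> * (h (int m) - h (int m - 1))" .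
  qed
  also have "\<dots> = \<kappa> * ((\<Sum>m<r. h (int m)) - (\<Sum>m<r. h (int m + (-1))))"
    by (simp add: sum_subtractf flip: sum_distrib_left)
  also have "\<dots> = 0" using sum_periodic_shift[of h r "-1"] hper by simp
  finally show ?thesis by (simp add: A_B_def)
qed

end

text \<open>A family \<open>f\<^sub>n\<close> that is invariant under \<open>(n, z) \<mapsto> (n + 1, q z)\<close> and periodic in \<open>n\<close> takes its
  maximum modulus over an annulus wider than \<open>\<bar>q\<bar>\<close> in a compact fundamental annulus.\<close>

lemma shift_invariant_annulus_const:
  fixes f :: "int \<Rightarrow> complex \<Rightarrow> complex"
  assumes q: "q \<noteq> 0" "norm q < 1" and \<rho>0: "0 < \<rho>0" "\<rho>0 < norm q" and r: "r > (0::nat)"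
    and hol: "\<And>n. f n holomorphic_on {z. \<rho>0 < norm z \<and> norm z < 1}"
    and per: "\<And>n z. \<rho>0 < norm z \<Longrightarrow> norm z < 1 \<Longrightarrow> f (n + int r) z = f n z"
    and sh: "\<And>n z. \<rho>0 < norm (q * z) \<Longrightarrow> norm z < 1 \<Longrightarrow> f (n + 1) (q * z) = f n z"
  shows "\<exists>c. \<forall>n z. \<rho>0 < norm z \<and> norm z < 1 \<longrightarrow> f n z = c"
proof -
  define D where "D = {z::complex. \<rho>0 < norm z \<and> norm z < 1}"
  have opD: "open D"
  proof -
    have "D = - cball 0 \<rho>0 \<inter> ball 0 1" by (auto simp: D_def)
    thus ?thesis by auto
  qed
  have conD: "connected D" using connected_annulus(1)[of \<rho>0 "0::complex" 1] by (simp add: D_def)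
  define x where "x = \<rho>0 / norm q"
  have x: "0 < x" "x < 1" "\<rho>0 = x * norm q" using \<rho>0 q by (simp_all add: x_def)
  \<comment> \<open>The closed annulus \<open>K\<close> from |q| \<rho>1 to \<rho>1 must lie inside
    \<open>D\<close>, which asks for x < \<rho>1 < 1. The bound \<rho>1 <= x / |q| ensures that a
    point of \<open>D\<close> below \<open>K\<close> enters it after one division by q.\<close>
  define \<rho>1 where "\<rho>1 = min ((x + 1) / 2) (x / norm q)"
  have xq: "x < x / norm q" using x q by (simp add: field_simps)
  have \<rho>1: "\<rho>1 < 1" "x < \<rho>1" "\<rho>1 \<le> x / norm q" using x xq unfolding \<rho>1_def by (auto simp: min_less_iff_disj)
  have \<rho>1p: "\<rho>1 > 0" using \<rho>1 x by linarith
  have \<rho>1q: "\<rho>0 < norm q * \<rho>1" using \<rho>1 q x by (simp add: mult.commute)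
  have \<rho>1qq: "norm q * \<rho>1 * norm q \<le> \<rho>0"
    using mult_left_mono[OF \<rho>1(3), of "norm q * norm q"] q x by (simp add: mult_ac)
  define K where "K = cball 0 \<rho>1 - ball (0::complex) (norm q * \<rho>1)"
  have cK: "compact K" unfolding K_def by (intro compact_diff) auto
  have KD: "K \<subseteq> D" using \<rho>1 \<rho>1q by (auto simp: K_def D_def)
  have neK: "of_real \<rho>1 \<in> K" using \<rho>1p q by (auto simp: K_def mult_le_cancel_right1)
  have red: "\<exists>n' z'. z' \<in> K \<and> f n z = f n' z'" if "z \<in> D" for n z
  proof -
    have down: "\<exists>n' z'. z' \<in> K \<and> f n z = f n' z'"
      if "z \<in> D" "norm q * \<rho>1 \<le> norm z" "norm q ^ k * norm z \<le> \<rho>1" for n z k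
      using that
    proof (induction k arbitrary: n z)
      case 0 thus ?case by (intro exI[of _ n] exI[of _ z]) (auto simp: K_def)
    next
      case (Suc k)
      show ?case
      proof (cases "norm z \<le> \<rho>1")
        case True thus ?thesis using Suc by (intro exI[of _ n] exI[of _ z]) (auto simp: K_def)
      next
        case False
        have b: "norm q * \<rho>1 \<le> norm (q * z)" using False by (simp add: norm_mult mult_left_mono)
        have "norm (q * z) < 1" using Suc.prems(1) q mult_strict_mono[of "norm q" 1 "norm z" 1]
          by (simp add: norm_mult D_def)
        hence qz: "q * z \<in> D" using b \<rho>1q by (simp add: D_def)
        have "\<exists>n' z'. z' \<in> K \<and> f (n + 1) (q * z) = f n' z'"
          using Suc.IH[OF qz b] Suc.prems(3) by (simp add: norm_mult mult_ac)
        moreover have "f (n + 1) (q * z) = f n z"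
          using qz Suc.prems(1) by (intro sh) (auto simp: D_def)
        ultimately show ?thesis by simp
      qed
    qed
    show ?thesis
    proof (cases "norm q * \<rho>1 \<le> norm z")
      case True
      have "(\<lambda>k. norm q ^ k * norm z) \<longlonglongrightarrow> 0 * norm z" using q by (intro tendsto_intros LIMSEQ_power_zero) auto
      hence "eventually (\<lambda>k. norm q ^ k * norm z < \<rho>1) sequentially" using \<rho>1p by (intro order_tendstoD) auto
      then obtain k where "norm q ^ k * norm z < \<rho>1" by (auto simp: eventually_sequentially)
      thus ?thesis using down[OF that True, of k] by auto
    next
      case False
      have n1: "norm (z / q) < \<rho>1" using False q by (simp add: norm_divide field_simps)
      have "norm z \<le> norm (z / q)"
        using q mult_left_le_one_le[of "norm z" "norm q"] by (simp add: norm_divide field_simps)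
      hence zq: "z / q \<in> D" using n1 \<rho>1 that by (auto simp: D_def)
      have "f ((n - 1) + 1) (q * (z / q)) = f (n - 1) (z / q)"
        by (rule sh) (use that zq q in \<open>auto simp: D_def\<close>)
      hence "f n z = f (n - 1) (z / q)" using q by simp
      moreover have "norm q * \<rho>1 \<le> norm (z / q)"
      proof -
        have "norm q * \<rho>1 * norm q \<le> norm z" using \<rho>1qq that by (simp add: D_def)
        thus ?thesis using q by (simp add: norm_divide field_simps)
      qed
      hence "\<exists>n' z'. z' \<in> K \<and> f (n - 1) (z / q) = f n' z'"
        using down[OF zq, of 0] n1 by simp
      ultimately show ?thesis by simp
    qed
  qed
  have permod: "f n z = f (n mod int r) z" if z: "z \<in> D" for n z
  proof -
    have z': "\<rho>0 < norm z" "norm z < 1" using z by (auto simp: D_def)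
    have "f (n mod int r + int r * d) z = f (n mod int r) z" for d :: int
    proof (induction d rule: int_induct[where k = 0])
      case (step1 i) thus ?case using per[OF z', of "n mod int r + int r * i"] by (simp add: algebra_simps)
    next
      case (step2 i) thus ?case using per[OF z', of "n mod int r + int r * (i - 1)"] by (simp add: algebra_simps)
    qed auto
    from this[of "n div int r"] show ?thesis by simp
  qed
  have contK: "continuous_on K (\<lambda>z. norm (f n z))" for n
    using holomorphic_on_imp_continuous_on[OF hol[of n]] KD
    by (intro continuous_on_norm) (auto simp: D_def intro: continuous_on_subset)
  have "\<exists>z\<in>K. \<forall>w\<in>K. norm (f n w) \<le> norm (f n z)" for n
    using continuous_attains_sup[OF cK _ contK[of n]] neK by auto
  hence "\<forall>n. \<exists>z. z \<in> K \<and> (\<forall>w\<in>K. norm (f n w) \<le> norm (f n z))" by blast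
  then obtain zz where zz: "\<And>n. zz n \<in> K" "\<And>n w. w \<in> K \<Longrightarrow> norm (f n w) \<le> norm (f n (zz n))"
    unfolding choice_iff by blast
  define S where "S = (\<lambda>n. norm (f n (zz n))) ` {0..<int r}"
  have finS: "finite S" "S \<noteq> {}" using r by (auto simp: S_def)
  obtain n0 where n0: "n0 \<in> {0..<int r}" "Max S = norm (f n0 (zz n0))"
    using Max_in[OF finS] by (auto simp: S_def)
  have bound: "norm (f n z) \<le> norm (f n0 (zz n0))" if zD: "z \<in> D" for n z
  proof -
    obtain n' z' where z': "z' \<in> K" "f n z = f n' z'" using red[OF zD] by blast
    have "norm (f (n' mod int r) z') \<le> norm (f (n' mod int r) (zz (n' mod int r)))" using zz z' by blast
    also have "\<dots> \<le> Max S" using r by (intro Max_ge finS) (auto simp: S_def)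
    finally have "norm (f (n' mod int r) z') \<le> norm (f n0 (zz n0))" unfolding n0(2) .
    moreover have "f n z = f (n' mod int r) z'" unfolding z'(2) using KD z'(1) by (intro permod) auto
    ultimately show ?thesis by simp
  qed
  have "f n0 constant_on D"
    using hol[of n0] bound[of _ n0] zz(1)[of n0] KD
    by (intro maximum_modulus_principle[OF _ opD conD opD order_refl, of _ "zz n0"]) (auto simp: D_def)
  then obtain c where c: "\<And>z. z \<in> D \<Longrightarrow> f n0 z = c" by (auto simp: constant_on_def)
  \<comment> \<open>A shift transports the constant only to the smaller annulus |z| < |q|; the
    identity theorem extends it to \<open>D\<close>.\<close>
  have cn: "\<forall>z\<in>D. f (n0 + int k) z = c" for k
  proof (induction k)
    case (Suc k)
    define U where "U = {z::complex. \<rho>0 < norm z \<and> norm z < norm q}"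
    have opU: "open U"
    proof -
      have "U = - cball 0 \<rho>0 \<inter> ball 0 (norm q)" by (auto simp: U_def)
      thus ?thesis by auto
    qed
    have neU: "of_real ((\<rho>0 + norm q) / 2) \<in> U" using \<rho>0 by (auto simp: U_def simp del: of_real_add of_real_divide)
    show ?case
    proof
      fix z assume z: "z \<in> D"
      show "f (n0 + int (Suc k)) z = c"
      proof (rule analytic_continuation_open[OF opU opD _ conD _ _ _ _ z, of "f (n0 + int (Suc k))" "\<lambda>_. c"])
        show "f (n0 + int (Suc k)) w = c" if "w \<in> U" for w
        proof -
          have "norm (w / q) < 1" "\<rho>0 < norm (q * (w / q))" "\<rho>0 < norm (w / q)"
          proof -
            show "norm (w / q) < 1" "\<rho>0 < norm (q * (w / q))" using that q by (auto simp: U_def norm_divide)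
            have "norm w \<le> norm (w / q)"
              using q mult_left_le_one_le[of "norm w" "norm q"] by (simp add: norm_divide field_simps)
            thus "\<rho>0 < norm (w / q)" using that by (simp add: U_def)
          qed
          note w = this
          have "f (n0 + int k + 1) (q * (w / q)) = f (n0 + int k) (w / q)" by (rule sh[OF w(2,1)])
          moreover have "w / q \<in> D" using w by (simp add: D_def)
          ultimately show ?thesis using Suc q by (simp add: add_ac)
        qed
        show "U \<noteq> {}" using neU by blast
      qed (use U_def D_def hol q in auto)
    qed
  qed (use c in simp)
  have "f n z = c" if "z \<in> D" for n z
  proof -
    define m where "m = (n - n0) mod int r"
    have "n mod int r = (n0 + int (nat m)) mod int r" using r by (simp add: m_def mod_simps)
    hence "f n z = f (n0 + int (nat m)) z"
      using permod[OF that, of n] permod[OF that, of "n0 + int (nat m)"] by simp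
    also have "\<dots> = c" using cn that by blast
    finally show ?thesis .
  qed
  thus ?thesis by (auto simp: D_def)
qed

context rarefied
begin

section \<open>The quotient of the two sides of the beta integral\<close>

definition good :: "(nat \<Rightarrow> complex) \<Rightarrow> (nat \<Rightarrow> int) \<Rightarrow> int \<Rightarrow> bool" where
  "good t n e \<longleftrightarrow> bal 1 {1..6} t n e \<and> (\<forall>a\<in>{1..6}. norm (t a) < 1)"

definition J :: "(nat \<Rightarrow> complex) \<Rightarrow> (nat \<Rightarrow> int) \<Rightarrow> int \<Rightarrow> complex" where
  "J t n e = Iv {1..6} t n e / PG {1..6} t n e"

lemma good_altdef: "good t n e \<longleftrightarrow> (\<Prod>a=1..6. t a) = p * q \<and> (\<Sum>a=1..6. n a) + 3 * e = 0
   \<and> (\<forall>a\<in>{1..6}. t a \<noteq> 0 \<and> norm (t a) < 1)"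
  by (auto simp: good_def bal_def)

text \<open>The four parameters outside a pair have a product of modulus below 1, so the product of
  the pair has modulus between |p q| and 1, where \<open>G_nz\<close> applies.\<close>

lemma good_PG_nz: "good t n e \<Longrightarrow> PG {1..6} t n e \<noteq> 0"
proof -
  assume g: "good t n e"
  have "G (prod t x) (sum n x + e) \<noteq> 0" if x: "x \<in> pairs {1..6}" for x
  proof (rule G_nz)
    have x1: "x \<subseteq> {1..6}" "card x = 2" "finite x" using x finite_subset by (auto simp: pairs_def)
    have s: "(\<Prod>a\<in>y. norm (t a)) < 1" if y: "y \<subseteq> {1..6}" "y \<noteq> {}" for y
    proof -
      have fy: "finite y" using y finite_subset by blast
      obtain b where b: "b \<in> y" using y by auto
      have "(\<Prod>a\<in>y - {b}. norm (t a)) \<le> 1" using g y by (intro prod_le_1) (auto simp: good_altdef intro: less_imp_le)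
      hence "norm (t b) * (\<Prod>a\<in>y - {b}. norm (t a)) \<le> norm (t b) * 1" by (intro mult_left_mono) auto
      also have "\<dots> < 1" using g y b by (auto simp: good_altdef)
      finally show ?thesis using b fy by (simp add: prod.remove)
    qed
    have "x \<noteq> {}" using x1 by auto
    thus "norm (prod t x) < 1" using s x1 by (simp add: prod_norm)
    have "card ({1..6} - x) = 4" using x1 by (simp add: card_Diff_subset)
    hence "{1..6} - x \<noteq> {}" by (metis card.empty zero_neq_numeral)
    hence "(\<Prod>a\<in>{1..6} - x. norm (t a)) < 1" using s[of "{1..6} - x"] by auto
    moreover have "prod t x \<noteq> 0" using g x1 by (auto simp: good_altdef)
    ultimately have "norm (prod t x) * (\<Prod>a\<in>{1..6} - x. norm (t a)) < norm (prod t x) * 1"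
      by (intro mult_strict_left_mono) auto
    moreover have "norm (p * q) = norm (prod t x) * (\<Prod>a\<in>{1..6} - x. norm (t a))"
    proof -
      have "p * q = prod t ({1..6} - x) * prod t x"
        using g prod.subset_diff[OF x1(1), of t] by (simp add: good_altdef)
      thus ?thesis by (simp add: norm_mult prod_norm mult.commute)
    qed
    ultimately show "norm (p * q) < norm (prod t x)" by simp
  qed
  thus ?thesis unfolding PG_def by (simp add: finite_pairs)
qed

lemma set_1_6_split: "{1..6::nat} = insert 1 (insert 6 {2..5})" by auto

lemma PG_6_split: "PG {1..6} t n e = G (t 1 * t 6) (n 1 + n 6 + e) * (\<Prod>b=2..5. G (t 1 * t b) (n 1 + n b + e)) *
    ((\<Prod>b=2..5. G (t 6 * t b) (n 6 + n b + e)) * PG {2..5} t n e)"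
  unfolding set_1_6_split by (simp add: PG_insert)

text \<open>The parameters s multiply to p, not to p q; multiplying either s 1 or s 6 by q makes
  them balanced. The theta products of \<open>Iv_telescope\<close> are exactly the factors by which
  the corresponding gamma products \<open>PG\<close> differ.\<close>

lemma J_shift:
  assumes s: "\<And>a. a \<in> {1..6} \<Longrightarrow> s a \<noteq> 0 \<and> norm (s a) < 1" and sp: "(\<Prod>a=1..6. s a) = p"
    and n: "(\<Sum>a=1..6. n a) + 3 * e = -1"
  shows "J (s(1 := q * s 1)) (n(1 := n 1 + 1)) e = J (s(6 := q * s 6)) (n(6 := n 6 + 1)) e"
proof -
  define A B where "A = (\<Prod>a=2..5. Th (s a * s 6) (n a + n 6 + e))"
    "B = (\<Prod>a=2..5. Th (s 1 * s a) (n 1 + n a + e))"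
  have lt: "norm (s a * s b) < 1" "s a * s b \<noteq> 0" if "a \<in> {1..6}" "b \<in> {1..6}" for a b
    using s[OF that(1)] s[OF that(2)] mult_strict_mono[of "norm (s a)" 1 "norm (s b)" 1] by (auto simp: norm_mult)
  have g: "good (s(b := q * s b)) (n(b := n b + 1)) e" if b: "b \<in> {1..6}" for b
  proof -
    have "(\<Prod>a=1..6. (s(b := q * s b)) a) = q * (\<Prod>a=1..6. s a)"
    proof -
      have "(\<Prod>a\<in>{1..6} - {b}. (s(b := q * s b)) a) = (\<Prod>a\<in>{1..6} - {b}. s a)" by (intro prod.cong) auto
      thus ?thesis unfolding prod.remove[OF finite_atLeastAtMost b] by simp
    qed
    moreover have "(\<Sum>a=1..6. (n(b := n b + 1)) a) = (\<Sum>a=1..6. n a) + 1"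
    proof -
      have "(\<Sum>a\<in>{1..6} - {b}. (n(b := n b + 1)) a) = (\<Sum>a\<in>{1..6} - {b}. n a)" by (intro sum.cong) auto
      thus ?thesis unfolding sum.remove[OF finite_atLeastAtMost b] by simp
    qed
    ultimately show ?thesis unfolding good_altdef
      using s sp n norm_q b mult_strict_mono[of "norm q" 1 "norm (s b)" 1] s[OF b] by (auto simp: norm_mult)
  qed
  have T: "G (q * (s a * s b)) (k + 1) = Th (s a * s b) k * G (s a * s b) k" if "a \<in> {1..6}" "b \<in> {1..6}" for a b k
    using lt[OF that] by (intro G_shift_q)
  have c: "PG {2..5} (s(b := q * s b)) (n(b := n b + 1)) e = PG {2..5} s n e" if "b \<in> {1, 6}" for b
    using that by (intro PG_cong) auto
  have P1: "PG {1..6} (s(1 := q * s 1)) (n(1 := n 1 + 1)) e =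
     G (q * (s 1 * s 6)) (n 1 + n 6 + e + 1) * (B * (\<Prod>b=2..5. G (s 1 * s b) (n 1 + n b + e))) *
    ((\<Prod>b=2..5. G (s 6 * s b) (n 6 + n b + e)) * PG {2..5} s n e)"
  proof -
    have "(\<Prod>b=2..5. G (q * s 1 * s b) (n 1 + 1 + n b + e)) = (\<Prod>b=2..5. Th (s 1 * s b) (n 1 + n b + e) * G (s 1 * s b) (n 1 + n b + e))"
    proof (intro prod.cong refl)
      fix b assume b: "b \<in> {2..5::nat}"
      have "n 1 + 1 + n b + e = (n 1 + n b + e) + 1" by simp
      thus "G (q * s 1 * s b) (n 1 + 1 + n b + e) = Th (s 1 * s b) (n 1 + n b + e) * G (s 1 * s b) (n 1 + n b + e)"
        using T[of 1 b "n 1 + n b + e"] b by (simp only: mult.assoc) simp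
    qed
    thus ?thesis unfolding PG_6_split c[of 1, simplified] A_B_def by (simp add: prod.distrib mult.assoc add_ac)
  qed
  have P6: "PG {1..6} (s(6 := q * s 6)) (n(6 := n 6 + 1)) e =
     G (q * (s 1 * s 6)) (n 1 + n 6 + e + 1) * (\<Prod>b=2..5. G (s 1 * s b) (n 1 + n b + e)) *
    ((A * (\<Prod>b=2..5. G (s 6 * s b) (n 6 + n b + e))) * PG {2..5} s n e)"
  proof -
    have "(\<Prod>b=2..5. G (q * s 6 * s b) (n 6 + 1 + n b + e)) = (\<Prod>b=2..5. Th (s b * s 6) (n b + n 6 + e) * G (s 6 * s b) (n 6 + n b + e))"
    proof (intro prod.cong refl)
      fix b assume b: "b \<in> {2..5::nat}"
      have e: "n 6 + 1 + n b + e = (n b + n 6 + e) + 1" "n 6 + n b + e = n b + n 6 + e"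
        "q * s 6 * s b = q * (s b * s 6)" "s 6 * s b = s b * s 6" by simp_all
      show "G (q * s 6 * s b) (n 6 + 1 + n b + e) = Th (s b * s 6) (n b + n 6 + e) * G (s 6 * s b) (n 6 + n b + e)"
        unfolding e using b by (intro T) auto
    qed
    thus ?thesis unfolding PG_6_split c[of 6, simplified] A_B_def by (simp add: prod.distrib mult_ac add_ac)
  qed
  have nz: "PG {1..6} (s(1 := q * s 1)) (n(1 := n 1 + 1)) e \<noteq> 0" "PG {1..6} (s(6 := q * s 6)) (n(6 := n 6 + 1)) e \<noteq> 0"
    using good_PG_nz[OF g[of 1]] good_PG_nz[OF g[of 6]] by simp_all
  have "A \<noteq> 0" "B \<noteq> 0" using nz unfolding P1 P6 by auto
  moreover have "A * Iv {1..6} (s(1 := q * s 1)) (n(1 := n 1 + 1)) e = B * Iv {1..6} (s(6 := q * s 6)) (n(6 := n 6 + 1)) e"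
    unfolding A_B_def by (rule Iv_telescope[OF s sp n])
  moreover have "A * PG {1..6} (s(1 := q * s 1)) (n(1 := n 1 + 1)) e = B * PG {1..6} (s(6 := q * s 6)) (n(6 := n 6 + 1)) e"
    unfolding P1 P6 by (simp only: mult_ac)
  ultimately show ?thesis using nz unfolding J_def by (metis mult_divide_mult_cancel_left)
qed

text \<open>The integrand and \<open>PG\<close> acquire the same exponential factor, independent of
  z and of the summation index. The balancing conditions enter in the comparison of the two
  exponents.\<close>

lemma J_periodic:
  assumes g: "good t n e"
  shows "J t (n(1 := n 1 + int r, 6 := n 6 - int r)) e = J t n e"
proof -
  define n' where "n' = n(1 := n 1 + int r, 6 := n 6 - int r)"
  have n': "n' 1 = n 1 + int r" "n' 6 = n 6 - int r" "\<And>b. b \<in> {2..5} \<Longrightarrow> n' b = n b"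
    by (auto simp: n'_def)
  define \<tau> where "\<tau> = (\<lambda>a. Ln (t a))"
  have ta: "t a = exp (\<tau> a)" if "a \<in> {1..6}" for a using g that by (simp add: good_altdef \<tau>_def)
  have "exp (\<Sum>a=1..6. \<tau> a) = exp (lp + lq)"
    using g by (simp add: exp_sum good_altdef \<tau>_def pq_exp)
  then obtain j :: int where j: "(\<Sum>a=1..6. \<tau> a) = lp + lq + (of_int (2 * j) * pi) * \<i>"
    unfolding exp_eq by blast
  define C where "C = (\<Sum>b=2..5. cx (\<tau> 1 + \<tau> b) (n 1 + n b + e) - cx (\<tau> 6 + \<tau> b) (n 6 - int r + n b + e))"
  have sp1: "{1..6} - {1::nat, 6} = {2..5}" by auto
  have GU: "G (exp X) (k + int r) = exp (cx X k) * G (exp X) k" for X k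
    using G_step[of "exp X" k] by (simp add: cf_exp)
  have GD: "G (exp X) (k - int r) = exp (- cx X (k - int r)) * G (exp X) k" for X k
    using GU[of X "k - int r"] by (simp add: exp_minus)
  have PGr: "PG {1..6} t n' e = exp C * PG {1..6} t n e"
  proof -
    have c: "PG {2..5} t n' e = PG {2..5} t n e" by (intro PG_cong) (auto simp: n')
    have p1: "(\<Prod>b=2..5. G (t 1 * t b) (n 1 + int r + n b + e)) =
       exp (\<Sum>b=2..5. cx (\<tau> 1 + \<tau> b) (n 1 + n b + e)) * (\<Prod>b=2..5. G (t 1 * t b) (n 1 + n b + e))"
      unfolding exp_sum[OF finite_atLeastAtMost] prod.distrib[symmetric]
    proof (intro prod.cong refl)
      fix b assume b: "b \<in> {2..5::nat}"
      have "t 1 * t b = exp (\<tau> 1 + \<tau> b)" using ta[of 1] ta[of b] b by (simp add: exp_add)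
      thus "G (t 1 * t b) (n 1 + int r + n b + e) = exp (cx (\<tau> 1 + \<tau> b) (n 1 + n b + e)) * G (t 1 * t b) (n 1 + n b + e)"
        using GU[of "\<tau> 1 + \<tau> b" "n 1 + n b + e"] by (simp add: add_ac)
    qed
    have p6: "(\<Prod>b=2..5. G (t 6 * t b) (n 6 - int r + n b + e)) =
       exp (\<Sum>b=2..5. - cx (\<tau> 6 + \<tau> b) (n 6 - int r + n b + e)) * (\<Prod>b=2..5. G (t 6 * t b) (n 6 + n b + e))"
      unfolding exp_sum[OF finite_atLeastAtMost] prod.distrib[symmetric]
    proof (intro prod.cong refl)
      fix b assume b: "b \<in> {2..5::nat}"
      have "t 6 * t b = exp (\<tau> 6 + \<tau> b)" using ta[of 6] ta[of b] b by (simp add: exp_add)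
      moreover have e: "n 6 - int r + n b + e = n 6 + n b + e - int r" by simp
      ultimately show "G (t 6 * t b) (n 6 - int r + n b + e) = exp (- cx (\<tau> 6 + \<tau> b) (n 6 - int r + n b + e)) * G (t 6 * t b) (n 6 + n b + e)"
        unfolding e using GD[of "\<tau> 6 + \<tau> b" "n 6 + n b + e"] by simp
    qed
    have C: "exp C = exp (\<Sum>b=2..5. cx (\<tau> 1 + \<tau> b) (n 1 + n b + e)) * exp (\<Sum>b=2..5. - cx (\<tau> 6 + \<tau> b) (n 6 - int r + n b + e))"
      by (simp add: C_def sum_subtractf sum_negf flip: exp_add)
    have q1: "(\<Prod>b=2..5. G (y * t b) (n' 1 + n' b + e)) = (\<Prod>b=2..5. G (y * t b) (n 1 + int r + n b + e))"
      "(\<Prod>b=2..5. G (y * t b) (n' 6 + n' b + e)) = (\<Prod>b=2..5. G (y * t b) (n 6 - int r + n b + e))" for y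
      by (auto intro!: prod.cong simp: n')
    have m: "n' 1 + n' 6 + e = n 1 + n 6 + e" by (simp add: n')
    show ?thesis unfolding PG_6_split m c q1 p1 p6 C by (simp only: mult_ac)
  qed
  have Dr: "Dl {1..6} t n' e z m = exp C * Dl {1..6} t n e z m" if z: "z \<noteq> 0" for z m
  proof -
    define Z where "Z = Ln z"
    have zZ: "z = exp Z" using z by (simp add: Z_def)
    have tz: "t 1 * z = exp (\<tau> 1 + Z)" "t 1 / z = exp (\<tau> 1 - Z)" "t 6 * z = exp (\<tau> 6 + Z)" "t 6 / z = exp (\<tau> 6 - Z)"
      using ta[of 1] ta[of 6] by (simp_all add: zZ exp_add exp_diff)
    define E' where "E' = cx (\<tau> 1 + Z) (n 1 + e + m) + cx (\<tau> 1 - Z) (n 1 - m)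
       - cx (\<tau> 6 + Z) (n 6 + e + m - int r) - cx (\<tau> 6 - Z) (n 6 - m - int r)"
    let ?g = "\<lambda>n a. G (t a * z) (n a + e + m) * G (t a / z) (n a - m)"
    have "(\<Prod>a=1..6. ?g n' a) = ?g n' 1 * (?g n' 6 * (\<Prod>a=2..5. ?g n' a))"
      unfolding set_1_6_split by simp
    also have "(\<Prod>a=2..5. ?g n' a) = (\<Prod>a=2..5. ?g n a)" by (intro prod.cong) (auto simp: n')
    also have "?g n' 1 = exp (cx (\<tau> 1 + Z) (n 1 + e + m)) * exp (cx (\<tau> 1 - Z) (n 1 - m)) * ?g n 1"
      using GU[of "\<tau> 1 + Z" "n 1 + e + m"] GU[of "\<tau> 1 - Z" "n 1 - m"] unfolding tz n' by (simp add: algebra_simps)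
    also have "?g n' 6 = exp (- cx (\<tau> 6 + Z) (n 6 + e + m - int r)) * exp (- cx (\<tau> 6 - Z) (n 6 - m - int r)) * ?g n 6"
      using GD[of "\<tau> 6 + Z" "n 6 + e + m"] GD[of "\<tau> 6 - Z" "n 6 - m"] unfolding tz n' by (simp add: algebra_simps)
    finally have "(\<Prod>a=1..6. ?g n' a) = exp E' * (?g n 1 * (?g n 6 * (\<Prod>a=2..5. ?g n a)))"
      unfolding E'_def exp_diff exp_add exp_minus divide_inverse by (simp only: mult_ac)
    also have "?g n 1 * (?g n 6 * (\<Prod>a=2..5. ?g n a)) = (\<Prod>a=1..6. ?g n a)"
      unfolding set_1_6_split by simp
    also have "exp E' = exp C"
    proof -
      \<comment> \<open>\<open>T\<close> and \<open>N\<close> collect the parameters 2 to 5.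
        Balancing expresses both through parameters 1 and 6, after which the difference of the
        exponents collapses to a multiple of 2 pi i.\<close>
      define T N where "T = \<tau> 2 + \<tau> 3 + \<tau> 4 + \<tau> 5" "N = (of_int (n 2) + of_int (n 3) + of_int (n 4) + of_int (n 5) :: complex)"
      have T: "T = lp + lq + (of_int (2 * j) * pi) * \<i> - \<tau> 1 - \<tau> 6"
        using j unfolding set_1_6_split T_N_def by (simp add: set_2_5 algebra_simps)
      have "(of_int (n 2 + n 3 + n 4 + n 5) :: complex) = of_int (- 3 * e - n 1 - n 6)"
        using g unfolding good_altdef set_1_6_split by (intro arg_cong[of _ _ of_int]) (simp add: set_2_5)
      hence N: "N = - 3 * of_int e - of_int (n 1) - of_int (n 6)" by (simp add: T_N_def)
      define R h \<alpha> \<beta> where "R = (of_nat r - 1 :: complex)" "h = (of_nat r / 2 :: complex)"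
        "\<alpha> = (lp - lq) * (R / 2)" "\<beta> = lp * R\<^sup>2 / 2 - lq * R * (R + 2) / 2"
      define a b E where "a = (of_int (n 1) :: complex)" "b = (of_int (n 6) - of_nat r :: complex)" "E = (of_int e :: complex)"
      have cxd: "cx X k - cx Y l = R * (\<i> * of_real pi * (of_int k - of_int l) + X * (of_int k + h) - Y * (of_int l + h))
         + \<alpha> * ((of_int k)\<^sup>2 - (of_int l)\<^sup>2) + \<beta> * (of_int k - of_int l)" for X Y k l
        unfolding cx_def R_h_\<alpha>_\<beta>_def by (simp add: field_simps power2_eq_square)
      have C': "C = 4 * (\<i> * of_real pi) * R * (a - b) + R * ((4 * \<tau> 1 * (a + E + h) + \<tau> 1 * N + T * a)
          - (4 * \<tau> 6 * (b + E + h) + \<tau> 6 * N + T * b))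
          + \<alpha> * ((a - b) * (4 * (a + b) + 8 * E + 2 * N)) + \<beta> * (4 * (a - b))"
        unfolding C_def cxd set_2_5 T_N_def a_b_E_def by (simp add: algebra_simps power2_eq_square)
      have E': "E' = 2 * (\<i> * of_real pi) * R * (a - b) + R * (\<tau> 1 * (2 * a + E + 2 * h) - \<tau> 6 * (2 * b + E + 2 * h))
          + \<alpha> * (2 * ((a - b) * (a + b)) + 2 * E * (a - b)) + \<beta> * (2 * (a - b))"
      proof -
        have "E' = (cx (\<tau> 1 + Z) (n 1 + e + m) - cx (\<tau> 6 + Z) (n 6 + e + m - int r))
           + (cx (\<tau> 1 - Z) (n 1 - m) - cx (\<tau> 6 - Z) (n 6 - m - int r))" by (simp add: E'_def)
        thus ?thesis unfolding cxd a_b_E_def by (simp add: algebra_simps power2_eq_square)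
      qed
      have bh: "of_int (n 6) = b + 2 * h" by (simp add: a_b_E_def R_h_\<alpha>_\<beta>_def)
      have lpq: "lp * R = lq * R + 2 * \<alpha>" by (simp add: R_h_\<alpha>_\<beta>_def field_simps)
      have \<beta>: "2 * \<beta> = lp * R * (2 * h - 1) - lq * R * (2 * h + 1)"
        by (simp add: R_h_\<alpha>_\<beta>_def field_simps power2_eq_square)
      have "E' - C = 2 * of_real pi * \<i> * (- (R * (a - b)) - of_int j * (R * (a - b))) + (a - b) * (2 * \<alpha> * (2 * h) + lp * R * (- 1) + lq * R * (- 1)
          - 2 * \<beta> + 0)"
        unfolding C' E' T N a_b_E_def(1)[symmetric] bh a_b_E_def(3)[symmetric] by (simp add: algebra_simps)
      also have "\<dots> = 2 * of_real pi * \<i> * (- (R * (a - b)) - of_int j * (R * (a - b)))"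
        unfolding \<beta> lpq by (simp add: algebra_simps)
      also have "\<dots> = 2 * of_real pi * \<i> * of_int (- ((int r - 1) * (n 1 - n 6 + int r)) - j * ((int r - 1) * (n 1 - n 6 + int r)))"
        by (simp add: R_h_\<alpha>_\<beta>_def a_b_E_def algebra_simps)
      finally have "E' - C = 2 * of_real pi * \<i> * of_int (- ((int r - 1) * (n 1 - n 6 + int r)) - j * ((int r - 1) * (n 1 - n 6 + int r)))" .
      thus ?thesis by (rule exp_eqI)
    qed
    finally show ?thesis unfolding Dl_def by simp
  qed
  have "Iv {1..6} t n' e = exp C * Iv {1..6} t n e"
    unfolding Iv_def sum_distrib_left avg_cmult[symmetric]
    by (intro sum.cong refl avg_cong Dr) auto
  thus ?thesis unfolding n'_def[symmetric] J_def PGr by simp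
qed

lemma J_cong: "(\<And>a. a \<in> {1..6} \<Longrightarrow> t a = t' a \<and> n a = n' a) \<Longrightarrow> J t n e = J t' n' e"
  unfolding J_def by (simp only: Iv_cong[of "{1..6}" t t' n n'] PG_cong[of "{1..6}" t t' n n'])

text \<open>With t 2, ..., t 5 fixed, t 6 is determined by x = t 1, and both lie in the disc for
  \<rho>0 < |x| < 1. The condition on the product of t 2, ..., t 5 says that \<rho>0 < |q|, as
  required by \<open>shift_invariant_annulus_const\<close>.\<close>

lemma J_const:
  assumes g: "good t n e" "good t' n' e" and eq: "\<And>a. a \<in> {2..5} \<Longrightarrow> t a = t' a \<and> n a = n' a"
    and B: "norm p < norm (\<Prod>a=2..5. t a)"
  shows "J t n e = J t' n' e"
proof -
  define B where "B = (\<Prod>a=2..5. t a)"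
  define tt where "tt = (\<lambda>x. t(1 := x, 6 := p * q / (B * x)))"
  define nn where "nn = (\<lambda>k. n(1 := k, 6 := n 1 + n 6 - k))"
  define f where "f = (\<lambda>k x. J (tt x) (nn k) e)"
  define \<rho>0 where "\<rho>0 = norm (p * q) / norm B"
  have "0 < norm B" using le_less_trans[OF norm_ge_zero B] unfolding B_def .
  hence B0: "B \<noteq> 0" by simp
  have \<rho>0: "0 < \<rho>0" "\<rho>0 < norm q"
    using B0 B by (auto simp: \<rho>0_def norm_mult B_def[symmetric] field_simps)
  have sp: "(\<Prod>a=1..6. u a) = u 1 * (u 6 * (\<Prod>a=2..5. u a))" for u :: "nat \<Rightarrow> complex"
    unfolding set_1_6_split by simp
  have ss: "(\<Sum>a=1..6. k a) = k 1 + (k 6 + (\<Sum>a=2..5. k a))" for k :: "nat \<Rightarrow> int"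
    unfolding set_1_6_split by simp
  have Btt: "(\<Prod>a=2..5. tt x a) = B" "(\<Sum>a=2..5. nn k a) = (\<Sum>a=2..5. n a)" for x k
    by (auto simp: tt_def nn_def B_def intro!: prod.cong sum.cong)
  have gd: "good (tt x) (nn k) e" if x: "\<rho>0 < norm x" "norm x < 1" for x k
  proof -
    have x0: "x \<noteq> 0" using x \<rho>0 by auto
    have "norm (p * q / (B * x)) < 1"
      using x x0 B0 by (simp add: norm_divide norm_mult \<rho>0_def divide_simps mult.commute)
    hence "\<forall>a\<in>{1..6}. tt x a \<noteq> 0 \<and> norm (tt x a) < 1"
      using g(1) x x0 B0 by (auto simp: tt_def good_altdef)
    moreover have "(\<Prod>a=1..6. tt x a) = p * q"
      unfolding sp Btt using x0 B0 by (simp add: tt_def)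
    moreover have "(\<Sum>a=1..6. nn k a) + 3 * e = 0"
      using g(1) unfolding good_altdef ss Btt by (simp add: nn_def)
    ultimately show ?thesis by (simp add: good_altdef)
  qed
  have "\<exists>c. \<forall>k x. \<rho>0 < norm x \<and> norm x < 1 \<longrightarrow> f k x = c"
  proof (rule shift_invariant_annulus_const[OF q_nz norm_q \<rho>0 r])
    fix k
    have cl: "{x::complex. \<rho>0 < norm x \<and> norm x < 1} = - cball 0 \<rho>0 \<inter> ball 0 1" by auto
    have op: "open {x::complex. \<rho>0 < norm x \<and> norm x < 1}" unfolding cl by auto
    have hT: "(\<lambda>x. tt x a) holomorphic_on {x. \<rho>0 < norm x \<and> norm x < 1}" for a
    proof -
      consider "a = 6" | "a = 1" | "a \<noteq> 1" "a \<noteq> 6" by blast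
      thus ?thesis
        by cases (use B0 \<rho>0 in \<open>auto simp: tt_def intro!: holomorphic_intros\<close>)
    qed
    have nT: "tt x a \<noteq> 0 \<and> norm (tt x a) < 1" if "x \<in> {x. \<rho>0 < norm x \<and> norm x < 1}" "a \<in> {1..6}" for x a
      using gd[of x] that by (auto simp: good_altdef)
    show "f k holomorphic_on {x. \<rho>0 < norm x \<and> norm x < 1}"
      unfolding f_def J_def
      by (intro holomorphic_on_divide Iv_holomorphic PG_holomorphic op hT finite_atLeastAtMost)
         (use nT gd good_PG_nz in auto)
    show "f (k + int r) x = f k x" if x: "\<rho>0 < norm x" "norm x < 1" for x
    proof -
      have "f (k + int r) x = J (tt x) ((nn k)(1 := nn k 1 + int r, 6 := nn k 6 - int r)) e"
        unfolding f_def by (rule J_cong) (auto simp: nn_def)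
      also have "\<dots> = f k x" unfolding f_def by (rule J_periodic[OF gd[OF x]])
      finally show ?thesis .
    qed
    fix x assume x: "\<rho>0 < norm (q * x)" "norm x < 1"
    have "norm (q * x) \<le> norm x"
      using norm_q mult_left_le_one_le[of "norm x" "norm q"] by (simp add: norm_mult)
    hence x': "\<rho>0 < norm x" "norm (q * x) < 1" using x by auto
    have x0: "x \<noteq> 0" using x' \<rho>0 by auto
    \<comment> \<open>Common predecessor of two parameter sets: multiplying s 1 by q gives the one
      for (k + 1, q x), multiplying s 6 by q the one for (k, x).\<close>
    define s where "s = t(1 := x, 6 := p / (B * x))"
    define m where "m = n(1 := k, 6 := n 1 + n 6 - k - 1)"
    have Bs: "(\<Prod>a=2..5. s a) = B" "(\<Sum>a=2..5. m a) = (\<Sum>a=2..5. n a)"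
      by (auto simp: s_def m_def B_def intro!: prod.cong sum.cong)
    have "norm (p / (B * x)) < 1"
      using x(1) x0 B0 by (simp add: norm_divide norm_mult \<rho>0_def divide_simps mult.commute)
    hence s1: "s a \<noteq> 0 \<and> norm (s a) < 1" if "a \<in> {1..6}" for a
      using g(1) x x0 B0 that by (auto simp: s_def good_altdef)
    have s2: "(\<Prod>a=1..6. s a) = p" unfolding sp Bs using x0 B0 by (simp add: s_def)
    have s3: "(\<Sum>a=1..6. m a) + 3 * e = -1" using g(1) unfolding good_altdef ss Bs by (simp add: m_def)
    have "f (k + 1) (q * x) = J (s(1 := q * s 1)) (m(1 := m 1 + 1)) e"
      unfolding f_def by (rule J_cong) (auto simp: tt_def nn_def s_def m_def)
    also have "\<dots> = J (s(6 := q * s 6)) (m(6 := m 6 + 1)) e" by (rule J_shift[OF s1 s2 s3])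
    also have "\<dots> = f k x"
      unfolding f_def by (rule J_cong) (auto simp: tt_def nn_def s_def m_def)
    finally show "f (k + 1) (q * x) = f k x" .
  qed
  then obtain c where c: "\<And>k x. \<rho>0 < norm x \<Longrightarrow> norm x < 1 \<Longrightarrow> f k x = c" by blast
  have fin: "J u k e = c" if u: "good u k e" "\<And>a. a \<in> {2..5} \<Longrightarrow> u a = t a \<and> k a = n a" for u k
  proof -
    have "(\<Prod>a=2..5. u a) = B" "(\<Sum>a=2..5. k a) = (\<Sum>a=2..5. n a)" using u(2) by (auto simp: B_def intro!: prod.cong sum.cong)
    hence e: "u 1 * (u 6 * B) = p * q" "k 1 + k 6 = n 1 + n 6" "u 1 \<noteq> 0" "norm (u 1) < 1" "norm (u 6) < 1"
      using u(1) g(1) unfolding good_altdef sp ss by auto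
    have u6: "u 6 = p * q / (B * u 1)" using e(1,3) B0 by (simp add: field_simps)
    have "\<rho>0 < norm (u 1)"
      using e(5) e(3) B0 unfolding u6 by (simp add: norm_divide norm_mult \<rho>0_def divide_simps mult.commute)
    hence "f (k 1) (u 1) = c" using c e by blast
    moreover have "J u k e = f (k 1) (u 1)"
      unfolding f_def
    proof (rule J_cong)
      fix a assume "a \<in> {1..6::nat}"
      then consider "a = 1" | "a = 6" | "a \<in> {2..5}" unfolding set_1_6_split by auto
      thus "u a = tt (u 1) a \<and> k a = nn (k 1) a"
        by cases (use u(2)[of a] u6 e in \<open>auto simp: tt_def nn_def\<close>)
    qed
    ultimately show ?thesis by simp
  qed
  show ?thesis using fin[of t n] fin[of t' n'] g eq by auto
qed

end

section \<open>Circle means and simple poles\<close>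

text \<open>The polar part is normalized as \<open>R / (1 - \<tau> / z)\<close> because the mean of
  \<open>1 / (1 - \<tau> / z)\<close> over a circle about 0 is 1 or 0 according to whether \<tau>
  lies inside or outside.\<close>

lemma split_simple_pole:
  assumes S: "open S" "0 \<notin> S" "\<tau> \<in> S" and F: "F holomorphic_on S - {\<tau>}"
    and lim: "((\<lambda>z. (1 - \<tau> / z) * F z) \<longlongrightarrow> R) (at \<tau>)"
  obtains H where "H holomorphic_on S" "\<And>z. z \<in> S - {\<tau>} \<Longrightarrow> F z = H z + R / (1 - \<tau> / z)"
proof -
  define K where "K = (\<lambda>z. if z = \<tau> then R else (1 - \<tau> / z) * F z)"
  have K: "K holomorphic_on S"
  proof (rule no_isolated_singularity'[of "{\<tau>}"])
    have "(\<lambda>z. (1 - \<tau> / z) * F z) holomorphic_on S - {\<tau>}"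
      using F S by (auto intro!: holomorphic_intros)
    thus "K holomorphic_on S - {\<tau>}" by (rule holomorphic_transform) (auto simp: K_def)
    have "(K \<longlongrightarrow> R) (at \<tau>)"
      using lim by (rule Lim_transform_eventually) (auto simp: K_def eventually_at_filter)
    thus "(K \<longlongrightarrow> K z) (at z within S)" if "z \<in> {\<tau>}" for z
      using that by (auto simp: K_def intro: tendsto_within_subset)
  qed (use S in auto)
  define H where "H = (\<lambda>z. z * (if z = \<tau> then deriv K \<tau> else (K z - K \<tau>) / (z - \<tau>)))"
  show ?thesis
  proof (rule that[of H])
    show "H holomorphic_on S"
      unfolding H_def using S by (intro holomorphic_intros pole_lemma K) (simp add: interior_open)
    fix z assume z: "z \<in> S - {\<tau>}"
    have z0: "z \<noteq> 0" "z \<noteq> \<tau>" using z S by auto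
    hence "1 - \<tau> / z \<noteq> 0" by (simp add: field_simps)
    hence "F z = K z / (1 - \<tau> / z)" using z0 by (simp add: K_def)
    moreover have "H z = (K z - R) / (1 - \<tau> / z)" using z0 by (simp add: H_def K_def field_simps)
    ultimately show "F z = H z + R / (1 - \<tau> / z)" by (simp add: diff_divide_distrib)
  qed
qed

lemma avg_mean_value:
  assumes \<phi>: "\<phi> holomorphic_on ball 0 b" and w: "w \<noteq> 0" "norm w < b"
  shows "avg \<phi> w = \<phi> 0"
proof -
  have sub: "(\<lambda>z. w * z) ` cball 0 1 \<subseteq> ball 0 b"
  proof
    fix y assume "y \<in> (\<lambda>z. w * z) ` cball 0 1"
    then obtain z where z: "norm z \<le> 1" "y = w * z" by auto
    have "norm (w * z) \<le> norm w * 1" unfolding norm_mult using z by (intro mult_left_mono) auto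
    also have "\<dots> < b" using w by simp
    finally show "y \<in> ball 0 b" using z by simp
  qed
  have "(\<lambda>z. w * z) holomorphic_on cball 0 1" by (intro holomorphic_intros)
  from holomorphic_on_compose_gen[OF this \<phi> sub] have "(\<lambda>z. \<phi> (w * z)) holomorphic_on cball 0 1" by (simp add: o_def)
  from contour_integral_unique[OF Cauchy_integral_circlepath_simple[OF this, of 0]]
  have "2 * of_real pi * \<i> * avg (\<lambda>z. \<phi> (w * z)) 1 = 2 * of_real pi * \<i> * \<phi> 0"
    using contour_integral_unit_circle[of "\<lambda>z. \<phi> (w * z)"] by simp
  thus ?thesis by (simp add: avg_scale)
qed

lemma avg_simple_pole_inside:
  assumes "norm \<tau> < norm w" shows "avg (\<lambda>z. 1 / (1 - \<tau> / z)) w = 1"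
proof -
  have w: "w \<noteq> 0" using assms by auto
  define \<phi> where "\<phi> = (\<lambda>y. 1 / (1 - \<tau> / w * y))"
  obtain b where b: "1 < b" "b * norm \<tau> < norm w"
  proof (cases "\<tau> = 0")
    case True thus ?thesis using that[of 2] w by simp
  next
    case False
    define y where "y = norm w / norm \<tau>"
    define b where "b = (1 + y) / 2"
    have "1 < y" using False assms by (simp add: y_def)
    hence "1 < b" "b < y" by (simp_all add: b_def)
    hence "1 < b" "b < norm w / norm \<tau>" by (simp_all add: y_def)
    thus ?thesis using that[of b] False by (simp add: field_simps)
  qed
  have "\<phi> holomorphic_on ball 0 b"
    unfolding \<phi>_def
  proof (intro holomorphic_intros)
    fix y :: complex assume y: "y \<in> ball 0 b"
    have "norm (\<tau> * y) \<le> norm \<tau> * b" using y by (auto simp: norm_mult intro!: mult_left_mono)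
    hence "norm (\<tau> * y) < norm w" using b by (simp add: mult.commute)
    hence "\<tau> * y \<noteq> w" by auto
    thus "1 - \<tau> / w * y \<noteq> 0" using w by (simp add: field_simps)
  qed
  moreover have "sphere 0 1 \<subseteq> ball (0::complex) b" using b by auto
  ultimately have "avg \<phi> 1 = \<phi> 0" "continuous_on (sphere 0 1) \<phi>"
    using b avg_mean_value[of \<phi> b 1] holomorphic_on_imp_continuous_on continuous_on_subset by (auto, blast)
  hence "avg (\<lambda>z. \<phi> (1 / z)) 1 = 1" by (simp only: avg_inverse) (simp add: \<phi>_def)
  moreover have "avg (\<lambda>z. 1 / (1 - \<tau> / (w * z))) 1 = avg (\<lambda>z. \<phi> (1 / z)) 1"
    by (rule avg_cong) (simp add: \<phi>_def)
  moreover have "avg (\<lambda>z. 1 / (1 - \<tau> / z)) w = avg (\<lambda>z. 1 / (1 - \<tau> / (w * z))) 1"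
    using avg_scale[of "\<lambda>z. 1 / (1 - \<tau> / z)" w 1] by simp
  ultimately show ?thesis by simp
qed

lemma avg_simple_pole_outside:
  assumes "norm w < norm \<tau>" "w \<noteq> 0" shows "avg (\<lambda>z. 1 / (1 - \<tau> / z)) w = 0"
proof -
  have "avg (\<lambda>z. 1 / (1 - \<tau> / z)) w = avg (\<lambda>z. z / (z - \<tau>)) w"
  proof (rule avg_cong)
    fix z :: complex assume "norm z = norm w"
    hence "z \<noteq> 0" "z \<noteq> \<tau>" using assms by auto
    thus "1 / (1 - \<tau> / z) = z / (z - \<tau>)" by (simp add: field_simps)
  qed
  also have "\<dots> = 0 / (0 - \<tau>)"
    by (rule avg_mean_value[of _ "norm \<tau>"]) (use assms in \<open>auto intro!: holomorphic_intros\<close>)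
  finally show ?thesis by simp
qed

text \<open>Residue theorem for the measure dz / z: R1 and R2 are the residues of F(z) / z. Both
  polar parts are split off, and what remains has the same mean on the two circles.\<close>

lemma avg_two_poles:
  assumes F: "F holomorphic_on {z. a < norm z \<and> norm z < b} - {\<tau>1, \<tau>2}" and ne: "\<tau>1 \<noteq> \<tau>2"
    and a: "0 \<le> a" "a < \<rho>" and b: "1 < b"
    and \<tau>: "\<rho> < norm \<tau>1" "norm \<tau>1 < 1" "\<rho> < norm \<tau>2" "norm \<tau>2 < 1"
    and l1: "((\<lambda>z. (1 - \<tau>1 / z) * F z) \<longlongrightarrow> R1) (at \<tau>1)"
    and l2: "((\<lambda>z. (1 - \<tau>2 / z) * F z) \<longlongrightarrow> R2) (at \<tau>2)"
  shows "avg F 1 = avg F (of_real \<rho>) + R1 + R2"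
proof -
  define Ann where "Ann = {z::complex. a < norm z \<and> norm z < b}"
  have op: "open Ann"
  proof -
    have "Ann = - cball 0 a \<inter> ball 0 b" by (auto simp: Ann_def)
    thus ?thesis by auto
  qed
  have 0: "0 \<notin> Ann" using a by (auto simp: Ann_def)
  have tA: "\<tau>1 \<in> Ann" "\<tau>2 \<in> Ann" using a b \<tau> by (auto simp: Ann_def)
  have t0: "\<tau>1 \<noteq> 0" "\<tau>2 \<noteq> 0" using tA 0 by auto
  have "F holomorphic_on (Ann - {\<tau>2}) - {\<tau>1}"
    by (rule holomorphic_on_subset[OF F]) (auto simp: Ann_def)
  from split_simple_pole[OF _ _ _ this l1] obtain H1 where
    H1: "H1 holomorphic_on Ann - {\<tau>2}" "\<And>z. z \<in> Ann - {\<tau>2} - {\<tau>1} \<Longrightarrow> F z = H1 z + R1 / (1 - \<tau>1 / z)"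
    using op 0 tA ne by auto
  have "((\<lambda>z. (1 - \<tau>2 / z) * F z - (1 - \<tau>2 / z) * (R1 / (1 - \<tau>1 / z))) \<longlongrightarrow> R2 - (1 - \<tau>2 / \<tau>2) * (R1 / (1 - \<tau>1 / \<tau>2))) (at \<tau>2)"
    by (intro tendsto_intros l2) (use t0 ne in auto)
  moreover have "eventually (\<lambda>z. (1 - \<tau>2 / z) * F z - (1 - \<tau>2 / z) * (R1 / (1 - \<tau>1 / z)) = (1 - \<tau>2 / z) * H1 z) (at \<tau>2)"
  proof -
    have "eventually (\<lambda>z. z \<in> Ann - {\<tau>1} - {\<tau>2}) (at \<tau>2)"
      using op tA ne by (intro eventually_at_in_open) auto
    thus ?thesis by eventually_elim (simp add: H1(2) algebra_simps)
  qed
  ultimately have "((\<lambda>z. (1 - \<tau>2 / z) * H1 z) \<longlongrightarrow> R2) (at \<tau>2)"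
    using t0 by (auto dest: Lim_transform_eventually)
  from split_simple_pole[OF op 0 tA(2) H1(1) this] obtain H2 where
    H2: "H2 holomorphic_on Ann" "\<And>z. z \<in> Ann - {\<tau>2} \<Longrightarrow> H1 z = H2 z + R2 / (1 - \<tau>2 / z)" by blast
  have H2c: "continuous_on (sphere 0 s) H2" if "a < s" "s < b" for s
    using holomorphic_on_imp_continuous_on[OF H2(1)] by (rule continuous_on_subset) (use that in \<open>auto simp: Ann_def\<close>)
  have main: "avg F w = avg H2 w + R2 * avg (\<lambda>z. 1 / (1 - \<tau>2 / z)) w + R1 * avg (\<lambda>z. 1 / (1 - \<tau>1 / z)) w"
    if w: "a < norm w" "norm w < b" "norm w \<noteq> norm \<tau>1" "norm w \<noteq> norm \<tau>2" for w
  proof -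
    have c: "continuous_on (sphere 0 (norm w)) (\<lambda>z. R * (1 / (1 - \<tau> / z)))" if "norm \<tau> \<noteq> norm w" for R \<tau> :: complex
    proof -
      have nz: "z \<noteq> 0 \<and> 1 - \<tau> / z \<noteq> 0" if z: "norm z = norm w" for z :: complex
      proof -
        have "z \<noteq> 0" using z w a by auto
        moreover have "\<tau> \<noteq> z" using \<open>norm \<tau> \<noteq> norm w\<close> z by auto
        moreover have "1 - \<tau> / z = (z - \<tau>) / z" using \<open>z \<noteq> 0\<close> by (simp add: diff_divide_distrib)
        ultimately show ?thesis by simp
      qed
      show ?thesis
      proof (intro continuous_intros ballI)
        fix z :: complex assume "z \<in> sphere 0 (norm w)"
        hence "norm z = norm w" by simp
        from nz[OF this] show "z \<noteq> 0" "1 - \<tau> / z \<noteq> 0" by auto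
      qed
    qed
    have "avg F w = avg (\<lambda>z. (H2 z + R2 * (1 / (1 - \<tau>2 / z))) + R1 * (1 / (1 - \<tau>1 / z))) w"
    proof (rule avg_cong)
      fix z :: complex assume z: "norm z = norm w"
      hence "z \<in> Ann" "z \<noteq> \<tau>1" "z \<noteq> \<tau>2" using w by (auto simp: Ann_def)
      thus "F z = (H2 z + R2 * (1 / (1 - \<tau>2 / z))) + R1 * (1 / (1 - \<tau>1 / z))" by (simp add: H1(2) H2(2))
    qed
    also have "\<dots> = avg H2 w + avg (\<lambda>z. R2 * (1 / (1 - \<tau>2 / z))) w + avg (\<lambda>z. R1 * (1 / (1 - \<tau>1 / z))) w"
      using c w H2c[OF w(1,2)] by (simp add: avg_add continuous_on_add)
    finally show ?thesis unfolding avg_cmult .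
  qed
  have "avg H2 1 = avg H2 (of_real \<rho>)"
    using H2(1) a b \<tau> by (intro avg_annulus[of H2 a b]) (auto simp: Ann_def)
  thus ?thesis
    using main[of 1] main[of "of_real \<rho>"] a b \<tau>
    by (simp add: avg_simple_pole_inside avg_simple_pole_outside)
qed

lemma set_1_6_split2: "{1..6::nat} = insert 1 (insert 2 {3..6})"
  and set_3_6: "{3..6::nat} = {3, 4, 5, 6}"
  by auto

context rarefied
begin

section \<open>Evaluation by pinching the contour\<close>

definition qq :: complex where
  "qq = qpoch_inf (p ^ r) (p ^ r) * qpoch_inf (q ^ r) (q ^ r)"

lemma qq_nz: "qq \<noteq> 0"
  using qpoch_expL_nz[OF Re_rlp] qpoch_expL_nz[OF Re_rlq] pr_exp qr_exp by (simp add: qq_def)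

lemma Dl_cong_mod:
  assumes b: "bal l A t n e" and z: "z \<noteq> 0" and m: "int r dvd m - m'"
  shows "Dl A t n e z m = Dl A t n e z m'"
proof -
  obtain d where d: "m = m' + int r * d" using m by (metis add.commute diff_add_cancel dvdE)
  have "Dl A t n e z (m' + int r * d) = Dl A t n e z m'"
  proof (induction d rule: int_induct[where k = 0])
    case (step1 i) thus ?case using Dl_periodic[OF b z, of "m' + int r * i"] by (simp add: algebra_simps)
  next
    case (step2 i) thus ?case using Dl_periodic[OF b z, of "m' + int r * (i - 1)"] by (simp add: algebra_simps)
  qed auto
  thus ?thesis using d by simp
qed

lemma inverse_G_tendsto_0: "((\<lambda>w. 1 / G w 0) \<longlongrightarrow> 0) (at 1)"
proof -
  have "((\<lambda>w. (1 - w) / ((1 - w) * G w 0)) \<longlongrightarrow> (1 - 1) / (1 / qq)) (at 1)"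
    using qq_nz by (intro tendsto_intros G_pole[folded qq_def]) auto
  hence "((\<lambda>w. (1 - w) / ((1 - w) * G w 0)) \<longlongrightarrow> 0) (at 1)" by simp
  thus ?thesis by (rule Lim_transform_eventually) (auto simp: eventually_at_filter)
qed

lemma PG_continuous:
  assumes A: "finite A" and T: "\<And>a. a \<in> A \<Longrightarrow> continuous_on U (\<lambda>x. T x a)"
    and n: "\<And>x a. x \<in> U \<Longrightarrow> a \<in> A \<Longrightarrow> T x a \<noteq> 0 \<and> norm (T x a) < 1"
  shows "continuous_on U (\<lambda>x. PG A (T x) n e)"
  unfolding PG_def
proof (intro continuous_on_prod G_cont)
  fix y assume y: "y \<in> pairs A"
  then obtain a b where ab: "y = {a, b}" "a \<noteq> b" "a \<in> A" "b \<in> A" by (auto simp: pairs_def card_2_iff)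
  show "continuous_on U (\<lambda>x. T x c)" if "c \<in> y" for c using that ab T by auto
  fix x assume "x \<in> U"
  with n[of x a] n[of x b] ab have "norm (T x a) * norm (T x b) < 1 * 1" by (intro mult_strict_mono) auto
  thus "(\<Prod>a\<in>y. T x a) \<in> dom ((\<Sum>a\<in>y. n a) + e)"
    using n[OF \<open>x \<in> U\<close>] ab by (intro dom_unit) (auto simp: norm_mult)
qed

text \<open>As \<open>x\<close> tends to \<open>1\<close> from below, the poles of the integrand at \<open>z = \<plusminus>\<i>x\<close> and \<open>z = \<plusminus>\<i>/x\<close> pinch
  the unit circle.\<close>

definition pinch :: "(nat \<Rightarrow> complex) \<Rightarrow> real \<Rightarrow> nat \<Rightarrow> complex" where
  "pinch t x a = (if a = 1 then \<i> * of_real x else if a = 2 then - \<i> * of_real x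
     else if a = 6 then p * q / ((of_real x)\<^sup>2 * (t 3 * t 4 * t 5)) else t a)"

lemma pinch_simps: "pinch t x 1 = \<i> * of_real x" "pinch t x 2 = - \<i> * of_real x"
  "pinch t x 3 = t 3" "pinch t x 4 = t 4" "pinch t x 5 = t 5"
  "pinch t x 6 = p * q / ((of_real x)\<^sup>2 * (t 3 * t 4 * t 5))"
  by (simp_all add: pinch_def)

text \<open>The indices satisfy n 1 + n 2 + e = 0, so the pair of parameters 1 and 2 contributes
  \<open>G (x^2) 0\<close>, which has a pole at x = 1. The pinch points i and -i are distinct and
  have square -1, at which \<open>G_Ker\<close> is available.\<close>

context
  fixes t :: "nat \<Rightarrow> complex" and n :: "nat \<Rightarrow> int" and e :: int
  assumes t345: "\<And>a. a \<in> {3..5} \<Longrightarrow> t a \<noteq> 0 \<and> norm (t a) < 1"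
    and B: "norm p < norm (t 3 * t 4 * t 5)"
    and n1: "n 1 = 0" and n2: "n 2 = - e" and n6: "n 6 = - 2 * e - n 3 - n 4 - n 5"
begin

lemma pinch_prod: "x \<noteq> 0 \<Longrightarrow> (\<Prod>a=1..6. pinch t x a) = p * q"
proof -
  have "t 3 \<noteq> 0" "t 4 \<noteq> 0" "t 5 \<noteq> 0" using t345 by auto
  moreover assume "x \<noteq> 0"
  ultimately show ?thesis
    unfolding prod_1_6 pinch_simps by (simp add: power2_eq_square field_simps)
qed

text \<open>For x near 1, the poles belonging to parameters 3 to 6 stay in |z| < c, while those at
  the first two parameters have modulus x > \<rho>. The bound 1 / Rad < c keeps the further poles
  generated by the first two parameters below the inner circle. All bounds hold uniformly up to x =
  1.\<close>

lemma pinch_radii: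
  obtains c \<rho> x0 where "0 < c" "c < \<rho>" "\<rho> < x0" "x0 < 1" "1 / Rad < c"
    "\<And>x a. x0 < x \<Longrightarrow> x \<le> 1 \<Longrightarrow> a \<in> {3..6} \<Longrightarrow> pinch t x a \<noteq> 0 \<and> norm (pinch t x a) < c \<and> norm (p * q) < norm (pinch t x a)"
proof -
  define c0 where "c0 = Max {norm (t 3), norm (t 4), norm (t 5), norm (p * q) / norm (t 3 * t 4 * t 5), 1 / Rad}"
  have pq: "norm (p * q) < norm p" using norm_q by (simp add: norm_mult)
  have B0: "t 3 * t 4 * t 5 \<noteq> 0" using t345 by auto
  have "norm (p * q) / norm (t 3 * t 4 * t 5) < 1" using pq B B0 by (subst divide_less_eq_1_pos) auto
  moreover have "1 / Rad < 1" using Rad_gt_1 by simp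
  ultimately have c01: "c0 < 1" unfolding c0_def using t345 by (subst Max_less_iff) auto
  have c0: "norm (t 3) \<le> c0" "norm (t 4) \<le> c0" "norm (t 5) \<le> c0" "norm (p * q) / norm (t 3 * t 4 * t 5) \<le> c0" "1 / Rad \<le> c0"
    unfolding c0_def by (intro Max_ge; simp)+
  define c \<rho> where "c = (c0 + 1) / 2" "\<rho> = (c + 1) / 2"
  \<comment> \<open>The square root comes from parameter 6, which grows like 1 / x^2: its modulus is
    at most c0 / x^2, which is below c for x > sqrt (c0 / c).\<close>
  define x0 where "x0 = max ((\<rho> + 1) / 2) (sqrt (c0 / c))"
  have c0p: "c0 > 0" using c0(5) Rad_gt_1 by (smt (verit) divide_pos_pos)
  have c: "c0 < c" "c < 1" "c < \<rho>" "\<rho> < 1" using c01 unfolding c_\<rho>_def by (simp_all add: field_simps)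
  have "sqrt (c0 / c) < 1" using c c0p by simp
  hence x0: "\<rho> < x0" "x0 < 1" "sqrt (c0 / c) \<le> x0" using c unfolding x0_def by (auto simp: less_max_iff_disj)
  show ?thesis
  proof (rule that[of c \<rho> x0])
    fix x :: real and a :: nat assume x: "x0 < x" "x \<le> 1" and a: "a \<in> {3..6}"
    have x_pos: "x > 0" using x x0 c c0p by linarith
    have x2: "c0 / c < x\<^sup>2"
    proof -
      have "sqrt (c0 / c) < x" using x x0 by linarith
      hence "(sqrt (c0 / c))\<^sup>2 < x\<^sup>2" using c0p c by (intro power_strict_mono) auto
      thus ?thesis using c0p c by simp
    qed
    have small: "norm (t b) > norm (p * q)" if "b \<in> {3..5}" for b
    proof -
      have "norm (t 3 * t 4 * t 5) \<le> norm (t b)"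
      proof -
        have l: "norm (t 3) \<le> 1" "norm (t 4) \<le> 1" "norm (t 5) \<le> 1" using t345 by (auto intro: less_imp_le)
        have "b = 3 \<or> b = 4 \<or> b = 5" using that by auto
        thus ?thesis using l
          by (auto simp: norm_mult mult_le_one mult_left_le mult_left_le_one_le
                intro: order_trans[OF mult_right_mono[of _ 1]] order_trans[OF mult_left_le])
      qed
      thus ?thesis using B pq by linarith
    qed
    have six: "pinch t x 6 \<noteq> 0 \<and> norm (pinch t x 6) < c \<and> norm (p * q) < norm (pinch t x 6)"
    proof (intro conjI)
      show "pinch t x 6 \<noteq> 0" using B0 x_pos by (simp add: pinch_simps)
      have n: "norm (pinch t x 6) = norm (p * q) / norm (t 3 * t 4 * t 5) / x\<^sup>2"
        unfolding pinch_simps by (simp add: norm_divide norm_mult norm_power)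
      have "norm (pinch t x 6) \<le> c0 / x\<^sup>2" unfolding n using c0(4) x_pos by (intro divide_right_mono) auto
      also have "\<dots> < c" using x2 c c0p x_pos by (simp add: field_simps)
      finally show "norm (pinch t x 6) < c" .
      have "norm (t 3 * t 4 * t 5) * x\<^sup>2 < 1"
      proof -
        have "norm (t 3 * t 4 * t 5) < 1"
        proof -
          have l: "norm (t 3) < 1" "norm (t 4) < 1" "norm (t 5) < 1" using t345 by auto
          have "norm (t 3) * norm (t 4) < 1" using mult_strict_mono[OF l(1,2)] by simp
          from mult_strict_mono[OF this l(3)] show ?thesis by (simp add: norm_mult)
        qed
        moreover have "x\<^sup>2 \<le> 1" using x x_pos by (simp add: power_le_one)
        ultimately have "norm (t 3 * t 4 * t 5) * x\<^sup>2 \<le> norm (t 3 * t 4 * t 5) * 1" "norm (t 3 * t 4 * t 5) < 1"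
          by (auto intro!: mult_left_mono simp del: mult_1_right)
        thus ?thesis by linarith
      qed
      hence "norm (p * q) * (norm (t 3 * t 4 * t 5) * x\<^sup>2) < norm (p * q) * 1"
        by (intro mult_strict_left_mono) auto
      thus "norm (p * q) < norm (pinch t x 6)" unfolding n using B0 x_pos by (simp add: field_simps)
    qed
    show "pinch t x a \<noteq> 0 \<and> norm (pinch t x a) < c \<and> norm (p * q) < norm (pinch t x a)"
    proof (cases "a = 6")
      case False
      hence "a \<in> {3..5}" using a by auto
      moreover from this have "norm (t a) \<le> c0" using c0 by (auto simp: set_3_6 atLeastAtMost_iff le_Suc_eq numeral_eq_Suc)
      ultimately show ?thesis using t345[of a] small[of a] c by (auto simp: pinch_def)
    qed (use six in simp)
  qed (use c x0 c0p c0 in auto)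
qed

lemma pinch_bal: "x \<noteq> 0 \<Longrightarrow> (\<And>a. a \<in> {3..6} \<Longrightarrow> pinch t x a \<noteq> 0) \<Longrightarrow> bal 1 {1..6} (pinch t x) n e"
proof -
  assume x: "x \<noteq> 0" and nz: "\<And>a. a \<in> {3..6} \<Longrightarrow> pinch t x a \<noteq> 0"
  have "\<forall>a\<in>{1..6}. pinch t x a \<noteq> 0"
    unfolding set_1_6_split2 using x nz by (simp add: pinch_simps)
  moreover have "(\<Sum>a=1..6. n a) + 3 * e = 0" unfolding set_1_6 by (simp add: n1 n2 n6)
  ultimately show ?thesis using pinch_prod[OF x] by (simp add: bal_def)
qed

text \<open>\<open>Ares x i j\<close> is, up to the factor \<open>G (x\<^sup>2) 0 / qq\<close>, the residue at the pole \<open>z = pinch t x i\<close>; the pole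
  at \<open>pinch t x j\<close> is the other one.\<close>

definition Ares :: "real \<Rightarrow> nat \<Rightarrow> nat \<Rightarrow> complex" where
  "Ares x i j = G ((pinch t x i)\<^sup>2) (2 * n i + e) * Ker ((pinch t x i)\<^sup>2) (2 * n i + e) * G (pinch t x j / pinch t x i) (n j - n i)
     * (\<Prod>a=3..6. G (pinch t x a * pinch t x i) (n a + e + n i) * G (pinch t x a / pinch t x i) (n a - n i))"

text \<open>Of all factors only \<open>G (\<tau> / z) (n i - m)\<close> can be singular at z =
  \<tau>, and only if r divides m - n i. Then periodicity allows replacing m by n i, and
  \<open>G_pole\<close> gives the residue.\<close>

lemma Ares_limit:
  assumes x: "c < x" "x < 1" "0 < c" "1 / Rad < c" and ij: "(i, j) \<in> {(1, 2), (2, 1)}"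
    and sm: "\<And>a. a \<in> {3..6} \<Longrightarrow> pinch t x a \<noteq> 0 \<and> norm (pinch t x a) < c"
  shows "((\<lambda>z. (1 - pinch t x i / z) * Dl {1..6} (pinch t x) n e z m) \<longlongrightarrow>
     (if int r dvd m - n i then G ((of_real x)\<^sup>2) 0 / qq * Ares x i j else 0)) (at (pinch t x i))"
proof -
  define \<tau> where "\<tau> = pinch t x i"
  have x0: "x > 0" using x by linarith
  have i2: "\<i> * of_real x * (\<i> * of_real x) = - (of_real x * of_real x)"
    by (simp add: mult_ac)
  have ni: "norm \<tau> = x" "norm (pinch t x j) = x" "pinch t x j / \<tau> = -1" "\<tau> * pinch t x j = (of_real x)\<^sup>2"
    "n j + e + n i = 0" "\<tau> \<noteq> 0" "pinch t x j \<noteq> 0"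
    using ij x0 i2 by (auto simp: \<tau>_def pinch_simps norm_mult n1 n2 power2_eq_square)
  have bal: "bal 1 {1..6} (pinch t x) n e" using pinch_bal sm x0 by auto
  have ij6: "{1..6} = insert i (insert j {3..6})" "i \<noteq> j" "i \<notin> {3..6}" "j \<notin> {3..6}" using ij by auto
  have lt: "norm (pinch t x a) < 1" "pinch t x a \<noteq> 0" if "a \<in> {1..6}" for a
    using that sm[of a] ni x \<tau>_def unfolding ij6(1) by auto
  have cont: "isCont (\<lambda>z. G (w * z) k) \<tau>" if "norm w < 1" "w \<noteq> 0" for w k
  proof -
    have nw: "norm (w * \<tau>) < 1" using that ni x mult_strict_mono[of "norm w" 1 "norm \<tau>" 1] x0 by (simp add: norm_mult)
    hence "w * \<tau> \<in> dom k" using that ni by (intro dom_unit) auto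
    hence "isCont (\<lambda>z. G z k) (w * \<tau>)" using G_cont_dom[of k] by (simp add: continuous_on_eq_continuous_at)
    moreover have "isCont (\<lambda>z. w * z) \<tau>" by (intro continuous_intros)
    ultimately show ?thesis using isCont_o2[where f = "\<lambda>z. w * z" and g = "\<lambda>z. G z k" and a = \<tau>] by simp
  qed
  have cont2: "isCont (\<lambda>z. G (w / z) k) \<tau>" if "w / \<tau> \<in> dom k" for w k
  proof -
    have "isCont (\<lambda>z. G z k) (w / \<tau>)" using that G_cont_dom[of k] by (simp add: continuous_on_eq_continuous_at)
    moreover have "isCont (\<lambda>z. w / z) \<tau>" using ni by (intro continuous_intros)
    ultimately show ?thesis using isCont_o2[where f = "\<lambda>z. w / z" and g = "\<lambda>z. G z k" and a = \<tau>] by simp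
  qed
  have contK: "isCont (\<lambda>z. Ker (z\<^sup>2) k) \<tau>" for k
  proof -
    have "continuous_on (-{0}) (\<lambda>z. Ker (z\<^sup>2) k)" by (intro Ker_cont continuous_intros) auto
    thus ?thesis using ni by (auto simp: continuous_on_eq_continuous_at open_Compl)
  qed
  have smd: "pinch t x a / \<tau> \<in> dom k" if "a \<in> {3..6}" for a k
    using sm[OF that] ni x x0 by (intro dom_unit) (auto simp: norm_divide divide_simps)
  have jd: "pinch t x j / \<tau> \<in> dom k" for k unfolding ni(3) using Rad_gt_1 by (auto simp: dom_def)
  have rest: "isCont (\<lambda>z. (\<Prod>a\<in>insert j {3..6}. G (pinch t x a * z) (n a + e + m) * G (pinch t x a / z) (n a - m)) * Ker (z\<^sup>2) (2 * m + e)) \<tau>" for m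
    using smd jd lt ij6 by (intro isCont_mult continuous_prod cont cont2 contK) auto
  have D: "Dl {1..6} (pinch t x) n e z m = G (\<tau> * z) (n i + e + m) * G (\<tau> / z) (n i - m) *
     ((\<Prod>a\<in>insert j {3..6}. G (pinch t x a * z) (n a + e + m) * G (pinch t x a / z) (n a - m)) * Ker (z\<^sup>2) (2 * m + e))" for z m
    unfolding Dl_def ij6(1) \<tau>_def using ij6(2-4) by (simp add: mult.assoc)
  show ?thesis
  proof (cases "int r dvd m - n i")
    case False
    hence nd: "\<not> int r dvd n i - m" using dvd_minus_iff[of "int r" "n i - m"] by simp
    have d: "\<tau> / \<tau> \<in> dom (n i - m)" using nd ni(6) Rad_gt_1 by (simp add: dom_def)
    have a: "isCont (\<lambda>z. 1 - \<tau> / z) \<tau>" using ni(6) by (intro continuous_intros)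
    have b: "norm \<tau> < 1" using ni(1) x by simp
    have "isCont (\<lambda>z. (1 - \<tau> / z) * Dl {1..6} (pinch t x) n e z m) \<tau>"
      unfolding D by (rule isCont_mult[OF a isCont_mult[OF isCont_mult[OF cont[OF b ni(6)] cont2[OF d]] rest]])
    hence "((\<lambda>z. (1 - \<tau> / z) * Dl {1..6} (pinch t x) n e z m) \<longlongrightarrow> (1 - \<tau> / \<tau>) * Dl {1..6} (pinch t x) n e \<tau> m) (at \<tau>)"
      by (simp only: isCont_def)
    thus ?thesis using False ni(6) by (simp only: \<tau>_def[symmetric] if_False) simp
  next
    case True
    have b: "norm \<tau> < 1" using ni(1) x by simp
    have fl: "filterlim (\<lambda>z. \<tau> / z) (at 1) (at \<tau>)"
    proof -
      have "((\<lambda>z. \<tau> / z) \<longlongrightarrow> \<tau> / \<tau>) (at \<tau>)" using ni(6) by (intro tendsto_intros) auto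
      moreover have "eventually (\<lambda>z. \<tau> / z \<noteq> 1) (at \<tau>)"
        unfolding eventually_at_filter using ni(6) by (auto simp: divide_eq_1_iff)
      ultimately show ?thesis using ni(6) by (auto simp: filterlim_at)
    qed
    have g: "((\<lambda>z. (1 - \<tau> / z) * G (\<tau> / z) 0) \<longlongrightarrow> 1 / qq) (at \<tau>)"
      using filterlim_compose[OF G_pole[folded qq_def] fl] .
    have "((\<lambda>z. ((1 - \<tau> / z) * G (\<tau> / z) 0) * (G (\<tau> * z) (n i + e + n i) *
       ((\<Prod>a\<in>insert j {3..6}. G (pinch t x a * z) (n a + e + n i) * G (pinch t x a / z) (n a - n i)) * Ker (z\<^sup>2) (2 * n i + e)))) \<longlongrightarrow>
       1 / qq * (G (\<tau> * \<tau>) (n i + e + n i) *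
       ((\<Prod>a\<in>insert j {3..6}. G (pinch t x a * \<tau>) (n a + e + n i) * G (pinch t x a / \<tau>) (n a - n i)) * Ker (\<tau>\<^sup>2) (2 * n i + e)))) (at \<tau>)"
      by (rule tendsto_mult[OF g tendsto_mult[OF cont[OF b ni(6), unfolded isCont_def] rest[unfolded isCont_def]]])
    also have "1 / qq * (G (\<tau> * \<tau>) (n i + e + n i) *
       ((\<Prod>a\<in>insert j {3..6}. G (pinch t x a * \<tau>) (n a + e + n i) * G (pinch t x a / \<tau>) (n a - n i)) * Ker (\<tau>\<^sup>2) (2 * n i + e))) =
       G ((of_real x)\<^sup>2) 0 / qq * Ares x i j"
    proof -
      have "n i + e + n i = 2 * n i + e" by simp
      moreover have "G (pinch t x j * \<tau>) (n j + e + n i) = G ((of_real x)\<^sup>2) 0" using ni(4,5) by (simp add: mult.commute)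
      ultimately show ?thesis unfolding Ares_def \<tau>_def[symmetric] using ij6(2-4)
        by (simp add: power2_eq_square mult_ac)
    qed
    finally have l: "((\<lambda>z. ((1 - \<tau> / z) * G (\<tau> / z) 0) * (G (\<tau> * z) (n i + e + n i) *
       ((\<Prod>a\<in>insert j {3..6}. G (pinch t x a * z) (n a + e + n i) * G (pinch t x a / z) (n a - n i)) * Ker (z\<^sup>2) (2 * n i + e)))) \<longlongrightarrow>
       G ((of_real x)\<^sup>2) 0 / qq * Ares x i j) (at \<tau>)" .
    have ev: "eventually (\<lambda>z. ((1 - \<tau> / z) * G (\<tau> / z) 0) * (G (\<tau> * z) (n i + e + n i) *
       ((\<Prod>a\<in>insert j {3..6}. G (pinch t x a * z) (n a + e + n i) * G (pinch t x a / z) (n a - n i)) * Ker (z\<^sup>2) (2 * n i + e))) =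
       (1 - \<tau> / z) * Dl {1..6} (pinch t x) n e z m) (at \<tau>)"
    proof -
      have "eventually (\<lambda>z. z \<noteq> 0) (at \<tau>)" using ni by (intro eventually_neq_at_within)
      thus ?thesis
      proof eventually_elim
        case (elim z)
        show ?case unfolding Dl_cong_mod[OF bal elim True] unfolding D diff_self by (simp only: mult_ac)
      qed
    qed
    have "((\<lambda>z. (1 - \<tau> / z) * Dl {1..6} (pinch t x) n e z m) \<longlongrightarrow> G ((of_real x)\<^sup>2) 0 / qq * Ares x i j) (at \<tau>)"
      by (rule Lim_transform_eventually[OF l ev])
    thus ?thesis using True by (simp only: \<tau>_def[symmetric] if_True)
  qed
qed

text \<open>Among the r summation indices exactly one is congruent to n i, so each of the two poles
  is counted once when the contour shrinks to radius \<rho>.\<close>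

lemma Iv_residues:
  assumes x: "c < \<rho>" "\<rho> < x" "x < 1" "0 < c" "1 / Rad < c"
    and sm: "\<And>a. a \<in> {3..6} \<Longrightarrow> pinch t x a \<noteq> 0 \<and> norm (pinch t x a) < c"
  shows "Iv {1..6} (pinch t x) n e = (\<Sum>m<r. avg (\<lambda>z. Dl {1..6} (pinch t x) n e z (int m)) (of_real \<rho>))
    + G ((of_real x)\<^sup>2) 0 / qq * (Ares x 1 2 + Ares x 2 1)"
proof -
  define W where "W = (\<lambda>i j m. if int r dvd m - n i then G ((of_real x)\<^sup>2) 0 / qq * Ares x i j else 0)"
  have x0: "x > 0" using x by linarith
  have lt: "norm (pinch t x a) \<le> x" "pinch t x a \<noteq> 0" if "a \<in> {1..6}" for a
    using that sm[of a] x x0 unfolding set_1_6_split2 by (auto simp: pinch_simps norm_mult)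
  have hol: "(\<lambda>z. Dl {1..6} (pinch t x) n e z m) holomorphic_on {z. c < norm z \<and> norm z < 1 / x} - {pinch t x 1, pinch t x 2}" for m
    unfolding Dl_def
  proof (intro holomorphic_on_mult holomorphic_on_prod G_hol Ker_hol holomorphic_intros)
    fix a :: nat and z assume a: "a \<in> {1..6}" and z: "z \<in> {z. c < norm z \<and> norm z < 1 / x} - {pinch t x 1, pinch t x 2}"
    have z0: "z \<noteq> 0" using z x by auto
    have "norm (pinch t x a) * norm z \<le> x * norm z" using lt[OF a] by (intro mult_right_mono) auto
    also have "\<dots> < x * (1 / x)" using z x0 by (intro mult_strict_left_mono) auto
    finally show "pinch t x a * z \<in> dom (n a + e + m)" using lt[OF a] z0 x0 by (intro dom_unit) (auto simp: norm_mult)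
    show "pinch t x a / z \<in> dom (n a - m)"
    proof (cases "a \<in> {3..6}")
      case True
      thus ?thesis using sm[of a] z z0 x by (intro dom_unit) (auto simp: norm_divide divide_simps)
    next
      case False
      hence "a = 1 \<or> a = 2" using a by auto
      hence "z \<noteq> pinch t x a" using z by auto
      hence "pinch t x a / z \<noteq> 1" using z0 by (simp add: divide_eq_1_iff)
      moreover have "norm (pinch t x a / z) < Rad"
      proof -
        have "norm (pinch t x a) / norm z \<le> 1 / norm z" using lt[OF a] x by (intro divide_right_mono) auto
        also have "\<dots> < 1 / c" using z x by (intro divide_strict_left_mono mult_pos_pos) auto
        also have "\<dots> < Rad" using x Rad_gt_1 by (simp add: field_simps)
        finally show ?thesis by (simp add: norm_divide)
      qed
      ultimately show ?thesis using lt[OF a] z0 by (auto simp: dom_def)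
    qed
  qed (use x in auto)
  have avg: "avg (\<lambda>z. Dl {1..6} (pinch t x) n e z m) 1 = avg (\<lambda>z. Dl {1..6} (pinch t x) n e z m) (of_real \<rho>) + W 1 2 m + W 2 1 m" for m
  proof (rule avg_two_poles[OF hol])
    show "((\<lambda>z. (1 - pinch t x 1 / z) * Dl {1..6} (pinch t x) n e z m) \<longlongrightarrow> W 1 2 m) (at (pinch t x 1))"
         "((\<lambda>z. (1 - pinch t x 2 / z) * Dl {1..6} (pinch t x) n e z m) \<longlongrightarrow> W 2 1 m) (at (pinch t x 2))"
      unfolding W_def by (rule Ares_limit[of c]; use x sm in auto)+
  qed (use x x0 in \<open>auto simp: pinch_simps norm_mult\<close>)
  have sW: "(\<Sum>m<r. W i j (int m)) = G ((of_real x)\<^sup>2) 0 / qq * Ares x i j" for i j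
  proof -
    have "int r dvd int m - n i \<longleftrightarrow> m = nat (n i mod int r)" if m: "m < r" for m
    proof -
      have "int r dvd int m - n i \<longleftrightarrow> int m mod int r = n i mod int r" by (simp add: mod_eq_dvd_iff)
      also have "\<dots> \<longleftrightarrow> m = nat (n i mod int r)" using m by auto
      finally show ?thesis .
    qed
    hence "(\<Sum>m<r. W i j (int m)) = (\<Sum>m<r. if m = nat (n i mod int r) then G ((of_real x)\<^sup>2) 0 / qq * Ares x i j else 0)"
      by (intro sum.cong refl) (simp add: W_def)
    thus ?thesis using r by (simp add: nat_less_iff)
  qed
  show ?thesis unfolding Iv_def avg by (simp add: sum.distrib sW algebra_simps)
qed

text \<open>\<open>PG\<close> contains \<open>G (x^2) 0\<close>, which becomes infinite. After
  division by \<open>PG\<close> the integral over the inner circle tends to 0; the two residues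
  carry the same factor, survive, and each contributes 1 / qq.\<close>

lemma pinch_limit: "((\<lambda>x. J (pinch t x) n e) \<longlongrightarrow> 2 / qq) (at_left 1)"
proof -
  obtain c \<rho> x0 where cr: "0 < c" "c < \<rho>" "\<rho> < x0" "x0 < 1" "1 / Rad < c"
    and sm: "\<And>x a. x0 < x \<Longrightarrow> x \<le> 1 \<Longrightarrow> a \<in> {3..6} \<Longrightarrow> pinch t x a \<noteq> 0 \<and> norm (pinch t x a) < c \<and> norm (p * q) < norm (pinch t x a)"
    using pinch_radii by metis
  define U where "U = {x0<..1::real}"
  define C where "C = (\<lambda>x. \<Sum>m<r. avg (\<lambda>z. Dl {1..6} (pinch t x) n e z (int m)) (of_real \<rho>))"
  define W where "W = (\<lambda>x. (\<Prod>b=3..6. G (pinch t x 1 * pinch t x b) (n 1 + n b + e))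
     * ((\<Prod>b=3..6. G (pinch t x 2 * pinch t x b) (n 2 + n b + e)) * PG {3..6} (pinch t x) n e))"
  have x0: "x > 0" if "x \<in> U" for x using that cr by (simp add: U_def)
  have le: "pinch t x a \<noteq> 0 \<and> norm (pinch t x a) \<le> 1" "pinch t x a \<noteq> 0" if "x \<in> U" "a \<in> {1..6}" for x a
    using that sm[of x a] x0[of x] cr unfolding set_1_6_split2 by (auto simp: pinch_simps norm_mult U_def)
  have pc: "continuous_on U (\<lambda>x. pinch t x a)" for a
    unfolding pinch_def using t345 x0
    by (cases "a = 1"; cases "a = 2"; cases "a = 6") (auto intro!: continuous_intros dest: x0)
  have dU: "pinch t x i * pinch t x a \<in> dom k" "pinch t x a / pinch t x i \<in> dom k" "norm (pinch t x i * pinch t x a) < 1"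
     "norm (p * q) < norm (pinch t 1 i * pinch t 1 a)"
    if "x \<in> U" "i = 1 \<or> i = 2" "a \<in> {3..6}" for x i a k
  proof -
    have u: "x0 < x" "x \<le> 1" using that by (auto simp: U_def)
    have i: "norm (pinch t x i) = x" "pinch t x i \<noteq> 0" "norm (pinch t 1 i) = 1"
      using that(2) x0[OF that(1)] by (auto simp: pinch_simps norm_mult)
    have a: "norm (pinch t x a) < c" "c < x" "pinch t x a \<noteq> 0" using sm[OF u that(3)] cr u by auto
    have "norm (pinch t x i) * norm (pinch t x a) \<le> 1 * norm (pinch t x a)" using i u by (intro mult_right_mono) auto
    thus n: "norm (pinch t x i * pinch t x a) < 1" using a u unfolding norm_mult by linarith
    show "pinch t x i * pinch t x a \<in> dom k" using n i a by (intro dom_unit) auto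
    show "pinch t x a / pinch t x i \<in> dom k" using i a x0[OF that(1)] by (intro dom_unit) (auto simp: norm_divide divide_simps)
    show "norm (p * q) < norm (pinch t 1 i * pinch t 1 a)"
      using sm[of 1 a] that(3) cr i by (auto simp: norm_mult)
  qed
  have W: "continuous_on U W"
    unfolding W_def
  proof (intro continuous_intros G_cont pc PG_continuous)
    show "pinch t x a \<noteq> 0 \<and> norm (pinch t x a) < 1" if "x \<in> U" "a \<in> {3..6}" for x a
      using sm[of x a] that cr by (auto simp: U_def)
  qed (use dU in auto)
  have A: "continuous_on U (\<lambda>x. Ares x i j)" if ij: "(i, j) \<in> {(1, 2), (2, 1)}" for i j
  proof -
    have i: "i = 1 \<or> i = 2" "i \<in> {1..6}" using ij by auto
    have sq: "norm ((pinch t x i)\<^sup>2) \<le> 1" "(pinch t x i)\<^sup>2 \<noteq> 1" "pinch t x j / pinch t x i = -1" if "x \<in> U" for x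
    proof -
      show "pinch t x j / pinch t x i = -1" using ij x0[OF that] by (auto simp: pinch_simps)
      show "norm ((pinch t x i)\<^sup>2) \<le> 1" using le(1)[OF that i(2)] by (simp add: norm_power power_le_one)
      have "\<i> * of_real x * (\<i> * of_real x) = - (of_real x * of_real x)" by (simp add: mult_ac)
      hence "(pinch t x i)\<^sup>2 = of_real (- (x\<^sup>2))" using i(1) by (auto simp: pinch_simps power2_eq_square)
      hence "Re ((pinch t x i)\<^sup>2) \<le> 0" by simp
      thus "(pinch t x i)\<^sup>2 \<noteq> 1" by (metis one_complex.sel(1) not_one_le_zero)
    qed
    have d1: "(pinch t x i)\<^sup>2 \<in> dom k" "pinch t x j / pinch t x i \<in> dom k" if "x \<in> U" for x k
      using sq[OF that] le(2)[OF that i(2)] Rad_gt_1 by (auto simp: dom_def)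
    show ?thesis
      unfolding Ares_def
    proof (intro continuous_intros G_cont Ker_cont pc)
      fix x a assume "x \<in> U" "a \<in> {3..6::nat}"
      thus "pinch t x a * pinch t x i \<in> dom (n a + e + n i)" using dU(1)[of x i a] i by (simp add: mult.commute)
    qed (use d1 le(2)[OF _ i(2)] dU(2) i in auto)
  qed
  \<comment> \<open>At x = 1 the first two parameters multiply to 1, so parameters 3 to 6 multiply
    to p q and their pairs cancel against the complementary pairs by reflection.\<close>
  have PG1: "PG {3..6} (pinch t 1) n e = 1"
  proof -
    have nz: "t 3 \<noteq> 0" "t 4 \<noteq> 0" "t 5 \<noteq> 0" using t345 by auto
    have l: "norm (t 3) < 1" "norm (t 4) < 1" "norm (t 5) < 1" using t345 by auto
    have Bpq: "norm (p * q) < norm (t 3 * t 4 * t 5)"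
    proof -
      have "norm (p * q) \<le> norm p * 1" unfolding norm_mult using norm_q by (intro mult_left_mono) auto
      thus ?thesis using B by linarith
    qed
    have cancel: "G (t a * t b) k * G (t d * pinch t 1 6) (- k) = 1"
      if abd: "(a, b, d) \<in> {(3,4,5), (3,5,4), (4,5,3)}" for a b d :: nat and k
    proof -
      have la: "norm (t a) < 1" "norm (t b) < 1" "norm (t d) < 1" "t a \<noteq> 0" "t b \<noteq> 0" "t d \<noteq> 0" using l nz abd by auto
      have e6: "t d * pinch t 1 6 = p * q / (t a * t b)" using abd nz by (auto simp: pinch_simps field_simps)
      have "norm (t a * t b) * norm (t d) \<le> norm (t a * t b) * 1" using la by (intro mult_left_mono) auto
      moreover have "norm (t a * t b) * norm (t d) = norm (t 3 * t 4 * t 5)" using abd by (auto simp: norm_mult)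
      moreover have "norm (t a) * norm (t b) < 1 * 1" using la by (intro mult_strict_mono) auto
      ultimately show ?thesis unfolding e6 using Bpq by (intro G_reflect) (auto simp: norm_mult)
    qed
    have "PG {3..6} (pinch t 1) n e = (G (t 3 * t 4) (n 3 + n 4 + e) * G (t 5 * pinch t 1 6) (n 5 + n 6 + e))
       * (G (t 3 * t 5) (n 3 + n 5 + e) * G (t 4 * pinch t 1 6) (n 4 + n 6 + e))
       * (G (t 4 * t 5) (n 4 + n 5 + e) * G (t 3 * pinch t 1 6) (n 3 + n 6 + e))"
      unfolding set_3_6 by (simp add: PG_insert pinch_simps(3-5))
    also have "\<dots> = 1"
      using cancel[of 3 4 5 "n 3 + n 4 + e"] cancel[of 3 5 4 "n 3 + n 5 + e"] cancel[of 4 5 3 "n 4 + n 5 + e"]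
      by (simp add: n6)
    finally show ?thesis .
  qed
  \<comment> \<open>At the pinch points \<open>G_Ker\<close> at -1 removes the first three factors
    of \<open>Ares\<close>, and dividing by one of i, -i is multiplying by the other, so the
    remaining product is that of \<open>W\<close>.\<close>
  have A1: "Ares 1 i j = W 1" if ij: "(i, j) \<in> {(1, 2), (2, 1)}" for i j
  proof -
    have ij': "(pinch t 1 i)\<^sup>2 = -1" "pinch t 1 j / pinch t 1 i = -1" "2 * n i + e = - (n j - n i)" "n i + n j = - e"
      using ij by (auto simp: pinch_simps n1 n2)
    have "G (-1) (2 * n i + e) * Ker (-1) (2 * n i + e) * G (1 / (-1)) (- (2 * n i + e)) = 1"
      using Rad_gt_1 by (intro G_Ker) auto
    moreover have k: "- (2 * n i + e) = n j - n i" using ij'(4) by linarith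
    moreover have "1 / (-1 :: complex) = -1" by simp
    ultimately have 1: "G (-1) (2 * n i + e) * Ker (-1) (2 * n i + e) * G (-1) (n j - n i) = 1" by (simp only:)
    have 2: "pinch t 1 a / pinch t 1 i = pinch t 1 j * pinch t 1 a" for a
      using ij by (auto simp: pinch_simps)
    have 3: "n a - n i = n j + n a + e" for a using ij' by simp
    have "Ares 1 i j = (\<Prod>a=3..6. G (pinch t 1 i * pinch t 1 a) (n i + n a + e) * G (pinch t 1 j * pinch t 1 a) (n j + n a + e))"
      unfolding Ares_def ij'(1,2) 1 unfolding 2 3 by (simp add: mult_ac add_ac)
    also have "\<dots> = (\<Prod>a=3..6. G (pinch t 1 1 * pinch t 1 a) (n 1 + n a + e)) * (\<Prod>a=3..6. G (pinch t 1 2 * pinch t 1 a) (n 2 + n a + e))"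
      using ij unfolding prod.distrib by (auto simp: mult.commute)
    also have "\<dots> = W 1" by (simp add: W_def PG1)
    finally show ?thesis .
  qed
  have C: "continuous_on U C"
    unfolding C_def
  proof (intro continuous_on_sum avg_continuous_param)
    fix m
    define S where "S = U \<times> sphere (0::complex) (norm (of_real \<rho> :: complex))"
    have "continuous_on S (\<lambda>x. Dl {1..6} (pinch t (fst x)) n e (snd x) (int m))"
    proof (rule Dl_continuous)
      show "continuous_on S (\<lambda>x. pinch t (fst x) a)" if "a \<in> {1..6}" for a
        by (rule continuous_on_compose2[OF pc[of a]]) (auto simp: S_def intro!: continuous_intros)
      show "continuous_on S snd" by (intro continuous_intros)
      fix y :: "real \<times> complex" assume y: "y \<in> S"
      then obtain x z where xz: "y = (x, z)" "x \<in> U" "norm z = \<rho>" using cr by (cases y) (auto simp: S_def)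
      have z0: "z \<noteq> 0" using xz cr by auto
      thus "snd y \<noteq> 0" using xz by simp
      fix a :: nat assume a: "a \<in> {1..6}"
      have "norm (pinch t x a) * norm z \<le> 1 * norm z" using le[OF xz(2) a] by (intro mult_right_mono) auto
      hence "norm (pinch t x a * z) < 1" using xz cr unfolding norm_mult by linarith
      hence "pinch t x a * z \<in> dom (n a + e + int m)" using le[OF xz(2) a] z0 by (intro dom_unit) auto
      moreover have "pinch t x a / z \<in> dom (n a - int m)"
      proof (cases "a \<in> {3..6}")
        case True
        thus ?thesis using sm[of x a] xz cr z0 by (intro dom_unit) (auto simp: norm_divide U_def)
      next
        case False
        hence "a = 1 \<or> a = 2" using a by auto
        hence "norm (pinch t x a) = x" using x0[OF xz(2)] by (auto simp: pinch_simps norm_mult)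
        hence nn: "norm (pinch t x a / z) = x / \<rho>" using xz by (simp add: norm_divide)
        have "x / \<rho> > 1" using xz cr by (simp add: U_def)
        hence "pinch t x a / z \<noteq> 1" using nn by (metis norm_one less_irrefl)
        moreover have "x / \<rho> < Rad"
        proof -
          have "x / \<rho> \<le> 1 / \<rho>" using xz cr by (intro divide_right_mono) (auto simp: U_def)
          also have "\<dots> < 1 / c" using cr by (intro divide_strict_left_mono) auto
          also have "\<dots> < Rad" using cr Rad_gt_1 by (simp add: field_simps)
          finally show ?thesis .
        qed
        ultimately show ?thesis using le(2)[OF xz(2) a] z0 nn by (auto simp: dom_def)
      qed
      ultimately show "pinch t (fst y) a * snd y \<in> dom (n a + e + int m) \<and> pinch t (fst y) a / snd y \<in> dom (n a - int m)"
        using xz by simp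
    qed
    thus "continuous_on (U \<times> sphere 0 (norm (of_real \<rho> :: complex))) (\<lambda>(x, z). Dl {1..6} (pinch t x) n e z (int m))"
      by (simp add: S_def case_prod_beta)
  qed
  have U1: "1 \<in> U" using cr by (simp add: U_def)
  have W1: "W 1 \<noteq> 0"
  proof -
    have "W 1 = Ares 1 1 2" using A1[of 1 2] by simp
    moreover have "(\<Prod>b=3..6. G (pinch t 1 i * pinch t 1 b) (n i + n b + e)) \<noteq> 0" if "i = 1 \<or> i = 2" for i
      using dU(3,4)[OF U1 that] by (auto simp: G_nz)
    ultimately show ?thesis by (auto simp: W_def PG1)
  qed
  have fl: "(f \<longlongrightarrow> f 1) (at_left 1)" if "continuous_on U f" for f :: "real \<Rightarrow> complex"
  proof -
    have "(f \<longlongrightarrow> f 1) (at 1 within U)" using that U1 by (simp add: continuous_on)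
    moreover have "at 1 within U = at_left 1"
      unfolding U_def using cr by (intro at_within_Icc_at_left at_within_nhd[where S = "{x0<..}"]) auto
    ultimately show ?thesis by simp
  qed
  have ginv: "((\<lambda>x. 1 / G ((of_real x)\<^sup>2) 0) \<longlongrightarrow> 0) (at_left 1)"
  proof (rule filterlim_compose[OF inverse_G_tendsto_0])
    have "((\<lambda>x::real. (of_real x)\<^sup>2 :: complex) \<longlongrightarrow> (of_real 1)\<^sup>2) (at_left 1)" by (intro tendsto_intros)
    moreover have "eventually (\<lambda>x::real. (of_real x)\<^sup>2 \<noteq> (1 :: complex)) (at_left 1)"
    proof -
      have "eventually (\<lambda>x::real. x \<in> {0<..<1}) (at_left 1)" by (intro eventually_at_left_real) simp
      thus ?thesis
      proof eventually_elim
        case (elim x)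
        hence "x\<^sup>2 \<noteq> 1" by (auto simp: power2_eq_1_iff)
        thus ?case by (metis of_real_power of_real_eq_1_iff)
      qed
    qed
    ultimately show "filterlim (\<lambda>x::real. (of_real x)\<^sup>2 :: complex) (at 1) (at_left 1)" by (simp add: filterlim_at)
  qed
  have "((\<lambda>x. 1 / G ((of_real x)\<^sup>2) 0 * (C x / W x) + (Ares x 1 2 + Ares x 2 1) / (qq * W x))
     \<longlongrightarrow> 0 * (C 1 / W 1) + (Ares 1 1 2 + Ares 1 2 1) / (qq * W 1)) (at_left 1)"
    by (intro tendsto_add tendsto_mult tendsto_divide ginv fl[OF C] fl[OF W] fl[OF A] tendsto_const)
       (use W1 qq_nz in auto)
  also have "0 * (C 1 / W 1) + (Ares 1 1 2 + Ares 1 2 1) / (qq * W 1) = 2 / qq"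
    using W1 A1[of 1 2] A1[of 2 1] by (simp add: field_simps)
  finally show ?thesis
  proof (rule Lim_transform_eventually)
    \<comment> \<open>The lower bound by the square root gives |p q| < x^2 < 1, so that the factor
      \<open>G (x^2) 0\<close> is nonzero and may be cancelled.\<close>
    have "eventually (\<lambda>x::real. x \<in> {max x0 (sqrt (norm (p * q)))<..<1}) (at_left 1)"
      using cr norm_pq by (intro eventually_at_left_real) simp
    thus "eventually (\<lambda>x. 1 / G ((of_real x)\<^sup>2) 0 * (C x / W x) + (Ares x 1 2 + Ares x 2 1) / (qq * W x)
       = J (pinch t x) n e) (at_left 1)"
    proof eventually_elim
      case (elim x)
      have x: "x \<in> U" "x > 0" "x < 1" using elim cr by (auto simp: U_def)
      have "(sqrt (norm (p * q)))\<^sup>2 < x\<^sup>2" using elim by (intro power_strict_mono) auto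
      hence g0: "G ((of_real x)\<^sup>2) 0 \<noteq> 0"
        using x by (intro G_nz) (auto simp: norm_power power_less_one_iff)
      have PG: "PG {1..6} (pinch t x) n e = G ((of_real x)\<^sup>2) 0 * W x"
        unfolding set_1_6_split2 W_def by (simp add: PG_insert pinch_simps(1,2) n1 n2 power2_eq_square mult_ac)
      have Iv: "Iv {1..6} (pinch t x) n e = C x + G ((of_real x)\<^sup>2) 0 / qq * (Ares x 1 2 + Ares x 2 1)"
        unfolding C_def
        by (rule Iv_residues[of c]) (use cr elim sm in auto)
      show ?case
        unfolding J_def PG Iv using g0 qq_nz by (cases "W x = 0") (simp_all add: field_simps)
    qed
  qed
qed

end

end

section \<open>Analytic continuation and the full beta integral\<close>

text \<open>The admissible \<xi> form an intersection of preimages of a convex set under affine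
  maps, hence a connected open set containing 0 and 1; vanishing near 0 therefore spreads to 1. It
  is applied to logarithms of parameters, with a special point M and the target point L.\<close>

lemma affine_combination_continuation:
  fixes M L :: "'a \<Rightarrow> complex"
  assumes A: "finite A" and D: "open D" "convex D" "\<And>a. a \<in> A \<Longrightarrow> M a \<in> D" "\<And>a. a \<in> A \<Longrightarrow> L a \<in> D"
    and f: "f holomorphic_on {\<xi>. \<forall>a\<in>A. (1 - \<xi>) * M a + \<xi> * L a \<in> D}"
    and V: "open V" "0 \<in> V" "\<And>\<xi>. \<xi> \<in> V \<Longrightarrow> \<forall>a\<in>A. (1 - \<xi>) * M a + \<xi> * L a \<in> D \<Longrightarrow> f \<xi> = 0"
  shows "f 1 = 0"
proof -
  define h where "h = (\<lambda>a \<xi>. (1 - \<xi>) * M a + \<xi> * L a)"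
  define U where "U = {\<xi>. \<forall>a\<in>A. h a \<xi> \<in> D}"
  have U_eq: "U = (\<Inter>a\<in>A. h a -` D)" by (auto simp: U_def)
  have "open (h a -` D)" for a
    unfolding h_def by (intro open_vimage D continuous_intros)
  hence oU: "open U" unfolding U_eq using A by (intro open_INT) auto
  have "convex U"
  proof (rule convexI)
    fix x y :: complex and u v :: real assume *: "x \<in> U" "y \<in> U" "0 \<le> u" "0 \<le> v" "u + v = 1"
    have "h a (u *\<^sub>R x + v *\<^sub>R y) \<in> D" if "a \<in> A" for a
    proof -
      have v: "v = 1 - u" using * by simp
      have "h a (u *\<^sub>R x + v *\<^sub>R y) = u *\<^sub>R h a x + v *\<^sub>R h a y"
        unfolding v h_def scaleR_conv_of_real by (simp add: algebra_simps)
      thus ?thesis using * that convexD[OF D(2)] by (auto simp: U_def)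
    qed
    thus "u *\<^sub>R x + v *\<^sub>R y \<in> U" by (simp add: U_def)
  qed
  hence cU: "connected U" by (rule convex_connected)
  have "0 \<in> U" "1 \<in> U" using D by (auto simp: U_def h_def)
  have "f 1 = (\<lambda>_. 0) 1"
  proof (rule analytic_continuation_open[of "V \<inter> U" U f "\<lambda>_. 0"])
    show "f holomorphic_on U" using f by (simp add: U_def h_def)
  qed (use V oU cU \<open>0 \<in> U\<close> \<open>1 \<in> U\<close> in \<open>auto simp: U_def h_def\<close>)
  thus ?thesis by simp
qed

context rarefied
begin

lemma J_reindex: "bij_betw h {1..6} {1..6} \<Longrightarrow> J (\<lambda>a. t (h a)) (\<lambda>a. n (h a)) e = J t n e"
  by (simp add: J_def Iv_reindex PG_reindex)

text \<open>\<open>J_const\<close> changes one parameter, compensated by the sixth. Used twice, with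
  the first two labels exchanged in between, it carries both of these parameters to the pinching
  family, where the value is known in the limit x -> 1.\<close>

lemma J_eq_restricted:
  assumes g: "good t n e" and B: "norm p < norm (\<Prod>a=2..5. t a)"
  shows "J t n e = 2 / qq"
proof -
  define n' where "n' = n(1 := 0, 2 := - e, 6 := - 2 * e - n 3 - n 4 - n 5)"
  have t: "t a \<noteq> 0" "norm (t a) < 1" if "a \<in> {1..6}" for a
    using g that by (auto simp: good_altdef)
  have ns: "(\<Sum>a=1..6. n a) + 3 * e = 0" using g by (simp add: good_altdef)
  have t345: "\<And>a. a \<in> {3..5} \<Longrightarrow> t a \<noteq> 0 \<and> norm (t a) < 1" using t by auto
  have pe: "(\<Prod>a=2..5. t a) = t 2 * (t 3 * t 4 * t 5)" by (simp add: prod_2_5 mult.assoc)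
  have B3: "norm p < norm (t 3 * t 4 * t 5)"
  proof -
    have "norm (t 2) * norm (t 3 * t 4 * t 5) \<le> 1 * norm (t 3 * t 4 * t 5)"
      using t[of 2] by (intro mult_right_mono) auto
    thus ?thesis using B unfolding pe norm_mult by simp
  qed
  have n': "n' 1 = 0" "n' 2 = - e" "n' 6 = - 2 * e - n' 3 - n' 4 - n' 5" by (simp_all add: n'_def)
  obtain c \<rho> x0 where cr: "0 < c" "c < \<rho>" "\<rho> < x0" "x0 < 1" "1 / Rad < c"
    and sm: "\<And>x a. x0 < x \<Longrightarrow> x \<le> 1 \<Longrightarrow> a \<in> {3..6} \<Longrightarrow> pinch t x a \<noteq> 0 \<and> norm (pinch t x a) < c \<and> norm (p * q) < norm (pinch t x a)"
    using pinch_radii[of t n' e, OF t345 B3 n'] by metis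
  \<comment> \<open>The bound by |p| / |t 3 t 4 t 5| serves the hypothesis of the second use of
    \<open>J_const\<close>; the bound by |q| keeps the sixth parameter of the intermediate set in
    the unit disc.\<close>
  define x1 where "x1 = max x0 (norm p / norm (t 3 * t 4 * t 5))"
  define x2 where "x2 = max x1 (norm q)"
  have x2: "x2 < 1" "x2 \<ge> x0" "norm p / norm (t 3 * t 4 * t 5) \<le> x2" "norm q \<le> x2"
    using cr B3 t345 norm_q by (auto simp: x1_def x2_def divide_less_eq_1)
  have const: "J (pinch t x) n' e = J t n e" if x: "x2 < x" "x < 1" for x
  proof -
    have x0: "x > 0" "x \<noteq> 0" using x x2 cr by linarith+
    define t' where "t' = t(1 := - \<i> * of_real x, 6 := p * q / (- \<i> * of_real x * (t 2 * (t 3 * t 4 * t 5))))"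
    define n1 where "n1 = n(1 := - e, 6 := - 2 * e - n 2 - n 3 - n 4 - n 5)"
    define h where "h = id(1 := 2, 2 := 1 :: nat)"
    have h: "bij_betw h {1..6} {1..6}"
      by (rule bij_betw_byWitness[of _ h]) (auto simp: h_def)
    have g': "good t' n1 e"
      unfolding good_altdef
    proof (intro conjI)
      show "(\<Prod>a=1..6. t' a) = p * q"
        using t[of 2] t[of 3] t[of 4] t[of 5] x0 unfolding prod_1_6 by (simp add: t'_def field_simps)
      show "(\<Sum>a=1..6. n1 a) + 3 * e = 0" by (simp add: set_1_6 n1_def)
      have "norm (t' 6) < 1"
      proof -
        have "norm (p * q) < norm (t 2 * (t 3 * t 4 * t 5)) * norm q"
          unfolding norm_mult[of p q] using B pe by (intro mult_strict_right_mono) auto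
        also have "\<dots> \<le> norm (t 2 * (t 3 * t 4 * t 5)) * x" using x x2 by (intro mult_left_mono) auto
        finally show ?thesis using x0 t[of 2] t[of 3] t[of 4] t[of 5]
          by (simp add: t'_def norm_divide norm_mult divide_simps mult_ac)
      qed
      thus "\<forall>a\<in>{1..6}. t' a \<noteq> 0 \<and> norm (t' a) < 1"
        unfolding set_1_6 using x x0 t[of 2] t[of 3] t[of 4] t[of 5] by (auto simp: t'_def norm_mult)
    qed
    have "J t n e = J t' n1 e"
      by (rule J_const[OF g g' _ B]) (auto simp: t'_def n1_def)
    also have "\<dots> = J (\<lambda>a. t' (h a)) (\<lambda>a. n1 (h a)) e" by (rule J_reindex[OF h, symmetric])
    also have "\<dots> = J (pinch t x) n' e"
    proof (rule J_const)
      show "good (\<lambda>a. t' (h a)) (\<lambda>a. n1 (h a)) e"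
        unfolding good_altdef
      proof (intro conjI ballI)
        show "(\<Prod>a=1..6. t' (h a)) = p * q"
          using prod.reindex_bij_betw[OF h, of t'] g' by (simp add: good_altdef)
        show "(\<Sum>a=1..6. n1 (h a)) + 3 * e = 0"
          using sum.reindex_bij_betw[OF h, of n1] g' by (simp add: good_altdef)
        fix a :: nat assume "a \<in> {1..6}"
        hence "h a \<in> {1..6}" using h by (auto simp: bij_betw_def)
        thus "t' (h a) \<noteq> 0" "norm (t' (h a)) < 1" using g' by (auto simp: good_altdef)
      qed
      have px: "pinch t x a \<noteq> 0" "norm (pinch t x a) < 1" if "a \<in> {3..6}" for a
        using sm[of x a] x x2 cr that by auto
      have "norm (pinch t x a) < 1" if "a \<in> {1..6}" for a
        using that px(2)[of a] x x0 unfolding set_1_6_split2 by (auto simp: pinch_simps norm_mult)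
      moreover have "bal 1 {1..6} (pinch t x) n' e"
        using x0 px by (intro pinch_bal[of t n' e x, OF t345 B3 n']) auto
      ultimately show "good (pinch t x) n' e" by (simp add: good_def)
      show "t' (h a) = pinch t x a \<and> n1 (h a) = n' a" if "a \<in> {2..5}" for a
        using that unfolding set_2_5 by (auto simp: t'_def n1_def n'_def h_def pinch_simps)
      have "norm p < x * norm (t 3 * t 4 * t 5)"
      proof -
        have "norm p / norm (t 3 * t 4 * t 5) < x" using x x2 by linarith
        thus ?thesis using t345 by (simp add: pos_divide_less_eq)
      qed
      thus "norm p < norm (\<Prod>a=2..5. t' (h a))"
        unfolding prod_2_5 using x0 by (simp add: h_def t'_def norm_mult mult.assoc)
    qed
    finally show ?thesis by simp
  qed
  have "eventually (\<lambda>x. x \<in> {x2<..<1}) (at_left 1)" using x2 by (intro eventually_at_left_real) simp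
  hence "eventually (\<lambda>x. J (pinch t x) n' e = J t n e) (at_left 1)" by eventually_elim (auto intro: const)
  with pinch_limit[of t n' e, OF t345 B3 n'] have "((\<lambda>_::real. J t n e) \<longlongrightarrow> 2 / qq) (at_left 1)"
    by (rule Lim_transform_eventually)
  thus ?thesis by (simp add: tendsto_const_iff)
qed

text \<open>The condition |p| < |t2 t3 t4 t5| cuts out an open set of parameters. Both sides are
  holomorphic as long as all parameters stay in the disc, so the identity continues from a point of
  that set to any admissible one.\<close>

lemma beta_1_6:
  assumes g: "good t n e"
  shows "Iv {1..6} t n e = 2 / qq * PG {1..6} t n e"
proof -
  have t: "t a \<noteq> 0" "norm (t a) < 1" if "a \<in> {1..6}" for a
    using g that by (auto simp: good_altdef)
  have Lt: "exp (Ln (t a)) = t a" "Re (Ln (t a)) < 0" if "a \<in> {1..6}" for a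
    using t[OF that] by auto
  have "exp (\<Sum>a=1..6. Ln (t a)) = (\<Prod>a=1..6. t a)"
    by (subst exp_sum) (auto intro!: prod.cong simp: t)
  also have "\<dots> = exp (lp + lq)" using g by (simp add: good_altdef pq_exp)
  finally obtain k :: int where k: "(\<Sum>a=1..6. Ln (t a)) = lp + lq + 2 * of_real pi * \<i> * of_int k"
    unfolding exp_eq by (auto simp: mult_ac)
  \<comment> \<open>At the starting point parameters 2 to 5 have modulus |p|^(1/8), hence a product
    of modulus |p|^(1/2) > |p|. Parameters 1 and 6 share the rest, and the first also carries 2 pi i
    k so that the sums of logarithms at both ends agree.\<close>
  define u where "u = Re lp / 8"
  define s where "s = (lp + lq - 4 * of_real u) / 2"
  define M where "M = (\<lambda>a::nat. if a = 1 then s + 2 * of_real pi * \<i> * of_int k else if a = 6 then s else of_real u)"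
  define h where "h = (\<lambda>a \<xi>. (1 - \<xi>) * M a + \<xi> * Ln (t a))"
  define T where "T = (\<lambda>\<xi> a. exp (h a \<xi>))"
  define D where "D = {z. Re z < 0}"
  define U where "U = {\<xi>. \<forall>a\<in>{1..6}. h a \<xi> \<in> D}"
  have T: "T \<xi> a \<noteq> 0" "\<xi> \<in> U \<Longrightarrow> a \<in> {1..6} \<Longrightarrow> norm (T \<xi> a) < 1" for \<xi> a
    by (auto simp: T_def U_def D_def)
  have "(\<Sum>a=1..6. M a) = (\<Sum>a=1..6. Ln (t a))"
    unfolding k by (simp add: set_1_6 M_def s_def field_simps)
  hence "(\<Sum>a=1..6. h a \<xi>) = (\<Sum>a=1..6. Ln (t a))" for \<xi>
    unfolding h_def sum.distrib sum_distrib_left[symmetric] by (simp only: algebra_simps) simp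
  hence "(\<Prod>a=1..6. T \<xi> a) = exp (\<Sum>a=1..6. Ln (t a))" for \<xi>
    unfolding T_def by (simp flip: exp_sum)
  hence TP: "(\<Prod>a=1..6. T \<xi> a) = p * q" for \<xi>
    using \<open>exp (\<Sum>a=1..6. Ln (t a)) = (\<Prod>a=1..6. t a)\<close> g by (simp add: good_altdef)
  have gT: "good (T \<xi>) n e" if "\<xi> \<in> U" for \<xi>
    using TP T that g by (simp add: good_altdef)
  define f where "f = (\<lambda>\<xi>. Iv {1..6} (T \<xi>) n e - 2 / qq * PG {1..6} (T \<xi>) n e)"
  have "f 1 = 0"
  proof (rule affine_combination_continuation[where M = M and L = "\<lambda>a. Ln (t a)" and D = D and A = "{1..6}"])
    show "open D" "convex D" unfolding D_def by (auto simp: open_halfspace_Re_lt convex_halfspace_Re_lt)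
    have "u < 0" "Re s < 0" using Re_lp Re_lq by (auto simp: u_def s_def)
    thus "M a \<in> D" for a by (auto simp: M_def D_def)
    show "Ln (t a) \<in> D" if "a \<in> {1..6}" for a using Lt that by (simp add: D_def)
    have oU: "open U"
    proof -
      have "U = (\<Inter>a\<in>{1..6}. h a -` D)" by (auto simp: U_def)
      moreover have "open (h a -` D)" for a
        unfolding h_def by (rule open_vimage[OF \<open>open D\<close>]) (intro continuous_intros)
      ultimately show ?thesis by (simp only:) (intro open_INT; simp)
    qed
    have "f holomorphic_on U"
      unfolding f_def
      by (intro holomorphic_intros Iv_holomorphic PG_holomorphic oU) (use T in \<open>auto simp: T_def h_def intro!: holomorphic_intros\<close>)
    thus "f holomorphic_on {\<xi>. \<forall>a\<in>{1..6}. (1 - \<xi>) * M a + \<xi> * Ln (t a) \<in> D}"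
      by (simp add: U_def h_def)
    define V where "V = {\<xi>. norm p < norm (\<Prod>a=2..5. T \<xi> a)}"
    show "open V" unfolding V_def T_def h_def by (intro open_Collect_less continuous_intros)
    have "(\<Prod>a=2..5. T 0 a) = exp (of_real u) * exp (of_real u) * exp (of_real u) * exp (of_real u)"
      unfolding prod_2_5 by (simp add: T_def h_def M_def)
    also have "\<dots> = exp (of_real (u + u + u + u))" by (simp only: exp_add of_real_add)
    finally have "norm (\<Prod>a=2..5. T 0 a) = exp (u + u + u + u)" by (simp only: norm_exp_eq_Re Re_complex_of_real)
    moreover have "norm p = exp (Re lp)" by (simp add: p_exp)
    ultimately show "0 \<in> V" using Re_lp by (simp add: V_def u_def)
    fix \<xi> assume V: "\<xi> \<in> V" and "\<forall>a\<in>{1..6}. (1 - \<xi>) * M a + \<xi> * Ln (t a) \<in> D"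
    hence "good (T \<xi>) n e" by (intro gT) (simp add: U_def h_def)
    with J_eq_restricted[OF this] good_PG_nz[OF this] V show "f \<xi> = 0"
      by (simp add: V_def f_def J_def field_simps)
  qed simp
  moreover have "Iv {1..6} (T 1) n e = Iv {1..6} t n e" "PG {1..6} (T 1) n e = PG {1..6} t n e"
    by (intro Iv_cong PG_cong; simp add: T_def h_def t)+
  ultimately show ?thesis by (simp add: f_def)
qed

text \<open>Arbitrary labels are needed: the inner integral in \<open>Xi\<close> has the labels 9
  and 10 besides four from {1..8}.\<close>

theorem elliptic_beta:
  assumes A: "finite A" "card A = 6" and t: "\<And>a. a \<in> A \<Longrightarrow> t a \<noteq> 0 \<and> norm (t a) < 1"
    and tp: "(\<Prod>a\<in>A. t a) = p * q" and n: "(\<Sum>a\<in>A. n a) + 3 * e = 0"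
  shows "Iv A t n e = 2 / qq * PG A t n e"
proof -
  obtain h :: "nat \<Rightarrow> nat" where h: "bij_betw h {1..6} A" using ex_bij_betw_nat_finite_1[OF A(1)] A(2) by auto
  have "good (\<lambda>a. t (h a)) (\<lambda>a. n (h a)) e"
    using t tp n prod.reindex_bij_betw[OF h, of t] sum.reindex_bij_betw[OF h, of n] bij_betwE[OF h]
    by (auto simp: good_altdef)
  from beta_1_6[OF this] show ?thesis by (simp add: Iv_reindex[OF h] PG_reindex[OF h])
qed

section \<open>The symmetry transformation\<close>

definition hp :: "nat set \<Rightarrow> (nat \<Rightarrow> complex) \<Rightarrow> (nat \<Rightarrow> int) \<Rightarrow> int \<Rightarrow> complex \<Rightarrow> int \<Rightarrow> complex" where
  "hp A t n e z m = (\<Prod>a\<in>A. G (t a * z) (n a + e + m) * G (t a / z) (n a - m))"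

lemma Dl_hp: "Dl A t n e z m = hp A t n e z m * Ker (z\<^sup>2) (2 * m + e)"
  by (simp add: Dl_def hp_def)

lemma hp_cong: "(\<And>a. a \<in> A \<Longrightarrow> t a = t' a \<and> n a = n' a) \<Longrightarrow> hp A t n e z m = hp A t' n' e z m"
  unfolding hp_def by (intro prod.cong) auto

text \<open>The weight of the double integral: \<open>A\<close> carries the parameters of the outer variable, \<open>B\<close> those
  of the inner one, and the two variables interact through the parameters numbered 9 and 10.\<close>

definition Xi where
  "Xi A t n e1 B u k e2 c \<tau> z m w m' = Dl A t n e1 z m *
     Dl (insert 9 (insert 10 B)) (u(9 := c * z, 10 := c / z)) (k(9 := m + \<tau>, 10 := - m - e1 + \<tau>)) e2 w m'"

lemma Xi_continuous:
  assumes t: "\<And>a. a \<in> A \<Longrightarrow> t a \<noteq> 0 \<and> norm (t a) < 1" and u: "\<And>a. a \<in> B \<Longrightarrow> u a \<noteq> 0 \<and> norm (u a) < 1"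
    and c: "c \<noteq> 0" "norm c < 1"
  shows "continuous_on (sphere 0 1 \<times> sphere 0 1) (\<lambda>(z, w). Xi A t n e1 B u k e2 c \<tau> z m w m')"
proof -
  define S where "S = sphere (0::complex) 1 \<times> sphere (0::complex) 1"
  have S: "norm (fst x) = 1" "norm (snd x) = 1" "fst x \<noteq> 0" "snd x \<noteq> 0" if "x \<in> S" for x
    using that by (auto simp: S_def)
  have "continuous_on S (\<lambda>x. Dl A t n e1 (fst x) m)"
  proof (rule Dl_continuous[where T = "\<lambda>_. t"])
    fix x a assume "x \<in> S" "a \<in> A"
    thus "t a * fst x \<in> dom (n a + e1 + m) \<and> t a / fst x \<in> dom (n a - m)"
      using S[of x] t[of a] by (auto intro!: dom_unit simp: norm_mult norm_divide)
  qed (use S in \<open>auto intro!: continuous_intros\<close>)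
  moreover have "continuous_on S (\<lambda>x. Dl (insert 9 (insert 10 B)) (u(9 := c * fst x, 10 := c / fst x))
       (k(9 := m + \<tau>, 10 := - m - e1 + \<tau>)) e2 (snd x) m')"
  proof (rule Dl_continuous)
    show "continuous_on S (\<lambda>x. (u(9 := c * fst x, 10 := c / fst x)) a)" for a
      by (cases "a = 10"; cases "a = 9") (use S in \<open>auto intro!: continuous_intros\<close>)
    fix x and a :: nat assume x: "x \<in> S" and a: "a \<in> insert 9 (insert 10 B)"
    have *: "(u(9 := c * fst x, 10 := c / fst x)) a \<noteq> 0 \<and> norm ((u(9 := c * fst x, 10 := c / fst x)) a) < 1"
      using a S[OF x] u c by (auto simp: norm_mult norm_divide)
    show "(u(9 := c * fst x, 10 := c / fst x)) a * snd x \<in> dom ((k(9 := m + \<tau>, 10 := - m - e1 + \<tau>)) a + e2 + m') \<and>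
         (u(9 := c * fst x, 10 := c / fst x)) a / snd x \<in> dom ((k(9 := m + \<tau>, 10 := - m - e1 + \<tau>)) a - m')"
      using * S[OF x] by (intro conjI dom_unit) (simp_all add: norm_mult norm_divide del: fun_upd_apply)
  qed (use S in \<open>auto intro!: continuous_intros\<close>)
  ultimately show ?thesis unfolding Xi_def S_def case_prod_beta by (rule continuous_on_mult)
qed

text \<open>The integral over w is a beta integral. Its pairs {9, b} and {10, b} produce the gamma
  factors with arguments \<open>c * u b * z\<close> and \<open>c * u b / z\<close>, so the
  parameters in B, multiplied by c, join those in A for the integral over z; the other pairs do not
  involve z.\<close>

lemma Xi_double_integral:
  assumes A: "A \<subseteq> {1..8}" "B \<subseteq> {1..8}" "A \<inter> B = {}" "card B = 4"
    and t: "\<And>a. a \<in> A \<Longrightarrow> t a \<noteq> 0 \<and> norm (t a) < 1" and u: "\<And>a. a \<in> B \<Longrightarrow> u a \<noteq> 0 \<and> norm (u a) < 1"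
    and c: "c \<noteq> 0" "norm c < 1" and up: "c\<^sup>2 * (\<Prod>a\<in>B. u a) = p * q" and k: "(\<Sum>a\<in>B. k a) + 2 * \<tau> - e1 + 3 * e2 = 0"
  shows "(\<Sum>m<r. \<Sum>m'<r. avg (\<lambda>z. avg (\<lambda>w. Xi A t n e1 B u k e2 c \<tau> z (int m) w (int m')) 1) 1) =
    2 / qq * G (c\<^sup>2) (2 * \<tau> - e1 + e2) * PG B u k e2 *
      Iv (A \<union> B) (\<lambda>a. if a \<in> A then t a else c * u a) (\<lambda>a. if a \<in> A then n a else k a + \<tau> + e2 - e1) e1"
    (is "?lhs = ?K * _")
proof -
  have fin: "finite A" "finite B" using A finite_subset by blast+
  have nin: "9 \<notin> insert 10 B" "10 \<notin> B" using A by auto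
  define u' where "u' = (\<lambda>z. u(9 := c * z, 10 := c / z))"
  define k' where "k' = (\<lambda>m. k(9 := m + \<tau>, 10 := - m - e1 + \<tau>))"
  have beta: "Iv (insert 9 (insert 10 B)) (u' z) (k' m) e2 = ?K * hp B (\<lambda>a. c * u a) (\<lambda>a. k a + \<tau> + e2 - e1) e1 z m"
    if z: "norm z = 1" for z m
  proof -
    have z0: "z \<noteq> 0" using z by auto
    have uB: "u' z b = u b" "k' m b = k b" if "b \<in> B" for b using nin that by (auto simp: u'_def k'_def)
    have up': "prod (u' z) B = prod u B" and kp': "sum (k' m) B = sum k B" by (auto intro!: prod.cong sum.cong uB)
    have "Iv (insert 9 (insert 10 B)) (u' z) (k' m) e2 = 2 / qq * PG (insert 9 (insert 10 B)) (u' z) (k' m) e2"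
    proof (rule elliptic_beta)
      show "(\<Prod>a\<in>insert 9 (insert 10 B). u' z a) = p * q"
        using nin fin up z0 c by (simp add: up' power2_eq_square mult_ac) (simp add: u'_def mult_ac)
      show "(\<Sum>a\<in>insert 9 (insert 10 B). k' m a) + 3 * e2 = 0"
        using nin fin k by (simp add: kp') (simp add: k'_def)
      show "card (insert 9 (insert 10 B)) = 6" using nin fin A by simp
      show "u' z a \<noteq> 0 \<and> norm (u' z a) < 1" if "a \<in> insert 9 (insert 10 B)" for a
        using that u c z z0 by (auto simp: u'_def norm_mult norm_divide)
    qed (use fin in auto)
    also have "PG (insert 9 (insert 10 B)) (u' z) (k' m) e2 =
      (\<Prod>b\<in>insert 10 B. G (u' z 9 * u' z b) (k' m 9 + k' m b + e2)) *
      ((\<Prod>b\<in>B. G (u' z 10 * u' z b) (k' m 10 + k' m b + e2)) * PG B (u' z) (k' m) e2)"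
      using nin fin by (simp add: PG_insert)
    also have "PG B (u' z) (k' m) e2 = PG B u k e2" using uB by (intro PG_cong) auto
    also have "(\<Prod>b\<in>insert 10 B. G (u' z 9 * u' z b) (k' m 9 + k' m b + e2)) =
       G (c\<^sup>2) (2 * \<tau> - e1 + e2) * (\<Prod>b\<in>B. G (c * u b * z) (k b + \<tau> + e2 - e1 + e1 + m))"
    proof -
      have "u' z 9 * u' z 10 = c\<^sup>2" "k' m 9 + k' m 10 + e2 = 2 * \<tau> - e1 + e2"
        using z0 by (simp_all add: u'_def k'_def power2_eq_square)
      moreover have "(\<Prod>b\<in>B. G (u' z 9 * u' z b) (k' m 9 + k' m b + e2)) = (\<Prod>b\<in>B. G (c * u b * z) (k b + \<tau> + e2 - e1 + e1 + m))"
        by (rule prod.cong) (simp_all add: uB, simp add: u'_def k'_def mult_ac add_ac)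
      ultimately show ?thesis using nin fin by simp
    qed
    also have "(\<Prod>b\<in>B. G (u' z 10 * u' z b) (k' m 10 + k' m b + e2)) = (\<Prod>b\<in>B. G (c * u b / z) (k b + \<tau> + e2 - e1 - m))"
      by (rule prod.cong) (simp_all add: uB, simp add: u'_def k'_def algebra_simps)
    finally show ?thesis by (simp add: hp_def prod.distrib mult_ac)
  qed
  note cX = Xi_continuous[of A t B u c, OF t u c]
  have inner: "(\<Sum>m'<r. avg (\<lambda>z. avg (\<lambda>w. Xi A t n e1 B u k e2 c \<tau> z m w (int m')) 1) 1) =
     ?K * avg (\<lambda>z. Dl (A \<union> B) (\<lambda>a. if a \<in> A then t a else c * u a) (\<lambda>a. if a \<in> A then n a else k a + \<tau> + e2 - e1) e1 z m) 1" for m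
  proof -
    have "(\<Sum>m'<r. avg (\<lambda>z. avg (\<lambda>w. Xi A t n e1 B u k e2 c \<tau> z m w (int m')) 1) 1) =
       avg (\<lambda>z. \<Sum>m'<r. avg (\<lambda>w. Xi A t n e1 B u k e2 c \<tau> z m w (int m')) 1) 1"
    proof (rule avg_sum[symmetric])
      show "continuous_on (sphere 0 (norm (1::complex))) (\<lambda>z. avg (\<lambda>w. Xi A t n e1 B u k e2 c \<tau> z m w (int m')) 1)" for m'
        using cX by (intro avg_continuous_param) simp
    qed simp
    also have "\<dots> = avg (\<lambda>z. ?K * Dl (A \<union> B) (\<lambda>a. if a \<in> A then t a else c * u a) (\<lambda>a. if a \<in> A then n a else k a + \<tau> + e2 - e1) e1 z m) 1"
    proof (rule avg_cong)
      fix z :: complex assume "norm z = norm (1 :: complex)"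
      hence z: "norm z = 1" by simp
      have "(\<Sum>m'<r. avg (\<lambda>w. Xi A t n e1 B u k e2 c \<tau> z m w (int m')) 1) = Dl A t n e1 z m * Iv (insert 9 (insert 10 B)) (u' z) (k' m) e2"
        unfolding Xi_def avg_cmult Iv_def u'_def k'_def by (simp add: sum_distrib_left)
      also have "\<dots> = ?K * (hp A t n e1 z m * hp B (\<lambda>a. c * u a) (\<lambda>a. k a + \<tau> + e2 - e1) e1 z m * Ker (z\<^sup>2) (2 * m + e1))"
        unfolding beta[OF z] Dl_hp by (simp only: mult_ac)
      also have "hp A t n e1 z m * hp B (\<lambda>a. c * u a) (\<lambda>a. k a + \<tau> + e2 - e1) e1 z m =
        hp (A \<union> B) (\<lambda>a. if a \<in> A then t a else c * u a) (\<lambda>a. if a \<in> A then n a else k a + \<tau> + e2 - e1) e1 z m"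
        unfolding hp_def using A fin
        by (subst prod.union_disjoint) (auto intro!: arg_cong2[where f = "(*)"] prod.cong)
      finally show "(\<Sum>m'<r. avg (\<lambda>w. Xi A t n e1 B u k e2 c \<tau> z m w (int m')) 1) =
         ?K * Dl (A \<union> B) (\<lambda>a. if a \<in> A then t a else c * u a) (\<lambda>a. if a \<in> A then n a else k a + \<tau> + e2 - e1) e1 z m"
        by (simp only: Dl_hp)
    qed
    finally show ?thesis by (simp only: avg_cmult)
  qed
  show ?thesis unfolding inner Iv_def by (simp only: sum_distrib_left)
qed

text \<open>Taking complements permutes the two-element subsets of a four-element set, and each pair
  cancels against its complement by \<open>G_reflect\<close>.\<close>

lemma PG_complement:
  assumes B: "card B = 4" and t: "\<And>a. a \<in> B \<Longrightarrow> t a \<noteq> 0 \<and> norm (t a) < 1"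
    and t': "\<And>a. a \<in> B \<Longrightarrow> norm (t' a) < 1"
    and rel: "\<And>x. x \<subseteq> B \<Longrightarrow> card x = 2 \<Longrightarrow> (\<Prod>a\<in>x. t a) * (\<Prod>a\<in>B - x. t' a) = p * q"
      "\<And>x. x \<subseteq> B \<Longrightarrow> card x = 2 \<Longrightarrow> (\<Sum>a\<in>x. n a) + (\<Sum>a\<in>B - x. n' a) + e + e' = 0"
  shows "PG B t n e * PG B t' n' e' = 1"
proof -
  have fin: "finite B" using B card.infinite by fastforce
  have two: "norm (\<Prod>a\<in>x. f a) < 1" if x: "x \<in> pairs B" and f: "\<And>a. a \<in> B \<Longrightarrow> norm (f a) < 1" for x and f :: "nat \<Rightarrow> complex"
  proof -
    obtain a b where "x = {a, b}" "a \<noteq> b" "a \<in> B" "b \<in> B" using x by (auto simp: pairs_def card_2_iff)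
    thus ?thesis using mult_strict_mono[of "norm (f a)" 1 "norm (f b)" 1] f by (simp add: norm_mult)
  qed
  have cp: "B - x \<in> pairs B" if "x \<in> pairs B" for x
    using that fin B by (auto simp: pairs_def card_Diff_subset finite_subset)
  have "bij_betw (\<lambda>x. B - x) (pairs B) (pairs B)"
    by (rule bij_betw_byWitness[of _ "\<lambda>x. B - x"]) (use cp in \<open>auto simp: pairs_def\<close>)
  hence "PG B t' n' e' = (\<Prod>x\<in>pairs B. G (\<Prod>a\<in>B - x. t' a) ((\<Sum>a\<in>B - x. n' a) + e'))"
    unfolding PG_def by (rule prod.reindex_bij_betw[symmetric])
  hence "PG B t n e * PG B t' n' e' = (\<Prod>x\<in>pairs B. G (\<Prod>a\<in>x. t a) ((\<Sum>a\<in>x. n a) + e) * G (\<Prod>a\<in>B - x. t' a) ((\<Sum>a\<in>B - x. n' a) + e'))"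
    by (simp add: PG_def prod.distrib)
  also have "\<dots> = 1"
  proof (rule prod.neutral, rule ballI)
    fix x assume x: "x \<in> pairs B"
    hence x': "x \<subseteq> B" "card x = 2" by (auto simp: pairs_def)
    have nz: "(\<Prod>a\<in>x. t a) \<noteq> 0" using x' t by (metis (no_types, lifting) prod_zero_iff card.infinite zero_neq_numeral subsetD)
    have e: "(\<Prod>a\<in>B - x. t' a) = p * q / (\<Prod>a\<in>x. t a)" using rel(1)[OF x'] nz by (simp add: field_simps)
    have e2: "(\<Sum>a\<in>B - x. n' a) + e' = - ((\<Sum>a\<in>x. n a) + e)" using rel(2)[OF x'] by simp
    have "norm (p * q / (\<Prod>a\<in>x. t a)) < 1" unfolding e[symmetric] by (rule two[OF cp[OF x] t'])
    hence "norm (p * q) < norm (\<Prod>a\<in>x. t a)" using nz by (simp add: norm_divide)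
    thus "G (\<Prod>a\<in>x. t a) ((\<Sum>a\<in>x. n a) + e) * G (\<Prod>a\<in>B - x. t' a) ((\<Sum>a\<in>B - x. n' a) + e') = 1"
      unfolding e e2 using two[OF x] t by (intro G_reflect) auto
  qed
  finally show ?thesis .
qed

text \<open>The double integral of \<open>Xi\<close> is evaluated in both orders; the two results
  share the factor \<open>G (c^2) (- \<sigma>)\<close>. A symmetric form would shift the indices by
  \<sigma> / 2 in opposite directions; shifting only those in S' and passing to e - \<sigma> keeps
  all of them integral.\<close>

lemma first_transformation:
  assumes S: "S \<subseteq> {1..8}" "S' \<subseteq> {1..8}" "S \<inter> S' = {}" "card S = 4" "card S' = 4"
    and t: "\<And>a. a \<in> S \<union> S' \<Longrightarrow> t a \<noteq> 0 \<and> norm (t a) < 1" and tc: "\<And>b. b \<in> S' \<Longrightarrow> norm (t b) < norm c"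
    and c: "norm c < 1" "norm (p * q) < norm (c\<^sup>2)" "c\<^sup>2 * (\<Prod>a\<in>S. t a) = p * q"
    and tp: "(\<Prod>a\<in>S. t a) * (\<Prod>a\<in>S'. t a) = (p * q)\<^sup>2" and n: "(\<Sum>a\<in>S. n a) + (\<Sum>a\<in>S'. n a) + 4 * e = 0"
    and \<sigma>: "\<sigma> = (\<Sum>a\<in>S. n a) + 2 * e"
  shows "Iv (S \<union> S') t n e = PG S t n e * PG S' t n e *
     Iv (S \<union> S') (\<lambda>a. if a \<in> S then c * t a else t a / c) (\<lambda>a. if a \<in> S then n a else n a + \<sigma>) (e - \<sigma>)"
proof -
  have c0: "c \<noteq> 0" using c(2) by auto
  have fin: "finite S" "finite S'" using finite_subset[OF S(1)] finite_subset[OF S(2)] by simp_all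
  have S3': "S' \<inter> S = {}" using S(3) by auto
  \<comment> \<open>Dividing by c in advance makes the first evaluation of the double integral
    return the original parameters.\<close>
  define u where "u = (\<lambda>a. t a / c)"
  define k where "k = (\<lambda>a. n a + \<sigma>)"
  have cu: "c * u a = t a" for a using c0 by (simp add: u_def)
  have u: "u a \<noteq> 0 \<and> norm (u a) < 1" if "a \<in> S'" for a
    using that t[of a] tc[of a] c0 by (auto simp: u_def norm_divide)
  have tS: "t a \<noteq> 0 \<and> norm (t a) < 1" if "a \<in> S" for a using that t by auto
  have c4: "c ^ 4 = c\<^sup>2 * c\<^sup>2" by (simp flip: power_add)
  have up: "c\<^sup>2 * (\<Prod>a\<in>S'. u a) = p * q"
  proof -
    have "p * q * (\<Prod>a\<in>S'. t a) = c\<^sup>2 * ((\<Prod>a\<in>S. t a) * (\<Prod>a\<in>S'. t a))"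
      by (simp only: c(3)[symmetric] mult.assoc)
    also have "\<dots> = p * q * (c\<^sup>2 * (p * q))" unfolding tp power2_eq_square by (simp only: mult_ac)
    finally have P: "(\<Prod>a\<in>S'. t a) = c\<^sup>2 * (p * q)" using mult_left_cancel[of "p * q"] by simp
    have "(\<Prod>a\<in>S'. u a) = (\<Prod>a\<in>S'. t a) / (c\<^sup>2 * c\<^sup>2)"
      unfolding u_def prod_dividef prod_constant S(5) c4 ..
    thus ?thesis unfolding P using c0 by simp
  qed
  have ku: "(\<Sum>a\<in>S'. k a) + 2 * 0 - e + 3 * (e - \<sigma>) = 0"
    unfolding k_def sum.distrib sum_constant S(5) using n \<sigma> by simp
  have kn: "(\<Sum>a\<in>S. n a) + 2 * (- \<sigma>) - (e - \<sigma>) + 3 * e = 0" using \<sigma> by simp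
  \<comment> \<open>The coupling factors depend on c z w, c z / w, c w / z and c / (z w) only, so z
    and w may exchange roles; the offset of the indices changes from 0 to -\<sigma>.\<close>
  have sym: "Xi S t n e S' u k (e - \<sigma>) c 0 z m w m' = Xi S' u k (e - \<sigma>) S t n e c (- \<sigma>) w m' z m"
    if "z \<noteq> 0" "w \<noteq> 0" for z w m m'
  proof -
    have nin: "9 \<notin> insert 10 S" "10 \<notin> S" "9 \<notin> insert 10 S'" "10 \<notin> S'" using S(1,2) by auto
    have 1: "hp S' (u(9 := c * z, 10 := c / z)) (k(9 := m + 0, 10 := - m - e + 0)) (e - \<sigma>) w m' = hp S' u k (e - \<sigma>) w m'"
      using nin by (intro hp_cong) auto
    have 2: "hp S (t(9 := c * w, 10 := c / w)) (n(9 := m' + - \<sigma>, 10 := - m' - (e - \<sigma>) + - \<sigma>)) e z m = hp S t n e z m"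
      using nin by (intro hp_cong) auto
    have ins: "hp (insert 9 (insert 10 X)) t n e z m = (G (t 9 * z) (n 9 + e + m) * G (t 9 / z) (n 9 - m)) *
       ((G (t 10 * z) (n 10 + e + m) * G (t 10 / z) (n 10 - m)) * hp X t n e z m)"
      if "finite X" "9 \<notin> insert 10 X" "10 \<notin> X" for X t n e z m using that by (simp add: hp_def)
    have a1: "c * z * w = c * w * z" "c * z / w = c / w * z" "c / z * w = c * w / z" "c / z / w = c / w / z"
      by simp_all
    have b1: "m + 0 + (e - \<sigma>) + m' = m' + - \<sigma> + e + m" "m + 0 - m' = - m' - (e - \<sigma>) + - \<sigma> + e + m"
      "- m - e + 0 + (e - \<sigma>) + m' = m' + - \<sigma> - m" "- m - e + 0 - m' = - m' - (e - \<sigma>) + - \<sigma> - m" by simp_all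
    have v: "(f(9 := x, 10 := y)) 9 = x" "(f(9 := x, 10 := y)) 10 = y" for f :: "nat \<Rightarrow> complex" and x y by simp_all
    have v': "(f(9 := x, 10 := y)) 9 = x" "(f(9 := x, 10 := y)) 10 = y" for f :: "nat \<Rightarrow> int" and x y by simp_all
    show ?thesis
      unfolding Xi_def Dl_hp ins[OF fin(1) nin(1,2)] ins[OF fin(2) nin(3,4)] 1 2
      unfolding v v' a1 b1 by (simp only: mult_ac)
  qed
  have "(\<Sum>m<r. \<Sum>m'<r. avg (\<lambda>z. avg (\<lambda>w. Xi S t n e S' u k (e - \<sigma>) c 0 z (int m) w (int m')) 1) 1)
      = (\<Sum>m<r. \<Sum>m'<r. avg (\<lambda>w. avg (\<lambda>z. Xi S' u k (e - \<sigma>) S t n e c (- \<sigma>) w (int m') z (int m)) 1) 1)"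
  proof (intro sum.cong refl)
    fix m m'
    have "avg (\<lambda>z. avg (\<lambda>w. Xi S t n e S' u k (e - \<sigma>) c 0 z (int m) w (int m')) 1) 1
        = avg (\<lambda>w. avg (\<lambda>z. Xi S t n e S' u k (e - \<sigma>) c 0 z (int m) w (int m')) 1) 1"
      by (rule avg_swap) (use Xi_continuous[of S t S' u c, OF tS u c0 c(1)] in simp)
    also have "\<dots> = avg (\<lambda>w. avg (\<lambda>z. Xi S' u k (e - \<sigma>) S t n e c (- \<sigma>) w (int m') z (int m)) 1) 1"
      by (intro avg_cong sym) auto
    finally show "avg (\<lambda>z. avg (\<lambda>w. Xi S t n e S' u k (e - \<sigma>) c 0 z (int m) w (int m')) 1) 1
      = avg (\<lambda>w. avg (\<lambda>z. Xi S' u k (e - \<sigma>) S t n e c (- \<sigma>) w (int m') z (int m)) 1) 1" .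
  qed
  also have "\<dots> = (\<Sum>m'<r. \<Sum>m<r. avg (\<lambda>w. avg (\<lambda>z. Xi S' u k (e - \<sigma>) S t n e c (- \<sigma>) w (int m') z (int m)) 1) 1)"
    by (rule sum.swap)
  finally have "2 / qq * G (c\<^sup>2) (2 * 0 - e + (e - \<sigma>)) * PG S' u k (e - \<sigma>) *
       Iv (S \<union> S') (\<lambda>a. if a \<in> S then t a else c * u a) (\<lambda>a. if a \<in> S then n a else k a + 0 + (e - \<sigma>) - e) e
     = 2 / qq * G (c\<^sup>2) (2 * (- \<sigma>) - (e - \<sigma>) + e) * PG S t n e *
       Iv (S' \<union> S) (\<lambda>a. if a \<in> S' then u a else c * t a) (\<lambda>a. if a \<in> S' then k a else n a + - \<sigma> + e - (e - \<sigma>)) (e - \<sigma>)"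
    using Xi_double_integral[of S S' t u c k 0 e "e - \<sigma>" n, OF S(1-3,5) tS u c0 c(1) up ku]
      Xi_double_integral[of S' S u t c n "- \<sigma>" "e - \<sigma>" e k, OF S(2,1) S3' S(4) u tS c0 c(1,3) kn]
    by (simp only:)
  moreover have "Iv (S \<union> S') (\<lambda>a. if a \<in> S then t a else c * u a) (\<lambda>a. if a \<in> S then n a else k a + 0 + (e - \<sigma>) - e) e = Iv (S \<union> S') t n e"
    by (intro Iv_cong) (auto simp: cu k_def)
  moreover have "Iv (S' \<union> S) (\<lambda>a. if a \<in> S' then u a else c * t a) (\<lambda>a. if a \<in> S' then k a else n a + - \<sigma> + e - (e - \<sigma>)) (e - \<sigma>)
     = Iv (S \<union> S') (\<lambda>a. if a \<in> S then c * t a else t a / c) (\<lambda>a. if a \<in> S then n a else n a + \<sigma>) (e - \<sigma>)"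
    unfolding Un_commute[of S'] by (intro Iv_cong) (use S in \<open>auto simp: u_def k_def\<close>)
  moreover have "G (c\<^sup>2) (- \<sigma>) \<noteq> 0"
    using c(1,2) by (intro G_nz) (auto simp: norm_power power_less_one_iff)
  moreover have "2 * 0 - e + (e - \<sigma>) = - \<sigma>" "2 * (- \<sigma>) - (e - \<sigma>) + e = - \<sigma>" by simp_all
  ultimately have E: "PG S' u k (e - \<sigma>) * Iv (S \<union> S') t n e = PG S t n e *
     Iv (S \<union> S') (\<lambda>a. if a \<in> S then c * t a else t a / c) (\<lambda>a. if a \<in> S then n a else n a + \<sigma>) (e - \<sigma>)"
    using qq_nz by simp
  \<comment> \<open>This moves the gamma product that stands at the integral with the original
    parameters to the other side.\<close>
  have "PG S' t n e * PG S' u k (e - \<sigma>) = 1"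
  proof (rule PG_complement[OF S(5)])
    fix x assume x: "x \<subseteq> S'" "card x = 2"
    have fx: "finite x" using x fin finite_subset by blast
    have cx: "card (S' - x) = 2" using x fin S fx by (simp add: card_Diff_subset)
    have "(\<Prod>a\<in>x. t a) * (\<Prod>a\<in>S' - x. u a) = (\<Prod>a\<in>x. t a) * (\<Prod>a\<in>S' - x. t a) / c\<^sup>2"
      by (simp add: u_def prod_dividef cx)
    also have "(\<Prod>a\<in>x. t a) * (\<Prod>a\<in>S' - x. t a) = (\<Prod>a\<in>S'. t a)"
      using prod.subset_diff[OF x(1) fin(2), of t] by (simp add: mult.commute)
    also have "\<dots> = c ^ 4 * (\<Prod>a\<in>S'. u a)"
      unfolding u_def prod_dividef prod_constant S(5) using c0 by simp
    also have "\<dots> / c\<^sup>2 = p * q" using up c0 unfolding c4 mult.assoc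
      by (simp only: nonzero_mult_div_cancel_left power_not_zero not_False_eq_True)
    finally show "(\<Prod>a\<in>x. t a) * (\<Prod>a\<in>S' - x. u a) = p * q" .
    have "(\<Sum>a\<in>x. n a) + (\<Sum>a\<in>S' - x. n a) = (\<Sum>a\<in>S'. n a)"
      using sum.subset_diff[OF x(1) fin(2), of n] by simp
    thus "(\<Sum>a\<in>x. n a) + (\<Sum>a\<in>S' - x. k a) + e + (e - \<sigma>) = 0"
      using n \<sigma> by (simp add: k_def sum.distrib cx)
  qed (use t u in auto)
  hence "Iv (S \<union> S') t n e = PG S' t n e * (PG S' u k (e - \<sigma>) * Iv (S \<union> S') t n e)" by (simp add: mult.assoc[symmetric])
  thus ?thesis unfolding E by (simp only: mult_ac)
qed

end

section \<open>Composition of three transformations\<close>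

lemma set_1_8: "{1..8::nat} = {1, 2, 3, 4, 5, 6, 7, 8}" by auto

context rarefied
begin

lemma PG_4: "distinct [a, b, c, d] \<Longrightarrow> PG {a, b, c, d} t n e =
    G (t a * t b) (n a + n b + e) * G (t a * t c) (n a + n c + e) * G (t a * t d) (n a + n d + e) *
    G (t b * t c) (n b + n c + e) * G (t b * t d) (n b + n d + e) * G (t c * t d) (n c + n d + e)"
  by (simp add: PG_insert mult.assoc)

text \<open>The conditions under which \<open>first_transformation\<close> applies three times. The
  first three give each multiplier modulus below 1, the next puts t 5, ..., t 8 divided by c1 into
  the disc, and the last four do so for the parameters 3, 4, 7, 8 that the second step divides by
  c2.\<close>

definition near :: "(nat \<Rightarrow> complex) \<Rightarrow> bool" where
  "near t \<longleftrightarrow> norm (p * q) < norm (t 1 * t 2 * t 3 * t 4) \<and> norm (p * q) < norm (t 1 * t 2 * t 5 * t 6)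
     \<and> norm (p * q) < norm (t 1 * t 2 * t 7 * t 8)
     \<and> (\<forall>b\<in>{5, 6, 7, 8}. (norm (t b))\<^sup>2 * norm (t 1 * t 2 * t 3 * t 4) < norm (p * q))
     \<and> norm (t 3 * t 5 * t 6) < norm (t 4) \<and> norm (t 4 * t 5 * t 6) < norm (t 3)
     \<and> norm (t 1 * t 2 * t 7) < norm (t 8) \<and> norm (t 1 * t 2 * t 8) < norm (t 7)"

text \<open>The composite sends t a to s / t b, where b is the partner of a in the pairs 12, 34, 56,
  78. In the collected gamma products these four pairs occur twice and once reflected, so once in
  effect; every other pair occurs exactly once. Together this is \<open>PG {1..8}\<close>.\<close>

lemma transformation_near:
  assumes s: "s\<^sup>2 = p * q" and t: "\<And>a. a \<in> {1..8} \<Longrightarrow> norm s < norm (t a) \<and> norm (t a) < 1"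
    and tp: "(\<Prod>a=1..8. t a) = (p * q)\<^sup>2" and n: "(\<Sum>a=1..8. n a) + 4 * e = 0" and near: "near t"
  shows "Iv {1..8} t n e = PG {1..8} t n e * Iv {1..8} (\<lambda>a. s / t a) (\<lambda>a. - n a - e) e"
proof -
  have t0: "t a \<noteq> 0" if "a \<in> {1..8}" for a using t[OF that] by auto
  have t0s: "t 1 \<noteq> 0" "t 2 \<noteq> 0" "t 3 \<noteq> 0" "t 4 \<noteq> 0" "t 5 \<noteq> 0" "t 6 \<noteq> 0" "t 7 \<noteq> 0" "t 8 \<noteq> 0"
    by (simp_all add: t0)
  have s0: "s \<noteq> 0" using s by auto
  define X1 X2 X3 where "X1 = t 1 * t 2 * t 3 * t 4" "X2 = t 1 * t 2 * t 5 * t 6" "X3 = t 1 * t 2 * t 7 * t 8"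
  have X0: "X1 \<noteq> 0" "X2 \<noteq> 0" "X3 \<noteq> 0" using t0s by (simp_all add: X1_X2_X3_def)
  \<comment> \<open>c1 and c2 may be any square roots, but c3 is tied to them and to s: otherwise
    the final parameters would agree with s / t only up to sign.\<close>
  define c1 c2 c3 where "c1 = csqrt (s\<^sup>2 / X1)" "c2 = csqrt (s\<^sup>2 / X2)" "c3 = s / (t 1 * t 2 * c1 * c2)"
  have c1: "c1\<^sup>2 * X1 = s\<^sup>2" and c2: "c2\<^sup>2 * X2 = s\<^sup>2" using X0 by (simp_all add: c1_c2_c3_def)
  hence c0: "c1 \<noteq> 0" "c2 \<noteq> 0" using s0 by auto
  hence c30: "c3 \<noteq> 0" using s0 t0s by (simp add: c1_c2_c3_def)
  have c3': "c3 * (t 1 * t 2 * c1 * c2) = s" using c0 t0s by (simp add: c1_c2_c3_def)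
  have P8: "t 1 * t 2 * t 3 * t 4 * t 5 * t 6 * t 7 * t 8 = s ^ 4"
    using tp unfolding set_1_8 s[symmetric] by (simp add: mult.assoc flip: power_mult)
  have c3: "c3\<^sup>2 * X3 = s\<^sup>2"
  proof -
    have "(s\<^sup>2 * s\<^sup>2) * (c3\<^sup>2 * X3) = (c1\<^sup>2 * X1) * (c2\<^sup>2 * X2) * (c3\<^sup>2 * X3)" using c1 c2 by simp
    also have "\<dots> = (c3 * (t 1 * t 2 * c1 * c2))\<^sup>2 * (t 1 * t 2 * t 3 * t 4 * t 5 * t 6 * t 7 * t 8)"
      unfolding X1_X2_X3_def power2_eq_square by (simp only: mult_ac)
    also have "\<dots> = (s\<^sup>2 * s\<^sup>2) * s\<^sup>2" unfolding c3' P8 by (simp flip: power_add)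
    finally have E: "(s\<^sup>2 * s\<^sup>2) * (c3\<^sup>2 * X3) = (s\<^sup>2 * s\<^sup>2) * s\<^sup>2" .
    show ?thesis by (rule mult_left_cancel[THEN iffD1, OF _ E]) (use s0 in simp)
  qed
  have P: "norm (p * q) = (norm s)\<^sup>2" by (simp add: norm_power flip: s)
  have prod_lt: "norm (a * b * c * d) < 1 \<and> norm (a * b * c * d) \<le> norm (a * b) \<and> norm (a * b * c * d) \<le> norm (c * d)"
    if "norm a < 1" "norm b < 1" "norm c < 1" "norm d < 1" for a b c d :: complex
  proof -
    have 2: "norm (x * y) < 1" if "norm x < 1" "norm y < 1" for x y :: complex
      using that mult_strict_mono[of "norm x" 1 "norm y" 1] by (simp add: norm_mult)
    have eq: "norm (a * b * c * d) = norm (a * b) * norm (c * d)" by (simp add: norm_mult)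
    have l: "norm (a * b) < 1" "norm (c * d) < 1" using that by (auto intro: 2)
    have "norm (a * b) * norm (c * d) \<le> norm (a * b) * 1" "norm (a * b) * norm (c * d) \<le> 1 * norm (c * d)"
      using l by (intro mult_left_mono mult_right_mono; simp)+
    thus ?thesis using l unfolding eq by simp
  qed
  have X: "norm (p * q) < norm X1" "norm (p * q) < norm X2" "norm (p * q) < norm X3"
    and X1: "norm X1 < 1" "norm X2 < 1" "norm X3 < 1"
    using near t unfolding near_def X1_X2_X3_def by (auto simp: prod_lt)
  have c_bounds: "norm c < 1 \<and> norm (p * q) < norm (c\<^sup>2)" if c: "c\<^sup>2 * Y = s\<^sup>2" and Y: "norm (p * q) < norm Y" "norm Y < 1" for c Y
  proof -
    have e: "norm (c\<^sup>2) * norm Y = norm (p * q)" unfolding norm_mult[symmetric] c s ..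
    have Y0: "norm Y > 0" using Y(1) by (metis norm_ge_zero order_le_less_trans)
    have pq0: "norm (p * q) > 0" by simp
    have "norm (c\<^sup>2) = norm (p * q) / norm Y" using e Y0 by (simp add: field_simps)
    moreover have "norm (p * q) / norm Y < 1" using Y Y0 by simp
    moreover have "norm (p * q) < norm (p * q) / norm Y" using Y Y0 pq0 by (simp add: less_divide_eq)
    ultimately have "norm (c\<^sup>2) < 1" "norm (p * q) < norm (c\<^sup>2)" by simp_all
    thus ?thesis by (simp add: norm_power power_less_one_iff)
  qed
  note cb1 = c_bounds[OF c1 X(1) X1(1)] and cb2 = c_bounds[OF c2 X(2) X1(2)] and cb3 = c_bounds[OF c3 X(3) X1(3)]

  define \<sigma>1 \<sigma>2 \<sigma>3 where "\<sigma>1 = n 1 + n 2 + n 3 + n 4 + 2 * e" "\<sigma>2 = n 1 + n 2 + n 5 + n 6 + 2 * e"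
    "\<sigma>3 = n 1 + n 2 + n 7 + n 8 + 2 * e"
  define t1 where "t1 = (\<lambda>a. if a \<in> {1, 2, 3, 4} then c1 * t a else t a / c1)"
  define n1 where "n1 = (\<lambda>a. if a \<in> {1, 2, 3, 4} then n a else n a + \<sigma>1)"
  define t2 where "t2 = (\<lambda>a. if a \<in> {1, 2, 5, 6} then c2 * t1 a else t1 a / c2)"
  define n2 where "n2 = (\<lambda>a. if a \<in> {1, 2, 5, 6} then n1 a else n1 a + \<sigma>2)"
  define t3 where "t3 = (\<lambda>a. if a \<in> {1, 2, 7, 8} then c3 * t2 a else t2 a / c3)"
  define n3 where "n3 = (\<lambda>a. if a \<in> {1, 2, 7, 8} then n2 a else n2 a + \<sigma>3)"
  define e1 e2 e3 where "e1 = e - \<sigma>1" "e2 = e1 - \<sigma>2" "e3 = e2 - \<sigma>3"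
  note es = e1_e2_e3_def and \<sigma>s = \<sigma>1_\<sigma>2_\<sigma>3_def
  have t1v: "t1 1 = c1 * t 1" "t1 2 = c1 * t 2" "t1 3 = c1 * t 3" "t1 4 = c1 * t 4"
    "t1 5 = t 5 / c1" "t1 6 = t 6 / c1" "t1 7 = t 7 / c1" "t1 8 = t 8 / c1" by (simp_all add: t1_def)
  have t2v: "t2 1 = c2 * (c1 * t 1)" "t2 2 = c2 * (c1 * t 2)" "t2 3 = c1 * t 3 / c2" "t2 4 = c1 * t 4 / c2"
    "t2 5 = c2 * (t 5 / c1)" "t2 6 = c2 * (t 6 / c1)" "t2 7 = t 7 / c1 / c2" "t2 8 = t 8 / c1 / c2" by (simp_all add: t2_def t1v)
  have n1v: "n1 1 = n 1" "n1 2 = n 2" "n1 3 = n 3" "n1 4 = n 4"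
    "n1 5 = n 5 + \<sigma>1" "n1 6 = n 6 + \<sigma>1" "n1 7 = n 7 + \<sigma>1" "n1 8 = n 8 + \<sigma>1" by (simp_all add: n1_def)
  have n2v: "n2 1 = n 1" "n2 2 = n 2" "n2 3 = n 3 + \<sigma>2" "n2 4 = n 4 + \<sigma>2"
    "n2 5 = n 5 + \<sigma>1" "n2 6 = n 6 + \<sigma>1" "n2 7 = n 7 + \<sigma>1 + \<sigma>2" "n2 8 = n 8 + \<sigma>1 + \<sigma>2" by (simp_all add: n2_def n1v)
  have n8: "n 8 = - 4 * e - n 1 - n 2 - n 3 - n 4 - n 5 - n 6 - n 7" using n unfolding set_1_8 by simp

  have q1: "c1 * c1 * (t 1 * t 2 * t 3 * t 4) = s * s" using c1 by (simp only: X1_X2_X3_def power2_eq_square)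
  have q2: "c2 * c2 * (t 1 * t 2 * t 5 * t 6) = s * s" using c2 by (simp only: X1_X2_X3_def power2_eq_square)
  have q3: "c3 * c3 * (t 1 * t 2 * t 7 * t 8) = s * s" using c3 by (simp only: X1_X2_X3_def power2_eq_square)
  have pqs: "p * q = s * s" using s by (simp add: power2_eq_square)
  have P8': "t 1 * t 2 * t 3 * t 4 * t 5 * t 6 * t 7 * t 8 = s * s * s * s" using P8 by (simp add: power4_eq_xxxx)
  have c12: "c1 * c1 * (c2 * c2) * (t 1 * t 2) = t 7 * t 8"
  proof -
    have "(t 1 * t 2 * t 3 * t 4 * t 5 * t 6) * (c1 * c1 * (c2 * c2) * (t 1 * t 2)) = (t 1 * t 2 * t 3 * t 4 * t 5 * t 6) * (t 7 * t 8)"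
      using q1 q2 P8' by algebra
    thus ?thesis using t0s by simp
  qed

  have lt1: "norm (t1 a) < 1" "t1 a \<noteq> 0" if "a \<in> {1..8}" for a
  proof -
    have "norm (t a / c1) < 1" if "a \<in> {5, 6, 7, 8}" for a
    proof -
      have "(norm (t a))\<^sup>2 * norm X1 < norm (p * q)" using near that unfolding near_def X1_X2_X3_def by blast
      also have "norm (p * q) = (norm c1)\<^sup>2 * norm X1" unfolding s[symmetric] c1[symmetric] by (simp add: norm_mult norm_power)
      finally have "(norm (t a))\<^sup>2 < (norm c1)\<^sup>2" using X0 by simp
      thus ?thesis using c0 by (simp add: norm_divide power_less_imp_less_base)
    qed
    moreover have "norm (c1 * t a) < 1" if "a \<in> {1, 2, 3, 4}" for a
      using cb1 t[of a] that mult_strict_mono[of "norm c1" 1 "norm (t a)" 1] by (auto simp: norm_mult)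
    moreover have "a \<in> {1, 2, 3, 4} \<or> a \<in> {5, 6, 7, 8}" using that unfolding set_1_8 by auto
    ultimately show "norm (t1 a) < 1" unfolding t1_def by auto
    show "t1 a \<noteq> 0" using c0 t0[OF that] by (simp add: t1_def)
  qed
  have lt2: "norm (t2 a) < 1" "t2 a \<noteq> 0" if "a \<in> {1..8}" for a
  proof -
    have *: "norm x < norm c2" if x: "x * x * y = c2 * c2 * z" and zy: "norm z < norm y" for x y z
    proof -
      have y: "norm y > 0" using zy norm_ge_zero[of z] by linarith
      have "norm (x * x) * norm y = norm (c2 * c2) * norm z" unfolding norm_mult[symmetric] x ..
      also have "\<dots> < norm (c2 * c2) * norm y" using zy c0 by (intro mult_strict_left_mono) auto
      finally have "norm (x * x) < norm (c2 * c2)" using y by simp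
      hence "(norm x)\<^sup>2 < (norm c2)\<^sup>2" by (simp add: norm_mult power2_eq_square)
      thus ?thesis by (rule power_less_imp_less_base) simp
    qed
    have nr: "norm (t 3 * t 5 * t 6) < norm (t 4)" "norm (t 4 * t 5 * t 6) < norm (t 3)"
      "norm (t 1 * t 2 * t 7) < norm (t 8)" "norm (t 1 * t 2 * t 8) < norm (t 7)"
      using near unfolding near_def by auto
    have l: "c2 * c2 * (t 5 * t 6) = c1 * c1 * (t 3 * t 4)"
    proof -
      have "(t 1 * t 2) * (c2 * c2 * (t 5 * t 6)) = (t 1 * t 2) * (c1 * c1 * (t 3 * t 4))" using q1 q2 by algebra
      thus ?thesis using t0s by simp
    qed
    have r: "c1 * t 3 * (c1 * t 3) * t 4 = c2 * c2 * (t 3 * t 5 * t 6)"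
      "c1 * t 4 * (c1 * t 4) * t 3 = c2 * c2 * (t 4 * t 5 * t 6)" using l by algebra+
    have "c1 * c1 * (c2 * c2 * (t 1 * t 2 * t 7)) = t 7 * t 7 * t 8" "c1 * c1 * (c2 * c2 * (t 1 * t 2 * t 8)) = t 8 * t 8 * t 7"
      using c12 by algebra+
    hence r': "t 7 / c1 * (t 7 / c1) * t 8 = c2 * c2 * (t 1 * t 2 * t 7)" "t 8 / c1 * (t 8 / c1) * t 7 = c2 * c2 * (t 1 * t 2 * t 8)"
      using c0 by (auto simp: divide_eq_eq mult_ac)
    have "norm (t1 a) < norm c2" if "a \<in> {3, 4, 7, 8}" for a
      using that *[OF r(1) nr(1)] *[OF r(2) nr(2)] *[OF r'(1) nr(3)] *[OF r'(2) nr(4)] by (auto simp: t1v)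
    hence "norm (t1 a / c2) < 1" if "a \<in> {3, 4, 7, 8}" for a using c0 that by (auto simp: norm_divide)
    moreover have "norm (c2 * t1 a) < 1"
      using cb2 lt1[OF that] mult_strict_mono[of "norm c2" 1 "norm (t1 a)" 1] by (simp add: norm_mult)
    moreover have "a \<in> {1, 2, 5, 6} \<or> a \<in> {3, 4, 7, 8}" using that unfolding set_1_8 by auto
    ultimately show "norm (t2 a) < 1" unfolding t2_def by auto
    show "t2 a \<noteq> 0" using c0 lt1(2)[OF that] by (simp add: t2_def)
  qed
  have t3v: "t3 1 = s / t 2" "t3 2 = s / t 1" "t3 3 = s / t 4" "t3 4 = s / t 3"
      "t3 5 = s / t 6" "t3 6 = s / t 5" "t3 7 = s / t 8" "t3 8 = s / t 7"
  proof -
    have v: "t3 1 = c3 * (c2 * (c1 * t 1))" "t3 2 = c3 * (c2 * (c1 * t 2))" "t3 3 = c1 * t 3 / c2 / c3" "t3 4 = c1 * t 4 / c2 / c3"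
      "t3 5 = c2 * (t 5 / c1) / c3" "t3 6 = c2 * (t 6 / c1) / c3" "t3 7 = c3 * (t 7 / c1 / c2)" "t3 8 = c3 * (t 8 / c1 / c2)"
      by (simp_all add: t3_def t2v)
    have a: "c1 * t 3 * t 4 = s * (c2 * c3)"
    proof -
      have "(t 1 * t 2 * c1) * (c1 * t 3 * t 4) = (t 1 * t 2 * c1) * (s * (c2 * c3))" using q1 c3' by algebra
      thus ?thesis using t0s c0 by simp
    qed
    have b: "c2 * t 5 * t 6 = s * (c1 * c3)"
    proof -
      have "(t 1 * t 2 * c2) * (c2 * t 5 * t 6) = (t 1 * t 2 * c2) * (s * (c1 * c3))" using q2 c3' by algebra
      thus ?thesis using t0s c0 by simp
    qed
    have d: "c3 * t 7 * t 8 = s * (c1 * c2)"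
    proof -
      have "(t 1 * t 2 * c3) * (c3 * t 7 * t 8) = (t 1 * t 2 * c3) * (s * (c1 * c2))" using q3 c3' by algebra
      thus ?thesis using t0s c30 by simp
    qed
    show "t3 1 = s / t 2" "t3 2 = s / t 1" unfolding v using t0s c3' by (simp_all add: eq_divide_eq mult_ac)
    show "t3 3 = s / t 4" "t3 4 = s / t 3" unfolding v using t0s c0 c30 a by (simp_all add: frac_eq_eq mult_ac)
    show "t3 5 = s / t 6" "t3 6 = s / t 5" unfolding v using t0s c0 c30 b by (simp_all add: frac_eq_eq mult_ac)
    show "t3 7 = s / t 8" "t3 8 = s / t 7" unfolding v using t0s c0 c30 d by (simp_all add: frac_eq_eq mult_ac)
  qed
  have un: "{1, 2, 3, 4} \<union> {5, 6, 7, 8} = {1..8::nat}" "{1, 2, 5, 6} \<union> {3, 4, 7, 8} = {1..8::nat}"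
    "{1, 2, 7, 8} \<union> {3, 4, 5, 6} = {1..8::nat}" by (auto simp: set_1_8)
  have step1: "Iv {1..8} t n e = PG {1, 2, 3, 4} t n e * PG {5, 6, 7, 8} t n e * Iv {1..8} t1 n1 e1"
    unfolding un(1)[symmetric] t1_def n1_def es
  proof (rule first_transformation)
    show "norm (t b) < norm c1" if "b \<in> {5, 6, 7, 8}" for b
      using lt1(1)[of b] that c0 by (auto simp: t1_def norm_divide)
    show "t a \<noteq> 0 \<and> norm (t a) < 1" if "a \<in> {1, 2, 3, 4} \<union> {5, 6, 7, 8}" for a
      using that t t0 unfolding un by blast
    show "c1\<^sup>2 * (\<Prod>a\<in>{1, 2, 3, 4}. t a) = p * q" using c1 s by (simp add: X1_X2_X3_def mult.assoc)
    show "(\<Prod>a\<in>{1, 2, 3, 4}. t a) * (\<Prod>a\<in>{5, 6, 7, 8}. t a) = (p * q)\<^sup>2" using tp unfolding set_1_8 by (simp add: mult.assoc)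
    show "(\<Sum>a\<in>{1, 2, 3, 4}. n a) + (\<Sum>a\<in>{5, 6, 7, 8}. n a) + 4 * e = 0" using n8 by simp
    show "\<sigma>1 = (\<Sum>a\<in>{1, 2, 3, 4}. n a) + 2 * e" by (simp add: \<sigma>s)
  qed (use cb1 in auto)
  have step2: "Iv {1..8} t1 n1 e1 = PG {1, 2, 5, 6} t1 n1 e1 * PG {3, 4, 7, 8} t1 n1 e1 * Iv {1..8} t2 n2 e2"
    unfolding un(2)[symmetric] t2_def n2_def es(2)
  proof (rule first_transformation)
    show "norm (t1 b) < norm c2" if "b \<in> {3, 4, 7, 8}" for b
      using lt2(1)[of b] that c0 by (auto simp: t2_def norm_divide)
    show "t1 a \<noteq> 0 \<and> norm (t1 a) < 1" if "a \<in> {1, 2, 5, 6} \<union> {3, 4, 7, 8}" for a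
      using that lt1 unfolding un by blast
    show a: "c2\<^sup>2 * (\<Prod>a\<in>{1, 2, 5, 6}. t1 a) = p * q"
      using q2 c0 unfolding pqs by (simp add: t1v power2_eq_square mult_ac)
    show "(\<Prod>a\<in>{1, 2, 5, 6}. t1 a) * (\<Prod>a\<in>{3, 4, 7, 8}. t1 a) = (p * q)\<^sup>2"
      using P8' c0 unfolding pqs by (simp add: t1v power2_eq_square mult_ac)
    show "(\<Sum>a\<in>{1, 2, 5, 6}. n1 a) + (\<Sum>a\<in>{3, 4, 7, 8}. n1 a) + 4 * e1 = 0" by (simp add: n1v es \<sigma>s n8)
    show "\<sigma>2 = (\<Sum>a\<in>{1, 2, 5, 6}. n1 a) + 2 * e1" by (simp add: n1v es \<sigma>s)
  qed (use cb2 in auto)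
  have step3: "Iv {1..8} t2 n2 e2 = PG {1, 2, 7, 8} t2 n2 e2 * PG {3, 4, 5, 6} t2 n2 e2 * Iv {1..8} t3 n3 e3"
    unfolding un(3)[symmetric] t3_def n3_def es(3)
  proof (rule first_transformation)
    \<comment> \<open>No condition in \<open>near\<close> is needed for the third step: its
      quotients t2 b / c3 are already final parameters s / t a, of modulus below 1.\<close>
    show "norm (t2 b) < norm c3" if "b \<in> {3, 4, 5, 6}" for b
    proof -
      have "norm (t3 b) < 1" using that t by (auto simp: t3v norm_divide divide_less_eq)
      thus ?thesis using that c30 by (auto simp: t3_def norm_divide)
    qed
    show "t2 a \<noteq> 0 \<and> norm (t2 a) < 1" if "a \<in> {1, 2, 7, 8} \<union> {3, 4, 5, 6}" for a
      using that lt2 unfolding un by blast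
    show a: "c3\<^sup>2 * (\<Prod>a\<in>{1, 2, 7, 8}. t2 a) = p * q"
      using q3 c0 unfolding pqs by (simp add: t2v power2_eq_square mult_ac)
    show "(\<Prod>a\<in>{1, 2, 7, 8}. t2 a) * (\<Prod>a\<in>{3, 4, 5, 6}. t2 a) = (p * q)\<^sup>2"
      using P8' c0 unfolding pqs by (simp add: t2v power2_eq_square mult_ac)
    show "(\<Sum>a\<in>{1, 2, 7, 8}. n2 a) + (\<Sum>a\<in>{3, 4, 5, 6}. n2 a) + 4 * e2 = 0" by (simp add: n2v es \<sigma>s n8)
    show "\<sigma>3 = (\<Sum>a\<in>{1, 2, 7, 8}. n2 a) + 2 * e2" by (simp add: n2v es \<sigma>s)
  qed (use cb3 in auto)

  \<comment> \<open>The three steps change e by an even number in total, namely 2 d;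
    \<open>Iv_shift\<close> undoes this together with the common shift of the indices.\<close>
  define d where "d = - n 1 - n 2 - e"
  define \<pi> where "\<pi> = id(1 := 2, 2 := 1, 3 := 4, 4 := 3, 5 := 6, 6 := 5, 7 := 8, 8 := 7 :: nat)"
  have \<pi>: "bij_betw \<pi> {1..8} {1..8}"
    by (rule bij_betw_byWitness[of _ \<pi>]) (auto simp: \<pi>_def set_1_8)
  have "Iv {1..8} t3 n3 e3 = Iv {1..8} (\<lambda>a. s / t (\<pi> a)) (\<lambda>a. (- n (\<pi> a) - e) - d) (e + 2 * d)"
  proof -
    have "e3 = e + 2 * d" by (simp add: es \<sigma>s d_def n8)
    moreover have "t3 a = s / t (\<pi> a) \<and> n3 a = (- n (\<pi> a) - e) - d" if "a \<in> {1..8}" for a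
      using that unfolding set_1_8 by (auto simp: t3v \<pi>_def n3_def n2v \<sigma>s d_def n8)
    ultimately show ?thesis by (auto intro: Iv_cong)
  qed
  also have "\<dots> = Iv {1..8} (\<lambda>a. s / t (\<pi> a)) (\<lambda>a. - n (\<pi> a) - e) e"
  proof (rule Iv_shift[of 2])
    have "(\<Prod>a=1..8. s / t (\<pi> a)) = (\<Prod>a=1..8. s / t a)"
      using prod.reindex_bij_betw[OF \<pi>, of "\<lambda>a. s / t a"] .
    also have "\<dots> = s ^ 8 / (p * q)\<^sup>2" by (simp add: prod_dividef tp)
    also have "s ^ 8 = (p * q)\<^sup>2 * (p * q)\<^sup>2" by (simp flip: s power_mult power_add)
    also have "(p * q)\<^sup>2 * (p * q)\<^sup>2 / (p * q)\<^sup>2 = (p * q)\<^sup>2" by (rule nonzero_mult_div_cancel_right) simp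
    finally have "(\<Prod>a=1..8. s / t (\<pi> a)) = (p * q)\<^sup>2" .
    moreover have "(\<Sum>a=1..8. - n (\<pi> a) - e) = (\<Sum>a=1..8. - n a - e)"
      using sum.reindex_bij_betw[OF \<pi>, of "\<lambda>a. - n a - e"] .
    moreover have "(\<Sum>a=1..8. - n a - e) = - 4 * e" unfolding set_1_8 by (simp add: n8)
    moreover have "s / t (\<pi> a) \<noteq> 0" if "a \<in> {1..8}" for a
      using t0[of "\<pi> a"] bij_betwE[OF \<pi>] that s0 by auto
    ultimately show "bal 2 {1..8} (\<lambda>a. s / t (\<pi> a)) (\<lambda>a. - n (\<pi> a) - e) e" by (simp add: bal_def)
  qed
  also have "\<dots> = Iv {1..8} (\<lambda>a. s / t a) (\<lambda>a. - n a - e) e"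
    using Iv_reindex[OF \<pi>, of "\<lambda>a. s / t a" "\<lambda>a. - n a - e" e] .
  finally have I: "Iv {1..8} t3 n3 e3 = Iv {1..8} (\<lambda>a. s / t a) (\<lambda>a. - n a - e) e" .

  \<comment> \<open>\<open>h a b\<close> is the reflection partner of \<open>g a b\<close>; it
    occurs only in the second step, for the four pairs 12, 34, 56, 78.\<close>
  define g where "g = (\<lambda>a b. G (t a * t b) (n a + n b + e))"
  define h where "h = (\<lambda>a b. G (p * q / (t a * t b)) (- (n a + n b + e)))"
  have gh: "g a b * h a b = 1" if "norm (p * q) < norm (t a * t b)" "a \<in> {1..8}" "b \<in> {1..8}" for a b
    unfolding g_def h_def using that t[of a] t[of b] mult_strict_mono[of "norm (t a)" 1 "norm (t b)" 1]
    by (intro G_reflect) (auto simp: norm_mult)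
  have gh': "g 1 2 * h 1 2 = 1" "g 3 4 * h 3 4 = 1" "g 5 6 * h 5 6 = 1" "g 7 8 * h 7 8 = 1"
    using X prod_lt[of "t 1" "t 2" "t 3" "t 4"] prod_lt[of "t 1" "t 2" "t 5" "t 6"] prod_lt[of "t 1" "t 2" "t 7" "t 8"] t
    unfolding X1_X2_X3_def by (auto intro!: gh)
  have PG1: "PG {1, 2, 3, 4} t n e * PG {5, 6, 7, 8} t n e =
     (g 1 2 * g 1 3 * g 1 4 * g 2 3 * g 2 4 * g 3 4) * (g 5 6 * g 5 7 * g 5 8 * g 6 7 * g 6 8 * g 7 8)"
    unfolding g_def by (subst PG_4, simp)+ (rule refl)
  have PG2: "PG {1, 2, 5, 6} t1 n1 e1 * PG {3, 4, 7, 8} t1 n1 e1 =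
     (h 3 4 * g 1 5 * g 1 6 * g 2 5 * g 2 6 * h 7 8) * (h 1 2 * g 3 7 * g 3 8 * g 4 7 * g 4 8 * h 5 6)"
  proof -
    have m: "t1 1 * t1 2 = p * q / (t 3 * t 4)" "t1 5 * t1 6 = p * q / (t 7 * t 8)"
      "t1 3 * t1 4 = p * q / (t 1 * t 2)" "t1 7 * t1 8 = p * q / (t 5 * t 6)"
    proof -
      have k: "t 5 * t 6 * (t 7 * t 8) = p * q * (c1 * c1)"
      proof -
        have "(t 1 * t 2 * t 3 * t 4) * (t 5 * t 6 * (t 7 * t 8)) = (t 1 * t 2 * t 3 * t 4) * (p * q * (c1 * c1))"
          using q1 P8' pqs by algebra
        thus ?thesis using t0s by simp
      qed
      show "t1 1 * t1 2 = p * q / (t 3 * t 4)" "t1 3 * t1 4 = p * q / (t 1 * t 2)"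
        using q1 t0s unfolding pqs t1v by (simp_all add: eq_divide_eq mult_ac)
      show "t1 5 * t1 6 = p * q / (t 7 * t 8)" "t1 7 * t1 8 = p * q / (t 5 * t 6)"
        using k t0s c0 unfolding t1v by (simp_all add: frac_eq_eq mult_ac)
    qed
    have m': "t1 1 * t1 5 = t 1 * t 5" "t1 1 * t1 6 = t 1 * t 6" "t1 2 * t1 5 = t 2 * t 5" "t1 2 * t1 6 = t 2 * t 6"
      "t1 3 * t1 7 = t 3 * t 7" "t1 3 * t1 8 = t 3 * t 8" "t1 4 * t1 7 = t 4 * t 7" "t1 4 * t1 8 = t 4 * t 8"
      using c0 by (simp_all add: t1v)
    have i: "n1 1 + n1 2 + e1 = - (n 3 + n 4 + e)" "n1 5 + n1 6 + e1 = - (n 7 + n 8 + e)"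
      "n1 3 + n1 4 + e1 = - (n 1 + n 2 + e)" "n1 7 + n1 8 + e1 = - (n 5 + n 6 + e)"
      by (simp_all add: n1v es \<sigma>s n8)
    have i': "n1 1 + n1 5 + e1 = n 1 + n 5 + e" "n1 1 + n1 6 + e1 = n 1 + n 6 + e" "n1 2 + n1 5 + e1 = n 2 + n 5 + e"
      "n1 2 + n1 6 + e1 = n 2 + n 6 + e" "n1 3 + n1 7 + e1 = n 3 + n 7 + e" "n1 3 + n1 8 + e1 = n 3 + n 8 + e"
      "n1 4 + n1 7 + e1 = n 4 + n 7 + e" "n1 4 + n1 8 + e1 = n 4 + n 8 + e"
      by (simp_all add: n1v es)
    show ?thesis
      unfolding g_def h_def by (subst PG_4, simp)+ (simp only: m m' i i')
  qed
  have PG3: "PG {1, 2, 7, 8} t2 n2 e2 * PG {3, 4, 5, 6} t2 n2 e2 =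
     (g 7 8 * g 1 7 * g 1 8 * g 2 7 * g 2 8 * g 1 2) * (g 5 6 * g 3 5 * g 3 6 * g 4 5 * g 4 6 * g 3 4)"
  proof -
    have m: "t2 1 * t2 2 = t 7 * t 8" "t2 7 * t2 8 = t 1 * t 2"
      using c12 c0 by (simp_all add: t2v divide_eq_eq mult_ac)
    have l: "t 5 * t 6 * (c2 * c2) = t 3 * t 4 * (c1 * c1)"
    proof -
      have "(t 1 * t 2) * (t 5 * t 6 * (c2 * c2)) = (t 1 * t 2) * (t 3 * t 4 * (c1 * c1))" using q1 q2 by algebra
      thus ?thesis using t0s by simp
    qed
    have m2: "t2 3 * t2 4 = t 5 * t 6" "t2 5 * t2 6 = t 3 * t 4"
      using l c0 by (simp_all add: t2v divide_eq_eq mult_ac)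
    have m': "t2 1 * t2 7 = t 1 * t 7" "t2 1 * t2 8 = t 1 * t 8" "t2 2 * t2 7 = t 2 * t 7" "t2 2 * t2 8 = t 2 * t 8"
      "t2 3 * t2 5 = t 3 * t 5" "t2 3 * t2 6 = t 3 * t 6" "t2 4 * t2 5 = t 4 * t 5" "t2 4 * t2 6 = t 4 * t 6"
      using c0 by (simp_all add: t2v)
    have i: "n2 1 + n2 2 + e2 = n 7 + n 8 + e" "n2 7 + n2 8 + e2 = n 1 + n 2 + e"
      "n2 3 + n2 4 + e2 = n 5 + n 6 + e" "n2 5 + n2 6 + e2 = n 3 + n 4 + e"
      by (simp_all add: n2v es \<sigma>s n8)
    have i': "n2 1 + n2 7 + e2 = n 1 + n 7 + e" "n2 1 + n2 8 + e2 = n 1 + n 8 + e" "n2 2 + n2 7 + e2 = n 2 + n 7 + e"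
      "n2 2 + n2 8 + e2 = n 2 + n 8 + e" "n2 3 + n2 5 + e2 = n 3 + n 5 + e" "n2 3 + n2 6 + e2 = n 3 + n 6 + e"
      "n2 4 + n2 5 + e2 = n 4 + n 5 + e" "n2 4 + n2 6 + e2 = n 4 + n 6 + e"
      by (simp_all add: n2v es)
    show ?thesis
      unfolding g_def by (subst PG_4, simp)+ (simp only: m m2 m' i i')
  qed
  have PG8: "PG {1..8} t n e =
     g 1 2 * g 1 3 * g 1 4 * g 1 5 * g 1 6 * g 1 7 * g 1 8 * (g 2 3 * g 2 4 * g 2 5 * g 2 6 * g 2 7 * g 2 8) *
     (g 3 4 * g 3 5 * g 3 6 * g 3 7 * g 3 8) * (g 4 5 * g 4 6 * g 4 7 * g 4 8) * (g 5 6 * g 5 7 * g 5 8) * (g 6 7 * g 6 8) * g 7 8"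
    unfolding set_1_8 by (simp add: PG_insert g_def mult.assoc)
  have "(PG {1, 2, 3, 4} t n e * PG {5, 6, 7, 8} t n e) * (PG {1, 2, 5, 6} t1 n1 e1 * PG {3, 4, 7, 8} t1 n1 e1) *
      (PG {1, 2, 7, 8} t2 n2 e2 * PG {3, 4, 5, 6} t2 n2 e2)
     = ((g 1 2 * h 1 2) * (g 3 4 * h 3 4) * (g 5 6 * h 5 6) * (g 7 8 * h 7 8)) * PG {1..8} t n e"
    unfolding PG1 PG2 PG3 PG8 by (simp only: mult_ac)
  also have "\<dots> = PG {1..8} t n e" unfolding gh' by simp
  finally show ?thesis unfolding step1 step2 step3 I by (simp only: mult.assoc[symmetric])
qed

text \<open>While all moduli stay strictly between |s| and 1, the parameters s / t a remain in the
  disc too and both sides are holomorphic. The intermediate parameters need to make sense only near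
  the starting point.\<close>

lemma transformation:
  assumes s: "s\<^sup>2 = p * q" and t: "\<And>a. a \<in> {1..8} \<Longrightarrow> norm s < norm (t a) \<and> norm (t a) < 1"
    and tp: "(\<Prod>a=1..8. t a) = (p * q)\<^sup>2" and n: "(\<Sum>a=1..8. n a) + 4 * e = 0"
  shows "Iv {1..8} t n e = PG {1..8} t n e * Iv {1..8} (\<lambda>a. s / t a) (\<lambda>a. - n a - e) e"
proof -
  define l where "l = lp + lq"
  have Rl: "Re l < 0" using Re_lpq by (simp add: l_def)
  have t0: "t a \<noteq> 0" if "a \<in> {1..8}" for a using t[OF that] by auto
  have s0: "s \<noteq> 0" using s by auto
  have ns: "norm s = exp (Re l / 2)"
  proof -
    have "(norm s)\<^sup>2 = (exp (Re l / 2))\<^sup>2"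
      by (simp add: s pq_exp l_def flip: norm_power exp_double)
    thus ?thesis by (simp add: power2_eq_iff_nonneg)
  qed
  have "exp (\<Sum>a=1..8. Ln (t a)) = (\<Prod>a=1..8. t a)"
    by (subst exp_sum) (auto intro!: prod.cong simp: t0)
  hence eT: "exp (\<Sum>a=1..8. Ln (t a)) = (p * q)\<^sup>2" unfolding tp .
  also have "(p * q)\<^sup>2 = exp (2 * l)" unfolding pq_exp l_def exp_double ..
  finally obtain k :: int where k: "(\<Sum>a=1..8. Ln (t a)) = 2 * l + 2 * of_real pi * \<i> * of_int k"
    unfolding exp_eq by (auto simp: mult_ac)
  \<comment> \<open>Starting moduli |p q|^(1/16) twice and |p q|^(5/16) six times: the exponents add
    up to 2, each is below 1/2, and all inequalities of \<open>near\<close> hold strictly. The term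
    with k matches the sum of the chosen logarithms.\<close>
  define M where "M = (\<lambda>a::nat. if a = 1 then l / 16 + 2 * of_real pi * \<i> * of_int k else if a = 2 then l / 16 else 5 * l / 16)"
  define h where "h = (\<lambda>a \<xi>. (1 - \<xi>) * M a + \<xi> * Ln (t a))"
  define T where "T = (\<lambda>\<xi> a. exp (h a \<xi>))"
  \<comment> \<open>The strip of logarithms corresponding to |s| < |t a| < 1.\<close>
  define D where "D = {z. Re l / 2 < Re z} \<inter> {z. Re z < 0}"
  define U where "U = {\<xi>. \<forall>a\<in>{1..8}. h a \<xi> \<in> D}"
  have T: "T \<xi> a \<noteq> 0" "\<xi> \<in> U \<Longrightarrow> a \<in> {1..8} \<Longrightarrow> norm s < norm (T \<xi> a) \<and> norm (T \<xi> a) < 1" for \<xi> a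
    by (auto simp: T_def U_def D_def ns)
  have "(\<Sum>a=1..8. M a) = (\<Sum>a=1..8. Ln (t a))"
    unfolding k by (simp add: set_1_8 M_def field_simps)
  hence "(\<Sum>a=1..8. h a \<xi>) = (\<Sum>a=1..8. Ln (t a))" for \<xi>
    unfolding h_def sum.distrib sum_distrib_left[symmetric] by (simp only: algebra_simps) simp
  hence "(\<Prod>a=1..8. T \<xi> a) = exp (\<Sum>a=1..8. Ln (t a))" for \<xi>
    unfolding T_def by (simp flip: exp_sum)
  hence TP: "(\<Prod>a=1..8. T \<xi> a) = (p * q)\<^sup>2" for \<xi> by (simp only: eT)
  define f where "f = (\<lambda>\<xi>. Iv {1..8} (T \<xi>) n e - PG {1..8} (T \<xi>) n e * Iv {1..8} (\<lambda>a. s / T \<xi> a) (\<lambda>a. - n a - e) e)"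
  have "f 1 = 0"
  proof (rule affine_combination_continuation[where M = M and L = "\<lambda>a. Ln (t a)" and D = D and A = "{1..8}"])
    show oD: "open D" unfolding D_def by (intro open_Int open_halfspace_Re_lt open_halfspace_Re_gt)
    show "convex D" unfolding D_def by (intro convex_Int convex_halfspace_Re_lt convex_halfspace_Re_gt)
    show "M a \<in> D" for a using Rl by (auto simp: M_def D_def)
    show "Ln (t a) \<in> D" if "a \<in> {1..8}" for a
    proof -
      have "exp (Re l / 2) < norm (t a)" "norm (t a) < 1" using t[OF that] by (simp_all add: ns)
      moreover have "norm (t a) = exp (Re (Ln (t a)))" using t0[OF that] by simp
      ultimately have "exp (Re l / 2) < exp (Re (Ln (t a)))" "exp (Re (Ln (t a))) < exp 0" by simp_all
      thus ?thesis unfolding exp_less_cancel_iff by (simp add: D_def)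
    qed
    have oU: "open U"
    proof -
      have "U = (\<Inter>a\<in>{1..8}. h a -` D)" by (auto simp: U_def)
      moreover have "open (h a -` D)" for a
        unfolding h_def by (rule open_vimage[OF oD]) (intro continuous_intros)
      ultimately show ?thesis by (simp only:) (intro open_INT; simp)
    qed
    have Th: "(\<lambda>\<xi>. T \<xi> a) holomorphic_on U" for a unfolding T_def h_def by (intro holomorphic_intros)
    have "(\<lambda>\<xi>. Iv {1..8} (T \<xi>) n e) holomorphic_on U" "(\<lambda>\<xi>. PG {1..8} (T \<xi>) n e) holomorphic_on U"
      using T Th by (auto intro!: Iv_holomorphic PG_holomorphic oU)
    moreover have "(\<lambda>\<xi>. Iv {1..8} (\<lambda>a. s / T \<xi> a) (\<lambda>a. - n a - e) e) holomorphic_on U"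
    proof (rule Iv_holomorphic[OF oU])
      show "(\<lambda>\<xi>. s / T \<xi> a) holomorphic_on U" for a using Th T(1) by (auto intro!: holomorphic_intros)
      show "s / T \<xi> a \<noteq> 0 \<and> norm (s / T \<xi> a) < 1" if "\<xi> \<in> U" "a \<in> {1..8}" for \<xi> a
        using T(1)[of \<xi> a] T(2)[OF that] s0 by (simp add: norm_divide)
    qed
    ultimately have "f holomorphic_on U" unfolding f_def by (intro holomorphic_intros)
    thus "f holomorphic_on {\<xi>. \<forall>a\<in>{1..8}. (1 - \<xi>) * M a + \<xi> * Ln (t a) \<in> D}"
      by (simp add: U_def h_def)
    show "open {\<xi>. near (T \<xi>)}"
      unfolding near_def ball_simps T_def h_def
      by (intro open_Collect_conj open_Collect_less continuous_intros open_Collect_const)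
    have "norm (T 0 1) = exp (Re l / 16)" "norm (T 0 2) = exp (Re l / 16)" "norm (p * q) = exp (Re l)"
      by (simp_all add: T_def h_def M_def pq_exp l_def)
    moreover have "norm (T 0 3) = exp (5 * Re l / 16)" "norm (T 0 4) = exp (5 * Re l / 16)" "norm (T 0 5) = exp (5 * Re l / 16)"
      "norm (T 0 6) = exp (5 * Re l / 16)" "norm (T 0 7) = exp (5 * Re l / 16)" "norm (T 0 8) = exp (5 * Re l / 16)"
      by (simp_all add: T_def h_def M_def)
    ultimately have "near (T 0)"
      unfolding near_def ball_simps norm_mult
      by (simp only: power2_eq_square exp_add[symmetric] exp_less_cancel_iff) (use Rl in simp)
    thus "0 \<in> {\<xi>. near (T \<xi>)}" by simp
    fix \<xi> assume V: "\<xi> \<in> {\<xi>. near (T \<xi>)}" and "\<forall>a\<in>{1..8}. (1 - \<xi>) * M a + \<xi> * Ln (t a) \<in> D"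
    hence "\<xi> \<in> U" by (simp add: U_def h_def)
    from transformation_near[OF s T(2)[OF this] TP n] V show "f \<xi> = 0"
      by (simp add: f_def)
  qed simp
  moreover have "Iv {1..8} (T 1) n e = Iv {1..8} t n e" "PG {1..8} (T 1) n e = PG {1..8} t n e"
    "Iv {1..8} (\<lambda>a. s / T 1 a) (\<lambda>a. - n a - e) e = Iv {1..8} (\<lambda>a. s / t a) (\<lambda>a. - n a - e) e"
    by (intro Iv_cong PG_cong; simp add: T_def h_def t0)+
  ultimately show ?thesis by (simp add: f_def)
qed

section \<open>The rarefied hypergeometric function\<close>

text \<open>At z = 1 and z = -1 the pointwise quotient need not be meaningful, since a denominator
  may have a pole. Off these points \<open>G_Ker\<close> identifies it with \<open>Dl\<close>, which
  is continuous, and \<open>remove_sings\<close> supplies the limit.\<close>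

lemma rar_integrand_eq_Dl:
  assumes t: "\<And>a. a \<in> {1..8} \<Longrightarrow> t a \<noteq> 0 \<and> norm (t a) < 1" and z: "norm z = 1"
  shows "rar_integrand r e t n p q m z = Dl {1..8} t n e z m"
proof -
  \<comment> \<open>A neighbourhood of z on which every gamma function in the integrand is evaluated
    inside its domain, apart from w^2 = 1.\<close>
  define W where "W = {w. norm (w\<^sup>2) < Rad} \<inter> {w. 1 / Rad < norm (w\<^sup>2)} \<inter>
     (\<Inter>a\<in>{1..8}. {w. norm (t a * w) < 1} \<inter> {w. norm (t a) < norm w})"
  have oW: "open W"
    unfolding W_def by (intro open_Int open_INT ballI open_Collect_less continuous_intros) auto
  have zW: "z \<in> W" using t z Rad_gt_1 by (auto simp: W_def norm_mult norm_power)
  have W: "w \<noteq> 0" "t a * w \<in> dom k" "t a / w \<in> dom k" if "w \<in> W" "a \<in> {1..8}" for w a k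
  proof -
    have *: "norm (t a * w) < 1" "norm (t a) < norm w" using that unfolding W_def by blast+
    thus w0: "w \<noteq> 0" using norm_ge_zero[of "t a"] by auto
    show "t a * w \<in> dom k" "t a / w \<in> dom k"
      using * w0 t[OF that(2)] by (auto intro!: dom_unit simp: norm_divide)
  qed
  let ?f = "\<lambda>z. (\<Prod>a=1..8. rar_gamma r p q (t a * z) (n a + e + m) * rar_gamma r p q (t a * inverse z) (n a - m))
          / (rar_gamma r p q (z ^ 2) (2 * m + e) * rar_gamma r p q (inverse (z ^ 2)) (- 2 * m - e))"
  have "eventually (\<lambda>w. w \<in> W) (at z)" using oW zW eventually_at_topological by blast
  moreover have "eventually (\<lambda>w. w \<noteq> 1) (at z)" "eventually (\<lambda>w. w \<noteq> -1) (at z)"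
    by (rule eventually_neq_at_within)+
  ultimately have "eventually (\<lambda>w. ?f w = Dl {1..8} t n e w m) (at z)"
  proof eventually_elim
    case (elim w)
    have w0: "w \<noteq> 0" using W(1)[OF elim(1), of 1] by simp
    have w2: "w\<^sup>2 \<noteq> 1" using elim by (simp add: power2_eq_1_iff)
    have nw: "norm (w\<^sup>2) < Rad" "1 / Rad < norm (w\<^sup>2)" using elim by (auto simp: W_def)
    have "1 < norm (w\<^sup>2) * Rad" using nw(2) Rad_gt_1 by (simp add: field_simps)
    hence "norm (1 / w\<^sup>2) < Rad" using w0 by (simp add: norm_divide field_simps)
    moreover have "1 / w\<^sup>2 \<noteq> 1" using w0 w2 by (simp add: divide_eq_1_iff)
    ultimately have d: "w\<^sup>2 \<in> dom k" "1 / w\<^sup>2 \<in> dom k" for k using nw w0 w2 by (auto simp: dom_def)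
    have k: "- 2 * m - e = - (2 * m + e)" by simp
    have GK: "G (w\<^sup>2) (2 * m + e) * Ker (w\<^sup>2) (2 * m + e) * G (1 / w\<^sup>2) (- (2 * m + e)) = 1"
      by (rule G_Ker) (use nw w2 in auto)
    have gg: "rar_gamma r p q (w\<^sup>2) (2 * m + e) * rar_gamma r p q (inverse (w\<^sup>2)) (- 2 * m - e) =
       G (w\<^sup>2) (2 * m + e) * G (1 / w\<^sup>2) (- (2 * m + e))"
      unfolding k inverse_eq_divide by (simp only: rar_gamma_eq_G[OF d(1)] rar_gamma_eq_G[OF d(2)])
    have "(\<Prod>a=1..8. rar_gamma r p q (t a * w) (n a + e + m) * rar_gamma r p q (t a * inverse w) (n a - m))
      = (\<Prod>a=1..8. G (t a * w) (n a + e + m) * G (t a / w) (n a - m))"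
      by (rule prod.cong) (use W[OF elim(1)] in \<open>simp_all add: rar_gamma_eq_G flip: divide_inverse\<close>)
    moreover have "x / (a * b) = x * c" if "a * c * b = 1" for a b c x :: complex
      using that by (metis divide_inverse inverse_unique mult.assoc mult.commute)
    ultimately show ?case unfolding gg Dl_def using GK by simp
  qed
  moreover have "((\<lambda>w. Dl {1..8} t n e w m) \<longlongrightarrow> Dl {1..8} t n e z m) (at z)"
  proof -
    have "continuous_on W (\<lambda>w. Dl {1..8} t n e w m)"
      by (rule Dl_continuous) (use W W(1)[of _ 1] in \<open>auto intro!: continuous_intros\<close>)
    thus ?thesis using oW zW by (simp add: continuous_on_eq_continuous_at isCont_def)
  qed
  ultimately have "(?f \<longlongrightarrow> Dl {1..8} t n e z m) (at z)" by (subst filterlim_cong[OF refl refl])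
  thus ?thesis unfolding rar_integrand_def by (rule remove_sings_eqI)
qed

lemma rar_V_eq_Iv:
  assumes t: "\<And>a. a \<in> {1..8} \<Longrightarrow> t a \<noteq> 0 \<and> norm (t a) < 1"
  shows "rar_V r e t n p q = qq / 2 * Iv {1..8} t n e"
proof -
  have "contour_integral (circlepath 0 1) (\<lambda>z. rar_integrand r e t n p q m z / z) =
     2 * of_real pi * \<i> * avg (\<lambda>z. Dl {1..8} t n e z m) 1" for m
    unfolding contour_integral_unit_circle
    by (intro arg_cong2[where f = "(*)"] avg_cong refl rar_integrand_eq_Dl t) simp_all
  thus ?thesis
    unfolding rar_V_def Iv_def qq_def by (simp add: atLeast0LessThan flip: sum_distrib_left)
qed

lemma PG_eq_rar_gamma:
  assumes t: "\<And>a. a \<in> {1..8} \<Longrightarrow> t a \<noteq> 0 \<and> norm (t a) < 1"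
  shows "(\<Prod>b=1..8. \<Prod>c\<in>{b<..8}. rar_gamma r p q (t b * t c) (n b + n c + e)) = PG {1..8} t n e"
proof -
  have "(\<Prod>b=1..8. \<Prod>c\<in>{b<..8}. rar_gamma r p q (t b * t c) (n b + n c + e)) =
    (\<Prod>b=1..8. \<Prod>c\<in>{b<..8}. G (t b * t c) (n b + n c + e))"
  proof (intro prod.cong refl rar_gamma_eq_G dom_unit)
    fix b c :: nat assume b: "b \<in> {1..8}" "c \<in> {b<..8}"
    hence "c \<in> {1..8}" by auto
    thus "t b * t c \<noteq> 0" "norm (t b * t c) < 1"
      using t[OF b(1)] t[of c] mult_strict_mono[of "norm (t b)" 1 "norm (t c)" 1] by (auto simp: norm_mult)
  qed
  moreover have "{1<..8::nat} = {2, 3, 4, 5, 6, 7, 8}" "{2<..8::nat} = {3, 4, 5, 6, 7, 8}" "{3<..8::nat} = {4, 5, 6, 7, 8}"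
    "{4<..8::nat} = {5, 6, 7, 8}" "{5<..8::nat} = {6, 7, 8}" "{6<..8::nat} = {7, 8}" "{7<..8::nat} = {8}" by auto
  ultimately show ?thesis unfolding set_1_8 by (simp add: PG_insert)
qed

end

theorem mainTheorem8:
  fixes r :: nat and p q s :: complex and \<epsilon> :: int
    and t :: "nat \<Rightarrow> complex" and n :: "nat \<Rightarrow> int"
  assumes "r > 0"
    and "p \<noteq> 0" and "q \<noteq> 0" and "norm p < 1" and "norm q < 1"
    and "\<epsilon> \<in> {0, 1}"
    and "s ^ 2 = p * q"
    and "\<And>a. a \<in> {1..8} \<Longrightarrow> sqrt (norm (p * q)) < norm (t a) \<and> norm (t a) < 1"
    and "(\<Prod>a=1..8. t a) = (p * q) ^ 2"
    and "(\<Sum>a=1..8. n a) + 4 * \<epsilon> = 0"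
  shows "rar_V r \<epsilon> t n p q =
           (\<Prod>b=1..8. \<Prod>c\<in>{b<..8}. rar_gamma r p q (t b * t c) (n b + n c + \<epsilon>))
           * rar_V r \<epsilon> (\<lambda>a. s / t a) (\<lambda>a. - n a - \<epsilon>) p q"
proof -
  interpret rarefied r p q "Ln p" "Ln q"
    using assms(1-5) by unfold_locales auto
  have ns: "norm s = sqrt (norm (p * q))"
    by (simp add: norm_power flip: assms(7))
  have t: "t a \<noteq> 0 \<and> norm (t a) < 1" "norm s < norm (t a)" if "a \<in> {1..8}" for a
    using assms(8)[OF that] real_sqrt_ge_zero[of "norm (p * q)"] by (auto simp: ns simp del: real_sqrt_ge_zero)
  have "s \<noteq> 0" using assms(7) by auto
  hence st: "s / t a \<noteq> 0 \<and> norm (s / t a) < 1" if "a \<in> {1..8}" for a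
    using t[OF that] by (simp add: norm_divide)
  have "Iv {1..8} t n \<epsilon> = PG {1..8} t n \<epsilon> * Iv {1..8} (\<lambda>a. s / t a) (\<lambda>a. - n a - \<epsilon>) \<epsilon>"
    using t assms(7,9,10) by (intro transformation) auto
  moreover have "rar_V r \<epsilon> t n p q = qq / 2 * Iv {1..8} t n \<epsilon>"
    by (rule rar_V_eq_Iv) (rule t(1))
  moreover have "rar_V r \<epsilon> (\<lambda>a. s / t a) (\<lambda>a. - n a - \<epsilon>) p q = qq / 2 * Iv {1..8} (\<lambda>a. s / t a) (\<lambda>a. - n a - \<epsilon>) \<epsilon>"
    by (rule rar_V_eq_Iv) (rule st)
  moreover have "(\<Prod>b=1..8. \<Prod>c\<in>{b<..8}. rar_gamma r p q (t b * t c) (n b + n c + \<epsilon>)) = PG {1..8} t n \<epsilon>"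
    by (rule PG_eq_rar_gamma) (rule t(1))
  ultimately show ?thesis by (simp only: mult_ac)
qed

end
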